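(* For every integer $n\geqslant 0$ there is an isomorphism of $G$-modules $$ H_{c}^{1}(\tilde X_n ,\mathbb C )\;\simeq\; \mathbf{St}_G\;\oplus\; \bigoplus_{(\mathcal K ,\lambda )\in {\mathcal P}_n} \bigl(\mathrm{c\text{-}ind}_{\mathcal K}^{G}\, \lambda \bigr)^{m_\lambda} , $$ where $m_\lambda=m_{n,\lambda}$ is the multiplicity defined in the context.
   Context: $F$ is a non-Archimedean non-discrete locally compact field with odd residue characteristic, $\mathfrak o$ its valuation ring, $\mathfrak p$ the maximal ideal; $G=\mathrm{PGL}(2,F)$. $\mathbf{St}_G$ is the Steinberg representation of $G$, and $\mathrm{c\text{-}ind}$ is smooth compact induction. Representations are complex and smooth. $X$ is the Bruhat-Tits tree of $G$: vertices are homothety classes $[L]$ of full $\mathfrak o$-lattices in $F^2$; $[L],[M]$ are adjacent iff, for some basis $(e_1,e_2)$ of $F^2$, up to homothety $L=\mathfrak o e_1\oplus\mathfrak o e_2$ and $M=\mathfrak o e_1\oplus\mathfrak p e_2$. For $k\in\mathbb Z$ let $s_k=[\mathfrak o\oplus\mathfrak p^k]$. $\mathcal K_0$ is the stabilizer in $G$ of the vertex $s_0$ and $\mathcal K_1$ is the (global) stabilizer of the edge $[s_0,s_1]$. An oriented $k$-path in $X$ ($k\geqslant 1$) is an injective sequence of $k+1$ vertices of $X$ in which consecutive vertices are adjacent. For $n\geqslant 1$, $\tilde X_n$ is the directed graph whose vertices are the oriented $n$-paths and whose edges are the oriented $(n+1)$-paths; the edge $a=(x_0,\dots,x_{n+1})$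 has tail $a^-=(x_0,\dots,x_n)$ and head $a^+=(x_1,\dots,x_{n+1})$. $\tilde X_0$ is the directed graph whose vertices are the vertices of $X$ and whose edges are the oriented edges $[s,t]$ of $X$ (tail $s$, head $t$), so that each edge of $X$ gives two edges of $\tilde X_0$. $G$ acts on each $\tilde X_n$ preserving the directed graph structure. For a locally finite directed graph $\Sigma$, $H^1_c(\Sigma,\mathbb C)$ is the cokernel of $d:C^0_c\to C^1_c$, where $C_c^0$ (resp. $C_c^1$) is the space of finitely supported complex functions on the vertex set (resp. on the set of directed edges) and $df(a)=f(a^+)-f(a^-)$; this is the usual cohomology with compact support of the geometric realization. If $\Sigma$ is finite write $H^1(\Sigma,\mathbb C)$. Groups acting on $\Sigma$ by directed graph automorphisms act on these spaces. If $n$ is even, $p_n:\tilde X_n\to X$ is the $G$-equivariant graph map sending a vertex (oriented $n$-path) to its middle vertex and an edge (oriented $(n+1)$-path) to its middle edge (for $n=0$: identity on vertices, $[s,t]\mapsto\{s,t\}$ on edges); put $\Sigma_n=p_n^{-1}([s_0,s_1])$. If $n$ is odd, $p_n$ is the $G$-equivariant map, defined after passing to first barycentric subdivisions, sending a vertex (oriented $n$-path) to the midpoint of its middle edge and the midpoint of an edge (oriented $(n+1)$-path) to the middle vertex of that path; put $\Sigma_n=p_n^{-1}(S(s_0,1/2))$, where $S(s_0,1/2)$ is the set of points of the geometric realization of $X$ at distance $\leqslant 1/2$ from $s_0$ (edges having length $1$). $\Sigma_n$ is a finite graph acted on by $\mathcal K_1$ if $n$ is even and by $\mathcal K_0$ if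 $n$ is odd, so $H^1(\Sigma_n,\mathbb C)$ is a finite dimensional smooth representation of that group. $\mathcal P_n$ is the finite set of pairs $(\mathcal K,\lambda)$, with $\mathcal K\in\{\mathcal K_0,\mathcal K_1\}$ and $\lambda$ an irreducible smooth representation of $\mathcal K$ (up to isomorphism), such that for some $k\in\{0,1,\dots,n\}$, $\mathcal K=\mathcal K_1$ if $k$ is even, $\mathcal K=\mathcal K_0$ if $k$ is odd, and $\lambda$ is an irreducible constituent of the representation $H^1(\Sigma_k,\mathbb C)$ of $\mathcal K$. For $(\mathcal K,\lambda)\in\mathcal P_n$ and $0\leqslant k\leqslant n$, $m_\lambda^k$ is the multiplicity of $\lambda$ in $H^1(\Sigma_k,\mathbb C)$ (taken to be $0$ when $\mathcal K$ is not the group attached to the parity of $k$), and $m_{n,\lambda}=m_\lambda=m_\lambda^0+\cdots+m_\lambda^n$. *)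

theory Defs
  imports "HOL-Analysis.Analysis" "HOL-Algebra.Algebra" "Graph_Theory.Digraph"
begin

section \<open>Non-Archimedean local fields\<close>

text \<open>
  The metric of the type is the one of the absolute value, so that topological notions on the
  field, on vectors and on matrices are those of the library.
\<close>

class nonarch_local_field = field + metric_space +
  fixes absv :: "'a \<Rightarrow> real"
  assumes dist_absv: "dist x y = absv (x - y)"
    and absv_mult: "absv (x * y) = absv x * absv y"
    and absv_add: "absv (x + y) \<le> max (absv x) (absv y)"
    and nondiscrete: "\<not> open {0}"
    and locally_compact_nonarch: "\<exists>U K. open U \<and> compact K \<and> x \<in> U \<and> U \<subseteq> K"

definition val_ring :: "'a::nonarch_local_field set"
  where "val_ring = {x. absv x \<le> 1}"

definition max_ideal :: "'a::nonarch_local_field set"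
  where "max_ideal = {x. absv x < 1}"

text \<open>The characteristic of the quotient of the valuation ring by its maximal ideal.\<close>

definition residue_char :: "'a::nonarch_local_field itself \<Rightarrow> nat"
  where "residue_char _ = (LEAST p. 0 < p \<and> of_nat p \<in> (max_ideal :: 'a set))"


section \<open>The topological group PGL(2)\<close>

type_synonym 'a pgl = "('a^2^2) set"

definition GL2 :: "('a::nonarch_local_field^2^2) monoid"
  where "GL2 = \<lparr>carrier = {A. invertible A}, monoid.mult = (**), one = mat 1\<rparr>"

definition scalars :: "('a::nonarch_local_field^2^2) set"
  where "scalars = {mat c | c. c \<noteq> 0}"

definition PGL :: "'a::nonarch_local_field pgl monoid"
  where "PGL = GL2 Mod scalars"

text \<open>
  The quotient topology. An element of the quotient group is a coset of matrices, hence
  \<open>\<Union>U\<close> is the preimage of a set \<open>U\<close> under the projection.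
\<close>

definition PGL_top :: "'a::nonarch_local_field pgl topology"
  where "PGL_top = topology (\<lambda>U. U \<subseteq> carrier PGL \<and> openin (top_of_set (carrier GL2)) (\<Union>U))"

lemma group_GL2: "group (GL2 :: ('a::nonarch_local_field^2^2) monoid)"
proof (rule groupI)
  fix A :: "'a^2^2"
  assume "A \<in> carrier GL2"
  then obtain B where "A ** B = mat 1" "B ** A = mat 1"
    by (auto simp: GL2_def invertible_def)
  then show "\<exists>B\<in>carrier GL2. B \<otimes>\<^bsub>GL2\<^esub> A = \<one>\<^bsub>GL2\<^esub>"
    by (intro bexI[of _ B]) (auto simp: GL2_def invertible_def)
qed (auto simp: GL2_def invertible_mult matrix_mul_assoc invertible_def[of "mat 1"])

lemma mat_mult_mat: "mat c ** mat d = (mat (c * d) :: 'a::nonarch_local_field^2^2)"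
  by (simp add: matrix_matrix_mult_def mat_def vec_eq_iff sum_2 forall_2)

lemma mat_commutes: "mat c ** A = A ** (mat c :: 'a::nonarch_local_field^2^2)"
  by (simp add: matrix_matrix_mult_def mat_def vec_eq_iff if_distrib[of "\<lambda>x. _ * x"] if_distrib[of "\<lambda>x. x * _"] mult.commute
      cong: if_cong)

lemma mat_in_GL2: "c \<noteq> 0 \<Longrightarrow> (mat c :: 'a::nonarch_local_field^2^2) \<in> carrier GL2"
  unfolding GL2_def by (auto simp: invertible_def mat_mult_mat intro!: exI[of _ "mat (inverse c)"])

lemma normal_scalars: "scalars \<lhd> (GL2 :: ('a::nonarch_local_field^2^2) monoid)"
proof -
  interpret group "GL2 :: ('a^2^2) monoid" by (rule group_GL2)
  have "inv\<^bsub>GL2\<^esub> (mat c) = (mat (inverse c) :: 'a^2^2)" if "c \<noteq> 0" for c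
    using that by (intro inv_equality mat_in_GL2) (simp_all add: mat_mult_mat GL2_def)
  then have "subgroup scalars (GL2 :: ('a^2^2) monoid)"
  proof (intro subgroupI)
    show "a \<otimes>\<^bsub>GL2\<^esub> b \<in> scalars" if "a \<in> scalars" "b \<in> scalars" for a b :: "'a^2^2"
      using that by (auto simp: scalars_def GL2_def mat_mult_mat)
  qed (use mat_in_GL2 in \<open>auto simp: scalars_def intro: exI[of _ 1]\<close>)
  moreover have "scalars #>\<^bsub>GL2\<^esub> A = A <#\<^bsub>GL2\<^esub> scalars" for A :: "'a^2^2"
    by (auto simp: r_coset_def l_coset_def scalars_def GL2_def mat_commutes)
  ultimately show ?thesis
    by (simp add: normal_def normal_axioms_def group_GL2)
qed

lemma group_PGL: "group (PGL :: 'a::nonarch_local_field pgl monoid)"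
  unfolding PGL_def by (intro normal.factorgroup_is_group normal_scalars)

lemma openin_PGL_top:
  fixes U :: "'a::nonarch_local_field pgl set"
  shows "openin PGL_top U \<longleftrightarrow> U \<subseteq> carrier PGL \<and> openin (top_of_set (carrier GL2)) (\<Union>U)"
proof -
  have "pairwise disjnt (carrier (PGL :: 'a pgl monoid))"
    using group.rcos_disjoint[OF group_GL2 normal_imp_subgroup[OF normal_scalars]]
    by (simp add: PGL_def FactGroup_def)
  then have disj: "C = D" if "C \<in> carrier PGL" "D \<in> carrier PGL" "x \<in> C" "x \<in> D"
    for C D :: "'a pgl" and x
    using that unfolding pairwise_def disjnt_def by blast
  have "\<Union>(S \<inter> T) = \<Union>S \<inter> \<Union>T" if "S \<subseteq> carrier PGL" "T \<subseteq> carrier PGL"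
    for S T :: "'a pgl set"
    using that disj by blast
  moreover have "openin (top_of_set (carrier GL2)) (\<Union>(\<Union>\<K>))"
    if "\<And>K. K \<in> \<K> \<Longrightarrow> openin (top_of_set (carrier GL2)) (\<Union>K)"
    for \<K> :: "'a pgl set set"
  proof -
    have "\<Union>(\<Union>\<K>) = \<Union>(Union ` \<K>)" by auto
    then show ?thesis using that by (auto intro: openin_Union)
  qed
  ultimately have "istopology (\<lambda>U::'a pgl set. U \<subseteq> carrier PGL \<and>
      openin (top_of_set (carrier GL2)) (\<Union>U))"
    unfolding istopology_def by (auto intro: openin_Int)
  then show ?thesis by (simp add: PGL_top_def)
qed


section \<open>The tree\<close>

type_synonym 'a vertex = "('a^2) set set"

definition is_basis :: "'a::nonarch_local_field^2 \<Rightarrow> 'a^2 \<Rightarrow> bool"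
  where "is_basis e f \<longleftrightarrow> e \<noteq> f \<and> vec.independent {e, f} \<and> vec.span {e, f} = UNIV"

definition span_on :: "'a::nonarch_local_field set \<Rightarrow> 'a^2 \<Rightarrow> 'a set \<Rightarrow> 'a^2 \<Rightarrow> ('a^2) set"
  where "span_on I e J f = {a *s e + b *s f | a b. a \<in> I \<and> b \<in> J}"

definition lattices :: "('a::nonarch_local_field^2) set set"
  where "lattices = {span_on val_ring e val_ring f | e f. is_basis e f}"

definition homothety_class :: "('a::nonarch_local_field^2) set \<Rightarrow> 'a vertex"
  where "homothety_class L = {(*s) c ` L | c. c \<noteq> 0}"

definition tree_verts :: "'a::nonarch_local_field vertex set"
  where "tree_verts = homothety_class ` lattices"

definition adjacent :: "'a::nonarch_local_field vertex \<Rightarrow> 'a vertex \<Rightarrow> bool"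
  where "adjacent x y \<longleftrightarrow> (\<exists>e f. is_basis e f \<and>
    x = homothety_class (span_on val_ring e val_ring f) \<and>
    y = homothety_class (span_on val_ring e max_ideal f))"

definition s0 :: "'a::nonarch_local_field vertex"
  where "s0 = homothety_class (span_on val_ring (axis 1 1) val_ring (axis 2 1))"

definition s1 :: "'a::nonarch_local_field vertex"
  where "s1 = homothety_class (span_on val_ring (axis 1 1) max_ideal (axis 2 1))"

definition vertex_act :: "'a::nonarch_local_field pgl \<Rightarrow> 'a vertex \<Rightarrow> 'a vertex"
  where "vertex_act g x = {(*v) A ` L | A L. A \<in> g \<and> L \<in> x}"

definition K0 :: "'a::nonarch_local_field pgl set"
  where "K0 = {g \<in> carrier PGL. vertex_act g s0 = s0}"

definition K1 :: "'a::nonarch_local_field pgl set"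
  where "K1 = {g \<in> carrier PGL. vertex_act g ` {s0, s1} = {s0, s1}}"

definition K_par :: "nat \<Rightarrow> 'a::nonarch_local_field pgl set"
  where "K_par n = (if even n then K1 else K0)"


section \<open>Graphs of paths\<close>

type_synonym 'a vpath = "'a vertex list"

definition opaths :: "nat \<Rightarrow> 'a::nonarch_local_field vpath set"
  where "opaths k = {xs. length xs = k + 1 \<and> set xs \<subseteq> tree_verts \<and> distinct xs \<and>
    (\<forall>i<k. adjacent (xs ! i) (xs ! Suc i))}"

text \<open>For \<open>n = 0\<close> a vertex of the tree is identified with the one-element list it forms.\<close>

definition path_graph :: "nat \<Rightarrow> ('a::nonarch_local_field vpath, 'a vpath) pre_digraph"
  where "path_graph n =
    \<lparr>verts = opaths n, arcs = opaths (n + 1), tail = butlast, head = tl\<rparr>"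

text \<open>The middle vertex of a path of even length and the middle edge of a path of odd length.\<close>

definition mid_vertex :: "'a vpath \<Rightarrow> 'a vertex"
  where "mid_vertex xs = xs ! (length xs div 2)"

definition mid_edge :: "'a vpath \<Rightarrow> 'a vertex set"
  where "mid_edge xs = {xs ! (length xs div 2 - 1), xs ! (length xs div 2)}"

text \<open>
  For even \<open>n\<close> this is the preimage of the closed edge joining \<open>s0\<close> and \<open>s1\<close>.
  For odd \<open>n\<close>, vertices of the path graph lie over midpoints of edges of the tree, and the
  midpoint of an arc lies over a vertex of the tree. The closed ball of radius 1/2 around \<open>s0\<close>
  consists of \<open>s0\<close> and the half-edges issuing from it; its preimage therefore consists of the
  vertices lying over the midpoint of an edge that contains \<open>s0\<close>, and of the whole arcs whose
  midpoint lies over \<open>s0\<close>.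
\<close>

definition Sigma_graph :: "nat \<Rightarrow> ('a::nonarch_local_field vpath, 'a vpath) pre_digraph"
  where "Sigma_graph n = (path_graph n)
    \<lparr>verts := {x \<in> opaths n. if even n then mid_vertex x \<in> {s0, s1} else s0 \<in> mid_edge x},
     arcs := {a \<in> opaths (n + 1). if even n then mid_edge a = {s0, s1} else mid_vertex a = s0}\<rparr>"


section \<open>Representations\<close>

definition complex_ring :: "complex ring"
  where "complex_ring =
    \<lparr>carrier = UNIV, monoid.mult = (*), one = 1, ring.zero = 0, add = (+)\<rparr>"

text \<open>
  The ring multiplication inherited from the record of modules plays no role.
  All notions below refer to a set \<open>K\<close> of group elements, and only the action of the elements
  of \<open>K\<close> on the carrier matters.
\<close>

record ('g, 'v) rep = "(complex, 'v) module" +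
  ract :: "'g \<Rightarrow> 'v \<Rightarrow> 'v"

definition smooth_rep :: "'a::nonarch_local_field pgl set \<Rightarrow> ('a pgl, 'v) rep \<Rightarrow> bool"
  where "smooth_rep K M \<longleftrightarrow> Module.module complex_ring M \<and>
    (\<forall>g\<in>K. \<forall>v\<in>carrier M. ract M g v \<in> carrier M) \<and>
    (\<forall>g\<in>K. \<forall>v\<in>carrier M. \<forall>w\<in>carrier M. ract M g (v \<oplus>\<^bsub>M\<^esub> w) = ract M g v \<oplus>\<^bsub>M\<^esub> ract M g w) \<and>
    (\<forall>g\<in>K. \<forall>c. \<forall>v\<in>carrier M. ract M g (c \<odot>\<^bsub>M\<^esub> v) = c \<odot>\<^bsub>M\<^esub> ract M g v) \<and>
    (\<forall>v\<in>carrier M. ract M \<one>\<^bsub>PGL\<^esub> v = v) \<and>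
    (\<forall>g\<in>K. \<forall>h\<in>K. \<forall>v\<in>carrier M. ract M (g \<otimes>\<^bsub>PGL\<^esub> h) v = ract M g (ract M h v)) \<and>
    (\<forall>v\<in>carrier M. openin (subtopology PGL_top K) {g \<in> K. ract M g v = v})"

definition rep_iso :: "'g set \<Rightarrow> ('g, 'v) rep \<Rightarrow> ('g, 'w) rep \<Rightarrow> bool"
  where "rep_iso K M N \<longleftrightarrow> (\<exists>\<phi>. bij_betw \<phi> (carrier M) (carrier N) \<and>
    (\<forall>v\<in>carrier M. \<forall>w\<in>carrier M. \<phi> (v \<oplus>\<^bsub>M\<^esub> w) = \<phi> v \<oplus>\<^bsub>N\<^esub> \<phi> w) \<and>
    (\<forall>c. \<forall>v\<in>carrier M. \<phi> (c \<odot>\<^bsub>M\<^esub> v) = c \<odot>\<^bsub>N\<^esub> \<phi> v) \<and>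
    (\<forall>g\<in>K. \<forall>v\<in>carrier M. \<phi> (ract M g v) = ract N g (\<phi> v)))"

definition subrep :: "'g set \<Rightarrow> ('g, 'v) rep \<Rightarrow> 'v set \<Rightarrow> bool"
  where "subrep K M W \<longleftrightarrow> submodule W complex_ring M \<and> (\<forall>g\<in>K. ract M g ` W \<subseteq> W)"

text \<open>
  Vectors of the quotient are cosets of \<open>W\<close>; adding \<open>W\<close> in the scalar multiplication is needed
  for the scalar 0 only.
\<close>

definition rep_quot :: "('g, 'v) rep \<Rightarrow> 'v set \<Rightarrow> ('g, 'v set) rep"
  where "rep_quot M W =
    \<lparr>carrier = a_rcosets\<^bsub>M\<^esub> W, monoid.mult = undefined, one = undefined,
     ring.zero = W, add = set_add M, smult = (\<lambda>c C. W <+>\<^bsub>M\<^esub> smult M c ` C),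
     ract = (\<lambda>g C. ract M g ` C)\<rparr>"

definition irreducible_rep :: "'g set \<Rightarrow> ('g, 'v) rep \<Rightarrow> bool"
  where "irreducible_rep K M \<longleftrightarrow> carrier M \<noteq> {\<zero>\<^bsub>M\<^esub>} \<and>
    (\<forall>W. subrep K M W \<longrightarrow> W = {\<zero>\<^bsub>M\<^esub>} \<or> W = carrier M)"

abbreviation subquot :: "('g, 'v) rep \<Rightarrow> 'v set \<Rightarrow> 'v set \<Rightarrow> ('g, 'v set) rep"
  where "subquot M W' W \<equiv> rep_quot (M\<lparr>carrier := W'\<rparr>) W"

definition irreducible_subquot :: "'g set \<Rightarrow> ('g, 'v) rep \<Rightarrow> 'v set \<Rightarrow> 'v set \<Rightarrow> bool"
  where "irreducible_subquot K M W' W \<longleftrightarrow> subrep K M W \<and> subrep K M W' \<and> W \<subseteq> W' \<and>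
    irreducible_rep K (subquot M W' W)"

definition constituent :: "'g set \<Rightarrow> ('g, 'v) rep \<Rightarrow> ('g, 'w) rep \<Rightarrow> bool"
  where "constituent K M L \<longleftrightarrow>
    (\<exists>W W'. irreducible_subquot K M W' W \<and> rep_iso K (subquot M W' W) L)"

definition composition_series :: "'g set \<Rightarrow> ('g, 'v) rep \<Rightarrow> 'v set list \<Rightarrow> bool"
  where "composition_series K M Ws \<longleftrightarrow> Ws \<noteq> [] \<and> hd Ws = {\<zero>\<^bsub>M\<^esub>} \<and> last Ws = carrier M \<and>
    (\<forall>i. Suc i < length Ws \<longrightarrow> irreducible_subquot K M (Ws ! Suc i) (Ws ! i))"

text \<open>Independent of the composition series by the Jordan-Hoelder theorem.\<close>

definition rep_mult :: "'g set \<Rightarrow> ('g, 'v) rep \<Rightarrow> ('g, 'w) rep \<Rightarrow> nat"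
  where "rep_mult K M L = (THE m. \<exists>Ws. composition_series K M Ws \<and>
    m = card {i. Suc i < length Ws \<and> rep_iso K (subquot M (Ws ! Suc i) (Ws ! i)) L})"

definition rep_plus :: "('g, 'v) rep \<Rightarrow> ('g, 'w) rep \<Rightarrow> ('g, 'v \<times> 'w) rep"
  where "rep_plus M N =
    \<lparr>carrier = carrier M \<times> carrier N, monoid.mult = undefined, one = undefined,
     ring.zero = (\<zero>\<^bsub>M\<^esub>, \<zero>\<^bsub>N\<^esub>),
     add = (\<lambda>p q. (fst p \<oplus>\<^bsub>M\<^esub> fst q, snd p \<oplus>\<^bsub>N\<^esub> snd q)),
     smult = (\<lambda>c p. (c \<odot>\<^bsub>M\<^esub> fst p, c \<odot>\<^bsub>N\<^esub> snd p)),
     ract = (\<lambda>g p. (ract M g (fst p), ract N g (snd p)))\<rparr>"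

definition rep_dsum :: "'i set \<Rightarrow> ('i \<Rightarrow> ('g, 'v) rep) \<Rightarrow> ('g, 'i \<Rightarrow> 'v) rep"
  where "rep_dsum I M =
    \<lparr>carrier = {f \<in> \<Pi>\<^sub>E i\<in>I. carrier (M i). finite {i \<in> I. f i \<noteq> \<zero>\<^bsub>M i\<^esub>}},
     monoid.mult = undefined, one = undefined,
     ring.zero = (\<lambda>i\<in>I. \<zero>\<^bsub>M i\<^esub>),
     add = (\<lambda>f h. \<lambda>i\<in>I. f i \<oplus>\<^bsub>M i\<^esub> h i),
     smult = (\<lambda>c f. \<lambda>i\<in>I. c \<odot>\<^bsub>M i\<^esub> f i),
     ract = (\<lambda>g f. \<lambda>i\<in>I. ract (M i) g (f i))\<rparr>"


section \<open>Induced representations\<close>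

definition smooth_ind ::
  "'a::nonarch_local_field pgl set \<Rightarrow> ('a pgl, 'v) rep \<Rightarrow> ('a pgl, 'a pgl \<Rightarrow> 'v) rep"
  where "smooth_ind H M =
    \<lparr>carrier = {f \<in> carrier PGL \<rightarrow>\<^sub>E carrier M.
       (\<forall>h\<in>H. \<forall>x\<in>carrier PGL. f (h \<otimes>\<^bsub>PGL\<^esub> x) = ract M h (f x)) \<and>
       (\<exists>U. subgroup U PGL \<and> openin PGL_top U \<and>
         (\<forall>x\<in>carrier PGL. \<forall>u\<in>U. f (x \<otimes>\<^bsub>PGL\<^esub> u) = f x))},
     monoid.mult = undefined, one = undefined,
     ring.zero = (\<lambda>x\<in>carrier PGL. \<zero>\<^bsub>M\<^esub>),
     add = (\<lambda>f h. \<lambda>x\<in>carrier PGL. f x \<oplus>\<^bsub>M\<^esub> h x),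
     smult = (\<lambda>c f. \<lambda>x\<in>carrier PGL. c \<odot>\<^bsub>M\<^esub> f x),
     ract = (\<lambda>g f. \<lambda>x\<in>carrier PGL. f (x \<otimes>\<^bsub>PGL\<^esub> g))\<rparr>"

text \<open>Functions whose support is compact modulo \<open>H\<close>.\<close>

definition c_ind ::
  "'a::nonarch_local_field pgl set \<Rightarrow> ('a pgl, 'v) rep \<Rightarrow> ('a pgl, 'a pgl \<Rightarrow> 'v) rep"
  where "c_ind H M = (smooth_ind H M)
    \<lparr>carrier := {f \<in> carrier (smooth_ind H M). \<exists>C. compactin PGL_top C \<and>
       {x \<in> carrier PGL. f x \<noteq> \<zero>\<^bsub>M\<^esub>} \<subseteq> H <#>\<^bsub>PGL\<^esub> C}\<rparr>"

definition trivial_rep :: "('g, complex) rep"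
  where "trivial_rep =
    \<lparr>carrier = UNIV, monoid.mult = (*), one = 1, ring.zero = 0, add = (+), smult = (*),
     ract = (\<lambda>g v. v)\<rparr>"

definition borel_subgroup :: "'a::nonarch_local_field pgl set"
  where "borel_subgroup = {scalars #>\<^bsub>GL2\<^esub> A | A. A \<in> carrier GL2 \<and> A $ 2 $ 1 = 0}"

text \<open>
  Smooth functions on the projective line modulo constant functions, in the form of the
  (unnormalized) induction of the trivial representation of the Borel subgroup.
\<close>

definition Steinberg :: "('a::nonarch_local_field pgl, ('a pgl \<Rightarrow> complex) set) rep"
  where "Steinberg = rep_quot (smooth_ind borel_subgroup trivial_rep)
    {(\<lambda>x\<in>carrier PGL. c) | c. True}"


section \<open>Cohomology with compact support\<close>

definition fin_supp :: "'x set \<Rightarrow> ('x \<Rightarrow> complex) set"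
  where "fin_supp S = {f. finite {x. f x \<noteq> 0} \<and> {x. f x \<noteq> 0} \<subseteq> S}"

text \<open>
  Functions on \<open>S\<close> are extended by 0. This is a representation of the subgroup of those group
  elements that stabilize \<open>S\<close>.
\<close>

definition fin_supp_rep ::
  "'a::nonarch_local_field vpath set \<Rightarrow> ('a pgl, 'a vpath \<Rightarrow> complex) rep"
  where "fin_supp_rep S =
    \<lparr>carrier = fin_supp S, monoid.mult = undefined, one = undefined,
     ring.zero = (\<lambda>x. 0), add = (\<lambda>f h x. f x + h x), smult = (\<lambda>c f x. c * f x),
     ract = (\<lambda>g f x. if x \<in> S then f (map (vertex_act (inv\<^bsub>PGL\<^esub> g)) x) else 0)\<rparr>"

definition coboundary :: "('x, 'y) pre_digraph \<Rightarrow> ('x \<Rightarrow> complex) \<Rightarrow> 'y \<Rightarrow> complex"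
  where "coboundary S f = (\<lambda>a. if a \<in> arcs S then f (head S a) - f (tail S a) else 0)"

definition H1c :: "('a::nonarch_local_field vpath, 'a vpath) pre_digraph \<Rightarrow>
    ('a pgl, ('a vpath \<Rightarrow> complex) set) rep"
  where "H1c S = rep_quot (fin_supp_rep (arcs S)) (coboundary S ` fin_supp (verts S))"


section \<open>The inducing data\<close>

text \<open>
  \<open>P\<close> is a set of representatives, with representation spaces in the type \<open>'v\<close>, of the
  isomorphism classes of pairs in question: its members are such pairs, they are pairwise
  non-isomorphic, and every irreducible subquotient is represented. In the last clause the
  subquotients are taken where they live naturally, so that the completeness of \<open>P\<close> does not
  depend on the choice of \<open>'v\<close>.
\<close>

definition inducing_data ::
  "nat \<Rightarrow> ('a::nonarch_local_field pgl set \<times> ('a pgl, 'v) rep) set \<Rightarrow> bool"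
  where "inducing_data n P \<longleftrightarrow>
    (\<forall>(K, L)\<in>P. smooth_rep K L \<and> irreducible_rep K L \<and>
      (\<exists>k\<le>n. K = K_par k \<and> constituent K (H1c (Sigma_graph k)) L)) \<and>
    (\<forall>(K, L)\<in>P. \<forall>(K', L')\<in>P. K = K' \<and> rep_iso K L L' \<longrightarrow> L = L') \<and>
    (\<forall>k\<le>n. \<forall>W W'. irreducible_subquot (K_par k) (H1c (Sigma_graph k)) W' W \<longrightarrow>
      (\<exists>L. (K_par k, L) \<in> P \<and> rep_iso (K_par k) (subquot (H1c (Sigma_graph k)) W' W) L))"

definition inducing_mult ::
  "nat \<Rightarrow> 'a::nonarch_local_field pgl set \<Rightarrow> ('a pgl, 'v) rep \<Rightarrow> nat"
  where "inducing_mult n K L =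
    (\<Sum>k\<le>n. if K = K_par k then rep_mult K (H1c (Sigma_graph k)) L else 0)"

end

theory Submission
  imports Defs "HOL-Library.Function_Algebras"
begin

text \<open>
  Functions on the oriented paths with \<open>k + 1\<close> edges are the sections of a \<open>G\<close>-equivariant bundle
  over the orbit of the base of \<open>\<Sigma>\<^sub>k\<close>, with fibre the functions on the arcs of \<open>\<Sigma>\<^sub>k\<close>; a \<open>\<K>\<close>-stable
  space \<open>T\<close> of such functions thus spans a subrepresentation \<open>ind k T\<close>, which is compactly induced
  from \<open>T\<close>. Split the fibre orthogonally into the coboundaries \<open>D\<close> and irreducible spaces
  \<open>T\<^sub>i\<close>, the latter adding up to \<open>H\<^sup>1(\<Sigma>\<^sub>k)\<close>. The coboundaries of finitely supported functions lie in
  \<open>ind k D\<close>, so the cohomology of the \<open>k\<close>-th path graph is the sum of the \<open>ind k T\<^sub>i\<close> and of the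
  quotient of \<open>ind k D\<close> by the coboundaries. For \<open>k > 0\<close> the space \<open>ind k D\<close> consists of the functions
  \<open>a \<mapsto> f (a\<^sup>+) - g (a\<^sup>-)\<close>, and \<open>f - g\<close> identifies the quotient with the cohomology of the
  \<open>(k - 1)\<close>-st path graph. For \<open>k = 0\<close> it consists of the odd functions on the oriented edges; an odd
  function is the coboundary of a function on the vertices that is eventually constant along
  every ray, and its boundary value is a locally constant function on the projective line,
  unique up to constants: this gives the Steinberg representation.
\<close>

section \<open>Algebraic representations\<close>

text \<open>The descent from \<open>k\<close> to \<open>k - 1\<close> rests on one asymmetry. For
  \<open>k > 0\<close> the arcs entering a vertex of the path graph and the arcs leaving it lie over
  different translates of the base, so translates of local coboundaries prescribe values at heads
  and at tails independently, and comparison with the true coboundaries comes down to the pairs of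
  functions on which \<open>delta\<close> vanishes. For \<open>k = 0\<close> both orientations of an
  edge lie over that same edge, and this coupling is what produces oddness and the different end of
  the recursion.

  Multiplicities are counted in composition series of a quotient, whereas \<open>ind\<close> applies
  to subspaces. The groups permute finite sets, so the standard hermitian form is invariant and
  turns quotients into subspaces; Jordan-Hoelder makes the count independent of the series.

  That the graph of lattice classes is a tree enters through one number, \<open>level\<close>: every
  vertex other than \<open>s0\<close> has exactly one neighbour of smaller level. The spaces
  compared have different types, so they are linked by isomorphisms only, and quotients are mostly
  compared through a common source.\<close>

definition alg_rep :: "'a::nonarch_local_field pgl set \<Rightarrow> ('a pgl, 'v) rep \<Rightarrow> bool"
  where "alg_rep K M \<longleftrightarrow> Module.module complex_ring M \<and>
    (\<forall>g\<in>K. \<forall>v\<in>carrier M. ract M g v \<in> carrier M) \<and>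
    (\<forall>g\<in>K. \<forall>v\<in>carrier M. \<forall>w\<in>carrier M. ract M g (v \<oplus>\<^bsub>M\<^esub> w) = ract M g v \<oplus>\<^bsub>M\<^esub> ract M g w) \<and>
    (\<forall>g\<in>K. \<forall>c. \<forall>v\<in>carrier M. ract M g (c \<odot>\<^bsub>M\<^esub> v) = c \<odot>\<^bsub>M\<^esub> ract M g v) \<and>
    (\<forall>v\<in>carrier M. ract M \<one>\<^bsub>PGL\<^esub> v = v) \<and>
    (\<forall>g\<in>K. \<forall>h\<in>K. \<forall>v\<in>carrier M. ract M (g \<otimes>\<^bsub>PGL\<^esub> h) v = ract M g (ract M h v))"

lemma smooth_rep_alg_rep: "smooth_rep K M \<Longrightarrow> alg_rep K M"
  by (simp add: smooth_rep_def alg_rep_def)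

definition rep_hom :: "'g set \<Rightarrow> ('v \<Rightarrow> 'w) \<Rightarrow> ('g, 'v) rep \<Rightarrow> ('g, 'w) rep \<Rightarrow> bool"
  where "rep_hom K \<phi> M N \<longleftrightarrow> (\<forall>v\<in>carrier M. \<phi> v \<in> carrier N) \<and>
    (\<forall>v\<in>carrier M. \<forall>w\<in>carrier M. \<phi> (v \<oplus>\<^bsub>M\<^esub> w) = \<phi> v \<oplus>\<^bsub>N\<^esub> \<phi> w) \<and>
    (\<forall>c. \<forall>v\<in>carrier M. \<phi> (c \<odot>\<^bsub>M\<^esub> v) = c \<odot>\<^bsub>N\<^esub> \<phi> v) \<and>
    (\<forall>g\<in>K. \<forall>v\<in>carrier M. \<phi> (ract M g v) = ract N g (\<phi> v))"

lemma rep_iso_iff: "rep_iso K M N \<longleftrightarrow> (\<exists>\<phi>. bij_betw \<phi> (carrier M) (carrier N) \<and> rep_hom K \<phi> M N)"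
  unfolding rep_iso_def rep_hom_def by (auto dest: bij_betw_apply)

lemma rep_hom_comp: "rep_hom K \<phi> M N \<Longrightarrow> rep_hom K \<psi> N Q \<Longrightarrow> rep_hom K (\<psi> \<circ> \<phi>) M Q"
  by (simp add: rep_hom_def)

lemma rep_iso_trans: "rep_iso K M N \<Longrightarrow> rep_iso K N Q \<Longrightarrow> rep_iso K M Q"
  unfolding rep_iso_iff by (meson bij_betw_trans rep_hom_comp)

lemma rep_iso_refl: "alg_rep K M \<Longrightarrow> rep_iso K M M"
  unfolding rep_iso_iff by (rule exI[of _ id]) (auto simp: rep_hom_def)

lemma complex_ring_simps [simp]:
  "carrier complex_ring = UNIV" "monoid.mult complex_ring = (*)" "monoid.one complex_ring = 1"
  "ring.zero complex_ring = 0" "ring.add complex_ring = (+)"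
  by (simp_all add: complex_ring_def)

lemma cring_complex_ring: "cring complex_ring"
proof (rule cringI)
  show "abelian_group complex_ring"
    by (rule abelian_groupI) (auto simp: algebra_simps intro: exI[of _ "- _"] add.left_inverse)
  show "Group.comm_monoid complex_ring"
    by (rule comm_monoidI) (auto simp: algebra_simps)
qed (auto simp: algebra_simps)

interpretation complex_ring: cring complex_ring by (rule cring_complex_ring)

lemma complex_ring_a_inv [simp]: "\<ominus>\<^bsub>complex_ring\<^esub> x = - x"
  by (rule complex_ring.minus_equality) auto

lemma modI:
  assumes "abelian_group M"
    and "\<And>a x. x \<in> carrier M \<Longrightarrow> a \<odot>\<^bsub>M\<^esub> x \<in> carrier M"
    and "\<And>a b x. x \<in> carrier M \<Longrightarrow> (a + b) \<odot>\<^bsub>M\<^esub> x = a \<odot>\<^bsub>M\<^esub> x \<oplus>\<^bsub>M\<^esub> b \<odot>\<^bsub>M\<^esub> x"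
    and "\<And>a x y. x \<in> carrier M \<Longrightarrow> y \<in> carrier M \<Longrightarrow> a \<odot>\<^bsub>M\<^esub> (x \<oplus>\<^bsub>M\<^esub> y) = a \<odot>\<^bsub>M\<^esub> x \<oplus>\<^bsub>M\<^esub> a \<odot>\<^bsub>M\<^esub> y"
    and "\<And>a b x. x \<in> carrier M \<Longrightarrow> (a * b) \<odot>\<^bsub>M\<^esub> x = a \<odot>\<^bsub>M\<^esub> (b \<odot>\<^bsub>M\<^esub> x)"
    and "\<And>x. x \<in> carrier M \<Longrightarrow> 1 \<odot>\<^bsub>M\<^esub> x = x"
  shows "Module.module complex_ring M"
  by (rule Module.moduleI) (use assms cring_complex_ring in auto)

locale arep =
  fixes K :: "'a::nonarch_local_field pgl set" and M :: "('a pgl, 'v) rep" (structure)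
  assumes rep: "alg_rep K M" and K: "subgroup K PGL"
begin

sublocale Module.module complex_ring M
  using rep by (simp add: alg_rep_def)

lemma act_closed [simp]: "g \<in> K \<Longrightarrow> v \<in> carrier M \<Longrightarrow> ract M g v \<in> carrier M"
  and act_add: "g \<in> K \<Longrightarrow> v \<in> carrier M \<Longrightarrow> w \<in> carrier M \<Longrightarrow> ract M g (v \<oplus> w) = ract M g v \<oplus> ract M g w"
  and act_smult: "g \<in> K \<Longrightarrow> v \<in> carrier M \<Longrightarrow> ract M g (c \<odot>\<^bsub>M\<^esub> v) = c \<odot>\<^bsub>M\<^esub> ract M g v"
  and act_one: "v \<in> carrier M \<Longrightarrow> ract M \<one>\<^bsub>PGL\<^esub> v = v"
  and act_mult: "g \<in> K \<Longrightarrow> h \<in> K \<Longrightarrow> v \<in> carrier M \<Longrightarrow> ract M (g \<otimes>\<^bsub>PGL\<^esub> h) v = ract M g (ract M h v)"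
  using rep by (simp_all add: alg_rep_def)

lemma smult_zero_left: "v \<in> carrier M \<Longrightarrow> 0 \<odot>\<^bsub>M\<^esub> v = \<zero>"
  using smult_l_null by simp

lemma smult_minus_one: "v \<in> carrier M \<Longrightarrow> (-1) \<odot>\<^bsub>M\<^esub> v = \<ominus> v"
  using smult_l_minus[of 1 v] smult_one[of v] by simp

lemma act_zero: "g \<in> K \<Longrightarrow> ract M g \<zero> = \<zero>"
  using act_smult[of g "\<zero>" 0] by (simp add: smult_zero_left)

lemma act_inv: "g \<in> K \<Longrightarrow> v \<in> carrier M \<Longrightarrow> ract M g (ract M (inv\<^bsub>PGL\<^esub> g) v) = v"
  using act_mult[of g "inv\<^bsub>PGL\<^esub> g" v, symmetric]
  by (simp add: act_one subgroup.m_inv_closed[OF K] group.r_inv[OF group_PGL] subgroup.mem_carrier[OF K])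

lemma hom_zero: "rep_hom K \<phi> M N \<Longrightarrow> arep K N \<Longrightarrow> \<phi> \<zero> = \<zero>\<^bsub>N\<^esub>"
  using smult_zero_left[of "\<zero>"] arep.smult_zero_left[of K N "\<phi> \<zero>"]
  unfolding rep_hom_def by (metis zero_closed)

lemma subrepI:
  assumes "W \<subseteq> carrier M" "\<zero> \<in> W" "\<And>v w. v \<in> W \<Longrightarrow> w \<in> W \<Longrightarrow> v \<oplus> w \<in> W"
    "\<And>c v. v \<in> W \<Longrightarrow> c \<odot>\<^bsub>M\<^esub> v \<in> W" "\<And>g v. g \<in> K \<Longrightarrow> v \<in> W \<Longrightarrow> ract M g v \<in> W"
  shows "subrep K M W"
  unfolding subrep_def
proof
  show "submodule W complex_ring M"
  proof (rule submoduleI)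
    fix v assume "v \<in> W"
    then have "(-1) \<odot>\<^bsub>M\<^esub> v \<in> W" "v \<in> carrier M" using assms by auto
    then show "\<ominus> v \<in> W" by (simp add: smult_minus_one)
  qed (use assms in auto)
qed (use assms in auto)

lemma subrepD:
  assumes "subrep K M W"
  shows "W \<subseteq> carrier M" "\<zero> \<in> W" "\<And>v w. v \<in> W \<Longrightarrow> w \<in> W \<Longrightarrow> v \<oplus> w \<in> W"
    "\<And>c v. v \<in> W \<Longrightarrow> c \<odot>\<^bsub>M\<^esub> v \<in> W" "\<And>g v. g \<in> K \<Longrightarrow> v \<in> W \<Longrightarrow> ract M g v \<in> W"
    "\<And>v. v \<in> W \<Longrightarrow> \<ominus> v \<in> W"
proof -
  have s: "submodule W complex_ring M" using assms by (simp add: subrep_def)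
  show "W \<subseteq> carrier M" "\<zero> \<in> W" "\<And>v w. v \<in> W \<Longrightarrow> w \<in> W \<Longrightarrow> v \<oplus> w \<in> W"
    "\<And>c v. v \<in> W \<Longrightarrow> c \<odot>\<^bsub>M\<^esub> v \<in> W" "\<And>v. v \<in> W \<Longrightarrow> \<ominus> v \<in> W"
    using submoduleE[OF s] subgroup.one_closed[OF submodule.axioms(1)[OF s]] by auto
  show "\<And>g v. g \<in> K \<Longrightarrow> v \<in> W \<Longrightarrow> ract M g v \<in> W" using assms by (auto simp: subrep_def)
qed

lemma arep_subrep:
  assumes "subrep K M W"
  shows "arep K (M\<lparr>carrier := W\<rparr>)"
proof -
  note W = subrepD[OF assms]
  have *: "v \<in> carrier M" if "v \<in> W" for v using that W(1) by blast
  have "abelian_group (M\<lparr>carrier := W\<rparr>)"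
  proof (rule abelian_groupI)
    fix x assume "x \<in> carrier (M\<lparr>carrier := W\<rparr>)"
    then show "\<exists>y\<in>carrier (M\<lparr>carrier := W\<rparr>). y \<oplus>\<^bsub>M\<lparr>carrier := W\<rparr>\<^esub> x = \<zero>\<^bsub>M\<lparr>carrier := W\<rparr>\<^esub>"
      using W * by (auto intro!: bexI[of _ "\<ominus> x"] l_neg)
  qed (use W * in \<open>auto simp: a_ac\<close>)
  then have "Module.module complex_ring (M\<lparr>carrier := W\<rparr>)"
    by (rule modI) (use W * smult_l_distr smult_r_distr smult_assoc1 smult_one in auto)
  then show ?thesis
    by (intro arep.intro K) (use W * in \<open>auto simp: alg_rep_def act_add act_smult act_one act_mult\<close>)
qed

lemma subrep_carrier: "subrep K M (carrier M)" and subrep_zero: "subrep K M {\<zero>}"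
  by (rule subrepI; auto simp: act_zero)+

lemma subrep_trans: "subrep K M W \<Longrightarrow> subrep K (M\<lparr>carrier := W\<rparr>) Y \<longleftrightarrow> subrep K M Y \<and> Y \<subseteq> W"
proof -
  assume W: "subrep K M W"
  interpret W: arep K "M\<lparr>carrier := W\<rparr>" by (rule arep_subrep[OF W])
  show ?thesis
  proof safe
    assume "subrep K (M\<lparr>carrier := W\<rparr>) Y"
    note * = W.subrepD[OF this]
    show "subrep K M Y" by (rule subrepI) (use * subrepD(1)[OF W] in auto)
    show "x \<in> W" if "x \<in> Y" for x using that * by auto
  next
    assume "subrep K M Y" "Y \<subseteq> W"
    note * = subrepD[OF this(1)] this(2)
    show "subrep K (M\<lparr>carrier := W\<rparr>) Y" by (rule W.subrepI) (use * in auto)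
  qed
qed

end

lemma rep_hom_restrict: "rep_hom K \<phi> M N \<Longrightarrow> W \<subseteq> carrier M \<Longrightarrow> \<phi> ` W \<subseteq> Y \<Longrightarrow>
    rep_hom K \<phi> (M\<lparr>carrier := W\<rparr>) (N\<lparr>carrier := Y\<rparr>)"
  unfolding rep_hom_def by (auto simp: subset_iff)

section \<open>Images, preimages and inverses of homomorphisms\<close>

lemma subrep_image:
  assumes "arep K M" "arep K N" and h: "rep_hom K \<phi> M N" and "subrep K M W"
  shows "subrep K N (\<phi> ` W)"
proof -
  interpret M: arep K M by fact
  interpret N: arep K N by fact
  note W = M.subrepD[OF \<open>subrep K M W\<close>]
  have *: "v \<in> carrier M" if "v \<in> W" for v using that W(1) by blast
  show ?thesis
  proof (rule N.subrepI)
    show "\<phi> ` W \<subseteq> carrier N" using h * by (auto simp: rep_hom_def)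
    show "\<zero>\<^bsub>N\<^esub> \<in> \<phi> ` W" using M.hom_zero[OF h \<open>arep K N\<close>] W(2) by (metis imageI)
  next
    fix v w assume "v \<in> \<phi> ` W" "w \<in> \<phi> ` W"
    then obtain a b where ab: "a \<in> W" "b \<in> W" "v = \<phi> a" "w = \<phi> b" by blast
    with * h have "\<phi> (a \<oplus>\<^bsub>M\<^esub> b) = v \<oplus>\<^bsub>N\<^esub> w" by (simp add: rep_hom_def)
    with W(3) ab show "v \<oplus>\<^bsub>N\<^esub> w \<in> \<phi> ` W" by (metis imageI)
  next
    fix c v assume "v \<in> \<phi> ` W"
    then obtain a where a: "a \<in> W" "v = \<phi> a" by blast
    with * h have "\<phi> (c \<odot>\<^bsub>M\<^esub> a) = c \<odot>\<^bsub>N\<^esub> v" by (simp add: rep_hom_def)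
    with W(4) a show "c \<odot>\<^bsub>N\<^esub> v \<in> \<phi> ` W" by (metis imageI)
  next
    fix g v assume g: "g \<in> K" and "v \<in> \<phi> ` W"
    then obtain a where a: "a \<in> W" "v = \<phi> a" by blast
    with * h g have "\<phi> (ract M g a) = ract N g v" by (simp add: rep_hom_def)
    with W(5) a g show "ract N g v \<in> \<phi> ` W" by (metis imageI)
  qed
qed

lemma subrep_vimage:
  assumes "arep K M" "arep K N" and h: "rep_hom K \<phi> M N" and "subrep K N Y"
  shows "subrep K M {v \<in> carrier M. \<phi> v \<in> Y}"
proof -
  interpret M: arep K M by fact
  interpret N: arep K N by fact
  note Y = N.subrepD[OF \<open>subrep K N Y\<close>]
  show ?thesis
    by (rule M.subrepI) (use h Y M.hom_zero[OF h \<open>arep K N\<close>] in \<open>auto simp: rep_hom_def\<close>)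
qed

lemma rep_iso_sym:
  assumes "arep K M" "rep_iso K M N"
  shows "rep_iso K N M"
proof -
  interpret M: arep K M by fact
  obtain \<phi> where b: "bij_betw \<phi> (carrier M) (carrier N)" and h: "rep_hom K \<phi> M N"
    using assms(2) by (auto simp: rep_iso_iff)
  define \<psi> where "\<psi> = inv_into (carrier M) \<phi>"
  have b': "bij_betw \<psi> (carrier N) (carrier M)"
    unfolding \<psi>_def by (rule bij_betw_inv_into[OF b])
  have 1: "\<psi> (\<phi> v) = v" if "v \<in> carrier M" for v
    using b that by (simp add: \<psi>_def bij_betw_inv_into_left)
  have 2: "\<exists>w\<in>carrier M. v = \<phi> w" if "v \<in> carrier N" for v
    using b that by (metis bij_betw_iff_bijections)
  have "rep_hom K \<psi> N M"
    unfolding rep_hom_def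
  proof (intro conjI ballI allI)
    show "\<psi> v \<in> carrier M" if "v \<in> carrier N" for v using b' that by (rule bij_betw_apply)
    show "\<psi> (v \<oplus>\<^bsub>N\<^esub> w) = \<psi> v \<oplus>\<^bsub>M\<^esub> \<psi> w" if "v \<in> carrier N" "w \<in> carrier N" for v w
      using 2[OF that(1)] 2[OF that(2)] h 1 by (auto simp: rep_hom_def) (metis M.a_closed 1)
    show "\<psi> (c \<odot>\<^bsub>N\<^esub> v) = c \<odot>\<^bsub>M\<^esub> \<psi> v" if "v \<in> carrier N" for c v
      using 2[OF that(1)] h 1 by (auto simp: rep_hom_def) (metis M.smult_closed UNIV_I complex_ring_simps(1) 1)
    show "\<psi> (ract N g v) = ract M g (\<psi> v)" if "g \<in> K" "v \<in> carrier N" for g v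
      using 2[OF that(2)] h 1 that(1) by (auto simp: rep_hom_def) (metis M.act_closed 1)
  qed
  with b' show ?thesis by (auto simp: rep_iso_iff)
qed

section \<open>Quotient representations\<close>

locale subrep_pair = arep K M for K :: "'a::nonarch_local_field pgl set" and M :: "('a pgl, 'v) rep" (structure) +
  fixes W :: "'v set"
  assumes sub: "subrep K M W"
begin

lemmas W = subrepD[OF sub]

lemma W_carrier: "w \<in> W \<Longrightarrow> w \<in> carrier M"
  using W(1) by blast

lemma abelian_subgroup_W: "abelian_subgroup W M"
proof (rule abelian_subgroupI3)
  have "subgroup W (add_monoid M)"
    using sub by (simp add: subrep_def submodule_def)
  then show "additive_subgroup W M" by (rule additive_subgroup.intro)
qed unfold_locales

lemma coset_eq_iff:
  assumes "v \<in> carrier M" "w \<in> carrier M"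
  shows "W +> v = W +> w \<longleftrightarrow> v \<ominus> w \<in> W"
proof -
  interpret W: abelian_subgroup W M by (rule abelian_subgroup_W)
  have "v \<in> W +> w \<longleftrightarrow> v \<ominus> w \<in> W"
    using W.a_rcos_module[OF assms(2,1)] by (simp add: a_minus_def)
  then show ?thesis using W.a_rcos_self[OF assms(1)] W.a_repr_independence'[OF _ assms(2)] by blast
qed

lemma coset_add: "v \<in> carrier M \<Longrightarrow> w \<in> carrier M \<Longrightarrow> (W +> v) <+>\<^bsub>M\<^esub> (W +> w) = W +> (v \<oplus> w)"
  by (rule abelian_subgroup.a_rcos_sum[OF abelian_subgroup_W])

lemma coset_smult:
  assumes "v \<in> carrier M"
  shows "W <+>\<^bsub>M\<^esub> (\<lambda>x. c \<odot>\<^bsub>M\<^esub> x) ` (W +> v) = W +> (c \<odot>\<^bsub>M\<^esub> v)"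
proof -
  have 1: "w \<oplus> c \<odot>\<^bsub>M\<^esub> (w' \<oplus> v) = (w \<oplus> c \<odot>\<^bsub>M\<^esub> w') \<oplus> c \<odot>\<^bsub>M\<^esub> v" if "w \<in> W" "w' \<in> W" for w w'
    using that assms by (simp add: smult_r_distr a_assoc W_carrier)
  have 2: "w \<oplus> c \<odot>\<^bsub>M\<^esub> v = w \<oplus> c \<odot>\<^bsub>M\<^esub> (\<zero> \<oplus> v)" if "w \<in> W" for w
    using that assms by (simp add: W_carrier)
  show ?thesis
  proof (intro equalityI subsetI)
    fix x assume "x \<in> W <+>\<^bsub>M\<^esub> (\<lambda>x. c \<odot>\<^bsub>M\<^esub> x) ` (W +> v)"
    then obtain w w' where w: "w \<in> W" "w' \<in> W" "x = w \<oplus> c \<odot>\<^bsub>M\<^esub> (w' \<oplus> v)"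
      unfolding set_add_def' a_r_coset_def' by blast
    then have "x = (w \<oplus> c \<odot>\<^bsub>M\<^esub> w') \<oplus> c \<odot>\<^bsub>M\<^esub> v" "w \<oplus> c \<odot>\<^bsub>M\<^esub> w' \<in> W"
      using 1 W(3,4) by auto
    then show "x \<in> W +> (c \<odot>\<^bsub>M\<^esub> v)" unfolding a_r_coset_def' by blast
  next
    fix x assume "x \<in> W +> (c \<odot>\<^bsub>M\<^esub> v)"
    then obtain w where "w \<in> W" "x = w \<oplus> c \<odot>\<^bsub>M\<^esub> v"
      unfolding a_r_coset_def' by blast
    then show "x \<in> W <+>\<^bsub>M\<^esub> (\<lambda>x. c \<odot>\<^bsub>M\<^esub> x) ` (W +> v)"
      using 2 W(2) unfolding set_add_def' a_r_coset_def' by blast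
  qed
qed

text \<open>The image of a coset must be a whole coset, not merely lie in one. This holds because
  the inverse of \<open>g\<close> also preserves \<open>W\<close>, so that \<open>g\<close> maps
  \<open>W\<close> onto itself.\<close>

lemma coset_act:
  assumes "v \<in> carrier M" "g \<in> K"
  shows "ract M g ` (W +> v) = W +> ract M g v"
proof -
  have "ract M g ` W = W"
  proof safe
    fix w assume w: "w \<in> W"
    show "ract M g w \<in> W" using W(5) w assms by blast
    have "ract M (inv\<^bsub>PGL\<^esub> g) w \<in> W" using W(5) w assms subgroup.m_inv_closed[OF K] by blast
    moreover have "w = ract M g (ract M (inv\<^bsub>PGL\<^esub> g) w)" using w assms by (simp add: act_inv W_carrier)
    ultimately show "w \<in> ract M g ` W" by blast
  qed
  moreover have "ract M g ` (W +> v) = (\<lambda>w. w \<oplus> ract M g v) ` (ract M g ` W)"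
    using assms by (force simp: a_r_coset_def' act_add W_carrier)
  ultimately show ?thesis by (auto simp: a_r_coset_def')
qed

lemma quot_carrier: "carrier (rep_quot M W) = (\<lambda>v. W +> v) ` carrier M"
  by (auto simp: rep_quot_def A_RCOSETS_def')

lemma quot_zero: "\<zero>\<^bsub>rep_quot M W\<^esub> = W +> \<zero>"
proof -
  have "w \<oplus> \<zero> = w" if "w \<in> W" for w using that by (simp add: W_carrier)
  then show ?thesis by (auto simp: rep_quot_def a_r_coset_def')
qed

lemma coset_zero_iff: "v \<in> carrier M \<Longrightarrow> W +> v = W +> \<zero> \<longleftrightarrow> v \<in> W"
  using smult_minus_one[of "\<zero>"] smult_r_null by (simp add: coset_eq_iff minus_eq)

lemma quot_hom: "rep_hom K (\<lambda>v. W +> v) M (rep_quot M W)"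
  using quot_carrier by (auto simp: rep_hom_def rep_quot_def coset_add coset_smult coset_act)

lemma quot_ops:
  "v \<in> carrier M \<Longrightarrow> w \<in> carrier M \<Longrightarrow> (W +> v) \<oplus>\<^bsub>rep_quot M W\<^esub> (W +> w) = W +> (v \<oplus> w)"
  "v \<in> carrier M \<Longrightarrow> c \<odot>\<^bsub>rep_quot M W\<^esub> (W +> v) = W +> (c \<odot>\<^bsub>M\<^esub> v)"
  "v \<in> carrier M \<Longrightarrow> g \<in> K \<Longrightarrow> ract (rep_quot M W) g (W +> v) = W +> ract M g v"
  by (auto simp: rep_quot_def coset_add coset_smult coset_act)

lemma quot_arep: "arep K (rep_quot M W)"
proof -
  have "abelian_group (rep_quot M W)"
  proof (rule abelian_groupI)
    fix x assume "x \<in> carrier (rep_quot M W)"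
    then obtain v where v: "v \<in> carrier M" "x = W +> v" by (auto simp: quot_carrier)
    then show "\<exists>y\<in>carrier (rep_quot M W). y \<oplus>\<^bsub>rep_quot M W\<^esub> x = \<zero>\<^bsub>rep_quot M W\<^esub>"
      by (intro bexI[of _ "W +> (\<ominus> v)"]) (auto simp: quot_carrier quot_zero quot_ops l_neg)
  qed (auto simp: quot_carrier quot_ops quot_zero a_ac)
  then have "Module.module complex_ring (rep_quot M W)"
    by (rule modI) (auto simp: quot_carrier quot_ops smult_l_distr[simplified] smult_r_distr[simplified]
        smult_assoc1[simplified] smult_one[simplified])
  then show ?thesis
    by (intro arep.intro K)
      (auto simp: alg_rep_def quot_carrier quot_ops act_add act_smult act_one act_mult
        subgroup.one_closed[OF K] subgroup.m_closed[OF K])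
qed

theorem quot_iso:
  assumes h: "rep_hom K \<phi> M N" and N: "arep K N" and surj: "\<phi> ` carrier M = carrier N"
    and ker: "\<And>v. v \<in> carrier M \<Longrightarrow> \<phi> v = \<zero>\<^bsub>N\<^esub> \<longleftrightarrow> v \<in> W"
  shows "rep_iso K (rep_quot M W) N"
proof -
  interpret N: arep K N by fact
  have minus: "\<phi> (v \<ominus> w) = \<phi> v \<ominus>\<^bsub>N\<^esub> \<phi> w" if "v \<in> carrier M" "w \<in> carrier M" for v w
  proof -
    have "v \<ominus> w = v \<oplus> (-1) \<odot>\<^bsub>M\<^esub> w" "\<phi> v \<ominus>\<^bsub>N\<^esub> \<phi> w = \<phi> v \<oplus>\<^bsub>N\<^esub> (-1) \<odot>\<^bsub>N\<^esub> \<phi> w"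
      using that h by (auto simp: a_minus_def smult_minus_one N.smult_minus_one rep_hom_def)
    then show ?thesis using h that by (simp add: rep_hom_def)
  qed
  \<comment> \<open>Read from right to left this makes the induced map independent of the
    representative, from left to right it makes it injective.\<close>
  have eq: "\<phi> v = \<phi> w \<longleftrightarrow> W +> v = W +> w" if "v \<in> carrier M" "w \<in> carrier M" for v w
  proof -
    have "\<phi> v \<in> carrier N" "\<phi> w \<in> carrier N" using that h by (auto simp: rep_hom_def)
    then have "\<phi> v = \<phi> w \<longleftrightarrow> \<phi> v \<ominus>\<^bsub>N\<^esub> \<phi> w = \<zero>\<^bsub>N\<^esub>"
      using N.a_assoc[of "\<phi> v" "\<ominus>\<^bsub>N\<^esub> \<phi> w" "\<phi> w"] by (auto simp: N.minus_eq N.l_neg N.r_neg)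
    then show ?thesis using that ker[of "v \<ominus> w"] minus[OF that] by (simp add: coset_eq_iff)
  qed
  define \<psi> where "\<psi> C = \<phi> (SOME v. v \<in> carrier M \<and> C = W +> v)" for C
  have \<psi>: "\<psi> (W +> v) = \<phi> v" if "v \<in> carrier M" for v
  proof -
    define s where "s = (SOME w. w \<in> carrier M \<and> W +> v = W +> w)"
    have "s \<in> carrier M \<and> W +> v = W +> s"
      unfolding s_def by (rule someI[of _ v]) (use that in auto)
    then have "\<phi> s = \<phi> v" using eq[OF that, of s] by simp
    then show ?thesis by (simp add: \<psi>_def s_def)
  qed
  have "bij_betw \<psi> (carrier (rep_quot M W)) (carrier N)"
    using surj by (auto simp: bij_betw_def inj_on_def quot_carrier \<psi> eq image_image)
  moreover have "rep_hom K \<psi> (rep_quot M W) N"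
    using h by (auto simp: rep_hom_def quot_carrier quot_ops \<psi>)
  ultimately show ?thesis by (auto simp: rep_iso_iff)
qed

end

text \<open>Both quotients are quotients of \<open>A\<close> by one and the same preimage. The
  common source is needed where no map from \<open>B\<close> to \<open>C\<close> exists before
  dividing: an element of \<open>B\<close> may come from several elements of \<open>A\<close> whose
  images in \<open>C\<close> differ, and only the class modulo \<open>W\<close> is well
  defined.\<close>

lemma rep_iso_zigzag:
  assumes "arep K A" "arep K B" "arep K C" and B: "rep_hom K \<beta> A B" "\<beta> ` carrier A = carrier B"
    and C: "rep_hom K \<gamma> A C" "\<gamma> ` carrier A = carrier C"
    and sub: "subrep K B V" "subrep K C W"
    and eq: "\<And>v. v \<in> carrier A \<Longrightarrow> \<beta> v \<in> V \<longleftrightarrow> \<gamma> v \<in> W"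
  shows "rep_iso K (rep_quot B V) (rep_quot C W)"
proof -
  have main: "rep_iso K (rep_quot A {v \<in> carrier A. \<beta> v \<in> V}) (rep_quot B V)"
    if "arep K B" "rep_hom K \<beta> A B" "\<beta> ` carrier A = carrier B" "subrep K B V"
    for B :: "('a pgl, 'x) rep" and \<beta> V
  proof -
    interpret A: subrep_pair K A "{v \<in> carrier A. \<beta> v \<in> V}"
      using assms(1) that subrep_vimage by (simp add: subrep_pair_def subrep_pair_axioms_def)
    interpret B: subrep_pair K B V
      using that by (simp add: subrep_pair_def subrep_pair_axioms_def)
    have *: "\<beta> v \<in> carrier B" if "v \<in> carrier A" for v
      using that \<open>rep_hom K \<beta> A B\<close> by (simp add: rep_hom_def)
    show ?thesis
    proof (rule A.quot_iso[OF rep_hom_comp[OF that(2) B.quot_hom] B.quot_arep])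
      show "((+>\<^bsub>B\<^esub>) V \<circ> \<beta>) ` carrier A = carrier (rep_quot B V)"
        unfolding image_comp[symmetric] that(3) B.quot_carrier ..
      show "((+>\<^bsub>B\<^esub>) V \<circ> \<beta>) v = \<zero>\<^bsub>rep_quot B V\<^esub> \<longleftrightarrow> v \<in> {v \<in> carrier A. \<beta> v \<in> V}"
        if "v \<in> carrier A" for v
        using that * by (simp add: B.quot_zero B.coset_zero_iff)
    qed
  qed
  have *: "{v \<in> carrier A. \<gamma> v \<in> W} = {v \<in> carrier A. \<beta> v \<in> V}" using eq by auto
  have "subrep_pair K A {v \<in> carrier A. \<beta> v \<in> V}"
    by (intro subrep_pair.intro subrep_pair_axioms.intro subrep_vimage[OF assms(1,2) B(1) sub(1)] assms(1))
  then have "arep K (rep_quot A {v \<in> carrier A. \<beta> v \<in> V})"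
    by (rule subrep_pair.quot_arep)
  from rep_iso_trans[OF rep_iso_sym[OF this main[OF assms(2) B sub(1)]] main[OF assms(3) C sub(2), unfolded *]]
  show ?thesis .
qed

section \<open>Direct sums\<close>

lemma rep_plus_simps:
  "carrier (rep_plus M N) = carrier M \<times> carrier N"
  "ring.zero (rep_plus M N) = (\<zero>\<^bsub>M\<^esub>, \<zero>\<^bsub>N\<^esub>)"
  "p \<oplus>\<^bsub>rep_plus M N\<^esub> q = (fst p \<oplus>\<^bsub>M\<^esub> fst q, snd p \<oplus>\<^bsub>N\<^esub> snd q)"
  "c \<odot>\<^bsub>rep_plus M N\<^esub> p = (c \<odot>\<^bsub>M\<^esub> fst p, c \<odot>\<^bsub>N\<^esub> snd p)"
  "ract (rep_plus M N) g p = (ract M g (fst p), ract N g (snd p))"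
  by (simp_all add: rep_plus_def)

lemma rep_dsum_simps:
  "carrier (rep_dsum I M) = {f \<in> \<Pi>\<^sub>E i\<in>I. carrier (M i). finite {i \<in> I. f i \<noteq> \<zero>\<^bsub>M i\<^esub>}}"
  "ring.zero (rep_dsum I M) = (\<lambda>i\<in>I. \<zero>\<^bsub>M i\<^esub>)"
  "f \<oplus>\<^bsub>rep_dsum I M\<^esub> h = (\<lambda>i\<in>I. f i \<oplus>\<^bsub>M i\<^esub> h i)"
  "c \<odot>\<^bsub>rep_dsum I M\<^esub> f = (\<lambda>i\<in>I. c \<odot>\<^bsub>M i\<^esub> f i)"
  "ract (rep_dsum I M) g f = (\<lambda>i\<in>I. ract (M i) g (f i))"
  by (simp_all add: rep_dsum_def)

lemma rep_plus_arep:
  assumes "arep K M" "arep K N"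
  shows "arep K (rep_plus M N)"
proof -
  interpret M: arep K M by fact
  interpret N: arep K N by fact
  have "abelian_group (rep_plus M N)"
  proof (rule abelian_groupI)
    fix x assume "x \<in> carrier (rep_plus M N)"
    then show "\<exists>y\<in>carrier (rep_plus M N). y \<oplus>\<^bsub>rep_plus M N\<^esub> x = \<zero>\<^bsub>rep_plus M N\<^esub>"
      by (intro bexI[of _ "(\<ominus>\<^bsub>M\<^esub> fst x, \<ominus>\<^bsub>N\<^esub> snd x)"]) (auto simp: rep_plus_simps M.l_neg N.l_neg)
  qed (auto simp: rep_plus_simps M.a_ac N.a_ac)
  then have "Module.module complex_ring (rep_plus M N)"
    by (rule modI) (auto simp: rep_plus_simps M.smult_l_distr[simplified] M.smult_r_distr[simplified]
        M.smult_assoc1[simplified] M.smult_one[simplified] N.smult_l_distr[simplified]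
        N.smult_r_distr[simplified] N.smult_assoc1[simplified] N.smult_one[simplified])
  then show ?thesis
    by (intro arep.intro M.K)
      (auto simp: alg_rep_def rep_plus_simps M.act_add M.act_smult M.act_one M.act_mult
        N.act_add N.act_smult N.act_one N.act_mult)
qed

lemma rep_dsum_carrier: "finite I \<Longrightarrow> carrier (rep_dsum I M) = (\<Pi>\<^sub>E i\<in>I. carrier (M i))"
  by (simp add: rep_dsum_simps)

lemma rep_dsum_cong:
  assumes "\<And>i. i \<in> I \<Longrightarrow> M i = N i"
  shows "rep_dsum I M = rep_dsum I N"
proof -
  have "(\<Pi>\<^sub>E i\<in>I. carrier (M i)) = (\<Pi>\<^sub>E i\<in>I. carrier (N i))"
    "{i \<in> I. f i \<noteq> \<zero>\<^bsub>M i\<^esub>} = {i \<in> I. f i \<noteq> \<zero>\<^bsub>N i\<^esub>}" for f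
    using assms by (auto intro!: PiE_cong)
  then show ?thesis using assms by (simp add: rep_dsum_def cong: restrict_cong)
qed

lemma rep_dsum_arep:
  assumes ar: "\<And>i. i \<in> I \<Longrightarrow> arep K (M i)" and K: "subgroup K PGL" and I: "finite I"
  shows "arep K (rep_dsum I M)"
proof -
  have ab: "abelian_monoid (M i)" and mod: "Module.module complex_ring (M i)" if "i \<in> I" for i
  proof -
    interpret arep K "M i" by (rule ar[OF that])
    show "abelian_monoid (M i)" "Module.module complex_ring (M i)" by unfold_locales
  qed
  note [simp] = arep.act_closed[OF ar] arep.act_add[OF ar] arep.act_smult[OF ar]
    arep.act_one[OF ar] arep.act_mult[OF ar] arep.smult_zero_left[OF ar] arep.act_zero[OF ar]
    abelian_monoid.a_closed[OF ab] abelian_monoid.zero_closed[OF ab] abelian_monoid.l_zero[OF ab]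
    Module.module.smult_closed[OF mod, simplified]
    Module.module.smult_r_distr[OF mod, simplified] Module.module.smult_l_distr[OF mod, simplified]
    Module.module.smult_assoc1[OF mod, simplified] Module.module.smult_one[OF mod, simplified]
  note [simp] = rep_dsum_carrier[OF I] rep_dsum_simps(2-) PiE_mem[of _ I "\<lambda>i. carrier (M i)"]
  have id: "(\<lambda>i\<in>I. F i) = f" if "f \<in> (\<Pi>\<^sub>E i\<in>I. carrier (M i))" "\<And>i. i \<in> I \<Longrightarrow> F i = f i" for F f
    using that by (metis (mono_tags, lifting) PiE_restrict restrict_ext)
  have abel: "abelian_group (rep_dsum I M)"
  proof (rule abelian_groupI)
    fix f assume f: "f \<in> carrier (rep_dsum I M)"
    have "(-1) \<odot>\<^bsub>M i\<^esub> f i \<oplus>\<^bsub>M i\<^esub> f i = \<zero>\<^bsub>M i\<^esub>" if "i \<in> I" for i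
    proof -
      have "f i \<in> carrier (M i)" using f that by simp
      moreover have "(-1 + 1) \<odot>\<^bsub>M i\<^esub> f i = \<zero>\<^bsub>M i\<^esub>" using calculation that by simp
      ultimately show ?thesis using that Module.module.smult_l_distr[OF mod[OF that], simplified, of "f i" "-1" 1] by simp
    qed
    then show "\<exists>h\<in>carrier (rep_dsum I M). h \<oplus>\<^bsub>rep_dsum I M\<^esub> f = \<zero>\<^bsub>rep_dsum I M\<^esub>"
      using f by (intro bexI[of _ "\<lambda>i\<in>I. (-1) \<odot>\<^bsub>M i\<^esub> f i"]) (auto intro!: restrict_ext)
  qed (auto simp: abelian_monoid.a_comm[OF ab] abelian_monoid.a_lcomm[OF ab]
      abelian_monoid.a_assoc[OF ab] abelian_monoid.r_zero[OF ab] intro!: restrict_ext id)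
  have "Module.module complex_ring (rep_dsum I M)"
    by (rule modI[OF abel]) (auto intro!: restrict_ext id)
  then show ?thesis
    by (intro arep.intro K) (auto simp: alg_rep_def intro!: restrict_ext id)
qed

lemma rep_plus_cong:
  assumes "rep_iso K M M'" "rep_iso K N N'"
  shows "rep_iso K (rep_plus M N) (rep_plus M' N')"
proof -
  obtain \<phi> \<psi> where "bij_betw \<phi> (carrier M) (carrier M')" "rep_hom K \<phi> M M'"
    "bij_betw \<psi> (carrier N) (carrier N')" "rep_hom K \<psi> N N'"
    using assms by (auto simp: rep_iso_iff)
  then show ?thesis
    unfolding rep_iso_iff
    by (intro exI[of _ "map_prod \<phi> \<psi>"])
      (auto simp: rep_plus_simps rep_hom_def map_prod_def split_beta intro: bij_betw_map_prod[unfolded map_prod_def])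
qed

lemma rep_quot_plus:
  assumes "subrep_pair K M W" "arep K N"
  shows "rep_iso K (rep_quot (rep_plus M N) (W \<times> {\<zero>\<^bsub>N\<^esub>})) (rep_plus (rep_quot M W) N)"
    and "subrep K (rep_plus M N) (W \<times> {\<zero>\<^bsub>N\<^esub>})"
proof -
  interpret M: subrep_pair K M W by fact
  interpret N: arep K N by fact
  interpret A: arep K "rep_plus M N" by (rule rep_plus_arep[OF M.arep_axioms N.arep_axioms])
  show sub: "subrep K (rep_plus M N) (W \<times> {\<zero>\<^bsub>N\<^esub>})"
    by (rule A.subrepI) (use M.W in \<open>auto simp: rep_plus_simps N.act_zero N.smult_r_null[simplified]\<close>)
  interpret A: subrep_pair K "rep_plus M N" "W \<times> {\<zero>\<^bsub>N\<^esub>}"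
    by unfold_locales (rule sub)
  show "rep_iso K (rep_quot (rep_plus M N) (W \<times> {\<zero>\<^bsub>N\<^esub>})) (rep_plus (rep_quot M W) N)"
  proof (rule A.quot_iso[where \<phi> = "map_prod (\<lambda>v. W +>\<^bsub>M\<^esub> v) id"])
    show "arep K (rep_plus (rep_quot M W) N)"
      by (rule rep_plus_arep[OF M.quot_arep N.arep_axioms])
    show "rep_hom K (map_prod (\<lambda>v. W +>\<^bsub>M\<^esub> v) id) (rep_plus M N) (rep_plus (rep_quot M W) N)"
      using M.quot_hom by (auto simp: rep_hom_def rep_plus_simps)
    show "map_prod (\<lambda>v. W +>\<^bsub>M\<^esub> v) id ` carrier (rep_plus M N) = carrier (rep_plus (rep_quot M W) N)"
      by (simp add: rep_plus_simps M.quot_carrier map_prod_surj_on)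
  qed (auto simp: rep_plus_simps M.quot_zero M.coset_zero_iff)
qed

text \<open>Associates the summands of a new path length with those already collected in the
  induction on \<open>n\<close>. Restriction to \<open>I\<close> and \<open>J\<close> is a two-sided
  inverse because members of the sums are extensional.\<close>

lemma rep_dsum_union:
  assumes disj: "I \<inter> J = {}" and fin: "finite I" "finite J"
  shows "rep_iso K (rep_plus (rep_plus S (rep_dsum I V)) (rep_dsum J V)) (rep_plus S (rep_dsum (I \<union> J) V))"
proof -
  let ?F = "\<lambda>((s, f), h). (s, \<lambda>i\<in>I \<union> J. if i \<in> I then f i else h i)"
  let ?G = "\<lambda>(s, f). ((s, restrict f I), restrict f J)"
  note car = rep_plus_simps rep_dsum_carrier[OF fin(1)] rep_dsum_carrier[OF fin(2)]
    rep_dsum_carrier[OF finite_UnI[OF fin]]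
  have J: "i \<notin> I" if "i \<in> J" for i using that disj by auto
  have G: "(\<lambda>i\<in>I. if i \<in> I then f i else h i) = f" "(\<lambda>i\<in>J. if i \<in> I then f i else h i) = h"
    if "f \<in> (\<Pi>\<^sub>E i\<in>I. carrier (V i))" "h \<in> (\<Pi>\<^sub>E i\<in>J. carrier (V i))" for f h
    using that J PiE_arb[OF that(1)] PiE_arb[OF that(2)] by (auto simp: fun_eq_iff)
  have F: "(\<lambda>i\<in>I \<union> J. if i \<in> I then restrict f I i else restrict f J i) = f"
    if "f \<in> (\<Pi>\<^sub>E i\<in>I \<union> J. carrier (V i))" for f
    using PiE_arb[OF that] by (auto simp: fun_eq_iff)
  have "bij_betw ?F (carrier (rep_plus (rep_plus S (rep_dsum I V)) (rep_dsum J V))) (carrier (rep_plus S (rep_dsum (I \<union> J) V)))"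
  proof (rule bij_betw_byWitness[where f' = ?G])
    show "?F ` carrier (rep_plus (rep_plus S (rep_dsum I V)) (rep_dsum J V)) \<subseteq> carrier (rep_plus S (rep_dsum (I \<union> J) V))"
      by (auto simp: car)
    show "?G ` carrier (rep_plus S (rep_dsum (I \<union> J) V)) \<subseteq> carrier (rep_plus (rep_plus S (rep_dsum I V)) (rep_dsum J V))"
      by (auto simp: car)
    show "\<forall>a\<in>carrier (rep_plus (rep_plus S (rep_dsum I V)) (rep_dsum J V)). ?G (?F a) = a"
      by (clarsimp simp: car G)
    show "\<forall>a\<in>carrier (rep_plus S (rep_dsum (I \<union> J) V)). ?F (?G a) = a"
      by (clarsimp simp: car F)
  qed
  moreover have "rep_hom K ?F (rep_plus (rep_plus S (rep_dsum I V)) (rep_dsum J V)) (rep_plus S (rep_dsum (I \<union> J) V))"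
    unfolding rep_hom_def
  proof (intro conjI ballI allI)
    show "?F v \<in> carrier (rep_plus S (rep_dsum (I \<union> J) V))"
      if "v \<in> carrier (rep_plus (rep_plus S (rep_dsum I V)) (rep_dsum J V))" for v
      using that by (rule bij_betw_apply[OF calculation])
  qed (auto simp: rep_plus_simps rep_dsum_simps(2-) J split_beta intro!: restrict_ext)
  ultimately show ?thesis by (auto simp: rep_iso_iff)
qed

text \<open>Passes from a list of pieces, each isomorphic to the \<open>Y\<close> of its label, to
  the form with multiplicities. An enumeration of each fibre of the labelling
  \<open>\<sigma>\<close> turns an index into a label together with a position.\<close>

lemma rep_dsum_regroup:
  assumes "finite I" and \<sigma>: "\<And>i. i \<in> I \<Longrightarrow> \<sigma> i \<in> P" and iso: "\<And>i. i \<in> I \<Longrightarrow> rep_iso K (V i) (Y (\<sigma> i))"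
    and m: "\<And>p. p \<in> P \<Longrightarrow> card {i \<in> I. \<sigma> i = p} = m p"
  shows "rep_iso K (rep_dsum I V) (rep_dsum P (\<lambda>p. rep_dsum {..<m p} (\<lambda>_. Y p)))"
proof -
  have "\<forall>i\<in>I. \<exists>\<theta>. bij_betw \<theta> (carrier (V i)) (carrier (Y (\<sigma> i))) \<and> rep_hom K \<theta> (V i) (Y (\<sigma> i))"
    using iso by (simp add: rep_iso_iff)
  then obtain \<theta> where \<theta>: "\<And>i. i \<in> I \<Longrightarrow> bij_betw (\<theta> i) (carrier (V i)) (carrier (Y (\<sigma> i)))"
    "\<And>i. i \<in> I \<Longrightarrow> rep_hom K (\<theta> i) (V i) (Y (\<sigma> i))" by metis
  have "\<forall>p\<in>P. \<exists>b. bij_betw b {..<m p} {i \<in> I. \<sigma> i = p}"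
    using m \<open>finite I\<close> by (auto intro!: finite_same_card_bij)
  then obtain b where b: "\<And>p. p \<in> P \<Longrightarrow> bij_betw (b p) {..<m p} {i \<in> I. \<sigma> i = p}" by metis
  have bI: "b p j \<in> I" "\<sigma> (b p j) = p" if "p \<in> P" "j < m p" for p j
    using bij_betw_apply[OF b[OF that(1)], of j] that by auto
  \<comment> \<open>The position of \<open>i\<close> in the enumeration \<open>b\<close> of its own
    fibre.\<close>
  define c where "c i = inv_into {..<m (\<sigma> i)} (b (\<sigma> i)) i" for i
  have c: "c i < m (\<sigma> i)" "b (\<sigma> i) (c i) = i" if "i \<in> I" for i
  proof -
    have "i \<in> b (\<sigma> i) ` {..<m (\<sigma> i)}" using b[OF \<sigma>[OF that]] that by (auto simp: bij_betw_def)
    then show "c i < m (\<sigma> i)" "b (\<sigma> i) (c i) = i"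
      unfolding c_def using inv_into_into f_inv_into_f by (metis lessThan_iff)+
  qed
  have cb: "c (b p j) = j" if "p \<in> P" "j < m p" for p j
    using bI[OF that] b[OF that(1)] that unfolding c_def by (auto simp: bij_betw_def)
  define \<eta> where "\<eta> i = inv_into (carrier (V i)) (\<theta> i)" for i
  have \<eta>: "\<eta> i (\<theta> i v) = v" if "i \<in> I" "v \<in> carrier (V i)" for i v
    using \<theta>(1)[OF that(1)] that unfolding \<eta>_def by (simp add: bij_betw_inv_into_left)
  have \<eta>': "\<theta> i (\<eta> i v) = v" "\<eta> i v \<in> carrier (V i)" if "i \<in> I" "v \<in> carrier (Y (\<sigma> i))" for i v
    using \<theta>(1)[OF that(1)] that unfolding \<eta>_def
    by (auto simp: bij_betw_inv_into_right bij_betw_def intro!: inv_into_into)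
  have \<theta>c: "\<theta> (b p j) v \<in> carrier (Y p)" if "p \<in> P" "j < m p" "v \<in> carrier (V (b p j))" for p j v
    using \<theta>(2)[OF bI(1)[OF that(1,2)]] bI(2)[OF that(1,2)] that by (simp add: rep_hom_def)
  let ?F = "\<lambda>f. \<lambda>p\<in>P. \<lambda>j\<in>{..<m p}. \<theta> (b p j) (f (b p j))"
  let ?G = "\<lambda>h. \<lambda>i\<in>I. \<eta> i (h (\<sigma> i) (c i))"
  let ?Y = "\<lambda>p. rep_dsum {..<m p} (\<lambda>_. Y p)"
  \<comment> \<open>The set \<open>P\<close> may be infinite. A label outside the image of
    \<open>\<sigma>\<close> has multiplicity 0, and the empty direct sum has no nonzero vector, so
    finite support is automatic.\<close>
  have sup: "finite {p \<in> P. h p \<noteq> \<zero>\<^bsub>?Y p\<^esub>}" if "h \<in> (\<Pi>\<^sub>E p\<in>P. carrier (?Y p))" for h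
  proof (rule finite_subset[OF _ finite_imageI[OF \<open>finite I\<close>, of \<sigma>]], safe)
    fix p assume p: "p \<in> P" "h p \<noteq> \<zero>\<^bsub>?Y p\<^esub>"
    show "p \<in> \<sigma> ` I"
    proof (rule ccontr)
      assume "p \<notin> \<sigma> ` I"
      then have "{i \<in> I. \<sigma> i = p} = {}" by auto
      then have "m p = 0" using m[OF p(1)] by (metis card.empty)
      then show False using PiE_mem[OF that p(1)] p(2) by (auto simp: rep_dsum_simps)
    qed
  qed
  have fm: "f i \<in> carrier (V i)" if "f \<in> carrier (rep_dsum I V)" "i \<in> I" for f i
    using that by (auto simp: rep_dsum_carrier[OF \<open>finite I\<close>])
  have FY: "?F f \<in> (\<Pi>\<^sub>E p\<in>P. carrier (?Y p))" if "f \<in> carrier (rep_dsum I V)" for f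
  proof (intro PiE_I)
    fix p assume p: "p \<in> P"
    have "\<theta> (b p j) (f (b p j)) \<in> carrier (Y p)" if "j < m p" for j
      using \<theta>c[OF p that] fm[OF \<open>f \<in> carrier (rep_dsum I V)\<close> bI(1)[OF p that]] .
    then show "?F f p \<in> carrier (?Y p)" using p by (simp add: rep_dsum_carrier)
  qed simp
  have hp: "h p \<in> (\<Pi>\<^sub>E j\<in>{..<m p}. carrier (Y p))" if "h \<in> carrier (rep_dsum P ?Y)" "p \<in> P" for h p
  proof -
    have "h p \<in> carrier (?Y p)" using that unfolding rep_dsum_simps(1)[of P] by blast
    then show ?thesis by (simp add: rep_dsum_carrier)
  qed
  have bij: "bij_betw ?F (carrier (rep_dsum I V)) (carrier (rep_dsum P ?Y))"
  proof (rule bij_betw_byWitness[where f' = ?G])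
    show "?F ` carrier (rep_dsum I V) \<subseteq> carrier (rep_dsum P ?Y)"
    proof
      fix h assume "h \<in> ?F ` carrier (rep_dsum I V)"
      with FY have "h \<in> (\<Pi>\<^sub>E p\<in>P. carrier (?Y p))" by blast
      with sup[OF this] show "h \<in> carrier (rep_dsum P ?Y)"
        unfolding rep_dsum_simps(1)[of P] by blast
    qed
    show "?G ` carrier (rep_dsum P ?Y) \<subseteq> carrier (rep_dsum I V)"
    proof
      fix f assume "f \<in> ?G ` carrier (rep_dsum P ?Y)"
      then obtain h where h: "h \<in> carrier (rep_dsum P ?Y)" and f: "f = ?G h" by blast
      have "h (\<sigma> i) (c i) \<in> carrier (Y (\<sigma> i))" if "i \<in> I" for i
        using PiE_mem[OF hp[OF h \<sigma>[OF that]], of "c i"] c(1)[OF that] by simp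
      then show "f \<in> carrier (rep_dsum I V)"
        unfolding f rep_dsum_carrier[OF \<open>finite I\<close>] by (auto simp: \<eta>')
    qed
    show "\<forall>f\<in>carrier (rep_dsum I V). ?G (?F f) = f"
    proof
      fix f assume f: "f \<in> carrier (rep_dsum I V)"
      show "?G (?F f) = f"
      proof (rule extensionalityI[of _ I])
        show "f \<in> extensional I" using f by (auto simp: rep_dsum_simps PiE_def)
      qed (use f in \<open>auto simp: \<sigma> c \<eta> fm\<close>)
    qed
    show "\<forall>h\<in>carrier (rep_dsum P ?Y). ?F (?G h) = h"
    proof
      fix h assume h: "h \<in> carrier (rep_dsum P ?Y)"
      show "?F (?G h) = h"
      proof (rule extensionalityI[of _ P])
        show "h \<in> extensional P" using h unfolding rep_dsum_simps(1) by (auto simp: PiE_def)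
        fix p assume p: "p \<in> P"
        have "(\<lambda>j\<in>{..<m p}. \<theta> (b p j) (?G h (b p j))) = h p"
        proof (rule extensionalityI[of _ "{..<m p}"])
          show "h p \<in> extensional {..<m p}" using hp[OF h p] by (auto simp: PiE_def)
          fix j assume j: "j \<in> {..<m p}"
          then have "h p j \<in> carrier (Y (\<sigma> (b p j)))" using hp[OF h p] bI(2)[OF p, of j] by auto
          then show "(\<lambda>j\<in>{..<m p}. \<theta> (b p j) (?G h (b p j))) j = h p j"
            using j p bI[OF p, of j] cb[OF p, of j] \<eta>'(1)[of "b p j" "h p j"] by auto
        qed simp
        then show "?F (?G h) p = h p" using p by simp
      qed simp
    qed
  qed
  moreover have "rep_hom K ?F (rep_dsum I V) (rep_dsum P ?Y)"
  proof -
    have h: "rep_hom K (\<theta> (b p j)) (V (b p j)) (Y p)" if "p \<in> P" "j < m p" for p j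
      using \<theta>(2)[OF bI(1)[OF that]] bI(2)[OF that] by simp
    have "\<theta> (b p j) (v (b p j) \<oplus>\<^bsub>V (b p j)\<^esub> w (b p j)) = \<theta> (b p j) (v (b p j)) \<oplus>\<^bsub>Y p\<^esub> \<theta> (b p j) (w (b p j))"
      "\<theta> (b p j) (a \<odot>\<^bsub>V (b p j)\<^esub> v (b p j)) = a \<odot>\<^bsub>Y p\<^esub> \<theta> (b p j) (v (b p j))"
      "\<And>g. g \<in> K \<Longrightarrow> \<theta> (b p j) (ract (V (b p j)) g (v (b p j))) = ract (Y p) g (\<theta> (b p j) (v (b p j)))"
      if "p \<in> P" "j < m p" "v \<in> carrier (rep_dsum I V)" "w \<in> carrier (rep_dsum I V)" for p j v w a
      using h[OF that(1,2)] fm[OF that(3) bI(1)[OF that(1,2)]] fm[OF that(4) bI(1)[OF that(1,2)]]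
      by (auto simp: rep_hom_def)
    then show ?thesis
      unfolding rep_hom_def
      by (intro conjI ballI allI bij_betw_apply[OF bij]) (auto simp: rep_dsum_simps(2-) bI intro!: restrict_ext)
  qed
  ultimately show ?thesis by (auto simp: rep_iso_iff)
qed

section \<open>Arithmetic of the local field\<close>

lemma absv_zero [simp]: "absv (0 :: 'a::nonarch_local_field) = 0"
  using dist_absv[of "0::'a" 0] by simp

lemma absv_eq_0 [simp]: "absv (x :: 'a::nonarch_local_field) = 0 \<longleftrightarrow> x = 0"
  by (metis diff_zero dist_absv dist_eq_0_iff)

lemma absv_nonneg [simp]: "0 \<le> absv (x :: 'a::nonarch_local_field)"
  by (metis diff_zero dist_absv zero_le_dist)

lemma absv_pos_iff [simp]: "0 < absv (x :: 'a::nonarch_local_field) \<longleftrightarrow> x \<noteq> 0"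
  using absv_nonneg[of x] absv_eq_0[of x] by linarith

lemma absv_one [simp]: "absv (1 :: 'a::nonarch_local_field) = 1"
  using absv_mult[of "1::'a" 1] by simp

lemma absv_minus [simp]: "absv (- x :: 'a::nonarch_local_field) = absv x"
  using dist_absv[of 0 x] dist_absv[of x 0] by (simp add: dist_commute)

lemma absv_diff: "absv (x - y :: 'a::nonarch_local_field) \<le> max (absv x) (absv y)"
  using absv_add[of x "- y"] by simp

lemma absv_minus_commute: "absv (x - y :: 'a::nonarch_local_field) = absv (y - x)"
  using absv_minus[of "x - y"] by simp

lemma absv_inverse [simp]: "absv (inverse x :: 'a::nonarch_local_field) = inverse (absv x)"
proof (cases "x = 0")
  case False
  then have "absv x * absv (inverse x) = 1" by (simp flip: absv_mult)
  then show ?thesis by (simp add: inverse_unique)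
qed simp

lemma absv_divide [simp]: "absv (x / y :: 'a::nonarch_local_field) = absv x / absv y"
  by (simp add: divide_inverse absv_mult)

lemma absv_power [simp]: "absv (x ^ n :: 'a::nonarch_local_field) = absv x ^ n"
  by (induction n) (simp_all add: absv_mult)

lemma absv_add_le: "absv x \<le> r \<Longrightarrow> absv y \<le> r \<Longrightarrow> absv (x + y :: 'a::nonarch_local_field) \<le> r"
  using absv_add[of x y] by linarith

lemma absv_diff_le: "absv x \<le> r \<Longrightarrow> absv y \<le> r \<Longrightarrow> absv (x - y :: 'a::nonarch_local_field) \<le> r"
  using absv_diff[of x y] by linarith

lemma absv_add_less: "absv x < r \<Longrightarrow> absv y < r \<Longrightarrow> absv (x + y :: 'a::nonarch_local_field) < r"
  using absv_add[of x y] by linarith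

lemma absv_diff_less: "absv x < r \<Longrightarrow> absv y < r \<Longrightarrow> absv (x - y :: 'a::nonarch_local_field) < r"
  using absv_diff[of x y] by linarith

lemma absv_mult_le: "absv x \<le> r \<Longrightarrow> absv y \<le> 1 \<Longrightarrow> absv (x * y :: 'a::nonarch_local_field) \<le> r"
  using mult_mono[of "absv x" r "absv y" 1] by (simp add: absv_mult order_trans[OF absv_nonneg])

lemma absv_mult_less: "absv x < r \<Longrightarrow> absv y \<le> 1 \<Longrightarrow> absv (x * y :: 'a::nonarch_local_field) < r"
  using absv_mult_le[of x "absv x" y] by simp

lemma absv_add_eq: "absv y < absv x \<Longrightarrow> absv (x + y :: 'a::nonarch_local_field) = absv x"
  using absv_add[of x y] absv_diff[of "x + y" y] by (simp add: max_def split: if_splits)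

lemma exists_small: "0 < e \<Longrightarrow> \<exists>x::'a::nonarch_local_field. x \<noteq> 0 \<and> absv x < e"
proof (rule ccontr)
  assume e: "0 < e" and "\<not> (\<exists>x::'a. x \<noteq> 0 \<and> absv x < e)"
  then have "ball (0::'a) e = {0}" by (auto simp: dist_absv)
  then show False using nondiscrete open_ball by metis
qed

text \<open>Local compactness makes some small ball around 0 compact, and non-discreteness gives a
  nonzero \<open>c\<close> inside it. Division by \<open>c\<close> carries the ball of radius
  \<open>absv c\<close> onto the valuation ring.\<close>

lemma compact_val_ring: "compact (val_ring :: 'a::nonarch_local_field set)"
proof -
  obtain U K where UK: "open U" "compact K" "(0::'a) \<in> U" "U \<subseteq> K"
    using locally_compact_nonarch by blast
  then obtain e where e: "e > 0" "ball 0 e \<subseteq> U" by (auto simp: open_contains_ball)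
  obtain c :: 'a where c: "c \<noteq> 0" "absv c < e" using exists_small e by blast
  have "cball (0::'a) (absv c) \<subseteq> K" using e UK c by (auto simp: dist_absv subset_iff)
  then have "compact (cball (0::'a) (absv c))"
    using compact_Int_closed[OF UK(2) closed_cball[of "0::'a" "absv c"]] by (simp add: Int_absorb1)
  moreover have "continuous_on (cball (0::'a) (absv c)) (\<lambda>x. x / c)"
  proof (rule continuous_onI)
    fix x :: 'a and r :: real assume "r > 0"
    have *: "dist (x' / c) (x / c) = dist x' x / absv c" for x'
      by (simp add: dist_absv flip: diff_divide_distrib)
    then show "\<exists>d>0. \<forall>x'\<in>cball 0 (absv c). dist x' x < d \<longrightarrow> dist (x' / c) (x / c) \<le> r"
      using c(1) \<open>r > 0\<close> unfolding * by (intro exI[of _ "r * absv c"]) (auto simp: divide_simps)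
  qed
  moreover have "(\<lambda>x. x / c) ` cball 0 (absv c) = (val_ring :: 'a set)"
  proof safe
    fix x :: 'a assume "x \<in> val_ring"
    then show "x \<in> (\<lambda>x. x / c) ` cball 0 (absv c)"
      using c mult_left_mono[of "absv x" 1 "absv c"]
      by (intro image_eqI[of _ _ "c * x"]) (auto simp: val_ring_def dist_absv absv_mult)
  qed (use c in \<open>auto simp: val_ring_def dist_absv divide_simps\<close>)
  ultimately show ?thesis by (metis compact_continuous_image)
qed

text \<open>Total boundedness of the compact valuation ring at scale 1: two elements at distance
  less than 1 have the same residue.\<close>

lemma finite_residues: "\<exists>R::'a::nonarch_local_field set. finite R \<and> R \<subseteq> val_ring \<and> (\<forall>x\<in>val_ring. \<exists>r\<in>R. absv (x - r) < 1)"
proof -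
  obtain R :: "'a set" where "finite R" "R \<subseteq> val_ring" "val_ring \<subseteq> (\<Union>x\<in>R. ball x 1)"
    using seq_compact_imp_totally_bounded[OF compact_imp_seq_compact[OF compact_val_ring]]
    by (metis zero_less_one)
  then show ?thesis
    by (intro exI[of _ R]) (auto simp: dist_absv absv_minus_commute subset_iff)
qed

text \<open>In an ultrametric the set where \<open>absv\<close> is at least 1 is open, so the
  maximal ideal is closed in the compact valuation ring, and \<open>absv\<close> attains its maximum
  there. Non-discreteness makes this maximum nonzero.\<close>

lemma uniformizer_exists:
  "\<exists>p::'a::nonarch_local_field. p \<noteq> 0 \<and> absv p < 1 \<and> (\<forall>x::'a. absv x < 1 \<longrightarrow> absv x \<le> absv p)"
proof -
  have "open {x::'a. absv x \<ge> 1}"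
    unfolding open_dist
  proof safe
    fix x :: 'a assume x: "1 \<le> absv x"
    have "1 \<le> absv y" if "dist y x < 1" for y
    proof -
      have "absv (y - x) < absv x" using that x by (simp add: dist_absv)
      then show ?thesis using absv_add_eq[of "y - x" x] x by simp
    qed
    then show "\<exists>e>0. \<forall>y. dist y x < e \<longrightarrow> y \<in> {x. 1 \<le> absv x}" by (intro exI[of _ 1]) auto
  qed
  then have "closed (- {x::'a. absv x \<ge> 1})" by (rule closed_Compl)
  moreover have "max_ideal = val_ring \<inter> - {x::'a. absv x \<ge> 1}"
    by (auto simp: max_ideal_def val_ring_def)
  ultimately have "compact (max_ideal :: 'a set)"
    using compact_Int_closed[OF compact_val_ring] by metis
  moreover have "max_ideal \<noteq> ({} :: 'a set)" by (auto simp: max_ideal_def intro: exI[of _ 0])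
  moreover have "continuous_on (max_ideal :: 'a set) absv"
    using continuous_on_dist[OF continuous_on_const continuous_on_id, of max_ideal "0::'a"]
    by (simp add: dist_absv)
  ultimately obtain p :: 'a where "p \<in> max_ideal" "\<forall>x\<in>(max_ideal::'a set). absv x \<le> absv p"
    using continuous_attains_sup[of "max_ideal :: 'a set" absv] by auto
  moreover obtain x :: 'a where "x \<noteq> 0" "absv x < 1" using exists_small[of 1] by (metis zero_less_one)
  ultimately have "0 < absv p" using absv_pos_iff[of x] by (force simp: max_ideal_def simp del: absv_pos_iff)
  then have "p \<noteq> 0" by simp
  then show ?thesis
    using \<open>p \<in> max_ideal\<close> \<open>\<forall>x\<in>(max_ideal::'a set). absv x \<le> absv p\<close>    by (intro exI[of _ p]) (auto simp: max_ideal_def)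
qed

definition unif :: "'a::nonarch_local_field"
  where "unif = (SOME p. p \<noteq> 0 \<and> absv p < 1 \<and> (\<forall>x::'a. absv x < 1 \<longrightarrow> absv x \<le> absv p))"

lemma unif: "(unif :: 'a::nonarch_local_field) \<noteq> 0" "absv (unif :: 'a) < 1" "absv (x::'a) < 1 \<Longrightarrow> absv x \<le> absv (unif :: 'a)"
  using someI_ex[OF uniformizer_exists] unfolding unif_def by blast+

lemma max_ideal_eq: "max_ideal = (*) unif ` (val_ring :: 'a::nonarch_local_field set)"
proof safe
  fix x :: 'a assume "x \<in> max_ideal"
  then have "absv (x / unif) \<le> 1" using unif(3)[of x] unif(1)[where 'a='a] by (simp add: max_ideal_def)
  then show "x \<in> (*) unif ` val_ring"
    using unif(1) by (intro image_eqI[of _ _ "x / unif"]) (auto simp: val_ring_def)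
qed (auto simp: max_ideal_def val_ring_def intro: absv_mult_less[OF unif(2)])

text \<open>For the least \<open>n\<close> with \<open>absv unif ^ n\<close> at most
  \<open>absv x\<close>, minimality says that \<open>x / unif ^ (n - 1)\<close> lies in the maximal
  ideal, where no absolute value exceeds that of \<open>unif\<close>. So the two bounds
  meet.\<close>

lemma absv_eq_power_unif:
  assumes "x \<noteq> 0" "absv (x::'a::nonarch_local_field) \<le> 1"
  obtains n where "absv x = absv (unif :: 'a) ^ n"
proof -
  let ?q = "absv (unif :: 'a)"
  have "\<exists>n. ?q ^ n \<le> absv x"
    using real_arch_pow_inv[of "absv x" ?q] assms unif by (auto intro: less_imp_le)
  define n where "n = (LEAST n. ?q ^ n \<le> absv x)"
  have n: "?q ^ n \<le> absv x" unfolding n_def by (rule LeastI_ex) fact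
  show ?thesis
  proof (cases n)
    case 0
    then show ?thesis using that[of 0] n assms by simp
  next
    case (Suc m)
    have "\<not> ?q ^ m \<le> absv x" using not_less_Least[of m "\<lambda>n. ?q ^ n \<le> absv x"] Suc by (simp add: n_def)
    then have "absv (x / unif ^ m) < 1" using unif(1)[where 'a='a] zero_less_power[of ?q m] by (simp add: divide_simps)
    then have "absv x / ?q ^ m \<le> ?q" using unif(3)[of "x / unif ^ m"] by simp
    then have "absv x \<le> ?q ^ n" using unif(1)[where 'a='a] zero_less_power[of ?q m] by (simp add: Suc divide_simps mult.commute)
    then show ?thesis using that[of n] n by simp
  qed
qed

lemma absv_unif_power_inj:
  assumes "absv (unif :: 'a::nonarch_local_field) ^ m = absv (unif :: 'a) ^ n"
  shows "m = n"
  using assms unif[where 'a='a] power_strict_decreasing_iff[of "absv (unif :: 'a)"]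
  by (metis absv_pos_iff less_irrefl nat_neq_iff)

section \<open>Lattices and two-by-two matrices\<close>

abbreviation mk2 :: "'a \<Rightarrow> 'a \<Rightarrow> 'a \<Rightarrow> 'a \<Rightarrow> 'a::nonarch_local_field^2^2"
  where "mk2 a b c d \<equiv> vector [vector [a, b], vector [c, d]]"

lemma mm2: "((A :: 'a::nonarch_local_field^2^2) ** B) $ i $ j = A $ i $ 1 * B $ 1 $ j + A $ i $ 2 * B $ 2 $ j"
  by (simp add: matrix_matrix_mult_def sum_2)

lemma mv2: "((A :: 'a::nonarch_local_field^2^2) *v x) $ i = A $ i $ 1 * x $ 1 + A $ i $ 2 * x $ 2"
  by (simp add: matrix_vector_mult_def sum_2)

lemma mat2: "(mat c :: 'a::nonarch_local_field^2^2) $ 1 $ 1 = c" "(mat c :: 'a^2^2) $ 1 $ 2 = 0"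
  "(mat c :: 'a^2^2) $ 2 $ 1 = 0" "(mat c :: 'a^2^2) $ 2 $ 2 = c"
  by (simp_all add: mat_def)

lemma eq2: "(A :: 'a::nonarch_local_field^2^2) = B \<longleftrightarrow>
    A $ 1 $ 1 = B $ 1 $ 1 \<and> A $ 1 $ 2 = B $ 1 $ 2 \<and> A $ 2 $ 1 = B $ 2 $ 1 \<and> A $ 2 $ 2 = B $ 2 $ 2"
  by (auto simp: vec_eq_iff forall_2)

lemma mat_mv: "mat c *v (x :: 'a::nonarch_local_field^2) = c *s x"
  by (simp add: vec_eq_iff forall_2 mv2 mat2)

lemma det_mat: "det (mat c :: 'a::nonarch_local_field^2^2) = c * c"
  by (simp add: det_2 mat2)

lemmas inv_det = invertible_det_nz[where 'a="'a::nonarch_local_field" and 'n=2]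

definition L0 :: "('a::nonarch_local_field^2) set"
  where "L0 = {v. absv (v $ 1) \<le> 1 \<and> absv (v $ 2) \<le> 1}"

text \<open>The group GL(2,o): integral matrices whose determinant is a unit. It is the stabilizer
  of the standard lattice \<open>L0\<close> in GL(2,F).\<close>

definition GLo :: "('a::nonarch_local_field^2^2) set"
  where "GLo = {A. (\<forall>i j. absv (A $ i $ j) \<le> 1) \<and> absv (det A) = 1}"

lemma GLo_iff: "A \<in> GLo \<longleftrightarrow> absv (A $ 1 $ 1) \<le> 1 \<and> absv (A $ 1 $ 2) \<le> 1 \<and> absv (A $ 2 $ 1) \<le> 1 \<and>
    absv (A $ 2 $ 2) \<le> 1 \<and> absv (det A) = 1"
  by (auto simp: GLo_def forall_2)

lemma GLo_invertible: "A \<in> GLo \<Longrightarrow> invertible A"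
  by (auto simp: GLo_def inv_det)

lemma GLo_mult: "A \<in> GLo \<Longrightarrow> B \<in> GLo \<Longrightarrow> A ** B \<in> GLo"
  by (auto simp: GLo_def mm2 det_mul absv_mult intro!: absv_add_le absv_mult_le)

lemma GLo_one: "mat 1 \<in> GLo"
  by (simp add: GLo_iff mat2 det_mat)

lemma GLo_inv:
  assumes "A \<in> GLo"
  obtains B where "B \<in> GLo" "A ** B = mat 1" "B ** A = mat 1"
proof -
  define B where "B = mk2 (A$2$2 / det A) (- A$1$2 / det A) (- A$2$1 / det A) (A$1$1 / det A)"
  have d: "det A \<noteq> 0" "absv (det A) = 1" using assms by (auto simp: GLo_def)
  have 1: "A ** B = mat 1" "B ** A = mat 1"
    using d(1) by (simp_all add: eq2 mm2 mat2 B_def field_simps) (simp_all add: det_2 algebra_simps)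
  have "det A * det B = 1" using 1 by (metis det_I det_mul)
  then have "absv (det A) * absv (det B) = 1" by (simp flip: absv_mult)
  then have "absv (det B) = 1" by (simp add: d)
  moreover have "absv (B $ i $ j) \<le> 1" for i j
    using assms exhaust_2[of i] exhaust_2[of j] by (auto simp: B_def d GLo_iff)
  ultimately have "B \<in> GLo" by (simp add: GLo_def)
  then show ?thesis using 1 that by blast
qed

definition lat :: "'a::nonarch_local_field^2^2 \<Rightarrow> ('a^2) set"
  where "lat A = (*v) A ` L0"

text \<open>Coordinates for the vertices: every vertex is some \<open>vx A\<close>, and by
  \<open>vx_eq_iff\<close> the matrix is unique up to a nonzero scalar and right multiplication by
  \<open>GLo\<close>. All questions on lattices thereby become questions on two-by-two
  matrices.\<close>

definition vx :: "'a::nonarch_local_field^2^2 \<Rightarrow> 'a vertex"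
  where "vx A = homothety_class (lat A)"

lemma lat_mult: "lat (A ** B) = (*v) A ` lat B"
  by (auto simp: lat_def image_image matrix_vector_mul_assoc)

lemma GLo_L0: "k \<in> GLo \<Longrightarrow> v \<in> L0 \<Longrightarrow> k *v v \<in> L0"
  by (auto simp: GLo_def L0_def mv2 intro!: absv_add_le absv_mult_le)

lemma lat_GLo: "k \<in> GLo \<Longrightarrow> lat k = L0"
proof -
  assume k: "k \<in> GLo"
  from GLo_inv[OF k] obtain h where h: "h \<in> GLo" "k ** h = mat 1" by metis
  show "lat k = L0"
  proof (intro equalityI subsetI)
    fix v assume "v \<in> (L0 :: ('a^2) set)"
    then have "h *v v \<in> L0" "v = k *v (h *v v)"
      using GLo_L0[OF h(1)] h(2) by (auto simp: matrix_vector_mul_assoc)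
    then show "v \<in> lat k" unfolding lat_def by blast
  qed (use GLo_L0[OF k] in \<open>auto simp: lat_def\<close>)
qed

lemma lat_mult_GLo: "k \<in> GLo \<Longrightarrow> lat (A ** k) = lat A"
  by (simp add: lat_mult lat_GLo) (simp add: lat_def)

lemma lat_one: "lat (mat 1) = L0"
  by (rule lat_GLo[OF GLo_one])

lemma basis_L0: "axis 1 1 \<in> L0" "axis 2 1 \<in> L0"
  by (auto simp: L0_def axis_def)

lemma lat_eq_L0D:
  assumes "lat A = L0"
  shows "absv ((A :: 'a::nonarch_local_field^2^2) $ i $ j) \<le> 1"
proof -
  have "A *v axis 1 1 \<in> L0" "A *v axis 2 1 \<in> L0" using assms basis_L0 by (auto simp: lat_def)
  moreover have "(A *v axis 1 1) $ k = A $ k $ 1" "(A *v axis 2 1) $ k = A $ k $ 2" for k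
    by (simp_all add: mv2 axis_def)
  ultimately show ?thesis using exhaust_2[of i] exhaust_2[of j] by (auto simp: L0_def)
qed

text \<open>If \<open>A\<close> fixes the standard lattice then so does its inverse. Both are
  integral, so both determinants have absolute value at most 1 while their product is 1.\<close>

lemma lat_eq_L0_iff:
  assumes "invertible (A :: 'a::nonarch_local_field^2^2)"
  shows "lat A = L0 \<longleftrightarrow> A \<in> GLo"
proof
  assume A: "lat A = L0"
  obtain B where B: "A ** B = mat 1" "B ** A = mat 1" using assms by (auto simp: invertible_def)
  have "lat B = L0"
    using lat_mult[of B A] lat_mult[of B "mat 1"] by (simp add: A B lat_one)
  then have le: "absv (det A) \<le> 1" "absv (det B) \<le> 1"
    using lat_eq_L0D[OF A] lat_eq_L0D[of B]
    by (auto simp: det_2 intro!: absv_diff_le absv_mult_le)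
  have "det A * det B = 1" using B by (metis det_I det_mul)
  then have "absv (det A) * absv (det B) = 1" by (simp flip: absv_mult)
  then have "absv (det A) = 1" using le mult_left_le[of "absv (det B)" "absv (det A)"] by simp
  then show "A \<in> GLo" using lat_eq_L0D[OF A] by (simp add: GLo_def)
qed (rule lat_GLo)

lemma homothety_lat: "homothety_class (lat A) = {lat (mat c ** A) | c. c \<noteq> 0}"
  by (simp add: homothety_class_def lat_mult mat_mv image_def)

lemma mat_mult_assoc: "mat c ** (mat d ** (A :: 'a::nonarch_local_field^2^2)) = mat (c * d) ** A"
  by (simp add: matrix_mul_assoc mat_mult_mat)

lemma invertible_mat: "invertible (mat c :: 'a::nonarch_local_field^2^2) \<longleftrightarrow> c \<noteq> 0"
  by (simp add: inv_det det_mat)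

lemma vx_eq_iff:
  assumes "invertible (A :: 'a::nonarch_local_field^2^2)" "invertible B"
  shows "vx A = vx B \<longleftrightarrow> (\<exists>c k. c \<noteq> 0 \<and> k \<in> GLo \<and> B = mat c ** A ** k)"
proof
  assume eq: "vx A = vx B"
  have "lat B \<in> vx A"
    unfolding eq by (auto simp: vx_def homothety_lat intro!: exI[of _ 1])
  then obtain c where c: "c \<noteq> 0" "lat B = lat (mat c ** A)"
    by (auto simp: vx_def homothety_lat)
  have "invertible (mat c ** A)" using c(1) assms by (simp add: invertible_mult invertible_mat)
  then obtain C where C: "(mat c ** A) ** C = mat 1" "C ** (mat c ** A) = mat 1" by (auto simp: invertible_def)
  have "lat (C ** B) = L0" using lat_mult[of C "mat c ** A"] by (simp add: lat_mult[of C B] c(2) C lat_one)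
  moreover have "invertible C" using C by (auto simp: invertible_def)
  then have "invertible (C ** B)" using assms(2) by (simp add: invertible_mult)
  ultimately have "C ** B \<in> GLo" by (simp add: lat_eq_L0_iff)
  moreover have "B = mat c ** A ** (C ** B)" using C(1) by (simp add: matrix_mul_assoc)
  ultimately show "\<exists>c k. c \<noteq> 0 \<and> k \<in> GLo \<and> B = mat c ** A ** k" using c(1) by blast
next
  assume "\<exists>c k. c \<noteq> 0 \<and> k \<in> GLo \<and> B = mat c ** A ** k"
  then obtain c k where ck: "c \<noteq> 0" "k \<in> GLo" "B = mat c ** A ** k" by blast
  have "vx B = {lat (mat d ** (mat c ** A)) | d. d \<noteq> 0}"
    using ck(2) by (simp add: ck(3) vx_def homothety_lat matrix_mul_assoc lat_mult_GLo)
  also have "\<dots> = {lat (mat d ** A) | d. d \<noteq> 0}"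
  proof safe
    fix d :: 'a assume "d \<noteq> 0"
    then show "\<exists>d'. lat (mat d ** (mat c ** A)) = lat (mat d' ** A) \<and> d' \<noteq> 0"
      using ck(1) by (intro exI[of _ "d * c"]) (simp add: mat_mult_assoc)
    show "\<exists>d'. lat (mat d ** A) = lat (mat d' ** (mat c ** A)) \<and> d' \<noteq> 0"
      using ck(1) \<open>d \<noteq> 0\<close> by (intro exI[of _ "d / c"]) (simp add: mat_mult_assoc)
  qed
  finally show "vx A = vx B" by (simp add: vx_def homothety_lat)
qed

lemma vx_mult_GLo: "invertible A \<Longrightarrow> k \<in> GLo \<Longrightarrow> vx (A ** k) = vx A"
  by (simp add: vx_def lat_mult_GLo)

lemma vx_scale: "invertible A \<Longrightarrow> c \<noteq> 0 \<Longrightarrow> vx (mat c ** A) = vx A"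
  by (rule sym, subst vx_eq_iff) (auto simp: invertible_mult invertible_mat intro!: exI[of _ c] exI[of _ "mat 1"] GLo_one)

subsection \<open>Bases, vertices and adjacency\<close>

definition cols :: "'a::nonarch_local_field^2 \<Rightarrow> 'a^2 \<Rightarrow> 'a^2^2"
  where "cols e f = mk2 (e$1) (f$1) (e$2) (f$2)"

lemma columns_cols: "columns (cols e f) = {e, f}"
proof -
  have "column 1 (cols e f) = e" "column 2 (cols e f) = f"
    by (simp_all add: column_def cols_def vec_eq_iff forall_2)
  moreover have "columns (cols e f) = {column 1 (cols e f), column 2 (cols e f)}"
    unfolding columns_def using exhaust_2 by (auto; metis)
  ultimately show ?thesis by simp
qed

lemma cols_mv: "cols e f *v v = v$1 *s e + v$2 *s f"
  by (simp add: vec_eq_iff forall_2 mv2 cols_def mult.commute)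

lemma cols_surj: obtains e f where "(A :: 'a::nonarch_local_field^2^2) = cols e f"
  by (rule that[of "vector [A$1$1, A$2$1]" "vector [A$1$2, A$2$2]"]) (simp add: cols_def eq2)

lemma is_basis_iff: "is_basis e f \<longleftrightarrow> invertible (cols e f :: 'a::nonarch_local_field^2^2)"
proof
  assume "is_basis e f"
  then have "vec.span (columns (cols e f)) = UNIV" by (simp add: is_basis_def columns_cols)
  then show "invertible (cols e f)"
    by (simp add: matrix_right_invertible_span_columns[symmetric] invertible_right_inverse)
next
  assume inv: "invertible (cols e f)"
  then have span: "vec.span {e, f} = UNIV"
    by (simp add: invertible_right_inverse matrix_right_invertible_span_columns columns_cols)
  have "e \<noteq> f"
  proof
    assume "e = f"
    then have "det (cols e f) = 0" by (simp add: det_2 cols_def)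
    then show False using inv by (simp add: inv_det)
  qed
  moreover have "vec.independent {e, f}"
    by (rule vec.card_le_dim_spanning[of _ UNIV]) (use span \<open>e \<noteq> f\<close> in \<open>auto simp: vec.dim_UNIV card_cart_basis\<close>)
  ultimately show "is_basis e f" using span by (simp add: is_basis_def)
qed

abbreviation dg :: "'a \<Rightarrow> 'a::nonarch_local_field^2^2"
  where "dg t \<equiv> mk2 1 0 0 t"

lemma det_dg: "det (dg t) = t" by (simp add: det_2)

lemma invertible_dg: "invertible (dg t) \<longleftrightarrow> t \<noteq> 0" by (simp add: inv_det det_dg)

lemma span_on_cols: "span_on val_ring e val_ring f = lat (cols e f)"
proof (intro equalityI subsetI)
  fix v assume "v \<in> span_on val_ring e val_ring f"
  then obtain a b where "a \<in> val_ring" "b \<in> val_ring" "v = a *s e + b *s f" by (auto simp: span_on_def)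
  then show "v \<in> lat (cols e f)"
    unfolding lat_def by (intro image_eqI[of _ _ "vector [a, b]"]) (auto simp: cols_mv L0_def val_ring_def)
qed (auto simp: lat_def cols_mv L0_def span_on_def val_ring_def)

lemma cols_dg: "cols e f ** dg t = cols e (t *s f)"
  by (simp add: eq2 mm2 cols_def mult.commute)

lemma span_on_max: "span_on val_ring e max_ideal f = lat (cols e f ** dg unif)"
proof -
  have "span_on val_ring e max_ideal f = span_on val_ring e val_ring (unif *s f)"
  proof (intro equalityI subsetI)
    fix v assume "v \<in> span_on val_ring e max_ideal f"
    then obtain a b where ab: "a \<in> val_ring" "b \<in> val_ring" "v = a *s e + (unif * b) *s f"
      unfolding span_on_def max_ideal_eq by blast
    then have "v = a *s e + b *s (unif *s f)" by (simp add: mult.commute)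
    with ab show "v \<in> span_on val_ring e val_ring (unif *s f)" unfolding span_on_def by blast
  next
    fix v assume "v \<in> span_on val_ring e val_ring (unif *s f)"
    then obtain a b where ab: "a \<in> val_ring" "b \<in> val_ring" "v = a *s e + b *s (unif *s f)"
      unfolding span_on_def by blast
    then have "v = a *s e + (unif * b) *s f" by (simp add: mult.commute)
    with ab show "v \<in> span_on val_ring e max_ideal f" unfolding span_on_def max_ideal_eq by blast
  qed
  then show ?thesis by (simp add: cols_dg span_on_cols)
qed

lemma tree_verts_iff: "x \<in> tree_verts \<longleftrightarrow> (\<exists>A. invertible A \<and> x = vx A)"
proof
  assume "\<exists>A. invertible A \<and> x = vx A"
  then obtain A where A: "invertible A" "x = vx A" by blast
  obtain e f where "A = cols e f" by (rule cols_surj)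
  with A show "x \<in> tree_verts"
    unfolding tree_verts_def lattices_def vx_def span_on_cols is_basis_iff by blast
next
  assume "x \<in> tree_verts"
  then show "\<exists>A. invertible A \<and> x = vx A"
    unfolding tree_verts_def lattices_def vx_def span_on_cols is_basis_iff by blast
qed

lemma vx_in_tree [simp]: "invertible A \<Longrightarrow> vx A \<in> tree_verts"
  by (auto simp: tree_verts_iff)

lemma adjacent_iff: "adjacent x y \<longleftrightarrow> (\<exists>A. invertible A \<and> x = vx A \<and> y = vx (A ** dg unif))"
proof
  assume "\<exists>A. invertible A \<and> x = vx A \<and> y = vx (A ** dg unif)"
  then obtain A where A: "invertible A" "x = vx A" "y = vx (A ** dg unif)" by blast
  obtain e f where "A = cols e f" by (rule cols_surj)
  with A show "adjacent x y"
    unfolding adjacent_def vx_def span_on_cols span_on_max is_basis_iff by blast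
next
  assume "adjacent x y"
  then show "\<exists>A. invertible A \<and> x = vx A \<and> y = vx (A ** dg unif)"
    unfolding adjacent_def vx_def span_on_cols span_on_max is_basis_iff by blast
qed

lemma cols_axis: "cols (axis 1 1) (axis 2 1) = mat 1"
  by (simp add: cols_def eq2 mat2 axis_def)

lemma s0_eq: "s0 = vx (mat 1)" and s1_eq: "s1 = vx (dg unif)"
  by (simp_all add: s0_def s1_def span_on_cols span_on_max cols_axis vx_def)

section \<open>Levels\<close>

lemma absv_le_0 [simp]: "absv (x :: 'a::nonarch_local_field) \<le> 0 \<longleftrightarrow> x = 0"
  using absv_pos_iff[of x] by (simp add: not_less[symmetric] del: absv_pos_iff)

definition mnorm :: "'a::nonarch_local_field^2^2 \<Rightarrow> real"
  where "mnorm A = max (max (absv (A$1$1)) (absv (A$1$2))) (max (absv (A$2$1)) (absv (A$2$2)))"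

lemma mnorm_le_iff: "mnorm A \<le> r \<longleftrightarrow> (\<forall>i j. absv (A$i$j) \<le> r)"
  by (auto simp: mnorm_def forall_2)

lemma absv_le_mnorm: "absv (A$i$j) \<le> mnorm A"
  using mnorm_le_iff by blast

lemma mnorm_scale: "mnorm (mat c ** A) = absv c * mnorm A"
  by (simp add: mnorm_def mm2 mat2 absv_mult max_mult_distrib_left)

lemma mnorm_attained: obtains i j where "absv (A$i$j) = mnorm (A :: 'a::nonarch_local_field^2^2)"
proof -
  have "mnorm A \<in> {absv (A$1$1), absv (A$1$2), absv (A$2$1), absv (A$2$2)}"
    by (auto simp: mnorm_def max_def)
  then show ?thesis using that by auto
qed

lemma mnorm_mult_GLo_le: "k \<in> GLo \<Longrightarrow> mnorm (A ** k) \<le> mnorm A"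
  by (auto simp: mnorm_le_iff mm2 GLo_def intro!: absv_add_le absv_mult_le absv_le_mnorm)

lemma mnorm_mult_GLo: "k \<in> GLo \<Longrightarrow> mnorm (A ** k) = mnorm A"
proof -
  assume k: "k \<in> GLo"
  then obtain h where h: "h \<in> GLo" "k ** h = mat 1" using GLo_inv by metis
  then show ?thesis
    using mnorm_mult_GLo_le[OF k, of A] mnorm_mult_GLo_le[OF h(1), of "A ** k"]
    by (simp flip: matrix_mul_assoc add: h)
qed

lemma mnorm_pos: "invertible A \<Longrightarrow> 0 < mnorm A"
proof -
  assume "invertible A"
  then have "A \<noteq> 0" by (auto simp: inv_det det_2)
  then have "\<not> mnorm A \<le> 0" by (auto simp: mnorm_le_iff vec_eq_iff)
  then show ?thesis by simp
qed

lemma normalize: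
  assumes "invertible A"
  obtains c where "c \<noteq> 0" "mnorm (mat c ** A) = 1"
proof -
  obtain i j where ij: "absv (A$i$j) = mnorm A" by (rule mnorm_attained)
  then have "A$i$j \<noteq> 0" using mnorm_pos[OF assms] by auto
  then show ?thesis using ij mnorm_pos[OF assms] that[of "inverse (A$i$j)"] by (simp add: mnorm_scale)
qed

lemma vertex_normalE:
  assumes "x \<in> tree_verts"
  obtains A where "invertible A" "x = vx A" "mnorm A = 1"
proof -
  obtain A where A: "invertible A" "x = vx A" using assms by (auto simp: tree_verts_iff)
  obtain c where c: "c \<noteq> 0" "mnorm (mat c ** A) = 1" by (rule normalize[OF A(1)])
  show ?thesis
    by (rule that[of "mat c ** A"]) (use A c in \<open>auto simp: vx_scale invertible_mult invertible_mat\<close>)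
qed

lemma absv_det_le: "mnorm A = 1 \<Longrightarrow> absv (det A) \<le> 1"
  using absv_le_mnorm[of A] by (auto simp: det_2 intro!: absv_diff_le absv_mult_le)

abbreviation q_inv :: "'a::nonarch_local_field itself \<Rightarrow> real"
  where "q_inv _ \<equiv> absv (unif :: 'a)"

text \<open>The distance from \<open>s0\<close>. If the elementary divisors of \<open>A\<close> have
  valuations \<open>a\<close> and \<open>b\<close> with \<open>a \<le> b\<close>, then
  \<open>mnorm A\<close> is \<open>absv unif ^ a\<close> and \<open>absv (det A)\<close> is
  \<open>absv unif ^ (a + b)\<close>, so the exponent here is \<open>b - a\<close>. Both sides scale
  by the square of a homothety factor, hence the number belongs to the vertex.\<close>

definition level :: "'a::nonarch_local_field vertex \<Rightarrow> nat"
  where "level x = (THE N. \<exists>A. invertible A \<and> x = vx A \<and> absv (det A) = absv (unif :: 'a) ^ N * mnorm A ^ 2)"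

lemma det_ratio:
  assumes "invertible A" "invertible B" "vx A = vx B" "absv (det A) = absv (unif :: 'a::nonarch_local_field) ^ N * mnorm A ^ 2"
  shows "absv (det (B :: 'a^2^2)) = absv (unif :: 'a) ^ N * mnorm B ^ 2"
proof -
  obtain c k where "c \<noteq> 0" "k \<in> GLo" "B = mat c ** A ** k" using vx_eq_iff assms by metis
  then show ?thesis
    using assms(4) by (simp add: mnorm_mult_GLo mnorm_scale det_mul absv_mult det_mat power2_eq_square GLo_def)
qed

lemma level_eqI:
  assumes A: "invertible A" "absv (det A) = absv (unif :: 'a::nonarch_local_field) ^ N * mnorm (A :: 'a^2^2) ^ 2"
  shows "level (vx A) = N"
  unfolding level_def
proof (rule the_equality)
  fix M assume "\<exists>B. invertible B \<and> vx A = vx B \<and> absv (det B) = absv (unif :: 'a) ^ M * mnorm B ^ 2"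
  then obtain B where B: "invertible B" "vx A = vx B" "absv (det B) = absv (unif :: 'a) ^ M * mnorm B ^ 2" by blast
  then have "absv (unif :: 'a) ^ M * mnorm B ^ 2 = absv (unif :: 'a) ^ N * mnorm B ^ 2"
    using det_ratio[OF A(1) B(1,2) A(2)] by auto
  then have "absv (unif :: 'a) ^ M = absv (unif :: 'a) ^ N" using mnorm_pos[OF B(1)] by auto
  then show "M = N" by (rule absv_unif_power_inj)
qed (use A in blast)

lemma level_vx:
  assumes A: "invertible (A :: 'a::nonarch_local_field^2^2)"
  shows "absv (det A) = absv (unif :: 'a) ^ level (vx A) * mnorm A ^ 2"
proof -
  obtain c where c: "c \<noteq> 0" "mnorm (mat c ** A) = 1" by (rule normalize[OF A])
  have inv: "invertible (mat c ** A)" using A c by (simp add: invertible_mult invertible_mat)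
  then have "det (mat c ** A) \<noteq> 0" by (simp add: inv_det)
  then obtain N where "absv (det (mat c ** A)) = absv (unif :: 'a) ^ N"
    using absv_eq_power_unif absv_det_le[OF c(2)] by metis
  then have "absv (det A) = absv (unif :: 'a) ^ N * mnorm A ^ 2"
    by (intro det_ratio[OF inv A]) (simp_all add: vx_scale A c)
  with level_eqI[OF A this] show ?thesis by simp
qed

lemma level_zero:
  assumes "x \<in> tree_verts" "level x = 0"
  shows "x = s0"
proof -
  obtain A where A: "invertible A" "x = vx A" "mnorm A = 1" by (rule vertex_normalE[OF assms(1)])
  then have "A \<in> GLo" using level_vx[OF A(1)] assms(2) absv_le_mnorm[of A] by (simp add: GLo_def)
  then show ?thesis using vx_mult_GLo[of "mat 1" A] A(2) by (simp add: s0_eq GLo_invertible[OF GLo_one])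
qed

lemma adjacent_vx:
  assumes A: "invertible A"
  shows "adjacent (vx A) y \<longleftrightarrow> (\<exists>k\<in>GLo. y = vx (A ** k ** dg unif))"
proof
  assume "adjacent (vx A) y"
  then obtain B where B: "invertible B" "vx A = vx B" "y = vx (B ** dg unif)" by (auto simp: adjacent_iff)
  then obtain c k where ck: "c \<noteq> 0" "k \<in> GLo" "B = mat c ** A ** k" using vx_eq_iff A by metis
  then have "y = vx (mat c ** (A ** k ** dg unif))" using B by (simp add: matrix_mul_assoc)
  then have "y = vx (A ** k ** dg unif)"
    using ck A by (simp add: vx_scale invertible_mult GLo_invertible invertible_dg unif)
  then show "\<exists>k\<in>GLo. y = vx (A ** k ** dg unif)" using ck by blast
next
  assume "\<exists>k\<in>GLo. y = vx (A ** k ** dg unif)"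
  then show "adjacent (vx A) y"
    unfolding adjacent_iff using A by (metis GLo_invertible invertible_mult vx_mult_GLo)
qed

text \<open>A neighbour of the class of a lattice is given by the line that the first basis vector
  spans modulo the maximal ideal. The expression on the right is the determinant of the two first
  columns, which vanishes in the residue field exactly when the two lines agree.\<close>

lemma nbr_eq:
  assumes A: "invertible A" and k: "k \<in> GLo" "k' \<in> GLo"
  shows "vx (A ** k ** dg unif) = vx (A ** k' ** dg unif) \<longleftrightarrow> absv (k$1$1 * k'$2$1 - k$2$1 * k'$1$1) < 1"
proof -
  obtain k1 where k1: "k1 \<in> GLo" "k ** k1 = mat 1" "k1 ** k = mat 1" using GLo_inv[OF k(1)] by metis
  define h where "h = k1 ** k'"
  have h: "h \<in> GLo" "k' = k ** h" using k k1 by (auto simp: h_def GLo_mult matrix_mul_assoc)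
  have "k$1$1 * k'$2$1 - k$2$1 * k'$1$1 = det k * h$2$1"
    by (simp add: h(2) mm2 det_2 algebra_simps)
  then have e: "absv (k$1$1 * k'$2$1 - k$2$1 * k'$1$1) = absv (h$2$1)"
    using k by (simp add: absv_mult GLo_def)
  have inv: "invertible (A ** k ** dg unif)" "invertible (A ** k' ** dg unif)" "invertible (A ** k)"
    using A k by (simp_all add: invertible_mult GLo_invertible invertible_dg unif)
  then obtain C where C: "C ** (A ** k) = mat 1" by (auto simp: invertible_def)
  have "vx (A ** k ** dg unif) = vx (A ** k' ** dg unif) \<longleftrightarrow>
      (\<exists>c m. c \<noteq> 0 \<and> m \<in> GLo \<and> A ** k' ** dg unif = mat c ** (A ** k ** dg unif) ** m)"
    by (rule vx_eq_iff[OF inv(1,2)])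
  also have "\<dots> \<longleftrightarrow> (\<exists>c m. c \<noteq> 0 \<and> m \<in> GLo \<and> h ** dg unif = mat c ** dg unif ** m)"
  proof -
    have "A ** k' ** dg unif = mat c ** (A ** k ** dg unif) ** m \<longleftrightarrow> h ** dg unif = mat c ** dg unif ** m" for c m
    proof -
      have 1: "A ** k' ** dg unif = (A ** k) ** (h ** dg unif)" by (simp add: h(2) matrix_mul_assoc)
      have "mat c ** (A ** k ** dg unif) ** m = (mat c ** (A ** k)) ** (dg unif ** m)"
        by (simp add: matrix_mul_assoc)
      also have "\<dots> = (A ** k) ** (mat c ** dg unif ** m)"
        by (subst mat_commutes) (simp add: matrix_mul_assoc)
      finally have 2: "mat c ** (A ** k ** dg unif) ** m = (A ** k) ** (mat c ** dg unif ** m)" .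
      have "(A ** k) ** P = (A ** k) ** Q \<longleftrightarrow> P = Q" for P Q
        using C by (metis matrix_mul_assoc matrix_mul_lid)
      then show ?thesis unfolding 1 2 .
    qed
    then show ?thesis by simp
  qed
  also have "\<dots> \<longleftrightarrow> absv (h$2$1) < 1"
  proof
    assume "\<exists>c m. c \<noteq> 0 \<and> m \<in> GLo \<and> h ** dg unif = mat c ** dg unif ** m"
    then obtain c m where cm: "c \<noteq> 0" "m \<in> GLo" "h ** dg unif = mat c ** dg unif ** m" by blast
    have "det h * unif = c * c * unif * det m" using arg_cong[OF cm(3), of det] by (simp add: det_mul det_mat det_dg)
    from arg_cong[OF this, of absv] have "absv c * absv c = 1" using h(1) cm(2) unif(1)[where 'a='a] by (simp add: absv_mult GLo_def)
    then have "absv c = 1" using absv_nonneg[of c] by (simp add: square_eq_1_iff)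
    moreover have "h$2$1 = c * unif * m$2$1" using arg_cong[OF cm(3), of "\<lambda>A. A$2$1"] by (simp add: mm2 mat2)
    ultimately have "absv (h$2$1) = absv (unif * m$2$1)" by (simp add: absv_mult)
    then show "absv (h$2$1) < 1" using cm(2) by (simp add: GLo_def absv_mult_less[OF unif(2)])
  next
    assume "absv (h$2$1) < 1"
    then have "absv (h$2$1 / unif) \<le> 1" using unif(1)[where 'a='a] unif(3)[of "h$2$1"] by simp
    moreover have "absv (unif * h$1$2) \<le> 1"
      using h(1) unif(2)[where 'a='a] by (intro absv_mult_le) (auto simp: GLo_def)
    \<comment> \<open>The matrix is \<open>h\<close> conjugated by \<open>dg unif\<close>. The
      conjugation multiplies the upper right entry by \<open>unif\<close> and divides the lower left
      entry by it, so integrality is a condition on \<open>h$2$1\<close> alone.\<close>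
    moreover have "det (mk2 (h$1$1) (unif * h$1$2) (h$2$1 / unif) (h$2$2)) = det h"
      using unif(1)[where 'a='a] by (simp add: det_2)
    ultimately have "mk2 (h$1$1) (unif * h$1$2) (h$2$1 / unif) (h$2$2) \<in> GLo"
      using h(1) unfolding GLo_iff by simp
    moreover have "h ** dg unif = mat 1 ** dg unif ** mk2 (h$1$1) (unif * h$1$2) (h$2$1 / unif) (h$2$2)"
      using unif(1)[where 'a='a] by (simp add: eq2 mm2)
    ultimately show "\<exists>c m. c \<noteq> 0 \<and> m \<in> GLo \<and> h ** dg unif = mat c ** dg unif ** m" by (metis one_neq_zero)
  qed
  finally show ?thesis by (simp add: e)
qed

text \<open>Passing to the neighbour multiplies the second column of \<open>B\<close> by
  \<open>unif\<close>, so the determinant gains one factor \<open>unif\<close>. If the first column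
  is primitive, the norm stays 1 and the level rises by one. Otherwise the norm drops to
  \<open>absv unif\<close>, and its square costs two, for a net change of minus one.\<close>

lemma level_nbr:
  assumes A: "invertible A" "mnorm A = 1" and k: "k \<in> GLo"
  defines "B \<equiv> A ** k"
  shows "max (absv (B$1$1)) (absv (B$2$1)) = 1 \<Longrightarrow> level (vx (B ** dg unif)) = Suc (level (vx A))"
    and "max (absv (B$1$1)) (absv (B$2$1)) < 1 \<Longrightarrow> Suc (level (vx (B ** dg unif))) = level (vx A)"
    and "max (absv (B$1$1)) (absv (B$2$1)) \<le> 1"
proof -
  let ?q = "absv (unif :: 'a)"
  have q: "0 < ?q" "?q < 1" by (simp_all add: unif)
  have B: "invertible B" "invertible (B ** dg unif)" "mnorm B = 1" "vx B = vx A"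
    using A k by (simp_all add: B_def invertible_mult GLo_invertible invertible_dg unif mnorm_mult_GLo vx_mult_GLo)
  show "max (absv (B$1$1)) (absv (B$2$1)) \<le> 1" using B(3) by (auto simp: mnorm_def)
  have det: "absv (det (B ** dg unif)) = ?q ^ Suc (level (vx A))"
    using level_vx[OF B(1)] by (simp add: B det_mul det_dg absv_mult mult.commute)
  have le: "?q * absv (B$i$2) \<le> ?q" for i
    using absv_le_mnorm[of B i 2] B(3) q by simp
  have m: "mnorm (B ** dg unif) = max (max (absv (B$1$1)) (?q * absv (B$1$2))) (max (absv (B$2$1)) (?q * absv (B$2$2)))"
    by (simp add: mnorm_def mm2 absv_mult mult.commute)
  {
    assume 1: "max (absv (B$1$1)) (absv (B$2$1)) = 1"
    have "?q * absv (B$1$2) \<le> 1" "?q * absv (B$2$2) \<le> 1" using le[of 1] le[of 2] q by linarith+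
    then have "mnorm (B ** dg unif) = 1" using 1 unfolding m by (auto simp: max_def split: if_splits)
    then show "level (vx (B ** dg unif)) = Suc (level (vx A))"
      using det by (intro level_eqI[OF B(2)]) simp
  next
    assume 1: "max (absv (B$1$1)) (absv (B$2$1)) < 1"
    then have "absv (B$1$1) \<le> ?q" "absv (B$2$1) \<le> ?q" using unif(3) by auto
    moreover have "absv (B$1$2) = 1 \<or> absv (B$2$2) = 1" using B(3) 1 by (auto simp: mnorm_def max_def split: if_splits)
    ultimately have "mnorm (B ** dg unif) = ?q"
      using le[of 1] le[of 2] unfolding m by (auto simp: max_def)
    then have "?q ^ Suc (level (vx A)) = ?q ^ (level (vx (B ** dg unif)) + 2)"
      using level_vx[OF B(2)] det by (simp add: power2_eq_square mult_ac)
    then have "Suc (level (vx A)) = level (vx (B ** dg unif)) + 2" by (rule absv_unif_power_inj)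
    then show "Suc (level (vx (B ** dg unif))) = level (vx A)" by simp
  }
qed

lemma extend_primitive:
  assumes "absv a \<le> 1" "absv b \<le> 1" "absv a = 1 \<or> absv (b::'a::nonarch_local_field) = 1"
  obtains k where "k \<in> GLo" "k$1$1 = a" "k$2$1 = b"
proof (cases "absv a = 1")
  case True
  then show ?thesis using assms that[of "mk2 a 0 b 1"] by (simp add: GLo_iff det_2)
next
  case False
  then show ?thesis using assms that[of "mk2 a 1 b 0"] by (simp add: GLo_iff det_2)
qed

lemma adjacent_level:
  assumes "adjacent x y"
  shows "level y = Suc (level x) \<or> level x = Suc (level y)"
proof -
  have "x \<in> tree_verts" using assms by (auto simp: adjacent_iff)
  then obtain A where A: "invertible A" "x = vx A" "mnorm A = 1" by (rule vertex_normalE)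
  then obtain k where "k \<in> GLo" "y = vx (A ** k ** dg unif)" using assms adjacent_vx by blast
  then show ?thesis using level_nbr[OF A(1,3)] A(2) by (metis le_less)
qed

text \<open>This is the absence of cycles in disguise. A step downwards requires a vector, primitive
  in the coordinates \<open>k\<close>, that \<open>A\<close> sends to 0 modulo the maximal ideal.
  Two such vectors spanning different lines would force all of \<open>A\<close> to vanish there,
  against \<open>mnorm A = 1\<close>.\<close>

lemma down_nbr_unique:
  assumes "adjacent x y" "adjacent x z" "level y < level x" "level z < level x"
  shows "y = z"
proof -
  have "x \<in> tree_verts" using assms by (auto simp: adjacent_iff)
  then obtain A where A: "invertible A" "x = vx A" "mnorm A = 1" by (rule vertex_normalE)
  obtain k where k: "k \<in> GLo" "y = vx (A ** k ** dg unif)" using assms(1) adjacent_vx A by blast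
  obtain k' where k': "k' \<in> GLo" "z = vx (A ** k' ** dg unif)" using assms(2) adjacent_vx A by blast
  define B where "B = A ** k"
  have small: "absv ((A ** k)$1$1) < 1" "absv ((A ** k)$2$1) < 1" "absv ((A ** k')$1$1) < 1" "absv ((A ** k')$2$1) < 1"
    using level_nbr[OF A(1,3) k(1)] level_nbr[OF A(1,3) k'(1)] assms A k k' by force+
  define d where "d = k$1$1 * k'$2$1 - k$2$1 * k'$1$1"
  have "absv d < 1"
  proof (rule ccontr)
    assume "\<not> absv d < 1"
    then have d: "1 \<le> absv d" by simp
    have "absv (A$i$j) < 1" for i j
    proof -
      have s: "absv ((A ** k)$i$1) < 1" "absv ((A ** k')$i$1) < 1" using small exhaust_2[of i] by auto
      have kl: "absv (k$i$j) \<le> 1" "absv (k'$i$j) \<le> 1" for i j using k k' by (auto simp: GLo_def)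
      \<comment> \<open>Cramer's rule: the entries of \<open>A\<close>, multiplied by the
        determinant \<open>d\<close> of the two first columns, are recovered from the images of
        these columns.\<close>
      have "d * A$i$1 = (A ** k)$i$1 * k'$2$1 - (A ** k')$i$1 * k$2$1"
        "d * A$i$2 = (A ** k')$i$1 * k$1$1 - (A ** k)$i$1 * k'$1$1"
        by (simp_all add: d_def mm2 algebra_simps)
      then have "absv (d * A$i$1) < 1" "absv (d * A$i$2) < 1"
        using s kl by (auto intro!: absv_diff_less absv_mult_less)
      then have "absv (d * A$i$j) < 1" using exhaust_2[of j] by auto
      moreover have "absv (A$i$j) \<le> absv (d * A$i$j)"
        using mult_right_mono[OF d, of "absv (A$i$j)"] by (simp add: absv_mult)
      ultimately show ?thesis by simp
    qed
    then show False using A(3) mnorm_attained[of A] by (metis less_irrefl)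
  qed
  then show ?thesis using nbr_eq[OF A(1) k(1) k'(1)] k k' by (simp add: d_def)
qed

lemma down_nbr_exists:
  assumes "x \<in> tree_verts" "0 < level x"
  shows "\<exists>y. adjacent x y \<and> level y < level x"
proof -
  obtain A where A: "invertible A" "x = vx A" "mnorm A = 1" using assms(1) by (rule vertex_normalE)
  obtain i j where ij: "absv (A$i$j) = 1" using mnorm_attained[of A] A(3) by metis
  have le: "absv (A$i$j) \<le> 1" for i j using absv_le_mnorm[of A] A(3) by metis
  \<comment> \<open>The column with entries \<open>- A$i$2\<close> and \<open>A$i$1\<close> is
    annihilated by row \<open>i\<close>, and the other row sends it to plus or minus
    \<open>det A\<close>, which is not a unit at positive level. It is primitive because row
    \<open>i\<close> was chosen to contain a unit.\<close>
  have "absv (- A$i$2) = 1 \<or> absv (A$i$1) = 1" using ij exhaust_2[of j] by auto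
  then obtain k where k: "k \<in> GLo" "k$1$1 = - A$i$2" "k$2$1 = A$i$1"
    using extend_primitive[of "- A$i$2" "A$i$1"] le by auto
  have "absv (det A) < 1"
    using level_vx[OF A(1)] A assms(2) unif(1,2)[where 'a='a] power_strict_decreasing_iff[of "absv (unif::'a)" "level x" 0]
    by simp
  then have "absv ((A ** k)$l$1) < 1" for l
    using exhaust_2[of l] exhaust_2[of i] absv_minus_commute[of "A$1$1 * A$2$2"]
    by (auto simp: mm2 k det_2 mult.commute)
  then have "Suc (level (vx (A ** k ** dg unif))) = level x"
    using level_nbr(2)[OF A(1,3) k(1)] A(2) by simp
  moreover have "adjacent x (vx (A ** k ** dg unif))" using A k adjacent_vx by blast
  ultimately show ?thesis by (intro exI[of _ "vx (A ** k ** dg unif)"]) simp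
qed

text \<open>Shrinking the second basis vector, exchanging the two vectors and shrinking again
  multiplies the whole lattice by \<open>unif\<close>, which does not change its class.\<close>

lemma adjacent_sym: "adjacent x y \<Longrightarrow> adjacent y x"
proof -
  assume "adjacent x y"
  then obtain A where A: "invertible A" "x = vx A" "y = vx (A ** dg unif)" by (auto simp: adjacent_iff)
  define w where "w = (mk2 0 1 1 0 :: 'a^2^2)"
  have w: "w \<in> GLo" by (simp add: w_def GLo_iff det_2)
  have "A ** dg unif ** w ** dg unif = mat unif ** (A ** w)"
    by (simp add: eq2 mm2 mat2 w_def mult.commute)
  then have "vx (A ** dg unif ** w ** dg unif) = x"
    using A w by (simp add: vx_scale invertible_mult GLo_invertible unif vx_mult_GLo)
  then show ?thesis
    using A adjacent_vx[of "A ** dg unif" x] w by (auto simp: invertible_mult invertible_dg unif)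
qed

text \<open>By \<open>nbr_eq\<close> the first column of \<open>k\<close> modulo the maximal ideal
  determines the neighbour, and its two entries have finitely many residues.\<close>

lemma finite_nbrs: "finite {y. adjacent x y}"
proof (cases "x \<in> tree_verts")
  case True
  then obtain A where A: "invertible A" "x = vx A" by (auto simp: tree_verts_iff)
  obtain R :: "'a set" where R: "finite R" "R \<subseteq> val_ring" "\<forall>x\<in>val_ring. \<exists>r\<in>R. absv (x - r) < 1"
    using finite_residues by metis
  define F where "F r = {vx (A ** k ** dg unif) | k. k \<in> GLo \<and> absv (k$1$1 - fst r) < 1 \<and> absv (k$2$1 - snd r) < 1}" for r :: "'a \<times> 'a"
  have "{y. adjacent x y} \<subseteq> (\<Union>r\<in>R \<times> R. F r)"
  proof
    fix y assume "y \<in> {y. adjacent x y}"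
    then obtain k where k: "k \<in> GLo" "y = vx (A ** k ** dg unif)" using A adjacent_vx by blast
    then have "k$1$1 \<in> val_ring" "k$2$1 \<in> val_ring" by (auto simp: GLo_def val_ring_def)
    then obtain r s where "r \<in> R" "s \<in> R" "absv (k$1$1 - r) < 1" "absv (k$2$1 - s) < 1"
      using R(3) by blast
    then show "y \<in> (\<Union>r\<in>R \<times> R. F r)"
      using k by (intro UN_I[of "(r, s)"]) (auto simp: F_def)
  qed
  moreover have "finite (F r)" if "r \<in> R \<times> R" for r
  proof -
    have "y = z" if yz: "y \<in> F r" "z \<in> F r" for y z
    proof -
      obtain k where k: "k \<in> GLo" "absv (k$1$1 - fst r) < 1" "absv (k$2$1 - snd r) < 1" "y = vx (A ** k ** dg unif)"
        using yz(1) unfolding F_def by blast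
      obtain k' where k': "k' \<in> GLo" "absv (k'$1$1 - fst r) < 1" "absv (k'$2$1 - snd r) < 1" "z = vx (A ** k' ** dg unif)"
        using yz(2) unfolding F_def by blast
      have d: "absv (k$1$1 - k'$1$1) < 1" "absv (k'$2$1 - k$2$1) < 1"
        using absv_diff_less[OF k(2) k'(2)] absv_diff_less[OF k'(3) k(3)] by simp_all
      have "k$1$1 * k'$2$1 - k$2$1 * k'$1$1 = (k'$2$1 - k$2$1) * k$1$1 + (k$1$1 - k'$1$1) * k$2$1"
        by (simp add: algebra_simps)
      also have "absv \<dots> < 1"
        using d k(1) by (intro absv_add_less absv_mult_less) (auto simp: GLo_def)
      finally show ?thesis using nbr_eq[OF A(1) k(1) k'(1)] k k' by simp
    qed
    then show ?thesis by (metis finite.emptyI finite_subset insertI1 is_singletonI' is_singleton_the_elem finite.insertI)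
  qed
  ultimately show ?thesis using R(1) finite_subset finite_UN_I[of "R \<times> R" F] by (metis finite_cartesian_product)
next
  case False
  then have "{y. adjacent x y} = {}" by (auto simp: adjacent_iff)
  then show ?thesis by simp
qed

text \<open>The points 0, 1 and infinity of the projective line exist over every residue field.
  Three neighbours are exactly enough to avoid two given vertices when a path is extended.\<close>

lemma three_nbrs:
  assumes "x \<in> tree_verts"
  obtains y1 y2 y3 where "adjacent x y1" "adjacent x y2" "adjacent x y3" "y1 \<noteq> y2" "y1 \<noteq> y3" "y2 \<noteq> y3"
proof -
  obtain A where A: "invertible A" "x = vx A" using assms by (auto simp: tree_verts_iff)
  define k1 k2 k3 where "k1 = (mk2 1 0 0 1 :: 'a^2^2)" and "k2 = (mk2 0 1 1 0 :: 'a^2^2)" and "k3 = (mk2 1 0 1 1 :: 'a^2^2)"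
  have k: "k1 \<in> GLo" "k2 \<in> GLo" "k3 \<in> GLo" by (simp_all add: k1_def k2_def k3_def GLo_iff det_2)
  show ?thesis
    by (rule that[of "vx (A ** k1 ** dg unif)" "vx (A ** k2 ** dg unif)" "vx (A ** k3 ** dg unif)"])
      (use A k adjacent_vx in \<open>auto simp: nbr_eq[OF A(1)], auto simp: k1_def k2_def k3_def\<close>)
qed

section \<open>Spheres around \<open>s0\<close> as orbits\<close>

definition sk :: "nat \<Rightarrow> 'a::nonarch_local_field vertex"
  where "sk N = vx (dg (unif ^ N))"

lemma level_k_sk:
  assumes "k \<in> GLo"
  shows "level (vx (k ** dg (unif ^ N))) = N"
proof (rule level_eqI)
  let ?q = "absv (unif :: 'a)"
  obtain h where h: "h \<in> GLo" "k ** h = mat 1" "h ** k = mat 1" using GLo_inv[OF assms] by metis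
  show "invertible (k ** dg (unif ^ N))" using assms by (simp add: invertible_mult GLo_invertible invertible_dg unif)
  have le: "absv (unif ^ N * k$i$2) \<le> 1" "absv (k$i$2 * unif ^ N) \<le> 1" for i
    using assms unif(2)[where 'a='a] by (auto simp: GLo_def mult.commute intro!: absv_mult_le power_le_one)
  have "mnorm (k ** dg (unif ^ N)) \<le> 1"
    using assms le by (auto simp: mnorm_def mm2 GLo_def)
  moreover have "1 \<le> mnorm (k ** dg (unif ^ N))"
  proof (rule ccontr)
    assume "\<not> ?thesis"
    then have "absv (k$1$1) < 1" "absv (k$2$1) < 1" by (auto simp: mnorm_def mm2)
    then have "absv (k$1$1 * k$2$2 - k$2$1 * k$1$2) < 1"
      by (intro absv_diff_less absv_mult_less) (use assms in \<open>auto simp: GLo_def\<close>)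
    then have "absv (det k) < 1" by (simp add: det_2 mult.commute)
    then show False using assms by (simp add: GLo_def)
  qed
  ultimately show "absv (det (k ** dg (unif ^ N))) = ?q ^ N * mnorm (k ** dg (unif ^ N)) ^ 2"
    using assms by (simp add: det_mul det_dg absv_mult GLo_def)
qed

text \<open>The Cartan decomposition, giving transitivity of \<open>GLo\<close> on each sphere
  around \<open>s0\<close>. Once a representative of norm 1 has a primitive first column, completing
  that column to \<open>k\<close> in \<open>GLo\<close> leaves a matrix with first column (1,0). Its
  determinant fixes the lower right entry up to a unit, and what remains is absorbed on the right by
  \<open>GLo\<close>.\<close>

lemma vertex_eq_k_sk:
  assumes "x \<in> tree_verts"
  obtains k where "k \<in> GLo" "x = vx (k ** dg (unif ^ level x))"
proof -
  let ?q = "absv (unif :: 'a)"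
  obtain A where A: "invertible A" "x = vx A" "mnorm A = 1" using assms by (rule vertex_normalE)
  define w where "w = (mk2 0 1 1 0 :: 'a^2^2)"
  have w: "w \<in> GLo" by (simp add: w_def GLo_iff det_2)
  have "\<exists>h\<in>GLo. absv ((A ** h)$1$1) = 1 \<or> absv ((A ** h)$2$1) = 1"
  proof (cases "absv (A$1$1) = 1 \<or> absv (A$2$1) = 1")
    case True
    then show ?thesis by (intro bexI[of _ "mat 1"] GLo_one) simp
  next
    case False
    then have "absv (A$1$2) = 1 \<or> absv (A$2$2) = 1" using A(3) by (auto simp: mnorm_def max_def split: if_splits)
    then show ?thesis using w by (intro bexI[of _ w]) (auto simp: mm2 w_def)
  qed
  then obtain h where h: "h \<in> GLo" "absv ((A ** h)$1$1) = 1 \<or> absv ((A ** h)$2$1) = 1" by blast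
  define B where "B = A ** h"
  have B: "invertible B" "vx B = x" "mnorm B = 1"
    using A h by (simp_all add: B_def invertible_mult GLo_invertible vx_mult_GLo mnorm_mult_GLo)
  have Ble: "absv (B$i$j) \<le> 1" for i j using absv_le_mnorm[of B] B(3) by metis
  obtain k where k: "k \<in> GLo" "k$1$1 = B$1$1" "k$2$1 = B$2$1"
    using extend_primitive[of "B$1$1" "B$2$1"] Ble h(2) unfolding B_def by auto
  obtain k1 where k1: "k1 \<in> GLo" "k ** k1 = mat 1" "k1 ** k = mat 1" using GLo_inv[OF k(1)] by metis
  define C where "C = k1 ** B"
  have kC: "B = k ** C" using k1 by (simp add: C_def matrix_mul_assoc)
  have Cle: "absv (C$i$j) \<le> 1" for i j
    using Ble k1(1) unfolding C_def mm2 by (auto simp: GLo_def intro!: absv_add_le absv_mult_le)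
  have C1: "C$1$1 = 1" "C$2$1 = 0"
    using arg_cong[OF k1(3), of "\<lambda>A. A$1$1"] arg_cong[OF k1(3), of "\<lambda>A. A$2$1"]
    by (simp_all add: C_def mm2 mat2 k)
  define d where "d = C$2$2"
  have "absv (det C) = ?q ^ level x"
    using level_vx[OF B(1)] B k(1) by (simp add: kC det_mul absv_mult GLo_def)
  then have d: "absv d = ?q ^ level x" by (simp add: det_2 C1 d_def)
  define u where "u = mk2 1 (C$1$2) 0 (d / unif ^ level x)"
  have u: "u \<in> GLo" using d Cle unif(1)[where 'a='a] by (simp add: u_def GLo_iff det_2)
  have "C = dg (unif ^ level x) ** u" using unif(1)[where 'a='a] by (simp add: eq2 mm2 u_def C1 d_def)
  then have "B = (k ** dg (unif ^ level x)) ** u" by (simp add: kC matrix_mul_assoc)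
  then have "x = vx (k ** dg (unif ^ level x))"
    using B(2) vx_mult_GLo[OF _ u] k(1) by (simp add: invertible_mult GLo_invertible invertible_dg unif)
  then show ?thesis using that k(1) by blast
qed

lemma adjacent_sk: "k \<in> GLo \<Longrightarrow> adjacent (vx (k ** dg (unif ^ N))) (vx (k ** dg (unif ^ Suc N)))"
  by (subst adjacent_vx)
    (auto simp: invertible_mult GLo_invertible invertible_dg unif eq2 mm2 mat2 intro!: bexI[of _ "mat 1"] GLo_one arg_cong[of _ _ vx])

section \<open>The action of PGL(2) on the tree\<close>

definition pg :: "'a::nonarch_local_field^2^2 \<Rightarrow> 'a pgl"
  where "pg A = scalars #>\<^bsub>GL2\<^esub> A"

lemma mem_pg: "M \<in> pg A \<longleftrightarrow> (\<exists>c. c \<noteq> 0 \<and> M = mat c ** A)"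
  by (auto simp: pg_def r_coset_def scalars_def GL2_def)

lemma pg_carrier: "carrier PGL = {pg A | A. invertible A}"
  by (auto simp: PGL_def FactGroup_def RCOSETS_def pg_def GL2_def)

lemma pg_in [simp]: "invertible A \<Longrightarrow> pg A \<in> carrier PGL"
  by (auto simp: pg_carrier)

lemma pg_mult: "invertible A \<Longrightarrow> invertible B \<Longrightarrow> pg A \<otimes>\<^bsub>PGL\<^esub> pg B = pg (A ** B)"
  unfolding pg_def PGL_def FactGroup_def
  using normal.rcos_sum[OF normal_scalars, of A B] by (simp add: GL2_def)

lemma pg_one: "\<one>\<^bsub>PGL\<^esub> = pg (mat 1)"
proof -
  have "scalars = pg (mat 1 :: 'a^2^2)"
    by (auto simp: mem_pg scalars_def)
  then show ?thesis by (simp add: PGL_def FactGroup_def)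
qed

lemma pg_eqI:
  assumes c: "c \<noteq> 0" "B = mat c ** A"
  shows "pg B = pg A"
proof (rule Set.set_eqI)
  fix M
  have "M = mat d ** A \<Longrightarrow> d \<noteq> 0 \<Longrightarrow> M = mat (d / c) ** B \<and> d / c \<noteq> 0" for d
    using c by (simp add: mat_mult_assoc)
  moreover have "M = mat d ** B \<Longrightarrow> d \<noteq> 0 \<Longrightarrow> M = mat (d * c) ** A \<and> d * c \<noteq> 0" for d
    using c by (simp add: mat_mult_assoc)
  ultimately show "M \<in> pg B \<longleftrightarrow> M \<in> pg A" unfolding mem_pg by blast
qed

lemma vertex_act_pg:
  assumes A: "invertible A" "invertible B"
  shows "vertex_act (pg A) (vx B) = vx (A ** B)"
proof -
  have "vertex_act (pg A) (vx B) = {lat (mat c ** A ** (mat d ** B)) | c d. c \<noteq> 0 \<and> d \<noteq> 0}"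
    unfolding vertex_act_def vx_def homothety_lat mem_pg lat_mult[of "mat _ ** A"] by blast
  also have "\<dots> = {lat (mat (c * d) ** (A ** B)) | c d. c \<noteq> 0 \<and> d \<noteq> 0}"
  proof -
  have "mat c ** A ** (mat d ** B) = mat (c * d) ** (A ** B)" for c d
  proof -
    have "mat c ** A ** (mat d ** B) = mat c ** (A ** mat d) ** B" by (simp add: matrix_mul_assoc)
    also have "\<dots> = mat c ** (mat d ** A) ** B" by (simp only: mat_commutes)
    finally show ?thesis by (simp add: matrix_mul_assoc mat_mult_mat)
  qed
  then show ?thesis by (simp only:)
  qed
  also have "{lat (mat (c * d) ** (A ** B)) | c d. c \<noteq> 0 \<and> d \<noteq> 0} = vx (A ** B)"
    unfolding vx_def homothety_lat
    by auto (metis mult.right_neutral one_neq_zero)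
  finally show ?thesis .
qed

interpretation PGL: group "PGL :: 'a::nonarch_local_field pgl monoid" by (rule group_PGL)

lemma carrier_pgE:
  assumes "g \<in> carrier PGL" obtains A where "invertible A" "g = pg A"
  using assms by (auto simp: pg_carrier)

lemma vertexE:
  assumes "x \<in> tree_verts" obtains A where "invertible A" "x = vx A"
  using assms by (auto simp: tree_verts_iff)

lemma act_tree [simp]: "g \<in> carrier PGL \<Longrightarrow> x \<in> tree_verts \<Longrightarrow> vertex_act g x \<in> tree_verts"
  by (auto elim!: carrier_pgE vertexE simp: vertex_act_pg invertible_mult)

lemma act_mult: "g \<in> carrier PGL \<Longrightarrow> h \<in> carrier PGL \<Longrightarrow> x \<in> tree_verts \<Longrightarrow>
    vertex_act (g \<otimes>\<^bsub>PGL\<^esub> h) x = vertex_act g (vertex_act h x)"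
  by (auto elim!: carrier_pgE vertexE simp: vertex_act_pg invertible_mult pg_mult matrix_mul_assoc)

lemma act_one [simp]: "x \<in> tree_verts \<Longrightarrow> vertex_act \<one>\<^bsub>PGL\<^esub> x = x"
  by (auto elim!: vertexE simp: pg_one vertex_act_pg GLo_invertible[OF GLo_one])

lemma act_inv [simp]:
  "g \<in> carrier PGL \<Longrightarrow> x \<in> tree_verts \<Longrightarrow> vertex_act g (vertex_act (inv\<^bsub>PGL\<^esub> g) x) = x"
  "g \<in> carrier PGL \<Longrightarrow> x \<in> tree_verts \<Longrightarrow> vertex_act (inv\<^bsub>PGL\<^esub> g) (vertex_act g x) = x"
  by (simp_all flip: act_mult)

lemma act_inj: "g \<in> carrier PGL \<Longrightarrow> x \<in> tree_verts \<Longrightarrow> y \<in> tree_verts \<Longrightarrow> vertex_act g x = vertex_act g y \<longleftrightarrow> x = y"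
  by (metis act_inv(2))

lemma adjacent_tree: "adjacent x y \<Longrightarrow> x \<in> tree_verts" "adjacent x y \<Longrightarrow> y \<in> tree_verts"
  by (auto simp: adjacent_iff invertible_mult invertible_dg unif)

lemma adjacent_act: "g \<in> carrier PGL \<Longrightarrow> adjacent x y \<Longrightarrow> adjacent (vertex_act g x) (vertex_act g y)"
proof -
  assume "g \<in> carrier PGL" "adjacent x y"
  then obtain A B where "invertible A" "g = pg A" "invertible B" "x = vx B" "y = vx (B ** dg unif)"
    by (auto simp: adjacent_iff elim!: carrier_pgE)
  then show ?thesis
    unfolding adjacent_iff by (intro exI[of _ "A ** B"])
      (auto simp: vertex_act_pg invertible_mult invertible_dg unif matrix_mul_assoc)
qed

lemma transitive_edges:
  assumes "adjacent x y"
  obtains g where "g \<in> carrier PGL" "vertex_act g x = s0" "vertex_act g y = s1"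
proof -
  obtain A where A: "invertible A" "x = vx A" "y = vx (A ** dg unif)" using assms by (auto simp: adjacent_iff)
  then obtain C where C: "A ** C = mat 1" "C ** A = mat 1" by (auto simp: invertible_def)
  then have iC: "invertible C" by (auto simp: invertible_def)
  show ?thesis
    by (rule that[of "pg C"])
      (use A C iC in \<open>auto simp: vertex_act_pg invertible_mult invertible_dg unif s0_eq s1_eq matrix_mul_assoc\<close>)
qed

lemma transitive_verts:
  assumes "x \<in> tree_verts"
  obtains g where "g \<in> carrier PGL" "vertex_act g x = s0"
  using three_nbrs[OF assms] transitive_edges by metis

lemma adjacent_s0_s1: "adjacent s0 s1"
  by (auto simp: adjacent_iff s0_eq s1_eq GLo_invertible[OF GLo_one] intro!: exI[of _ "mat 1"])

lemma s_tree [simp]: "s0 \<in> tree_verts" "s1 \<in> tree_verts"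
  using adjacent_tree[OF adjacent_s0_s1] by auto

lemma adjacent_irrefl: "adjacent x y \<Longrightarrow> x \<noteq> y"
  using adjacent_level by force

lemma s0_neq_s1 [simp]: "s0 \<noteq> s1" "s1 \<noteq> s0"
  using adjacent_irrefl[OF adjacent_s0_s1] by auto

lemma K0_eq: "K0 = {pg k | k. k \<in> GLo}"
proof safe
  fix g assume "g \<in> K0"
  then obtain A where A: "invertible A" "g = pg A" "vertex_act (pg A) s0 = s0"
    by (auto simp: K0_def elim!: carrier_pgE)
  then have "vx A = vx (mat 1)" by (simp add: s0_eq vertex_act_pg GLo_invertible[OF GLo_one])
  then obtain c k where "c \<noteq> 0" "k \<in> GLo" "A = mat c ** mat 1 ** k"
    using vx_eq_iff[OF GLo_invertible[OF GLo_one] A(1)] by metis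
  then show "\<exists>k. g = pg k \<and> k \<in> GLo" using A(2) pg_eqI[of c A k] by auto
next
  fix k :: "'a^2^2" assume "k \<in> GLo"
  then show "pg k \<in> K0"
    using vx_mult_GLo[OF GLo_invertible[OF GLo_one], of k]
    by (simp add: K0_def GLo_invertible s0_eq vertex_act_pg GLo_invertible[OF GLo_one])
qed

lemma subgroup_stabilizer:
  assumes "Y \<subseteq> tree_verts"
  shows "subgroup {g \<in> carrier PGL. vertex_act g ` Y = Y} PGL"
proof (rule PGL.subgroupI)
  fix g assume g: "g \<in> {g \<in> carrier PGL. vertex_act g ` Y = Y}"
  have *: "y \<in> tree_verts" if "y \<in> Y" for y using that assms by auto
  have "vertex_act (inv\<^bsub>PGL\<^esub> g) ` (vertex_act g ` Y) = (\<lambda>y. y) ` Y"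
    unfolding image_image by (rule image_cong) (use g * in auto)
  then show "inv\<^bsub>PGL\<^esub> g \<in> {g \<in> carrier PGL. vertex_act g ` Y = Y}" using g by auto
  fix h assume h: "h \<in> {g \<in> carrier PGL. vertex_act g ` Y = Y}"
  have "vertex_act (g \<otimes>\<^bsub>PGL\<^esub> h) ` Y = vertex_act g ` (vertex_act h ` Y)"
    unfolding image_image by (rule image_cong) (use g h * in \<open>auto simp: act_mult\<close>)
  then show "g \<otimes>\<^bsub>PGL\<^esub> h \<in> {g \<in> carrier PGL. vertex_act g ` Y = Y}" using g h by auto
next
  show "{g \<in> carrier PGL. vertex_act g ` Y = Y} \<noteq> {}"
    using assms by (auto intro!: exI[of _ "\<one>\<^bsub>PGL\<^esub>"] simp: subset_iff image_iff)
qed auto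

lemma subgroup_K0: "subgroup K0 PGL"
  using subgroup_stabilizer[of "{s0}"] by (simp add: K0_def)

lemma subgroup_K1: "subgroup K1 PGL"
  using subgroup_stabilizer[of "{s0, s1}"] by (simp add: K1_def)

lemma subgroup_K_par: "subgroup (K_par n) PGL"
  by (simp add: K_par_def subgroup_K0 subgroup_K1)

subsection \<open>The topology\<close>

lemma continuous_on_cmult:
  fixes f :: "'b::metric_space \<Rightarrow> 'a::nonarch_local_field"
  assumes "continuous_on S f"
  shows "continuous_on S (\<lambda>x. c * f x)"
proof -
  have "continuous_on UNIV (\<lambda>x::'a. c * x)"
    unfolding continuous_on_iff
  proof safe
    fix x :: 'a and e :: real assume "0 < e"
    have "dist (c * y) (c * x) = absv c * dist y x" for y
      by (simp add: dist_absv absv_mult flip: right_diff_distrib)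
    moreover have "absv c * dist y x < e" if "dist y x < e / (absv c + 1)" for y
    proof -
      have "absv c * dist y x \<le> (absv c + 1) * dist y x" by (intro mult_right_mono) auto
      also have "\<dots> < e" using that by (simp add: pos_less_divide_eq add_nonneg_pos mult.commute)
      finally show ?thesis .
    qed
    ultimately show "\<exists>d>0. \<forall>y\<in>UNIV. dist y x < d \<longrightarrow> dist (c * y) (c * x) < e"
      using \<open>0 < e\<close> by (intro exI[of _ "e / (absv c + 1)"]) (auto simp: add_nonneg_pos)
  qed
  from continuous_on_compose2[OF this assms] show ?thesis by simp
qed

lemma continuous_on_add_absv:
  fixes f :: "'b::metric_space \<Rightarrow> 'a::nonarch_local_field"
  assumes f: "continuous_on S f" and h: "continuous_on S h"
  shows "continuous_on S (\<lambda>x. f x + h x)"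
  unfolding continuous_on_iff
proof safe
  fix x :: 'b and e :: real assume x: "x \<in> S" and e: "0 < e"
  obtain d1 where d1: "d1 > 0" "\<forall>y\<in>S. dist y x < d1 \<longrightarrow> dist (f y) (f x) < e"
    using f x e unfolding continuous_on_iff by blast
  obtain d2 where d2: "d2 > 0" "\<forall>y\<in>S. dist y x < d2 \<longrightarrow> dist (h y) (h x) < e"
    using h x e unfolding continuous_on_iff by blast
  have "dist (f y + h y) (f x + h x) < e" if "dist (f y) (f x) < e" "dist (h y) (h x) < e" for y
  proof -
    have "f y + h y - (f x + h x) = (f y - f x) + (h y - h x)" by simp
    then show ?thesis using that by (simp only: dist_absv) (rule absv_add_less)
  qed
  then show "\<exists>d>0. \<forall>y\<in>S. dist y x < d \<longrightarrow> dist (f y + h y) (f x + h x) < e"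
    using d1 d2 by (intro exI[of _ "min d1 d2"]) auto
qed

lemma continuous_matrix_mult:
  fixes A :: "'a::nonarch_local_field^2^2"
  shows "continuous_on S (\<lambda>M::'a^2^2. A ** M)" "continuous_on S (\<lambda>M::'a^2^2. M ** A)"
proof -
  have "(\<lambda>M::'a^2^2. A ** M) = (\<lambda>M. \<chi> i j. A$i$1 * M$1$j + A$i$2 * M$2$j)"
    "(\<lambda>M::'a^2^2. M ** A) = (\<lambda>M. \<chi> i j. A$1$j * M$i$1 + A$2$j * M$i$2)"
    by (auto simp: fun_eq_iff vec_eq_iff mm2 mult.commute)
  then show "continuous_on S (\<lambda>M::'a^2^2. A ** M)" "continuous_on S (\<lambda>M::'a^2^2. M ** A)"
    by (simp_all only:) (intro continuous_on_vec_lambda continuous_on_add_absv continuous_on_cmult continuous_on_component continuous_on_id)+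
qed

lemma Union_pg: "U \<subseteq> carrier PGL \<Longrightarrow> M \<in> \<Union>U \<longleftrightarrow> invertible M \<and> pg M \<in> U"
proof -
  assume U: "U \<subseteq> carrier PGL"
  show ?thesis
  proof
    assume "M \<in> \<Union>U"
    then obtain A c where A: "invertible A" "pg A \<in> U" "c \<noteq> 0" "M = mat c ** A"
      using U by (force simp: pg_carrier mem_pg)
    then show "invertible M \<and> pg M \<in> U" using pg_eqI[of c M A] by (simp add: invertible_mult invertible_mat)
  next
    have "M \<in> pg M" by (auto simp: mem_pg intro: exI[of _ 1])
    then show "invertible M \<and> pg M \<in> U \<Longrightarrow> M \<in> \<Union>U" by blast
  qed
qed

lemma openin_PGL_iff:
  "openin PGL_top U \<longleftrightarrow> U \<subseteq> carrier PGL \<and> openin (top_of_set (carrier GL2)) {M. invertible M \<and> pg M \<in> U}"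
proof -
  have "\<Union>U = {M. invertible M \<and> pg M \<in> U}" if "U \<subseteq> carrier PGL" using Union_pg[OF that] by blast
  then show ?thesis unfolding openin_PGL_top by auto
qed

lemma openin_carrier: "openin PGL_top (carrier PGL)"
  by (auto simp: openin_PGL_iff openin_open GL2_def intro!: exI[of _ UNIV])

lemma topspace_PGL: "topspace PGL_top = carrier PGL"
  using openin_carrier openin_subset[of PGL_top] openin_PGL_top openin_topspace by blast

lemma openin_translate:
  assumes U: "openin PGL_top U" and g: "g \<in> carrier PGL"
  shows "openin PGL_top {h \<in> carrier PGL. g \<otimes>\<^bsub>PGL\<^esub> h \<in> U}" "openin PGL_top {h \<in> carrier PGL. h \<otimes>\<^bsub>PGL\<^esub> g \<in> U}"
proof -
  obtain A where A: "invertible A" "g = pg A" using g by (rule carrier_pgE)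
  have o: "openin (top_of_set (carrier GL2)) {M. invertible M \<and> pg M \<in> U}"
    using U by (simp add: openin_PGL_iff)
  have "{M. invertible M \<and> pg M \<in> {h \<in> carrier PGL. g \<otimes>\<^bsub>PGL\<^esub> h \<in> U}} =
      carrier GL2 \<inter> (\<lambda>M::'a^2^2. A ** M) -` {M. invertible M \<and> pg M \<in> U}"
    using A by (auto simp: GL2_def pg_mult invertible_mult)
  then show "openin PGL_top {h \<in> carrier PGL. g \<otimes>\<^bsub>PGL\<^esub> h \<in> U}"
    unfolding openin_PGL_iff
    using continuous_openin_preimage[OF continuous_matrix_mult(1)[of "carrier GL2" A] _ o] A
    by (auto simp: GL2_def invertible_mult)
  have "{M. invertible M \<and> pg M \<in> {h \<in> carrier PGL. h \<otimes>\<^bsub>PGL\<^esub> g \<in> U}} =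
      carrier GL2 \<inter> (\<lambda>M::'a^2^2. M ** A) -` {M. invertible M \<and> pg M \<in> U}"
    using A by (auto simp: GL2_def pg_mult invertible_mult)
  then show "openin PGL_top {h \<in> carrier PGL. h \<otimes>\<^bsub>PGL\<^esub> g \<in> U}"
    unfolding openin_PGL_iff
    using continuous_openin_preimage[OF continuous_matrix_mult(2)[of "carrier GL2" A] _ o] A
    by (auto simp: GL2_def invertible_mult)
qed

lemma absv_entry_le_dist: "absv ((A::'a::nonarch_local_field^2^2)$i$j - B$i$j) \<le> dist A B"
  using dist_vec_nth_le[of "A$i" j "B$i"] dist_vec_nth_le[of A i B] by (simp add: dist_absv)

text \<open>On integral matrices the determinant changes by less than 1 when the entries do, as the
  telescoped difference shows. In an ultrametric such a change leaves the absolute value 1 of the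
  determinant unaltered.\<close>

lemma GLo_near:
  assumes A: "A \<in> GLo" and near: "\<And>i j. absv (B$i$j - A$i$j) < 1"
  shows "B \<in> GLo"
proof -
  have A1: "absv (A$i$j) \<le> 1" for i j using A by (simp add: GLo_def)
  have B1: "absv (B$i$j) \<le> 1" for i j
    using absv_add_le[of "B$i$j - A$i$j" 1 "A$i$j"] near[of i j] A1 by simp
  have "det B - det A = ((B$1$1 - A$1$1) * B$2$2 + (B$2$2 - A$2$2) * A$1$1) - ((B$1$2 - A$1$2) * B$2$1 + (B$2$1 - A$2$1) * A$1$2)"
    by (simp add: det_2 algebra_simps)
  also have "absv \<dots> < 1" by (intro absv_diff_less absv_add_less absv_mult_less near A1 B1)
  finally have "absv (det B - det A) < absv (det A)" using A by (simp add: GLo_def)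
  from absv_add_eq[OF this] have "absv (det B) = 1" using A by (simp add: GLo_def)
  then show ?thesis using B1 by (simp add: GLo_def)
qed

lemma openin_K0: "openin PGL_top K0"
  unfolding openin_PGL_iff
proof
  show "K0 \<subseteq> carrier PGL" by (auto simp: K0_def)
  have "open {M :: 'a^2^2. invertible M \<and> pg M \<in> K0}"
    unfolding open_dist
  proof safe
    fix M :: "'a^2^2" assume M: "invertible M" "pg M \<in> K0"
    then obtain k where k: "k \<in> GLo" "pg M = pg k" by (auto simp: K0_eq)
    have "k \<in> pg M" using k by (auto simp: mem_pg intro: exI[of _ 1])
    then obtain c where c: "c \<noteq> 0" "k = mat c ** M" by (auto simp: mem_pg)
    \<comment> \<open>The scalar \<open>c\<close> moves \<open>M\<close> into \<open>GLo\<close>,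
      where perturbations of size less than 1 are harmless; undoing the scaling gives the
      radius.\<close>
    have "invertible N \<and> pg N \<in> K0" if "dist N M < 1 / absv c" for N
    proof -
      have "absv ((mat c ** N)$i$j - k$i$j) < 1" for i j
      proof -
        have "(mat c ** N)$i$j - k$i$j = c * (N$i$j - M$i$j)"
          using exhaust_2[of i] by (auto simp: c(2) mm2 mat2 right_diff_distrib)
        moreover have "absv c * absv (N$i$j - M$i$j) < 1"
        proof (rule le_less_trans[OF mult_left_mono[OF absv_entry_le_dist[of N i j M] absv_nonneg[of c]]])
          show "absv c * dist N M < 1" using that c(1) by (simp add: pos_less_divide_eq mult.commute)
        qed
        ultimately show ?thesis by (simp add: absv_mult)
      qed
      then have "mat c ** N \<in> GLo" by (rule GLo_near[OF k(1)])
      moreover have "N = mat (inverse c) ** (mat c ** N)" using c(1) by (simp add: mat_mult_assoc)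
      ultimately show ?thesis
        using c(1) pg_eqI[of "inverse c" N "mat c ** N"] GLo_invertible[of "mat c ** N"]
        by (auto simp: K0_eq inv_det det_mul det_mat)
    qed
    then show "\<exists>e>0. \<forall>N. dist N M < e \<longrightarrow> N \<in> {M. invertible M \<and> pg M \<in> K0}"
      using c(1) by (intro exI[of _ "1 / absv c"]) auto
  qed
  then show "openin (top_of_set (carrier GL2)) {M :: 'a^2^2. invertible M \<and> pg M \<in> K0}"
    by (rule open_subset[rotated]) (auto simp: GL2_def)
qed

text \<open>An element carrying \<open>x\<close> to \<open>s0\<close> conjugates the stabilizer into
  \<open>K0\<close>, and one-sided translations are homeomorphisms.\<close>

lemma openin_stab:
  assumes "x \<in> tree_verts"
  shows "openin PGL_top {g \<in> carrier PGL. vertex_act g x = x}"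
proof -
  obtain a where a: "a \<in> carrier PGL" "vertex_act a x = s0" using assms by (rule transitive_verts)
  have "vertex_act g x = x \<longleftrightarrow> (a \<otimes>\<^bsub>PGL\<^esub> g) \<otimes>\<^bsub>PGL\<^esub> inv\<^bsub>PGL\<^esub> a \<in> K0" if "g \<in> carrier PGL" for g
  proof -
    have "vertex_act (inv\<^bsub>PGL\<^esub> a) s0 = x" using a assms by (metis act_inv(2))
    then have "vertex_act ((a \<otimes>\<^bsub>PGL\<^esub> g) \<otimes>\<^bsub>PGL\<^esub> inv\<^bsub>PGL\<^esub> a) s0 = vertex_act a (vertex_act g x)"
      using a(1) that assms by (simp add: act_mult)
    moreover have "vertex_act a (vertex_act g x) = s0 \<longleftrightarrow> vertex_act g x = x"
      using act_inj[OF a(1), of "vertex_act g x" x] a(2) that assms by simp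
    ultimately show ?thesis using a(1) that by (simp add: K0_def)
  qed
  then have eq: "{g \<in> carrier PGL. vertex_act g x = x} =
      {g \<in> carrier PGL. a \<otimes>\<^bsub>PGL\<^esub> g \<in> {h \<in> carrier PGL. h \<otimes>\<^bsub>PGL\<^esub> inv\<^bsub>PGL\<^esub> a \<in> K0}}"
    using a by auto
  show ?thesis
    unfolding eq by (intro openin_translate openin_K0 PGL.inv_closed a(1))
qed

lemma openin_subgroup:
  assumes "subgroup H PGL" "openin PGL_top U" "U \<subseteq> H" "\<one>\<^bsub>PGL\<^esub> \<in> U"
  shows "openin PGL_top H"
proof (subst openin_subopen, safe)
  fix h assume h: "h \<in> H"
  interpret H: subgroup H PGL by fact
  have hc: "h \<in> carrier PGL" using h by simp
  let ?V = "{y \<in> carrier PGL. inv\<^bsub>PGL\<^esub> h \<otimes>\<^bsub>PGL\<^esub> y \<in> U}"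
  have "?V \<subseteq> H"
  proof safe
    fix y assume y: "y \<in> carrier PGL" "inv\<^bsub>PGL\<^esub> h \<otimes>\<^bsub>PGL\<^esub> y \<in> U"
    then have "h \<otimes>\<^bsub>PGL\<^esub> (inv\<^bsub>PGL\<^esub> h \<otimes>\<^bsub>PGL\<^esub> y) \<in> H" using assms(3) h by blast
    then show "y \<in> H" using y hc by (simp flip: PGL.m_assoc)
  qed
  then show "\<exists>T. openin PGL_top T \<and> h \<in> T \<and> T \<subseteq> H"
    using openin_translate(1)[OF assms(2), of "inv\<^bsub>PGL\<^esub> h"] hc assms(4) by (intro exI[of _ ?V]) auto
qed

lemma openin_K1: "openin PGL_top K1"
proof (rule openin_subgroup[OF subgroup_K1])
  show "openin PGL_top ({g \<in> carrier PGL. vertex_act g s0 = s0} \<inter> {g \<in> carrier PGL. vertex_act g s1 = s1})"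
    by (intro openin_Int openin_stab s_tree)
qed (auto simp: K1_def)

lemma openin_K_par: "openin PGL_top (K_par n)"
  by (simp add: K_par_def openin_K0 openin_K1)

text \<open>Congruence conditions modulo powers of \<open>unif\<close> form a neighbourhood basis of
  the identity. It makes the invariance of a smooth function under some open subgroup quantitative,
  so that it can be compared with depth in the tree.\<close>

lemma open_contains_congruence:
  assumes "openin PGL_top U" "\<one>\<^bsub>PGL\<^esub> \<in> (U :: 'a::nonarch_local_field pgl set)"
  obtains N where "\<And>A. invertible A \<Longrightarrow> (\<And>i j. absv (A$i$j - (mat 1 :: 'a^2^2)$i$j) \<le> absv (unif :: 'a) ^ N) \<Longrightarrow> pg A \<in> U"
proof -
  have "openin (top_of_set (carrier GL2)) {M. invertible M \<and> pg M \<in> U}" "mat 1 \<in> {M. invertible M \<and> pg M \<in> U}"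
    using assms by (auto simp: openin_PGL_iff pg_one GLo_invertible[OF GLo_one])
  then obtain e where e: "e > 0" "\<And>M. invertible M \<Longrightarrow> dist M (mat 1) < e \<Longrightarrow> pg M \<in> U"
    by (auto simp: openin_euclidean_subtopology_iff GL2_def)
  \<comment> \<open>The Euclidean norm over the indices is bounded by the sum over the four
    entries.\<close>
  have "dist A B \<le> 4 * r" if "\<And>i j. absv (A$i$j - B$i$j) \<le> r" for A B :: "'a^2^2" and r
  proof -
    have "dist A B \<le> (\<Sum>i\<in>UNIV. dist (A$i) (B$i))"
      unfolding dist_vec_def by (rule L2_set_le_sum) simp
    also have "\<dots> \<le> (\<Sum>i\<in>UNIV. \<Sum>j\<in>UNIV. dist (A$i$j) (B$i$j))"
      by (intro sum_mono) (simp add: dist_vec_def L2_set_le_sum)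
    also have "\<dots> \<le> 4 * r"
      using that[of 1 1] that[of 1 2] that[of 2 1] that[of 2 2] by (simp add: sum_2 dist_absv)
    finally show ?thesis .
  qed
  moreover obtain N where "absv (unif :: 'a) ^ N < e / 4"
    using real_arch_pow_inv[of "e / 4" "absv (unif :: 'a)"] e unif(2)[where 'a='a] by auto
  ultimately have "dist A (mat 1) < e" if "\<And>i j. absv (A$i$j - (mat 1 :: 'a^2^2)$i$j) \<le> absv (unif :: 'a) ^ N" for A
    using that by fastforce
  then show ?thesis using that[of N] e(2) by blast
qed

section \<open>Paths\<close>

lemma s0_sk: "s0 = vx (mat 1 ** dg (unif ^ 0))"
  unfolding s0_eq by (rule arg_cong[of _ _ vx]) (simp add: eq2 mat2)

lemma level_s0 [simp]: "level s0 = 0"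
  unfolding s0_sk by (rule level_k_sk[OF GLo_one])

text \<open>Injectivity is weakened to the absence of backtracking. That the two agree is a property
  of trees (\<open>opaths_iff\<close>), and it makes the extension and the gluing of paths local
  questions.\<close>

definition geodesic :: "nat \<Rightarrow> 'a::nonarch_local_field vpath \<Rightarrow> bool"
  where "geodesic k xs \<longleftrightarrow> length xs = k + 1 \<and> set xs \<subseteq> tree_verts \<and>
    (\<forall>i<k. adjacent (xs ! i) (xs ! Suc i)) \<and> (\<forall>i. Suc i < k \<longrightarrow> xs ! i \<noteq> xs ! Suc (Suc i))"

text \<open>The first step downwards would have to lead to the unique lower neighbour, which is the
  vertex just left. So a path from \<open>s0\<close> without backtracking can only climb.\<close>

lemma geodesic_level:
  assumes "geodesic k xs" "xs ! 0 = s0" "i \<le> k"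
  shows "level (xs ! i) = i"
  using \<open>i \<le> k\<close>
proof (induction i rule: less_induct)
  case (less i)
  show ?case
  proof (cases i)
    case 0
    then show ?thesis using assms by simp
  next
    case (Suc j)
    then have j: "level (xs ! j) = j" "adjacent (xs ! j) (xs ! i)" using less assms(1) by (auto simp: geodesic_def)
    show ?thesis
    proof (rule ccontr)
      assume "level (xs ! i) \<noteq> i"
      then have l: "j = Suc (level (xs ! i))" using adjacent_level[OF j(2)] j(1) Suc by auto
      then obtain m where m: "j = Suc m" "level (xs ! i) = m" by blast
      then have "level (xs ! m) = m" "adjacent (xs ! m) (xs ! j)" "xs ! m \<noteq> xs ! i"
        using less Suc assms(1) by (auto simp: geodesic_def)
      then show False using down_nbr_unique[OF j(2) adjacent_sym, of "xs ! m"] j(1) m by simp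
    qed
  qed
qed

text \<open>To separate two vertices of the path, move the earlier one to \<open>s0\<close>. The
  rest of the path then climbs, and the later vertex has positive level.\<close>

lemma opaths_iff: "xs \<in> opaths k \<longleftrightarrow> geodesic k xs"
proof
  assume "xs \<in> opaths k"
  then show "geodesic k xs" by (auto simp: opaths_def geodesic_def nth_eq_iff_index_eq)
next
  assume g: "geodesic k xs"
  have "xs ! i \<noteq> xs ! j" if ij: "i < j" "j < length xs" for i j
  proof -
    have "xs ! i \<in> tree_verts" using g ij by (auto simp: geodesic_def)
    then obtain a where a: "a \<in> carrier PGL" "vertex_act a (xs ! i) = s0" by (rule transitive_verts)
    define ys where "ys = map (vertex_act a) (drop i xs)"
    have len: "length xs = k + 1" using g by (simp add: geodesic_def)
    have nth: "ys ! l = vertex_act a (xs ! (i + l))" if "i + l \<le> k" for l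
      using that ij len by (simp add: ys_def)
    have tr: "xs ! l \<in> tree_verts" if "l \<le> k" for l using g that by (auto simp: geodesic_def)
    have "geodesic (k - i) ys"
      unfolding geodesic_def
    proof (intro conjI allI impI)
      show "length ys = k - i + 1" using ij len by (simp add: ys_def)
      show "set ys \<subseteq> tree_verts" using g a(1) set_drop_subset[of i xs] by (auto simp: ys_def geodesic_def)
      show "adjacent (ys ! l) (ys ! Suc l)" if "l < k - i" for l
        using that nth[of l] nth[of "Suc l"] g a(1) by (auto simp: geodesic_def intro!: adjacent_act)
      show "ys ! l \<noteq> ys ! Suc (Suc l)" if "Suc l < k - i" for l
        using that nth[of l] nth[of "Suc (Suc l)"] g a(1) tr[of "i + l"] tr[of "Suc (Suc (i + l))"]
        by (auto simp: geodesic_def act_inj)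
    qed
    moreover have "ys ! 0 = s0" using a nth[of 0] ij len by simp
    ultimately have "level (ys ! (j - i)) = j - i" using ij len by (intro geodesic_level) auto
    then have "ys ! (j - i) \<noteq> s0" using ij by auto
    then show ?thesis using nth[of "j - i"] ij len a by auto
  qed
  then have "distinct xs" unfolding distinct_conv_nth by (metis linorder_neqE_nat)
  then show "xs \<in> opaths k" using g by (simp add: opaths_def geodesic_def)
qed

lemma opaths_length: "xs \<in> opaths k \<Longrightarrow> length xs = k + 1"
  and opaths_tree: "xs \<in> opaths k \<Longrightarrow> set xs \<subseteq> tree_verts"
  and opaths_distinct: "xs \<in> opaths k \<Longrightarrow> distinct xs"
  and opaths_adjacent: "xs \<in> opaths k \<Longrightarrow> i < k \<Longrightarrow> adjacent (xs ! i) (xs ! Suc i)"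
  by (auto simp: opaths_def)

lemma opaths_nth_tree: "xs \<in> opaths k \<Longrightarrow> i \<le> k \<Longrightarrow> xs ! i \<in> tree_verts"
  using opaths_tree opaths_length by fastforce

lemma opaths_tl: "a \<in> opaths (Suc k) \<Longrightarrow> tl a \<in> opaths k"
  by (auto simp: opaths_def nth_tl distinct_tl dest: list.set_sel(2)[rotated])

lemma opaths_butlast: "a \<in> opaths (Suc k) \<Longrightarrow> butlast a \<in> opaths k"
  by (auto simp: opaths_def nth_butlast distinct_butlast dest: in_set_butlastD)

lemma opaths_0: "xs \<in> opaths 0 \<longleftrightarrow> (\<exists>x\<in>tree_verts. xs = [x])"
  by (auto simp: opaths_def length_Suc_conv)

lemma opaths_1: "xs \<in> opaths (Suc 0) \<longleftrightarrow> (\<exists>x y. adjacent x y \<and> xs = [x, y])"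
  by (auto simp: opaths_def length_Suc_conv dest: adjacent_tree adjacent_irrefl)

lemma Cons_opaths: "y # w \<in> opaths (Suc k) \<longleftrightarrow> w \<in> opaths k \<and> adjacent y (hd w) \<and> (0 < k \<longrightarrow> y \<noteq> w ! 1)"
proof -
  have "(\<forall>i<Suc k. adjacent ((y # w) ! i) ((y # w) ! Suc i)) \<longleftrightarrow> adjacent y (w ! 0) \<and> (\<forall>i<k. adjacent (w ! i) (w ! Suc i))"
    by (simp add: All_less_Suc2)
  moreover have "(\<forall>i. Suc i < Suc k \<longrightarrow> (y # w) ! i \<noteq> (y # w) ! Suc (Suc i)) \<longleftrightarrow>
      (0 < k \<longrightarrow> y \<noteq> w ! 1) \<and> (\<forall>i. Suc i < k \<longrightarrow> w ! i \<noteq> w ! Suc (Suc i))"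
    by (auto simp: nth_Cons split: nat.splits)
  ultimately show ?thesis
    unfolding opaths_iff geodesic_def
    by (cases w) (auto dest: adjacent_tree)
qed

lemma opaths_rev: "rev w \<in> opaths k \<longleftrightarrow> w \<in> opaths k"
proof -
  have "rev w \<in> opaths k" if w: "w \<in> opaths k" for w :: "'a vpath"
  proof -
    have "adjacent (rev w ! i) (rev w ! Suc i)" if "i < k" for i
    proof -
      have "rev w ! i = w ! Suc (k - Suc i)" "rev w ! Suc i = w ! (k - Suc i)"
        using that opaths_length[OF w] by (auto simp: rev_nth Suc_diff_Suc)
      then show ?thesis using opaths_adjacent[OF w, of "k - Suc i"] that adjacent_sym by simp
    qed
    then show ?thesis using w by (auto simp: opaths_def)
  qed
  from this[of w] this[of "rev w"] show ?thesis by auto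
qed

text \<open>Absence of backtracking concerns three consecutive vertices. For \<open>k > 0\<close>
  any three of the glued path already lie in one of the two given paths; for \<open>k = 0\<close>
  the three are \<open>y\<close>, the vertex of \<open>w\<close> and \<open>x\<close>, whence the
  separate assumption.\<close>

lemma opaths_glue:
  assumes "y # w \<in> opaths (Suc k)" "w @ [x] \<in> opaths (Suc k)" "k = 0 \<longrightarrow> y \<noteq> x"
  shows "y # w @ [x] \<in> opaths (Suc (Suc k))"
proof -
  have "length w = k + 1" using assms(1) opaths_length by fastforce
  then show ?thesis
    using assms unfolding Cons_opaths[of y "w @ [x]"]
    by (cases k) (auto simp: Cons_opaths nth_append hd_append length_Suc_conv)
qed

text \<open>Of three neighbours, one survives the exclusion of two vertices: \<open>z\<close>, and
  either the second vertex of \<open>w\<close>, which would be backtracking, or \<open>z'\<close>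
  when \<open>w\<close> is a single vertex.\<close>

lemma left_extension:
  assumes "w \<in> opaths k"
  obtains y where "y # w \<in> opaths (Suc k)" "y \<noteq> z" "0 < k \<or> y \<noteq> z'"
proof -
  have "hd w \<in> tree_verts" using assms opaths_length[OF assms] opaths_tree[OF assms] by (cases w) auto
  then obtain y1 y2 y3 where y: "adjacent (hd w) y1" "adjacent (hd w) y2" "adjacent (hd w) y3"
    "y1 \<noteq> y2" "y1 \<noteq> y3" "y2 \<noteq> y3" by (rule three_nbrs)
  define b where "b = (if 0 < k then w ! 1 else z')"
  obtain y where "adjacent (hd w) y" "y \<noteq> z" "y \<noteq> b" using y by metis
  then show ?thesis using assms by (intro that[of y]) (auto simp: Cons_opaths b_def adjacent_sym split: if_splits)
qed

lemma right_extension: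
  assumes "w \<in> opaths k"
  obtains x where "w @ [x] \<in> opaths (Suc k)" "x \<noteq> z" "0 < k \<or> x \<noteq> z'"
proof -
  obtain x where "x # rev w \<in> opaths (Suc k)" "x \<noteq> z" "0 < k \<or> x \<noteq> z'"
    using left_extension[of "rev w" k z z'] assms by (auto simp: opaths_rev)
  then show ?thesis using that[of x] opaths_rev[of "w @ [x]"] by simp
qed

lemma finite_level: "finite {x \<in> (tree_verts :: 'a::nonarch_local_field vertex set). level x \<le> N}"
proof (induction N)
  case 0
  have "{x \<in> (tree_verts :: 'a vertex set). level x \<le> 0} \<subseteq> {s0}" using level_zero by auto
  then show ?case using finite_subset by blast
next
  case (Suc N)
  have "{x \<in> (tree_verts :: 'a vertex set). level x \<le> Suc N} \<subseteq> {x \<in> (tree_verts :: 'a vertex set). level x \<le> N} \<union> (\<Union>y\<in>{x \<in> (tree_verts :: 'a vertex set). level x \<le> N}. {x. adjacent y x})"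
  proof
    fix x assume x: "x \<in> {x \<in> (tree_verts :: 'a vertex set). level x \<le> Suc N}"
    show "x \<in> {x \<in> (tree_verts :: 'a vertex set). level x \<le> N} \<union> (\<Union>y\<in>{x \<in> (tree_verts :: 'a vertex set). level x \<le> N}. {x. adjacent y x})"
    proof (cases "level x \<le> N")
      case False
      then obtain y where "adjacent x y" "level y < level x" using down_nbr_exists[of x] x by auto
      then show ?thesis using x adjacent_sym adjacent_tree by fastforce
    qed (use x in auto)
  qed
  moreover have "finite ({x \<in> (tree_verts :: 'a vertex set). level x \<le> N} \<union> (\<Union>y\<in>{x \<in> (tree_verts :: 'a vertex set). level x \<le> N}. {x. adjacent y x}))"
    using Suc finite_nbrs by auto
  ultimately show ?case by (rule finite_subset)
qed

lemma opaths_level: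
  assumes "xs \<in> opaths k" "i \<le> k" "j \<le> k"
  shows "level (xs ! j) \<le> level (xs ! i) + k"
proof -
  have up: "level (xs ! (l + d)) \<le> level (xs ! l) + d \<and> level (xs ! l) \<le> level (xs ! (l + d)) + d" if "l + d \<le> k" for l d
    using that
  proof (induction d)
    case (Suc d)
    then show ?case using adjacent_level[OF opaths_adjacent[OF assms(1), of "l + d"]] by auto
  qed simp
  show ?thesis
  proof (cases "i \<le> j")
    case True
    then show ?thesis using up[of i "j - i"] assms by auto
  next
    case False
    then show ?thesis using up[of j "i - j"] assms by auto
  qed
qed

lemma finite_opaths_through_s0: "finite {a \<in> opaths k. s0 \<in> set a}"
proof -
  have "{a \<in> opaths k. s0 \<in> set a} \<subseteq> {xs. set xs \<subseteq> {x \<in> tree_verts. level x \<le> k} \<and> length xs = k + 1}"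
  proof safe
    fix a x assume a: "a \<in> opaths k" "s0 \<in> set a" "x \<in> set a"
    then show "x \<in> tree_verts" using opaths_tree by blast
    obtain i j where "i \<le> k" "a ! i = s0" "j \<le> k" "a ! j = x"
      using a opaths_length[OF a(1)] by (metis in_set_conv_nth Suc_eq_plus1 less_Suc_eq_le)
    then show "level x \<le> k" using opaths_level[OF a(1), of i j] by simp
  qed (simp add: opaths_length)
  then show ?thesis using finite_lists_length_eq[OF finite_level] finite_subset by blast
qed

lemma finite_head_star: "finite {a \<in> opaths (Suc k). tl a = v}"
proof -
  have "{a \<in> opaths (Suc k). tl a = v} \<subseteq> (\<lambda>y. y # v) ` {y. adjacent (hd v) y}"
  proof safe
    fix a :: "'a vpath" assume a: "a \<in> opaths (Suc k)" "v = tl a"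
    then obtain y where "a = y # tl a" using opaths_length[OF a(1)] by (cases a) auto
    then show "a \<in> (\<lambda>y. y # tl a) ` {y. adjacent (hd (tl a)) y}"
      using a(1) Cons_opaths[of y "tl a" k] adjacent_sym by (metis image_eqI mem_Collect_eq)
  qed
  then show ?thesis using finite_nbrs finite_subset by blast
qed

lemma finite_tail_star: "finite {a \<in> opaths (Suc k). butlast a = v}"
proof -
  have "{a \<in> opaths (Suc k). butlast a = v} \<subseteq> rev ` {a \<in> opaths (Suc k). tl a = rev v}"
  proof safe
    fix a :: "'a vpath" assume a: "a \<in> opaths (Suc k)" "v = butlast a"
    have "tl (rev a) = rev (butlast a)" by (metis butlast_rev rev_rev_ident rev_swap)
    then show "a \<in> rev ` {x \<in> opaths (Suc k). tl x = rev (butlast a)}"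
      using a(1) opaths_rev[of a] by (intro image_eqI[of _ _ "rev a"]) auto
  qed
  then show ?thesis using finite_head_star finite_subset by blast
qed

abbreviation pact :: "'a::nonarch_local_field pgl \<Rightarrow> 'a vpath \<Rightarrow> 'a vpath"
  where "pact g \<equiv> map (vertex_act g)"

lemma pact_opaths [simp]:
  assumes "g \<in> carrier PGL" "a \<in> opaths k"
  shows "pact g a \<in> opaths k"
proof -
  have "inj_on (vertex_act g) (set a)"
    using opaths_tree[OF assms(2)] assms(1) by (auto simp: inj_on_def act_inj subset_iff)
  then show ?thesis using assms by (auto simp: opaths_def distinct_map intro: adjacent_act)
qed

lemma pact_one: "a \<in> opaths k \<Longrightarrow> pact \<one>\<^bsub>PGL\<^esub> a = a"
  using opaths_tree[of a k] by (auto intro!: map_idI)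

lemma pact_mult: "a \<in> opaths k \<Longrightarrow> g \<in> carrier PGL \<Longrightarrow> h \<in> carrier PGL \<Longrightarrow>
    pact (g \<otimes>\<^bsub>PGL\<^esub> h) a = pact g (pact h a)"
  using opaths_tree[of a k] by (auto simp: act_mult)

lemma pact_inv:
  "a \<in> opaths k \<Longrightarrow> g \<in> carrier PGL \<Longrightarrow> pact g (pact (inv\<^bsub>PGL\<^esub> g) a) = a"
  "a \<in> opaths k \<Longrightarrow> g \<in> carrier PGL \<Longrightarrow> pact (inv\<^bsub>PGL\<^esub> g) (pact g a) = a"
  by (simp_all add: pact_one del: map_map flip: pact_mult)

subsection \<open>Middles\<close>

text \<open>Vertex sets in place of the points of the tree over which \<open>path_graph k\<close> is fibred.\<close>

definition mid :: "nat \<Rightarrow> 'a vpath \<Rightarrow> 'a vertex set"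
  where "mid k a = (if even k then mid_edge a else {mid_vertex a})"

definition base :: "nat \<Rightarrow> 'a::nonarch_local_field vertex set"
  where "base k = (if even k then {s0, s1} else {s0})"

text \<open>The common value of \<open>mid k\<close> on all arcs with head \<open>v\<close>, see
  \<open>mid_head\<close>, just as \<open>tail_mid\<close> is its common value on the arcs with tail
  \<open>v\<close>. Reading it off from \<open>v\<close> requires \<open>k > 0\<close>; a single
  vertex does not determine the edge that ends there.\<close>

definition head_mid :: "nat \<Rightarrow> 'a vpath \<Rightarrow> 'a vertex set"
  where "head_mid k v = (if even k then {v ! (k div 2 - 1), v ! (k div 2)} else {v ! (k div 2)})"

definition tail_mid :: "nat \<Rightarrow> 'a vpath \<Rightarrow> 'a vertex set"
  where "tail_mid k v = (if even k then {v ! (k div 2), v ! Suc (k div 2)} else {v ! Suc (k div 2)})"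

definition Sig :: "nat \<Rightarrow> 'a::nonarch_local_field vpath set"
  where "Sig k = {a \<in> opaths (Suc k). mid k a = base k}"

lemma arcs_Sigma: "arcs (Sigma_graph k) = Sig k"
  by (auto simp: Sigma_graph_def Sig_def mid_def base_def)

lemma K_par_eq: "K_par k = {g \<in> carrier PGL. vertex_act g ` base k = base k}"
  by (simp add: K_par_def K0_def K1_def base_def)

lemma mid_head: "a \<in> opaths (Suc k) \<Longrightarrow> 0 < k \<Longrightarrow> mid k a = head_mid k (tl a)"
  using opaths_length[of a "Suc k"]
  by (auto simp: mid_def head_mid_def mid_edge_def mid_vertex_def nth_tl elim!: evenE oddE)

lemma mid_tail: "a \<in> opaths (Suc k) \<Longrightarrow> 0 < k \<Longrightarrow> mid k a = tail_mid k (butlast a)"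
  using opaths_length[of a "Suc k"]
  by (auto simp: mid_def tail_mid_def mid_edge_def mid_vertex_def nth_butlast elim!: evenE oddE)

text \<open>The arcs entering \<open>v\<close> and those leaving \<open>v\<close> sit over different
  translates of the base. Hence the values of a local function at heads and at tails do not
  interfere, which is the reason for \<open>ind_Dl\<close>.\<close>

lemma head_mid_neq_tail_mid:
  assumes v: "v \<in> opaths k" and k: "0 < k"
  shows "head_mid k v \<noteq> tail_mid k v"
proof (cases "even k")
  case True
  then obtain m where m: "k = 2 * m" "m > 0" using k by (auto elim!: evenE)
  then have "v ! (m - 1) \<noteq> v ! m" "v ! (m - 1) \<noteq> v ! Suc m"
    using opaths_distinct[OF v] opaths_length[OF v] by (auto simp: nth_eq_iff_index_eq)
  then show ?thesis using m by (auto simp: head_mid_def tail_mid_def)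
next
  case False
  then obtain m where m: "k = 2 * m + 1" by (auto elim!: oddE)
  then have "v ! m \<noteq> v ! Suc m"
    using opaths_distinct[OF v] opaths_length[OF v] by (auto simp: nth_eq_iff_index_eq)
  then show ?thesis using m by (auto simp: head_mid_def tail_mid_def)
qed

lemma verts_Sigma:
  assumes "v \<in> opaths k" "0 < k" "head_mid k v = base k \<or> tail_mid k v = base k"
  shows "v \<in> verts (Sigma_graph k)"
  using assms opaths_length[OF assms(1)]
  by (auto simp: Sigma_graph_def head_mid_def tail_mid_def base_def mid_vertex_def mid_edge_def elim!: evenE oddE
      split: if_splits)

lemma mid_pact: "a \<in> opaths (Suc k) \<Longrightarrow> mid k (pact g a) = vertex_act g ` mid k a"
  using opaths_length[of a "Suc k"] by (auto simp: mid_def mid_edge_def mid_vertex_def)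

lemma mid_tree: "a \<in> opaths (Suc k) \<Longrightarrow> mid k a \<subseteq> tree_verts"
  using opaths_nth_tree[of a "Suc k"] opaths_length[of a "Suc k"]
  by (auto simp: mid_def mid_edge_def mid_vertex_def)

lemma Sig_transitive:
  assumes a: "a \<in> opaths (Suc k)"
  obtains g where "g \<in> carrier PGL" "pact g a \<in> Sig k"
proof (cases "even k")
  case True
  then obtain m where m: "k = 2 * m" by (auto elim!: evenE)
  obtain g where g: "g \<in> carrier PGL" "vertex_act g (a ! m) = s0" "vertex_act g (a ! Suc m) = s1"
    using opaths_adjacent[OF a, of m] m transitive_edges by force
  have "mid k a = {a ! m, a ! Suc m}" using opaths_length[OF a] m by (auto simp: mid_def mid_edge_def)
  then have "mid k (pact g a) = base k" unfolding mid_pact[OF a] using g m by (simp add: base_def)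
  then show ?thesis using that[OF g(1)] g(1) a by (simp add: Sig_def)
next
  case False
  obtain g where g: "g \<in> carrier PGL" "vertex_act g (mid_vertex a) = s0"
    using transitive_verts mid_tree[OF a] False by (auto simp: mid_def)
  then have "mid k (pact g a) = base k" unfolding mid_pact[OF a] using False by (simp add: base_def mid_def)
  then show ?thesis using that[OF g(1)] g(1) a by (simp add: Sig_def)
qed

lemma Sig_stable: "g \<in> K_par k \<Longrightarrow> a \<in> Sig k \<Longrightarrow> pact g a \<in> Sig k"
  by (auto simp: Sig_def K_par_eq mid_pact)

text \<open>Together with \<open>Sig_transitive\<close> and \<open>Sig_stable\<close> this
  partitions the arcs into translates of \<open>Sig k\<close> indexed by the cosets of
  \<open>K_par k\<close>, the bundle structure behind the compact induction.\<close>

lemma Sig_stabilizer: "g \<in> carrier PGL \<Longrightarrow> a \<in> Sig k \<Longrightarrow> pact g a \<in> Sig k \<Longrightarrow> g \<in> K_par k"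
  by (auto simp: Sig_def K_par_eq mid_pact)

lemma finite_Sig: "finite (Sig k :: 'a::nonarch_local_field vpath set)"
proof -
  have "s0 \<in> set a" if "a \<in> Sig k" for a :: "'a vpath"
  proof -
    have "s0 \<in> mid k a" using that by (auto simp: Sig_def base_def)
    moreover have "length a = Suc (Suc k)" using that opaths_length[of a "Suc k"] by (simp add: Sig_def)
    then have "mid k a \<subseteq> set a" by (auto simp: mid_def mid_edge_def mid_vertex_def)
    ultimately show ?thesis by blast
  qed
  then have "Sig k \<subseteq> {a \<in> opaths (Suc k). s0 \<in> set (a :: 'a vpath)}" by (auto simp: Sig_def)
  then show ?thesis using finite_opaths_through_s0 finite_subset by blast
qed

section \<open>Function spaces and compact induction\<close>

lemma fin_supp_rep_simps [simp]:
  "carrier (fin_supp_rep S) = fin_supp S" "ring.zero (fin_supp_rep S) = (\<lambda>x. 0)"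
  "f \<oplus>\<^bsub>fin_supp_rep S\<^esub> h = (\<lambda>x. f x + h x)" "c \<odot>\<^bsub>fin_supp_rep S\<^esub> f = (\<lambda>x. c * f x)"
  "ract (fin_supp_rep S) g f = (\<lambda>x. if x \<in> S then f (pact (inv\<^bsub>PGL\<^esub> g) x) else 0)"
  by (simp_all add: fin_supp_rep_def)

lemma fin_supp_iff: "f \<in> fin_supp S \<longleftrightarrow> finite {x. f x \<noteq> 0} \<and> (\<forall>x. x \<notin> S \<longrightarrow> f x = 0)"
  by (auto simp: fin_supp_def)

lemma fin_supp_outside: "f \<in> fin_supp S \<Longrightarrow> x \<notin> S \<Longrightarrow> f x = 0"
  by (auto simp: fin_supp_def)

lemma fin_supp_zero [simp]: "(\<lambda>x. 0) \<in> fin_supp S"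
  by (simp add: fin_supp_def)

lemma fin_supp_add: "f \<in> fin_supp S \<Longrightarrow> h \<in> fin_supp S \<Longrightarrow> (\<lambda>x. f x + h x) \<in> fin_supp S"
proof -
  assume fh: "f \<in> fin_supp S" "h \<in> fin_supp S"
  have "finite {x. f x + h x \<noteq> 0}"
    by (rule finite_subset[of _ "{x. f x \<noteq> 0} \<union> {x. h x \<noteq> 0}"]) (use fh in \<open>auto simp: fin_supp_iff\<close>)
  then show ?thesis using fh by (auto simp: fin_supp_iff)
qed

lemma fin_supp_smult: "f \<in> fin_supp S \<Longrightarrow> (\<lambda>x. c * f x) \<in> fin_supp S"
  unfolding fin_supp_iff by (auto elim: rev_finite_subset)

lemma fin_supp_sum: "(\<And>i. i \<in> I \<Longrightarrow> f i \<in> fin_supp S) \<Longrightarrow> (\<lambda>x. \<Sum>i\<in>I. f i x) \<in> fin_supp S"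
  by (induction I rule: infinite_finite_induct) (auto intro: fin_supp_add)

lemma fin_supp_mono: "S \<subseteq> S' \<Longrightarrow> fin_supp S \<subseteq> fin_supp S'"
  by (auto simp: fin_supp_def)

lemma fin_supp_finite: "finite S \<Longrightarrow> f \<in> fin_supp S \<longleftrightarrow> (\<forall>x. x \<notin> S \<longrightarrow> f x = 0)"
  by (auto simp: fin_supp_def elim: rev_finite_subset)

definition stable :: "'a::nonarch_local_field pgl set \<Rightarrow> 'a vpath set \<Rightarrow> bool"
  where "stable K S \<longleftrightarrow> subgroup K PGL \<and> (\<forall>x\<in>S. set x \<subseteq> tree_verts) \<and> (\<forall>g\<in>K. \<forall>x\<in>S. pact g x \<in> S)"

lemma stable_opaths: "stable (carrier PGL) (opaths k)"
  by (auto simp: stable_def PGL.subgroup_self dest: opaths_tree)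

lemma stable_Sig: "stable (K_par k) (Sig k)"
  using opaths_tree[of _ "Suc k"] Sig_stable by (fastforce simp: stable_def subgroup_K_par Sig_def)

text \<open>The carrier \<open>C\<close> is left open because the boundary value argument uses,
  besides finitely supported functions, the space \<open>Efn\<close>, whose members may have
  infinite support.\<close>

lemma function_arep:
  assumes st: "stable K S" and C: "\<And>f x. f \<in> C \<Longrightarrow> x \<notin> S \<Longrightarrow> f x = 0"
    "(\<lambda>x. 0) \<in> C" "\<And>f h. f \<in> C \<Longrightarrow> h \<in> C \<Longrightarrow> (\<lambda>x. f x + h x) \<in> C" "\<And>c f. f \<in> C \<Longrightarrow> (\<lambda>x. c * f x) \<in> C"
    "\<And>g f. g \<in> K \<Longrightarrow> f \<in> C \<Longrightarrow> (\<lambda>x. if x \<in> S then f (pact (inv\<^bsub>PGL\<^esub> g) x) else 0) \<in> C"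
  shows "arep K ((fin_supp_rep S)\<lparr>carrier := C\<rparr>)"
proof -
  have K: "subgroup K PGL" and S: "\<And>x. x \<in> S \<Longrightarrow> set x \<subseteq> tree_verts" "\<And>g x. g \<in> K \<Longrightarrow> x \<in> S \<Longrightarrow> pact g x \<in> S"
    using st by (auto simp: stable_def)
  interpret K: subgroup K PGL by (rule K)
  let ?R = "(fin_supp_rep S)\<lparr>carrier := C\<rparr>"
  have abel: "abelian_group ?R"
  proof (rule abelian_groupI)
    fix f assume "f \<in> carrier ?R"
    then show "\<exists>h\<in>carrier ?R. h \<oplus>\<^bsub>?R\<^esub> f = \<zero>\<^bsub>?R\<^esub>"
      using C(4)[of f "-1"] by (intro bexI[of _ "\<lambda>x. (-1) * f x"]) simp_all
  qed (auto simp: C algebra_simps)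
  have "Module.module complex_ring ?R"
    by (rule modI[OF abel]) (auto simp: C algebra_simps)
  moreover have "pact (inv\<^bsub>PGL\<^esub> (g \<otimes>\<^bsub>PGL\<^esub> h)) x = pact (inv\<^bsub>PGL\<^esub> h) (pact (inv\<^bsub>PGL\<^esub> g) x)"
    if "g \<in> K" "h \<in> K" "x \<in> S" for g h x
    using that S(1)[of x] by (auto simp: PGL.inv_mult_group act_mult subset_iff)
  moreover have "pact (inv\<^bsub>PGL\<^esub> \<one>\<^bsub>PGL\<^esub>) x = x" if "x \<in> S" for x
    using S(1)[OF that] by (auto simp: subset_iff intro!: map_idI)
  ultimately show ?thesis
    by (intro arep.intro K)
      (auto simp: alg_rep_def fun_eq_iff C S(2) simp del: map_map)
qed

lemma fin_supp_arep:
  assumes st: "stable K S"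
  shows "arep K (fin_supp_rep S)"
proof -
  have "(\<lambda>x. if x \<in> S then f (pact (inv\<^bsub>PGL\<^esub> g) x) else 0) \<in> fin_supp S"
    if g: "g \<in> K" and f: "f \<in> fin_supp S" for f g
  proof -
    have gG: "g \<in> carrier PGL" using g st subgroup.mem_carrier by (auto simp: stable_def)
    have "{x. (if x \<in> S then f (pact (inv\<^bsub>PGL\<^esub> g) x) else 0) \<noteq> 0} \<subseteq> pact g ` {x. f x \<noteq> 0}"
    proof
      fix x assume "x \<in> {x. (if x \<in> S then f (pact (inv\<^bsub>PGL\<^esub> g) x) else 0) \<noteq> 0}"
      then have x: "x \<in> S" "f (pact (inv\<^bsub>PGL\<^esub> g) x) \<noteq> 0" by (auto split: if_splits)
      then have "set x \<subseteq> tree_verts" using st by (simp add: stable_def)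
      then have "x = pact g (pact (inv\<^bsub>PGL\<^esub> g) x)"
        using gG by (simp add: map_idI subset_iff)
      then show "x \<in> pact g ` {x. f x \<noteq> 0}" using x by blast
    qed
    then have "finite {x. (if x \<in> S then f (pact (inv\<^bsub>PGL\<^esub> g) x) else 0) \<noteq> 0}"
      by (rule finite_subset) (use f in \<open>simp add: fin_supp_iff\<close>)
    then show ?thesis by (simp add: fin_supp_iff)
  qed
  then have "arep K ((fin_supp_rep S)\<lparr>carrier := fin_supp S\<rparr>)"
    by (intro function_arep[OF st]) (auto simp: fin_supp_outside fin_supp_add fin_supp_smult)
  moreover have "(fin_supp_rep S)\<lparr>carrier := fin_supp S\<rparr> = fin_supp_rep S" by (simp add: fin_supp_rep_def)
  ultimately show ?thesis by simp
qed

abbreviation Vr :: "nat \<Rightarrow> ('a::nonarch_local_field pgl, 'a vpath \<Rightarrow> complex) rep"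
  where "Vr k \<equiv> fin_supp_rep (opaths k)"

abbreviation Sr :: "nat \<Rightarrow> ('a::nonarch_local_field pgl, 'a vpath \<Rightarrow> complex) rep"
  where "Sr k \<equiv> fin_supp_rep (Sig k)"

interpretation Vr: arep "carrier PGL" "Vr k" for k
  by (rule fin_supp_arep[OF stable_opaths])

interpretation Sr: arep "K_par k" "Sr k" for k
  by (rule fin_supp_arep[OF stable_Sig])

section \<open>Translation, restriction to the base fibre, and induction\<close>

definition res :: "nat \<Rightarrow> ('a::nonarch_local_field vpath \<Rightarrow> complex) \<Rightarrow> 'a vpath \<Rightarrow> complex"
  where "res k f = (\<lambda>x. if x \<in> Sig k then f x else 0)"

abbreviation tr :: "nat \<Rightarrow> 'a::nonarch_local_field pgl \<Rightarrow> ('a vpath \<Rightarrow> complex) \<Rightarrow> 'a vpath \<Rightarrow> complex"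
  where "tr k g f \<equiv> ract (Vr (Suc k)) g f"

text \<open>The compact induction of \<open>T\<close>, realized inside the functions on the arcs.\<close>

definition ind :: "nat \<Rightarrow> ('a::nonarch_local_field vpath \<Rightarrow> complex) set \<Rightarrow> ('a vpath \<Rightarrow> complex) set"
  where "ind k T = {f \<in> fin_supp (opaths (Suc k)). \<forall>g\<in>carrier PGL. res k (tr k g f) \<in> T}"

lemma Sig_opaths: "a \<in> Sig k \<Longrightarrow> a \<in> opaths (Suc k)"
  by (simp add: Sig_def)

lemma res_add: "res k (\<lambda>x. f x + h x) = (\<lambda>x. res k f x + res k h x)"
  and res_smult: "res k (\<lambda>x. c * f x) = (\<lambda>x. c * res k f x)"
  and res_zero: "res k (\<lambda>x. 0) = (\<lambda>x. 0)"
  by (auto simp: res_def)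

lemma tr_add: "tr k g (\<lambda>x. f x + h x) = (\<lambda>x. tr k g f x + tr k g h x)"
  and tr_smult: "tr k g (\<lambda>x. c * f x) = (\<lambda>x. c * tr k g f x)"
  and tr_zero: "tr k g (\<lambda>x. 0) = (\<lambda>x. 0)"
  by auto

lemma tr_mult: "f \<in> fin_supp (opaths (Suc k)) \<Longrightarrow> g \<in> carrier PGL \<Longrightarrow> h \<in> carrier PGL \<Longrightarrow>
    tr k (g \<otimes>\<^bsub>PGL\<^esub> h) f = tr k g (tr k h f)"
  using Vr.act_mult[of g h f "Suc k"] by simp

lemma tr_closed: "f \<in> fin_supp (opaths (Suc k)) \<Longrightarrow> g \<in> carrier PGL \<Longrightarrow> tr k g f \<in> fin_supp (opaths (Suc k))"
  using Vr.act_closed[of g f "Suc k"] by simp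

lemma tr_apply: "a \<in> opaths (Suc k) \<Longrightarrow> tr k g f a = f (pact (inv\<^bsub>PGL\<^esub> g) a)"
  by simp

lemma tr_apply': "a \<in> opaths (Suc k) \<Longrightarrow> g \<in> carrier PGL \<Longrightarrow> tr k g f (pact g a) = f a"
  by (simp add: pact_inv del: map_map)

declare fin_supp_rep_simps(5) [simp del]

lemma K_par_carrier: "h \<in> K_par k \<Longrightarrow> h \<in> carrier PGL"
  using subgroup.mem_carrier[OF subgroup_K_par] .

lemma res_tr_K:
  assumes h: "h \<in> K_par k"
  shows "res k (tr k h f) = ract (Sr k) h (res k f)"
proof
  fix a
  have "inv\<^bsub>PGL\<^esub> h \<in> K_par k" using h subgroup.m_inv_closed[OF subgroup_K_par] by blast
  then show "res k (tr k h f) a = ract (Sr k) h (res k f) a"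
    using Sig_stable[of "inv\<^bsub>PGL\<^esub> h" k a] Sig_opaths[of a k] by (simp add: res_def fin_supp_rep_simps(5))
qed

lemma subrep_Sr_subset: "subrep (K_par k) (Sr k) T \<Longrightarrow> T \<subseteq> fin_supp (Sig k)"
  using Sr.subrepD(1) by fastforce

lemma ind_subrep:
  assumes T: "subrep (K_par k) (Sr k) T"
  shows "subrep (carrier PGL) (Vr (Suc k)) (ind k T)"
proof (rule Vr.subrepI)
  note T' = Sr.subrepD[OF T, simplified]
  show "ind k T \<subseteq> carrier (Vr (Suc k))" by (auto simp: ind_def)
  show "\<zero>\<^bsub>Vr (Suc k)\<^esub> \<in> ind k T" using T' by (simp add: ind_def tr_zero res_zero)
  show "f \<oplus>\<^bsub>Vr (Suc k)\<^esub> h \<in> ind k T" if "f \<in> ind k T" "h \<in> ind k T" for f h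
    using that T' by (simp add: ind_def tr_add res_add fin_supp_add)
  show "c \<odot>\<^bsub>Vr (Suc k)\<^esub> f \<in> ind k T" if "f \<in> ind k T" for c f
    using that T' by (simp add: ind_def tr_smult res_smult fin_supp_smult)
  show "tr k g f \<in> ind k T" if "g \<in> carrier PGL" "f \<in> ind k T" for g f
    using that tr_mult[of f k _ g] by (auto simp: ind_def tr_closed) (metis PGL.m_closed)
qed

text \<open>A function on the base fibre is moved by elements of \<open>K_par k\<close> within
  \<open>T\<close>, and by any other element entirely off the fibre, where its restriction is
  0.\<close>

lemma ind_contains:
  assumes T: "subrep (K_par k) (Sr k) T"
  shows "T \<subseteq> ind k T"
proof
  fix f assume f: "f \<in> T"
  then have fS: "f \<in> fin_supp (Sig k)" using subrep_Sr_subset[OF T] by blast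
  then have fV: "f \<in> fin_supp (opaths (Suc k))" using fin_supp_mono[of "Sig k" "opaths (Suc k)"] Sig_opaths by blast
  have "res k (tr k g f) \<in> T" if g: "g \<in> carrier PGL" for g
  proof (cases "g \<in> K_par k")
    case True
    have "res k f = f" using fS by (auto simp: res_def fin_supp_iff fun_eq_iff)
    then show ?thesis using Sr.subrepD(5)[OF T True f] by (simp add: res_tr_K[OF True])
  next
    case False
    have "res k (tr k g f) = (\<lambda>x. 0)"
    proof
      fix a
      have "f (pact (inv\<^bsub>PGL\<^esub> g) a) = 0" if a: "a \<in> Sig k"
      proof (rule fin_supp_outside[OF fS] , rule notI)
        assume "pact (inv\<^bsub>PGL\<^esub> g) a \<in> Sig k"
        then have "inv\<^bsub>PGL\<^esub> g \<in> K_par k" using Sig_stabilizer[of "inv\<^bsub>PGL\<^esub> g" a k] a g by simp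
        then show False using False subgroup.m_inv_closed[OF subgroup_K_par, of "inv\<^bsub>PGL\<^esub> g" k] g by simp
      qed
      then show "res k (tr k g f) a = 0" using Sig_opaths[of a k] by (simp add: res_def tr_apply del: map_map)
    qed
    then show ?thesis using Sr.subrepD(2)[OF T] by simp
  qed
  then show "f \<in> ind k T" using fV by (simp add: ind_def)
qed

text \<open>Thus \<open>ind k T\<close> is the smallest \<open>G\<close>-stable space containing
  \<open>T\<close>. A function of finite support is taken apart one fibre at a time: its part over a
  single fibre is a translate of an element of \<open>T\<close>, and removing it shrinks the
  support.\<close>

lemma ind_least:
  assumes T: "subrep (K_par k) (Sr k) T" and Q: "subrep (carrier PGL) (Vr (Suc k)) Q" and "T \<subseteq> Q"
  shows "ind k T \<subseteq> Q"
proof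
  fix f assume "f \<in> ind k T"
  then show "f \<in> Q"
  proof (induction "card {x. f x \<noteq> 0}" arbitrary: f rule: less_induct)
    case less
    note I = Vr.subrepD[OF ind_subrep[OF T], simplified]
    note Q' = Vr.subrepD[OF Q, simplified]
    have fV: "f \<in> fin_supp (opaths (Suc k))" using less.prems by (simp add: ind_def)
    show ?case
    proof (cases "f = (\<lambda>x. 0)")
      case False
      then obtain a where a: "f a \<noteq> 0" by auto
      then have ao: "a \<in> opaths (Suc k)" using fin_supp_outside[OF fV] by blast
      then obtain g where g: "g \<in> carrier PGL" "pact g a \<in> Sig k" by (rule Sig_transitive)
      define t where "t = res k (tr k g f)"
      have tT: "t \<in> T" using less.prems g(1) by (simp add: ind_def t_def)
      define t' where "t' = tr k (inv\<^bsub>PGL\<^esub> g) t"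
      \<comment> \<open>So \<open>t'\<close> is the function \<open>f\<close> cut down to the
        translate of the base fibre that contains \<open>a\<close>.\<close>
      have t'a: "t' x = (if x \<in> opaths (Suc k) \<and> pact g x \<in> Sig k then f x else 0)" for x
        using g(1) by (simp add: t'_def t_def res_def tr_apply tr_apply' fin_supp_rep_simps(5) pact_inv del: map_map)
      have t': "t' \<in> ind k T" "t' \<in> Q"
        using I(5)[of "inv\<^bsub>PGL\<^esub> g" t] Q'(5)[of "inv\<^bsub>PGL\<^esub> g" t] g(1) tT ind_contains[OF T] \<open>T \<subseteq> Q\<close>
        by (auto simp: t'_def)
      define f' where "f' = (\<lambda>x. f x + (-1) * t' x)"
      have f'I: "f' \<in> ind k T" unfolding f'_def by (intro I(3,4) less.prems t')
      have "{x. f' x \<noteq> 0} \<subset> {x. f x \<noteq> 0}"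
        using a ao g(2) by (auto simp: f'_def t'a)
      then have "card {x. f' x \<noteq> 0} < card {x. f x \<noteq> 0}"
        using fV by (intro psubset_card_mono) (auto simp: fin_supp_iff)
      then have "f' \<in> Q" using less.hyps f'I by blast
      then have "(\<lambda>x. f' x + t' x) \<in> Q" using Q'(3) t' by blast
      then show ?thesis by (simp add: f'_def)
    qed (use Q' in simp)
  qed
qed

text \<open>The cosets of \<open>K\<close> are open, so a compact set meets only finitely many of
  them. Compact support modulo \<open>K\<close> becomes finiteness of the support in the
  tree.\<close>

lemma compact_mod_open:
  assumes K: "subgroup K PGL" "openin PGL_top K" and C: "compactin PGL_top C"
  obtains C0 where "finite C0" "C0 \<subseteq> carrier PGL" "K <#>\<^bsub>PGL\<^esub> C \<subseteq> K <#>\<^bsub>PGL\<^esub> C0"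
proof -
  interpret K: subgroup K PGL by (rule K)
  have CG: "C \<subseteq> carrier PGL" using C compactin_subset_topspace topspace_PGL by blast
  define U where "U x = {h \<in> carrier PGL. h \<otimes>\<^bsub>PGL\<^esub> inv\<^bsub>PGL\<^esub> x \<in> K}" for x
  have U: "openin PGL_top (U x)" "x \<in> U x" if "x \<in> C" for x
    using that CG openin_translate(2)[OF K(2), of "inv\<^bsub>PGL\<^esub> x"] by (auto simp: U_def subset_iff)
  then have "C \<subseteq> \<Union>(U ` C)" by blast
  with C U(1) obtain F where F: "finite F" "F \<subseteq> U ` C" "C \<subseteq> \<Union>F"
    unfolding compactin_def by (metis (no_types, lifting) imageE)
  then obtain C0 where C0: "C0 \<subseteq> C" "finite C0" "F = U ` C0" by (meson finite_subset_image)
  have "K <#>\<^bsub>PGL\<^esub> C \<subseteq> K <#>\<^bsub>PGL\<^esub> C0"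
  proof
    fix y assume "y \<in> K <#>\<^bsub>PGL\<^esub> C"
    then obtain h c where hc: "h \<in> K" "c \<in> C" "y = h \<otimes>\<^bsub>PGL\<^esub> c" by (auto simp: set_mult_def)
    then obtain x where x: "x \<in> C0" "c \<otimes>\<^bsub>PGL\<^esub> inv\<^bsub>PGL\<^esub> x \<in> K" using F C0 by (auto simp: U_def)
    have "y = (h \<otimes>\<^bsub>PGL\<^esub> (c \<otimes>\<^bsub>PGL\<^esub> inv\<^bsub>PGL\<^esub> x)) \<otimes>\<^bsub>PGL\<^esub> x"
      using hc x C0(1) CG by (auto simp: PGL.m_assoc subset_iff)
    then show "y \<in> K <#>\<^bsub>PGL\<^esub> C0" using hc x by (auto simp: set_mult_def)
  qed
  then show ?thesis using that C0 CG by blast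
qed

lemma c_ind_simps:
  "carrier (c_ind H M) = {f \<in> carrier PGL \<rightarrow>\<^sub>E carrier M.
       (\<forall>h\<in>H. \<forall>x\<in>carrier PGL. f (h \<otimes>\<^bsub>PGL\<^esub> x) = ract M h (f x)) \<and>
       (\<exists>U. subgroup U PGL \<and> openin PGL_top U \<and>
         (\<forall>x\<in>carrier PGL. \<forall>u\<in>U. f (x \<otimes>\<^bsub>PGL\<^esub> u) = f x)) \<and>
       (\<exists>C. compactin PGL_top C \<and> {x \<in> carrier PGL. f x \<noteq> \<zero>\<^bsub>M\<^esub>} \<subseteq> H <#>\<^bsub>PGL\<^esub> C)}"
  "f \<oplus>\<^bsub>c_ind H M\<^esub> h = (\<lambda>x\<in>carrier PGL. f x \<oplus>\<^bsub>M\<^esub> h x)"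
  "c \<odot>\<^bsub>c_ind H M\<^esub> f = (\<lambda>x\<in>carrier PGL. c \<odot>\<^bsub>M\<^esub> f x)"
  "ract (c_ind H M) g f = (\<lambda>x\<in>carrier PGL. f (x \<otimes>\<^bsub>PGL\<^esub> g))"
  by (auto simp: c_ind_def smooth_ind_def)

lemma open_pointwise_stabilizer:
  assumes "finite Y" "Y \<subseteq> tree_verts"
  shows "subgroup {g \<in> carrier PGL. \<forall>y\<in>Y. vertex_act g y = y} PGL"
    and "openin PGL_top {g \<in> carrier PGL. \<forall>y\<in>Y. vertex_act g y = y}"
proof -
  show sub: "subgroup {g \<in> carrier PGL. \<forall>y\<in>Y. vertex_act g y = y} PGL"
  proof (rule PGL.subgroupI)
    fix g h assume g: "g \<in> {g \<in> carrier PGL. \<forall>y\<in>Y. vertex_act g y = y}" and h: "h \<in> {g \<in> carrier PGL. \<forall>y\<in>Y. vertex_act g y = y}"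
    show "g \<otimes>\<^bsub>PGL\<^esub> h \<in> {g \<in> carrier PGL. \<forall>y\<in>Y. vertex_act g y = y}" using g h assms by (auto simp: act_mult subset_iff)
    show "inv\<^bsub>PGL\<^esub> g \<in> {g \<in> carrier PGL. \<forall>y\<in>Y. vertex_act g y = y}"
    proof -
      have "vertex_act (inv\<^bsub>PGL\<^esub> g) y = y" if "y \<in> Y" for y
      proof -
        have "vertex_act g y = y" "g \<in> carrier PGL" "y \<in> tree_verts" using g assms that by auto
        then show ?thesis using act_inv(2)[of g y] by simp
      qed
      then show ?thesis using g by auto
    qed
  qed (use assms in \<open>auto simp: subset_iff intro: exI[of _ "\<one>\<^bsub>PGL\<^esub>"]\<close>)
  have eq: "{g \<in> carrier PGL. \<forall>y\<in>insert z Y. vertex_act g y = y} =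
      {g \<in> carrier PGL. vertex_act g z = z} \<inter> {g \<in> carrier PGL. \<forall>y\<in>Y. vertex_act g y = y}" for z Y by auto
  show "openin PGL_top {g \<in> carrier PGL. \<forall>y\<in>Y. vertex_act g y = y}"
    using assms
  proof (induction Y rule: finite_induct)
    case empty
    then show ?case using openin_carrier by simp
  next
    case (insert z Y)
    then show ?case unfolding eq by (intro openin_Int openin_stab) auto
  qed
qed

text \<open>A function \<open>f\<close> on the arcs corresponds to the map sending \<open>x\<close>
  to the restriction of its \<open>x\<close>-translate to the base fibre. Equivariance under
  \<open>K_par k\<close> on the left holds because restriction commutes with it, and translating
  \<open>f\<close> by \<open>g\<close> becomes right translation. Finiteness of the support yields
  both smoothness and compactness of the support modulo \<open>K_par k\<close>.\<close>

theorem ind_iso_c_ind: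
  assumes T: "subrep (K_par k) (Sr k) T" and L: "alg_rep (K_par k) L"
    and iso: "rep_iso (K_par k) ((Sr k)\<lparr>carrier := T\<rparr>) L"
  shows "rep_iso (carrier PGL) ((Vr (Suc k))\<lparr>carrier := ind k T\<rparr>) (c_ind (K_par k) L)"
proof -
  let ?K = "K_par k :: 'a pgl set"
  interpret K: subgroup ?K PGL by (rule subgroup_K_par)
  interpret L: arep ?K L by (intro arep.intro L subgroup_K_par)
  interpret T: arep ?K "(Sr k)\<lparr>carrier := T\<rparr>" by (rule Sr.arep_subrep[OF T])
  note T' = Sr.subrepD[OF T, simplified]
  obtain \<theta> where b: "bij_betw \<theta> T (carrier L)" and h: "rep_hom ?K \<theta> ((Sr k)\<lparr>carrier := T\<rparr>) L"
    using iso by (auto simp: rep_iso_iff)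
  have \<theta>: "\<And>t. t \<in> T \<Longrightarrow> \<theta> t \<in> carrier L" "\<And>t u. t \<in> T \<Longrightarrow> u \<in> T \<Longrightarrow> \<theta> (\<lambda>x. t x + u x) = \<theta> t \<oplus>\<^bsub>L\<^esub> \<theta> u"
    "\<And>t c. t \<in> T \<Longrightarrow> \<theta> (\<lambda>x. c * t x) = c \<odot>\<^bsub>L\<^esub> \<theta> t"
    "\<And>t g. t \<in> T \<Longrightarrow> g \<in> ?K \<Longrightarrow> \<theta> (ract (Sr k) g t) = ract L g (\<theta> t)"
    using h by (auto simp: rep_hom_def)
  have \<theta>0: "\<theta> (\<lambda>x. 0) = \<zero>\<^bsub>L\<^esub>" using T.hom_zero[OF h L.arep_axioms] by simp
  have \<theta>inj: "\<theta> t = \<theta> u \<longleftrightarrow> t = u" if "t \<in> T" "u \<in> T" for t u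
    using b that by (auto simp: bij_betw_def inj_on_def)
  define \<eta> where "\<eta> = inv_into T \<theta>"
  have \<eta>: "\<eta> v \<in> T" "\<theta> (\<eta> v) = v" if "v \<in> carrier L" for v
    using b that unfolding \<eta>_def by (auto simp: bij_betw_def inv_into_into f_inv_into_f)
  have \<eta>K: "\<eta> (ract L g v) = ract (Sr k) g (\<eta> v)" if "v \<in> carrier L" "g \<in> ?K" for v g
  proof -
    have "\<theta> (\<eta> (ract L g v)) = \<theta> (ract (Sr k) g (\<eta> v))" using that \<eta> by (simp add: \<theta>)
    moreover have "ract (Sr k) g (\<eta> v) \<in> T" using that \<eta> T'(5) by blast
    ultimately show ?thesis using \<theta>inj \<eta>(1) that L.act_closed by blast
  qed
  define F where "F f = (\<lambda>x\<in>carrier PGL. \<theta> (res k (tr k x f)))" for f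
  have rT: "res k (tr k x f) \<in> T" if "f \<in> ind k T" "x \<in> carrier PGL" for f x using that by (simp add: ind_def)
  have iV: "f \<in> fin_supp (opaths (Suc k))" if "f \<in> ind k T" for f using that by (simp add: ind_def)
  define ga where "ga a = (SOME g. g \<in> carrier PGL \<and> pact g a \<in> Sig k)" for a :: "'a vpath"
  have ga: "ga a \<in> carrier PGL" "pact (ga a) a \<in> Sig k" if "a \<in> opaths (Suc k)" for a
  proof -
    have "\<exists>g. g \<in> carrier PGL \<and> pact g a \<in> Sig k" by (rule Sig_transitive[OF that]) (intro exI conjI)
    from someI_ex[OF this] show "ga a \<in> carrier PGL" "pact (ga a) a \<in> Sig k" unfolding ga_def by blast+
  qed
  \<comment> \<open>Two elements moving the same arc into the base fibre differ by an element of
    \<open>K_par k\<close> on the left. This is all the freedom in the choice of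
    \<open>ga\<close>.\<close>
  have gaK: "x \<otimes>\<^bsub>PGL\<^esub> inv\<^bsub>PGL\<^esub> y \<in> ?K"
    if "a \<in> opaths (Suc k)" "x \<in> carrier PGL" "y \<in> carrier PGL" "pact x a \<in> Sig k" "pact y a \<in> Sig k" for a x y
  proof (rule Sig_stabilizer[of _ "pact y a"])
    have "pact (x \<otimes>\<^bsub>PGL\<^esub> inv\<^bsub>PGL\<^esub> y) (pact y a) = pact x a"
      using that pact_mult[OF pact_opaths[OF that(3,1)], of x "inv\<^bsub>PGL\<^esub> y"] pact_inv(2)[OF that(1,3)]
      by (simp del: map_map)
    then show "pact (x \<otimes>\<^bsub>PGL\<^esub> inv\<^bsub>PGL\<^esub> y) (pact y a) \<in> Sig k" using that by (simp del: map_map)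
  qed (use that in auto)
  have inj: "inj_on F (ind k T)"
  proof (rule inj_onI)
    fix f f' assume f: "f \<in> ind k T" "f' \<in> ind k T" "F f = F f'"
    have "f a = f' a" if a: "a \<in> opaths (Suc k)" for a
    proof -
      have "\<theta> (res k (tr k (ga a) f)) = \<theta> (res k (tr k (ga a) f'))"
        using fun_cong[OF f(3), of "ga a"] ga[OF a] by (simp add: F_def)
      then have "res k (tr k (ga a) f) (pact (ga a) a) = res k (tr k (ga a) f') (pact (ga a) a)"
        using \<theta>inj rT f ga[OF a] by simp
      then show ?thesis using ga[OF a] a by (simp add: res_def tr_apply')
    qed
    then show "f = f'" using fin_supp_outside[OF iV[OF f(1)]] fin_supp_outside[OF iV[OF f(2)]] by (metis ext)
  qed
  have into: "F f \<in> carrier (c_ind ?K L)" if f: "f \<in> ind k T" for f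
  proof -
    have eq: "F f (g \<otimes>\<^bsub>PGL\<^esub> x) = ract L g (F f x)" if "g \<in> ?K" "x \<in> carrier PGL" for g x
      using that f by (simp add: F_def tr_mult iV res_tr_K \<theta> rT)
    \<comment> \<open>An element fixing every vertex on the finitely many arcs of the support fixes
      \<open>f\<close>, and such elements form an open subgroup.\<close>
    define Y where "Y = (\<Union>a\<in>{a. f a \<noteq> 0}. set a)"
    have Y: "finite Y" "Y \<subseteq> tree_verts"
      using iV[OF f] opaths_tree by (auto simp: Y_def fin_supp_iff)
    have fixed: "tr k u f = f" if u: "u \<in> {g \<in> carrier PGL. \<forall>y\<in>Y. vertex_act g y = y}" for u
    proof
      have ui: "inv\<^bsub>PGL\<^esub> u \<in> {g \<in> carrier PGL. \<forall>y\<in>Y. vertex_act g y = y}"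
        using subgroup.m_inv_closed[OF open_pointwise_stabilizer(1)[OF Y]] u by blast
      have fx: "pact v a = a" if "f a \<noteq> 0" "v \<in> {g \<in> carrier PGL. \<forall>y\<in>Y. vertex_act g y = y}" for v a
        using that by (auto simp: Y_def intro!: map_idI)
      fix a
      show "tr k u f a = f a"
      proof (cases "a \<in> opaths (Suc k)")
        case True
        show ?thesis
        proof (cases "f (pact (inv\<^bsub>PGL\<^esub> u) a) = 0 \<and> f a = 0")
          case False
          moreover have "f a \<noteq> 0 \<Longrightarrow> pact (inv\<^bsub>PGL\<^esub> u) a = a" by (rule fx[OF _ ui])
          moreover have "f (pact (inv\<^bsub>PGL\<^esub> u) a) \<noteq> 0 \<Longrightarrow> a = pact (inv\<^bsub>PGL\<^esub> u) a"
            using fx[OF _ u, of "pact (inv\<^bsub>PGL\<^esub> u) a"] pact_inv(1)[OF True, of u] u by (simp del: map_map)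
          ultimately have "pact (inv\<^bsub>PGL\<^esub> u) a = a" by metis
          then show ?thesis using True by (simp only: tr_apply)
        qed (use True in \<open>simp add: tr_apply del: map_map\<close>)
      qed (use fin_supp_outside[OF iV[OF f]] in \<open>simp add: fin_supp_rep_simps(5)\<close>)
    qed
    have sm: "\<exists>U. subgroup U PGL \<and> openin PGL_top U \<and> (\<forall>x\<in>carrier PGL. \<forall>u\<in>U. F f (x \<otimes>\<^bsub>PGL\<^esub> u) = F f x)"
      using open_pointwise_stabilizer[OF Y] fixed
      by (intro exI[of _ "{g \<in> carrier PGL. \<forall>y\<in>Y. vertex_act g y = y}"]) (simp add: F_def tr_mult iV[OF f])
    have "{x \<in> carrier PGL. F f x \<noteq> \<zero>\<^bsub>L\<^esub>} \<subseteq> ?K <#>\<^bsub>PGL\<^esub> (ga ` {a. f a \<noteq> 0})"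
    proof safe
      fix x assume x: "x \<in> carrier PGL" "F f x \<noteq> \<zero>\<^bsub>L\<^esub>"
      then have "res k (tr k x f) \<noteq> (\<lambda>x. 0)" using \<theta>0 by (auto simp: F_def)
      then obtain c where c: "c \<in> Sig k" "tr k x f c \<noteq> 0"
        by (auto simp: res_def fun_eq_iff split: if_splits)
      then have c: "c \<in> Sig k" "f (pact (inv\<^bsub>PGL\<^esub> x) c) \<noteq> 0"
        unfolding tr_apply[OF Sig_opaths[OF c(1)]] by blast+
      define a where "a = pact (inv\<^bsub>PGL\<^esub> x) c"
      have a: "a \<in> opaths (Suc k)" "pact x a = c" "f a \<noteq> 0"
        using c x Sig_opaths[OF c(1)] by (auto simp: a_def pact_inv simp del: map_map)
      then have "x \<otimes>\<^bsub>PGL\<^esub> inv\<^bsub>PGL\<^esub> (ga a) \<in> ?K" using ga[OF a(1)] x c by (intro gaK) auto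
      moreover have "x = (x \<otimes>\<^bsub>PGL\<^esub> inv\<^bsub>PGL\<^esub> (ga a)) \<otimes>\<^bsub>PGL\<^esub> ga a" using x ga[OF a(1)] by (simp add: PGL.m_assoc)
      ultimately show "x \<in> ?K <#>\<^bsub>PGL\<^esub> (ga ` {a. f a \<noteq> 0})" using a(3) by (auto simp: set_mult_def)
    qed
    moreover have "ga ` {a. f a \<noteq> 0} \<subseteq> carrier PGL" using ga fin_supp_outside[OF iV[OF f]] by blast
    then have "compactin PGL_top (ga ` {a. f a \<noteq> 0})"
      using iV[OF f] by (intro finite_imp_compactin) (auto simp: fin_supp_iff topspace_PGL)
    moreover have "F f \<in> carrier PGL \<rightarrow>\<^sub>E carrier L" using rT[OF f] \<theta>(1) by (auto simp: F_def)
    ultimately show ?thesis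
      unfolding c_ind_simps using eq sm by blast
  qed
  have surj: "f \<in> F ` ind k T" if f: "f \<in> carrier (c_ind ?K L)" for f
  proof -
    have fL: "f x \<in> carrier L" if "x \<in> carrier PGL" for x using f that by (auto simp: c_ind_simps)
    have fK: "f (g \<otimes>\<^bsub>PGL\<^esub> x) = ract L g (f x)" if "g \<in> ?K" "x \<in> carrier PGL" for g x
      using f that by (auto simp: c_ind_simps)
    obtain C where C: "compactin PGL_top C" "{x \<in> carrier PGL. f x \<noteq> \<zero>\<^bsub>L\<^esub>} \<subseteq> ?K <#>\<^bsub>PGL\<^esub> C"
      using f by (auto simp: c_ind_simps)
    obtain C0 where C0: "finite C0" "C0 \<subseteq> carrier PGL" "?K <#>\<^bsub>PGL\<^esub> C \<subseteq> ?K <#>\<^bsub>PGL\<^esub> C0"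
      using compact_mod_open[OF subgroup_K_par openin_K_par C(1)] by metis
    \<comment> \<open>The inverse construction: to evaluate at \<open>a\<close>, move
      \<open>a\<close> into the base fibre and use the vector that \<open>f\<close> assigns to the
      moving element. By equivariance every choice of that element gives the same value, which is
      the next claim.\<close>
    define \<phi> where "\<phi> a = (if a \<in> opaths (Suc k) then \<eta> (f (ga a)) (pact (ga a) a) else 0)" for a
    have \<phi>: "\<phi> a = \<eta> (f x) (pact x a)" if "a \<in> opaths (Suc k)" "x \<in> carrier PGL" "pact x a \<in> Sig k" for a x
    proof -
      define g where "g = x \<otimes>\<^bsub>PGL\<^esub> inv\<^bsub>PGL\<^esub> (ga a)"
      have g: "g \<in> ?K" "x = g \<otimes>\<^bsub>PGL\<^esub> ga a"
        using gaK that ga[OF that(1)] by (auto simp: g_def PGL.m_assoc)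
      have "\<eta> (f x) = ract (Sr k) g (\<eta> (f (ga a)))"
        using g fK ga[OF that(1)] fL by (simp add: \<eta>K)
      moreover have "pact x a = pact g (pact (ga a) a)"
        using g ga[OF that(1)] that K_par_carrier by (simp add: pact_mult[of _ "Suc k"] del: map_map)
      ultimately show ?thesis
        using that g(1) K_par_carrier[OF g(1)] pact_inv(2)[OF Sig_opaths[OF ga(2)[OF that(1)]], of g]
        by (simp add: \<phi>_def fin_supp_rep_simps(5) del: map_map)
    qed
    have "\<phi> \<in> fin_supp (opaths (Suc k))"
    proof -
      have "{a. \<phi> a \<noteq> 0} \<subseteq> (\<Union>c\<in>C0. pact (inv\<^bsub>PGL\<^esub> c) ` Sig k)"
      proof
        fix a assume "a \<in> {a. \<phi> a \<noteq> 0}"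
        then have a: "a \<in> opaths (Suc k)" "\<eta> (f (ga a)) (pact (ga a) a) \<noteq> 0" by (auto simp: \<phi>_def split: if_splits)
        have "f (ga a) \<noteq> \<zero>\<^bsub>L\<^esub>"
        proof
          assume "f (ga a) = \<zero>\<^bsub>L\<^esub>"
          then have "\<eta> (f (ga a)) = (\<lambda>x. 0)" using \<theta>0 \<theta>inj[of "\<eta> (f (ga a))" "\<lambda>x. 0"] \<eta> fL ga[OF a(1)] T'(2) by simp
          then show False using a(2) by simp
        qed
        then have "ga a \<in> ?K <#>\<^bsub>PGL\<^esub> C0" using C(2) C0(3) ga(1)[OF a(1)] by blast
        then obtain g c where c: "g \<in> ?K" "c \<in> C0" "ga a = g \<otimes>\<^bsub>PGL\<^esub> c"
          by (auto simp: set_mult_def)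
        have cc: "c \<in> carrier PGL" using c C0 by blast
        have gc: "g \<in> carrier PGL" "inv\<^bsub>PGL\<^esub> g \<in> ?K" using c(1) K_par_carrier by auto
        have "c = inv\<^bsub>PGL\<^esub> g \<otimes>\<^bsub>PGL\<^esub> (g \<otimes>\<^bsub>PGL\<^esub> c)"
          using gc cc by (simp flip: PGL.m_assoc)
        then have "pact c a = pact (inv\<^bsub>PGL\<^esub> g \<otimes>\<^bsub>PGL\<^esub> ga a) a" by (simp only: c(3))
        also have "\<dots> = pact (inv\<^bsub>PGL\<^esub> g) (pact (ga a) a)"
          by (rule pact_mult[OF a(1) _ ga(1)[OF a(1)]]) (use gc in simp)
        also have "\<dots> \<in> Sig k" by (rule Sig_stable[OF gc(2) ga(2)[OF a(1)]])
        finally have "pact c a \<in> Sig k" .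
        then show "a \<in> (\<Union>c\<in>C0. pact (inv\<^bsub>PGL\<^esub> c) ` Sig k)"
          by (intro UN_I[OF c(2)] image_eqI[of _ _ "pact c a"]) (rule pact_inv(2)[OF a(1) cc, symmetric])
      qed
      then have "finite {a. \<phi> a \<noteq> 0}"
        by (rule finite_subset) (use C0(1) finite_Sig in auto)
      then show ?thesis by (auto simp: fin_supp_iff \<phi>_def)
    qed
    moreover have rs: "res k (tr k x \<phi>) = \<eta> (f x)" if x: "x \<in> carrier PGL" for x
    proof
      fix a
      show "res k (tr k x \<phi>) a = \<eta> (f x) a"
      proof (cases "a \<in> Sig k")
        case True
        then show ?thesis
          using \<phi>[of "pact (inv\<^bsub>PGL\<^esub> x) a" x] x pact_inv(1)[OF Sig_opaths[OF True] x] Sig_opaths[OF True]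
          by (simp add: res_def tr_apply del: map_map)
      next
        case False
        have "\<eta> (f x) \<in> fin_supp (Sig k)" using \<eta>(1)[OF fL[OF x]] subrep_Sr_subset[OF T] by blast
        then show ?thesis using False by (simp add: res_def fin_supp_outside)
      qed
    qed
    ultimately have "\<phi> \<in> ind k T" using \<eta>(1)[OF fL] by (simp add: ind_def)
    moreover have "F \<phi> = f"
    proof (rule extensionalityI[of _ "carrier PGL"])
      show "f \<in> extensional (carrier PGL)" using f by (auto simp: c_ind_simps PiE_def)
    qed (use rs \<eta> fL in \<open>auto simp: F_def\<close>)
    ultimately show ?thesis by blast
  qed
  have "bij_betw F (ind k T) (carrier (c_ind ?K L))"
    unfolding bij_betw_def using inj into surj by blast
  moreover have "rep_hom (carrier PGL) F ((Vr (Suc k))\<lparr>carrier := ind k T\<rparr>) (c_ind ?K L)"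
    unfolding rep_hom_def
    by (auto simp: into[unfolded F_def] F_def c_ind_simps(2-) tr_add tr_smult res_add res_smult \<theta> rT tr_mult[symmetric] iV intro!: restrict_ext)
  ultimately show ?thesis by (auto simp: rep_iso_iff)
qed

section \<open>Cohomology of the path graphs\<close>

definition cob :: "nat \<Rightarrow> ('a::nonarch_local_field vpath \<Rightarrow> complex) \<Rightarrow> 'a vpath \<Rightarrow> complex"
  where "cob k f = (\<lambda>a. if a \<in> opaths (Suc k) then f (tl a) - f (butlast a) else 0)"

text \<open>The coboundary with its two ends decoupled. On the diagonal it is \<open>cob k\<close>;
  on all pairs of finitely supported functions its image is \<open>Ed k\<close>, which for
  \<open>k > 0\<close> is the space induced from the local coboundaries.\<close>

definition delta :: "nat \<Rightarrow> ('a::nonarch_local_field vpath \<Rightarrow> complex) \<times> ('a vpath \<Rightarrow> complex) \<Rightarrow> 'a vpath \<Rightarrow> complex"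
  where "delta k p = (\<lambda>a. if a \<in> opaths (Suc k) then fst p (tl a) - snd p (butlast a) else 0)"

definition Bd :: "nat \<Rightarrow> ('a::nonarch_local_field vpath \<Rightarrow> complex) set"
  where "Bd k = cob k ` fin_supp (opaths k)"

definition Dl :: "nat \<Rightarrow> ('a::nonarch_local_field vpath \<Rightarrow> complex) set"
  where "Dl k = coboundary (Sigma_graph k) ` fin_supp (verts (Sigma_graph k))"

lemma H1c_path: "H1c (path_graph k) = rep_quot (Vr (Suc k)) (Bd k)"
  by (simp add: H1c_def path_graph_def Bd_def cob_def coboundary_def cong: if_cong)

lemma H1c_Sigma: "H1c (Sigma_graph k) = rep_quot (Sr k) (Dl k)"
  by (simp add: H1c_def Dl_def arcs_Sigma)

lemma coboundary_Sigma: "coboundary (Sigma_graph k) f = (\<lambda>a. if a \<in> Sig k then f (tl a) - f (butlast a) else 0)"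
  unfolding coboundary_def arcs_Sigma by (simp add: Sigma_graph_def path_graph_def cong: if_cong)

lemma delta_diag: "delta k (f, f) = cob k f"
  by (simp add: delta_def cob_def cong: if_cong)

lemma pullback_finite:
  assumes "f \<in> fin_supp (opaths k)"
  shows "finite {a \<in> opaths (Suc k). f (tl a) \<noteq> 0}" "finite {a \<in> opaths (Suc k). f (butlast a) \<noteq> 0}"
proof -
  have "{a \<in> opaths (Suc k). f (tl a) \<noteq> 0} = (\<Union>v\<in>{v. f v \<noteq> 0}. {a \<in> opaths (Suc k). tl a = v})"
    "{a \<in> opaths (Suc k). f (butlast a) \<noteq> 0} = (\<Union>v\<in>{v. f v \<noteq> 0}. {a \<in> opaths (Suc k). butlast a = v})"
    by auto
  then show "finite {a \<in> opaths (Suc k). f (tl a) \<noteq> 0}" "finite {a \<in> opaths (Suc k). f (butlast a) \<noteq> 0}"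
    using assms finite_head_star finite_tail_star by (auto simp: fin_supp_iff)
qed

lemma delta_fin_supp:
  assumes "f \<in> fin_supp (opaths k)" "h \<in> fin_supp (opaths k)"
  shows "delta k (f, h) \<in> fin_supp (opaths (Suc k))"
proof -
  have "finite {a. delta k (f, h) a \<noteq> 0}"
    by (rule finite_subset[OF _ finite_UnI[OF pullback_finite(1)[OF assms(1)] pullback_finite(2)[OF assms(2)]]])
      (auto simp: delta_def)
  then show ?thesis by (auto simp: fin_supp_iff delta_def)
qed

lemma delta_hom: "rep_hom (carrier PGL) (delta k) (rep_plus (Vr k) (Vr k)) (Vr (Suc k))"
proof -
  have "inv\<^bsub>PGL\<^esub> g \<in> carrier PGL" if "g \<in> carrier PGL" for g :: "'a pgl" using that by simp
  note pact_opaths[OF this]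
  then show ?thesis
    unfolding rep_hom_def
    by (auto simp: rep_plus_simps delta_fin_supp fin_supp_rep_simps(5) fun_eq_iff opaths_tl opaths_butlast
        map_tl map_butlast algebra_simps) (auto simp: delta_def opaths_tl opaths_butlast map_tl map_butlast algebra_simps)
qed

lemma diag_hom: "rep_hom (carrier PGL) (\<lambda>f. (f, f)) (Vr k) (rep_plus (Vr k) (Vr k))"
  by (auto simp: rep_hom_def rep_plus_simps)

lemma cob_hom: "rep_hom (carrier PGL) (cob k) (Vr k) (Vr (Suc k))"
  using rep_hom_comp[OF diag_hom delta_hom, of k] by (simp add: comp_def delta_diag)

lemma Vr_arep: "arep (carrier PGL) (Vr k)" by (rule Vr.arep_axioms)

lemma VV_arep: "arep (carrier PGL) (rep_plus (Vr k) (Vr k))"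
  by (rule rep_plus_arep[OF Vr_arep Vr_arep])

lemma Bd_subrep: "subrep (carrier PGL) (Vr (Suc k)) (Bd k)"
  using subrep_image[OF Vr_arep Vr_arep cob_hom Vr.subrep_carrier, of k] by (simp add: Bd_def)

definition Ed :: "nat \<Rightarrow> ('a::nonarch_local_field vpath \<Rightarrow> complex) set"
  where "Ed k = delta k ` (fin_supp (opaths k) \<times> fin_supp (opaths k))"

lemma Ed_subrep: "subrep (carrier PGL) (Vr (Suc k)) (Ed k)"
  using subrep_image[OF VV_arep Vr_arep delta_hom arep.subrep_carrier[OF VV_arep], of k]
  by (simp add: Ed_def rep_plus_simps)

lemma Bd_Ed: "Bd k \<subseteq> Ed k"
  by (auto simp: Bd_def Ed_def delta_diag[symmetric])

subsection \<open>The kernel of the map to the local cohomology\<close>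

definition pullb :: "nat \<Rightarrow> ('a vpath \<Rightarrow> 'a vpath) \<Rightarrow> ('a::nonarch_local_field vpath \<Rightarrow> complex) \<Rightarrow> 'a vpath \<Rightarrow> complex"
  where "pullb k t u = (\<lambda>v. if v \<in> opaths (Suc k) then u (t v) else 0)"

lemma pullb_fin_supp:
  assumes "u \<in> fin_supp (opaths k)"
  shows "pullb k tl u \<in> fin_supp (opaths (Suc k))" "pullb k butlast u \<in> fin_supp (opaths (Suc k))"
  using pullback_finite[OF assms] by (auto simp: fin_supp_iff pullb_def elim: rev_finite_subset)

text \<open>The value of \<open>u\<close> at a path \<open>w\<close> is read off from any right extension of \<open>w\<close>; it does not depend on
  the extension because two right extensions have a common compatible left extension.\<close>

lemma delta_kernel:
  assumes f: "f \<in> fin_supp (opaths (Suc k))" and h: "h \<in> fin_supp (opaths (Suc k))"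
    and zero: "delta (Suc k) (f, h) = (\<lambda>a. 0)"
  obtains u where "u \<in> fin_supp (opaths k)" "f = pullb k butlast u" "h = pullb k tl u"
proof -
  have eq: "f (w @ [x]) = h (y # w)" if "y # w \<in> opaths (Suc k)" "w @ [x] \<in> opaths (Suc k)" "k = 0 \<longrightarrow> y \<noteq> x" for y w x
    using opaths_glue[OF that] opaths_length[OF that(1)] fun_cong[OF zero, of "y # w @ [x]"]
    by (auto simp: delta_def butlast_append)
  have ff: "f (w @ [x]) = f (w @ [x'])"
    if w: "w \<in> opaths k" "w @ [x] \<in> opaths (Suc k)" "w @ [x'] \<in> opaths (Suc k)" for w x x'
  proof -
    obtain y where y: "y # w \<in> opaths (Suc k)" "y \<noteq> x" "0 < k \<or> y \<noteq> x'" by (rule left_extension[OF w(1), of x x'])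
    have "k = 0 \<longrightarrow> y \<noteq> x'" using y(3) by blast
    with eq[OF y(1) w(3)] eq[OF y(1) w(2)] y(2) show ?thesis by simp
  qed
  define r where "r w = (SOME x. w @ [x] \<in> opaths (Suc k))" for w :: "'a vpath"
  have r: "w @ [r w] \<in> opaths (Suc k)" if "w \<in> opaths k" for w
    unfolding r_def by (rule right_extension[OF that]) (rule someI)
  define u where "u w = (if w \<in> opaths k then f (w @ [r w]) else 0)" for w
  have 1: "f = pullb k butlast u"
  proof
    fix v
    show "f v = pullb k butlast u v"
    proof (cases "v \<in> opaths (Suc k)")
      case True
      then have v: "v = butlast v @ [last v]" using opaths_length[OF True] by (metis append_butlast_last_id add_is_0 list.size(3) zero_neq_one)
      have "butlast v \<in> opaths k" by (rule opaths_butlast[OF True])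
      then have "f (butlast v @ [last v]) = u (butlast v)"
        using ff[of "butlast v" "last v" "r (butlast v)"] r True v by (simp add: u_def)
      then show ?thesis using True v by (simp add: pullb_def)
    qed (use f in \<open>simp add: pullb_def fin_supp_iff\<close>)
  qed
  have 2: "h = pullb k tl u"
  proof
    fix v
    show "h v = pullb k tl u v"
    proof (cases "v \<in> opaths (Suc k)")
      case True
      then obtain y where v: "v = y # tl v" using opaths_length[OF True] by (cases v) auto
      have w: "tl v \<in> opaths k" by (rule opaths_tl[OF True])
      obtain x where x: "tl v @ [x] \<in> opaths (Suc k)" "x \<noteq> y" by (rule right_extension[OF w, of y])
      have "f (tl v @ [x]) = h v" using eq[of y "tl v" x] True x v by auto
      moreover have "f (tl v @ [x]) = u (tl v)" using ff[OF w x(1) r[OF w]] w by (simp add: u_def)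
      ultimately show ?thesis using True by (simp add: pullb_def)
    qed (use h in \<open>simp add: pullb_def fin_supp_iff\<close>)
  qed
  have "{w. u w \<noteq> 0} \<subseteq> butlast ` {v. f v \<noteq> 0}"
    by (auto simp: u_def image_iff intro!: exI[of _ "_ @ [r _]"] split: if_splits)
  then have "finite {w. u w \<noteq> 0}" by (rule finite_subset) (use f in \<open>simp add: fin_supp_iff\<close>)
  then have "u \<in> fin_supp (opaths k)" by (simp add: fin_supp_iff u_def)
  then show ?thesis using that 1 2 by blast
qed

lemma diff_hom: "rep_hom (carrier PGL) (\<lambda>p x. fst p x - snd p x) (rep_plus (Vr k) (Vr k)) (Vr k)"
proof -
  have "(\<lambda>x. f x - h x) \<in> fin_supp (opaths k)" if "f \<in> fin_supp (opaths k)" "h \<in> fin_supp (opaths k)" for f h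
    using fin_supp_add[OF that(1) fin_supp_smult[OF that(2), of "-1"]] by simp
  then show ?thesis by (auto simp: rep_hom_def rep_plus_simps fin_supp_rep_simps(5) algebra_simps)
qed

text \<open>If \<open>delta (f, h)\<close> is the coboundary of \<open>e\<close>, then
  \<open>(f - e, h - e)\<close> lies in the kernel of \<open>delta\<close> and by
  \<open>delta_kernel\<close> consists of the two pullbacks of one function \<open>u\<close>;
  subtracting them exhibits \<open>f - h\<close> as the coboundary of \<open>- u\<close>.
  Conversely, if \<open>f - h\<close> is the coboundary of \<open>u\<close>, then \<open>f\<close>
  plus the \<open>butlast\<close> pullback of \<open>u\<close> equals \<open>h\<close> plus its
  \<open>tl\<close> pullback. This common function works as \<open>e\<close> because removing the
  first and the last vertex of a path commute.\<close>

lemma delta_Bd_iff: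
  assumes f: "f \<in> fin_supp (opaths (Suc k))" and h: "h \<in> fin_supp (opaths (Suc k))"
  shows "delta (Suc k) (f, h) \<in> Bd (Suc k) \<longleftrightarrow> (\<lambda>x. f x - h x) \<in> Bd k"
proof
  assume "delta (Suc k) (f, h) \<in> Bd (Suc k)"
  then obtain e where e: "e \<in> fin_supp (opaths (Suc k))" "delta (Suc k) (f, h) = cob (Suc k) e" by (auto simp: Bd_def)
  have *: "(\<lambda>x. p x - e x) \<in> fin_supp (opaths (Suc k))" if "p \<in> fin_supp (opaths (Suc k))" for p
    using fin_supp_add[OF that fin_supp_smult[OF e(1), of "-1"]] by simp
  have "delta (Suc k) (\<lambda>x. f x - e x, \<lambda>x. h x - e x) a = 0" for a
    using fun_cong[OF e(2), of a] by (auto simp: delta_def cob_def algebra_simps split: if_splits)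
  then have z: "delta (Suc k) (\<lambda>x. f x - e x, \<lambda>x. h x - e x) = (\<lambda>a. 0)" by blast
  obtain u where u: "u \<in> fin_supp (opaths k)" "(\<lambda>x. f x - e x) = pullb k butlast u" "(\<lambda>x. h x - e x) = pullb k tl u"
    by (rule delta_kernel[OF *[OF f] *[OF h] z])
  have "(\<lambda>x. f x - h x) = cob k (\<lambda>w. (-1) * u w)"
  proof
    fix x
    have "f x - h x = (f x - e x) - (h x - e x)" by simp
    also have "\<dots> = cob k (\<lambda>w. (-1) * u w) x"
      unfolding fun_cong[OF u(2), of x] fun_cong[OF u(3), of x] by (simp add: pullb_def cob_def)
    finally show "f x - h x = cob k (\<lambda>w. (-1) * u w) x" .
  qed
  then show "(\<lambda>x. f x - h x) \<in> Bd k" unfolding Bd_def using fin_supp_smult[OF u(1)] by blast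
next
  assume "(\<lambda>x. f x - h x) \<in> Bd k"
  then obtain u where u: "u \<in> fin_supp (opaths k)" "(\<lambda>x. f x - h x) = cob k u" by (auto simp: Bd_def)
  define e where "e = (\<lambda>x. f x + pullb k butlast u x)"
  have e: "e \<in> fin_supp (opaths (Suc k))" unfolding e_def by (intro fin_supp_add f pullb_fin_supp u)
  have eh: "e x = h x + pullb k tl u x" for x
    using fun_cong[OF u(2), of x] by (auto simp: e_def pullb_def cob_def algebra_simps split: if_splits)
  have "delta (Suc k) (f, h) = cob (Suc k) e"
  proof
    fix a
    show "delta (Suc k) (f, h) a = cob (Suc k) e a"
    proof (cases "a \<in> opaths (Suc (Suc k))")
      case True
      have "butlast (tl a) = tl (butlast a)" by (rule butlast_tl)
      then have "e (tl a) - e (butlast a) = f (tl a) - h (butlast a)"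
        using opaths_tl[OF True] opaths_butlast[OF True]
        unfolding eh[of "butlast a"] unfolding e_def by (simp add: pullb_def)
      then show ?thesis by (simp add: delta_def cob_def True)
    qed (simp add: delta_def cob_def)
  qed
  then show "delta (Suc k) (f, h) \<in> Bd (Suc k)" using e by (auto simp: Bd_def)
qed

text \<open>The arcs of one path graph are the vertices of the next, so \<open>f - h\<close> is a
  cochain one step down. Since \<open>delta (f, h)\<close> determines the pair only up to the kernel
  of \<open>delta\<close>, the comparison runs through pairs as common source.\<close>

lemma Ed_mod_Bd: "rep_iso (carrier PGL) (rep_quot ((Vr (Suc (Suc k)))\<lparr>carrier := Ed (Suc k)\<rparr>) (Bd (Suc k))) (H1c (path_graph k))"
  unfolding H1c_path
proof (rule rep_iso_zigzag[where A = "rep_plus (Vr (Suc k)) (Vr (Suc k))" and \<beta> = "delta (Suc k)" and \<gamma> = "\<lambda>p x. fst p x - snd p x"])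
  show "arep (carrier PGL) ((Vr (Suc (Suc k)))\<lparr>carrier := Ed (Suc k)\<rparr>)" by (rule Vr.arep_subrep[OF Ed_subrep])
  have "rep_hom (carrier PGL) (delta (Suc k)) ((rep_plus (Vr (Suc k)) (Vr (Suc k)))\<lparr>carrier := carrier (rep_plus (Vr (Suc k)) (Vr (Suc k)))\<rparr>)
      ((Vr (Suc (Suc k)))\<lparr>carrier := Ed (Suc k)\<rparr>)"
    by (rule rep_hom_restrict[OF delta_hom]) (auto simp: Ed_def rep_plus_simps)
  then show "rep_hom (carrier PGL) (delta (Suc k)) (rep_plus (Vr (Suc k)) (Vr (Suc k))) ((Vr (Suc (Suc k)))\<lparr>carrier := Ed (Suc k)\<rparr>)"
    by (auto simp: rep_hom_def)
  show "delta (Suc k) ` carrier (rep_plus (Vr (Suc k)) (Vr (Suc k))) = carrier ((Vr (Suc (Suc k)))\<lparr>carrier := Ed (Suc k)\<rparr>)"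
    by (simp add: Ed_def rep_plus_simps)
  show "(\<lambda>p x. fst p x - snd p x) ` carrier (rep_plus (Vr (Suc k)) (Vr (Suc k))) = carrier (Vr (Suc k))"
  proof
    show "(\<lambda>p x. fst p x - snd p x) ` carrier (rep_plus (Vr (Suc k)) (Vr (Suc k))) \<subseteq> carrier (Vr (Suc k))"
      using diff_hom[of "Suc k"] by (auto simp: rep_hom_def)
    show "carrier (Vr (Suc k)) \<subseteq> (\<lambda>p x. fst p x - snd p x) ` carrier (rep_plus (Vr (Suc k)) (Vr (Suc k)))"
    proof
      fix f assume "f \<in> carrier (Vr (Suc k))"
      then show "f \<in> (\<lambda>p x. fst p x - snd p x) ` carrier (rep_plus (Vr (Suc k)) (Vr (Suc k)))"
        by (intro image_eqI[of _ _ "(f, \<lambda>x. 0)"]) (auto simp: rep_plus_simps)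
    qed
  qed
  show "subrep (carrier PGL) ((Vr (Suc (Suc k)))\<lparr>carrier := Ed (Suc k)\<rparr>) (Bd (Suc k))"
    by (simp add: Vr.subrep_trans[OF Ed_subrep] Bd_subrep Bd_Ed)
qed (auto simp: VV_arep Vr_arep diff_hom Bd_subrep rep_plus_simps delta_Bd_iff)

subsection \<open>Localization\<close>

lemma stable_verts_Sigma: "stable (K_par k) (verts (Sigma_graph k))"
proof -
  have v: "verts (Sigma_graph k) = {x \<in> opaths k. if even k then mid_vertex x \<in> base k else base k \<subseteq> mid_edge x}"
    by (auto simp: Sigma_graph_def base_def)
  have "pact g x \<in> verts (Sigma_graph k)" if g: "g \<in> K_par k" and x: "x \<in> verts (Sigma_graph k)" for g and x :: "'a vpath"
  proof -
    have xo: "x \<in> opaths k" and len: "length x = k + 1" using x opaths_length by (auto simp: v)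
    have gb: "vertex_act g ` base k = base k" using g by (simp add: K_par_eq)
    show ?thesis
    proof (cases "even k")
      case True
      then have "mid_vertex x \<in> base k" using x by (simp add: v)
      then have "vertex_act g (mid_vertex x) \<in> base k" using gb by blast
      moreover have "mid_vertex (pact g x) = vertex_act g (mid_vertex x)" using len by (simp add: mid_vertex_def)
      ultimately show ?thesis using True xo K_par_carrier[OF g] by (simp add: v)
    next
      case False
      then have "base k \<subseteq> mid_edge x" using x by (simp add: v)
      then have "base k \<subseteq> vertex_act g ` mid_edge x" using gb by blast
      moreover have "mid_edge (pact g x) = vertex_act g ` mid_edge x" using len False by (auto simp: mid_edge_def elim!: oddE)
      ultimately show ?thesis using False xo K_par_carrier[OF g] by (simp add: v)
    qed
  qed
  then show ?thesis using opaths_tree by (fastforce simp: stable_def subgroup_K_par v)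
qed

lemma Dl_subrep: "subrep (K_par k) (Sr k) (Dl k :: ('a::nonarch_local_field vpath \<Rightarrow> complex) set)"
proof -
  let ?V = "verts (Sigma_graph k) :: 'a vpath set"
  have ar: "arep (K_par k) (fin_supp_rep ?V)" by (rule fin_supp_arep[OF stable_verts_Sigma])
  have st: "pact (inv\<^bsub>PGL\<^esub> g) x \<in> ?V \<longleftrightarrow> x \<in> ?V" if g: "g \<in> K_par k" and x: "x \<in> opaths k" for g and x :: "'a vpath"
  proof -
    have *: "pact h y \<in> ?V" if "h \<in> K_par k" "y \<in> ?V" for h and y :: "'a vpath" using stable_verts_Sigma[of k] that unfolding stable_def by blast
    have "inv\<^bsub>PGL\<^esub> g \<in> K_par k" using g subgroup.m_inv_closed[OF subgroup_K_par] by blast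
    then show ?thesis using *[of "inv\<^bsub>PGL\<^esub> g" x] *[OF g, of "pact (inv\<^bsub>PGL\<^esub> g) x"] pact_inv(1)[OF x K_par_carrier[OF g]]
      by (auto simp del: map_map)
  qed
  have "rep_hom (K_par k) (coboundary (Sigma_graph k)) (fin_supp_rep ?V) (Sr k)"
    unfolding rep_hom_def coboundary_Sigma
  proof (intro conjI ballI allI)
    show "(\<lambda>a. if a \<in> Sig k then f (tl a) - f (butlast a) else 0) \<in> carrier (Sr k)" for f
      by (simp add: fin_supp_finite[OF finite_Sig])
  next
    fix g :: "'a pgl" and f assume g: "g \<in> K_par k" and f: "f \<in> carrier (fin_supp_rep ?V)"
    have gi: "inv\<^bsub>PGL\<^esub> g \<in> K_par k" using g subgroup.m_inv_closed[OF subgroup_K_par] by blast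
    have act: "ract (fin_supp_rep ?V) g f x = f (pact (inv\<^bsub>PGL\<^esub> g) x)" if "x \<in> opaths k" for x
      using st[OF g that] f by (simp add: fin_supp_rep_simps(5) fin_supp_outside)
    show "(\<lambda>a. if a \<in> Sig k then ract (fin_supp_rep ?V) g f (tl a) - ract (fin_supp_rep ?V) g f (butlast a) else 0) =
        ract (Sr k) g (\<lambda>a. if a \<in> Sig k then f (tl a) - f (butlast a) else 0)"
    proof
      fix a
      show "(if a \<in> Sig k then ract (fin_supp_rep ?V) g f (tl a) - ract (fin_supp_rep ?V) g f (butlast a) else 0) =
          ract (Sr k) g (\<lambda>a. if a \<in> Sig k then f (tl a) - f (butlast a) else 0) a"
        using act[OF opaths_tl[OF Sig_opaths], of a] act[OF opaths_butlast[OF Sig_opaths], of a] Sig_stable[OF gi, of a]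
        by (cases "a \<in> Sig k") (simp_all add: fin_supp_rep_simps(5)[of "Sig k"] map_tl map_butlast)
    qed
  qed (auto simp: algebra_simps)
  from subrep_image[OF ar Sr.arep_axioms this arep.subrep_carrier[OF ar]]
  show ?thesis by (simp add: Dl_def)
qed

lemma mid_Sig: "a \<in> opaths (Suc k) \<Longrightarrow> 0 < k \<Longrightarrow> a \<in> Sig k \<longleftrightarrow> head_mid k (tl a) = base k"
  "a \<in> opaths (Suc k) \<Longrightarrow> 0 < k \<Longrightarrow> a \<in> Sig k \<longleftrightarrow> tail_mid k (butlast a) = base k"
  using mid_head[of a k] mid_tail[of a k] by (simp_all add: Sig_def)

text \<open>For one inclusion it suffices, by minimality of \<open>ind\<close>, to write a local
  coboundary as some \<open>delta (f, h)\<close>. For the other, a pair \<open>(f, h)\<close> must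
  become a single function on the vertices of the local graph, which is possible because each vertex
  there plays only one role, head or tail.\<close>

lemma ind_Dl:
  assumes k: "0 < k"
  shows "ind k (Dl k :: ('a::nonarch_local_field vpath \<Rightarrow> complex) set) = Ed k"
proof
  have "d \<in> Ed k" if "d \<in> Dl k" for d :: "'a vpath \<Rightarrow> complex"
  proof -
    obtain e where e: "e \<in> fin_supp (verts (Sigma_graph k))" "d = coboundary (Sigma_graph k) e"
      using \<open>d \<in> Dl k\<close> by (auto simp: Dl_def)
    \<comment> \<open>Cutting \<open>e\<close> down to the heads, respectively tails, of arcs in
      \<open>Sig k\<close> makes \<open>delta\<close> vanish on all other arcs. The coboundary of
      \<open>e\<close> in the whole path graph need not vanish there.\<close>
    define f where "f v = (if v \<in> opaths k \<and> head_mid k v = base k then e v else 0)" for v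
    define h where "h v = (if v \<in> opaths k \<and> tail_mid k v = base k then e v else 0)" for v
    have fin: "finite {x. e x \<noteq> 0}" using e(1) by (simp add: fin_supp_iff)
    have "finite {x. f x \<noteq> 0}" "finite {x. h x \<noteq> 0}"
      by (rule finite_subset[OF _ fin], auto simp: f_def h_def)+
    then have fh: "f \<in> fin_supp (opaths k)" "h \<in> fin_supp (opaths k)" by (auto simp: fin_supp_iff f_def h_def)
    have "d = delta k (f, h)"
    proof
      fix a
      show "d a = delta k (f, h) a"
        using mid_Sig[of a k] k opaths_tl[of a k] opaths_butlast[of a k] Sig_opaths[of a k]
        by (auto simp: e(2) coboundary_Sigma delta_def f_def h_def)
    qed
    then show ?thesis using fh by (auto simp: Ed_def)
  qed
  then show "ind k (Dl k :: ('a vpath \<Rightarrow> complex) set) \<subseteq> Ed k" by (intro ind_least Dl_subrep Ed_subrep subsetI)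
next
  show "Ed k \<subseteq> ind k (Dl k :: ('a vpath \<Rightarrow> complex) set)"
  proof
    fix d assume d: "d \<in> (Ed k :: ('a vpath \<Rightarrow> complex) set)"
    have "res k e \<in> Dl k" if e: "e \<in> Ed k" for e :: "'a vpath \<Rightarrow> complex"
    proof -
      obtain f h where fh: "f \<in> fin_supp (opaths k)" "h \<in> fin_supp (opaths k)" "e = delta k (f, h)"
        using e by (auto simp: Ed_def)
      \<comment> \<open>By \<open>head_mid_neq_tail_mid\<close> no vertex satisfies both conditions,
        so the order of the tests is immaterial.\<close>
      define b where "b v = (if v \<in> opaths k then (if head_mid k v = base k then f v else if tail_mid k v = base k then h v else 0) else 0)" for v
      have "finite {x. b x \<noteq> 0}"
        by (rule finite_subset[of _ "{x. f x \<noteq> 0} \<union> {x. h x \<noteq> 0}"]) (use fh in \<open>auto simp: b_def fin_supp_iff split: if_splits\<close>)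
      moreover have "b v = 0" if "v \<notin> verts (Sigma_graph k)" for v
        using that verts_Sigma[of v k] k by (auto simp: b_def)
      ultimately have "b \<in> fin_supp (verts (Sigma_graph k))" by (auto simp: fin_supp_iff)
      moreover have "res k e = coboundary (Sigma_graph k) b"
      proof
        fix a
        show "res k e a = coboundary (Sigma_graph k) b a"
        proof (cases "a \<in> Sig k")
          case True
          note ao = Sig_opaths[OF True]
          have hm: "head_mid k (tl a) = base k" "tail_mid k (butlast a) = base k"
            using mid_Sig[OF ao k] True by auto
          then have "head_mid k (butlast a) \<noteq> base k" using head_mid_neq_tail_mid[OF opaths_butlast[OF ao] k] by simp
          then show ?thesis
            using True ao hm opaths_tl[OF ao] opaths_butlast[OF ao]
            by (simp add: res_def fh(3) delta_def coboundary_Sigma b_def)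
        qed (simp add: res_def coboundary_Sigma)
      qed
      ultimately show ?thesis by (auto simp: Dl_def)
    qed
    moreover have "tr k g d \<in> Ed k" if "g \<in> carrier PGL" for g using Vr.subrepD(5)[OF Ed_subrep that d] .
    moreover have "d \<in> fin_supp (opaths (Suc k))" using Vr.subrepD(1)[OF Ed_subrep] d by auto
    ultimately show "d \<in> ind k (Dl k)" by (simp add: ind_def)
  qed
qed

subsection \<open>Splitting\<close>

lemma res_tr_zero:
  assumes "f \<in> fin_supp (opaths (Suc k))" "\<And>g. g \<in> carrier PGL \<Longrightarrow> res k (tr k g f) = (\<lambda>x. 0)"
  shows "f = (\<lambda>x. 0)"
proof
  fix a
  show "f a = 0"
  proof (cases "a \<in> opaths (Suc k)")
    case True
    obtain g where g: "g \<in> carrier PGL" "pact g a \<in> Sig k" by (rule Sig_transitive[OF True])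
    have "res k (tr k g f) (pact g a) = 0" by (simp only: assms(2)[OF g(1)])
    then show ?thesis using g tr_apply'[OF True g(1)] by (simp add: res_def)
  qed (use fin_supp_outside[OF assms(1)] in simp)
qed

lemma ind_full: "ind k (fin_supp (Sig k)) = fin_supp (opaths (Suc k))"
  by (auto simp: ind_def res_def fin_supp_finite[OF finite_Sig])

lemma tr_sum: "tr k g (\<lambda>x. \<Sum>i\<in>I. f i x) = (\<lambda>x. \<Sum>i\<in>I. tr k g (f i) x)"
  and res_sum: "res k (\<lambda>x. \<Sum>i\<in>I. f i x) = (\<lambda>x. \<Sum>i\<in>I. res k (f i) x)"
  by (auto simp: fin_supp_rep_simps(5) res_def fun_eq_iff)

text \<open>Induction carries a direct sum decomposition of the fibre to one of the whole function
  space: injectivity is tested on the restrictions of all translates to the base fibre, surjectivity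
  follows from minimality of \<open>ind\<close>. Since \<open>B\<close> lies in the first summand,
  dividing by it leaves the others untouched.\<close>

proposition ind_split:
  fixes D :: "('a::nonarch_local_field vpath \<Rightarrow> complex) set"
  assumes I: "finite I" and D: "subrep (K_par k) (Sr k) D" and T: "\<And>i. i \<in> I \<Longrightarrow> subrep (K_par k) (Sr k) (T i)"
    and dec: "\<And>p. p \<in> fin_supp (Sig k) \<Longrightarrow> \<exists>d\<in>D. \<exists>t\<in>Pi I T. p = (\<lambda>x. d x + (\<Sum>i\<in>I. t i x))"
    and uniq: "\<And>d t. d \<in> D \<Longrightarrow> t \<in> Pi I T \<Longrightarrow> (\<lambda>x. d x + (\<Sum>i\<in>I. t i x)) = (\<lambda>x. 0) \<Longrightarrow>
      d = (\<lambda>x. 0) \<and> (\<forall>i\<in>I. t i = (\<lambda>x. 0))"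
    and B: "subrep (carrier PGL) (Vr (Suc k)) B" "B \<subseteq> ind k D"
  shows "rep_iso (carrier PGL) (rep_quot (Vr (Suc k)) B)
    (rep_plus (rep_quot ((Vr (Suc k))\<lparr>carrier := ind k D\<rparr>) B)
      (rep_dsum I (\<lambda>i. (Vr (Suc k))\<lparr>carrier := ind k (T i)\<rparr>)))"
proof -
  let ?V = "Vr (Suc k) :: ('a pgl, 'a vpath \<Rightarrow> complex) rep"
  let ?G = "carrier PGL :: 'a pgl set"
  let ?DB = "?V\<lparr>carrier := ind k D\<rparr>" and ?Z = "rep_dsum I (\<lambda>i. ?V\<lparr>carrier := ind k (T i)\<rparr>)"
  let ?A = "rep_plus ?DB ?Z"
  let ?C = "\<lambda>p x. fst p x + (\<Sum>i\<in>I. snd p i x)"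
  note Isub = Vr.subrepD[OF ind_subrep, simplified]
  have arD: "arep ?G ?DB" by (rule Vr.arep_subrep[OF ind_subrep[OF D]])
  have arZ: "arep ?G ?Z"
    by (rule rep_dsum_arep[OF Vr.arep_subrep[OF ind_subrep[OF T]] PGL.subgroup_self I])
  have arA: "arep ?G ?A" by (rule rep_plus_arep[OF arD arZ])
  have carA: "p \<in> carrier ?A \<longleftrightarrow> fst p \<in> ind k D \<and> snd p \<in> (\<Pi>\<^sub>E i\<in>I. ind k (T i))" for p
    by (cases p) (simp add: rep_plus_simps rep_dsum_carrier[OF I])
  have hom: "rep_hom ?G ?C ?A ?V"
    unfolding rep_hom_def
  proof (intro conjI ballI allI)
    fix p assume p: "p \<in> carrier ?A"
    then have "fst p \<in> ind k D" "\<And>i. i \<in> I \<Longrightarrow> snd p i \<in> ind k (T i)" by (auto simp: carA)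
    then have "fst p \<in> fin_supp (opaths (Suc k))" "\<And>i. i \<in> I \<Longrightarrow> snd p i \<in> fin_supp (opaths (Suc k))"
      by (auto simp: ind_def)
    then show "?C p \<in> carrier ?V" by (simp add: fin_supp_add fin_supp_sum)
  qed (auto simp: rep_plus_simps rep_dsum_simps fin_supp_rep_simps(5) fun_eq_iff sum.distrib sum_distrib_left algebra_simps)
  have im: "?C ` carrier ?A = carrier ?V"
  proof
    show "?C ` carrier ?A \<subseteq> carrier ?V" using hom by (auto simp: rep_hom_def)
    \<comment> \<open>The image of the addition map is \<open>G\<close>-stable, so it is everything
      as soon as it contains the functions on the base fibre.\<close>
    have "fin_supp (Sig k) \<subseteq> ?C ` carrier ?A"
    proof
      fix p :: "'a vpath \<Rightarrow> complex" assume "p \<in> fin_supp (Sig k)"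
      from dec[OF this] obtain d t where dt: "d \<in> D" "t \<in> Pi I T" "p = (\<lambda>x. d x + (\<Sum>i\<in>I. t i x))" by blast
      have "(d, restrict t I) \<in> carrier ?A"
        using dt ind_contains[OF D] ind_contains[OF T] by (auto simp: carA)
      moreover have "p = ?C (d, restrict t I)" using dt(3) by simp
      ultimately show "p \<in> ?C ` carrier ?A" by blast
    qed
    moreover have "subrep (K_par k) (Sr k) (fin_supp (Sig k))" using Sr.subrep_carrier[of k] by simp
    moreover have "subrep ?G ?V (?C ` carrier ?A)"
      by (rule subrep_image[OF arA Vr_arep hom arep.subrep_carrier[OF arA]])
    ultimately have "ind k (fin_supp (Sig k)) \<subseteq> ?C ` carrier ?A" using ind_least by blast
    then show "carrier ?V \<subseteq> ?C ` carrier ?A" by (simp add: ind_full)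
  qed
  have zero: "fst p = (\<lambda>x. 0) \<and> (\<forall>i\<in>I. snd p i = (\<lambda>x. 0))"
    if p: "p \<in> carrier ?A" and "?C p = (\<lambda>x. 0)" for p
  proof -
    have pI: "fst p \<in> ind k D" "\<And>i. i \<in> I \<Longrightarrow> snd p i \<in> ind k (T i)" using p by (auto simp: carA)
    have *: "res k (tr k g (fst p)) = (\<lambda>x. 0) \<and> (\<forall>i\<in>I. res k (tr k g (snd p i)) = (\<lambda>x. 0))" if g: "g \<in> carrier PGL" for g
    proof (rule uniq)
      show "res k (tr k g (fst p)) \<in> D" "(\<lambda>i. res k (tr k g (snd p i))) \<in> Pi I T" using pI g by (auto simp: ind_def)
      have "res k (tr k g (?C p)) = (\<lambda>x. 0)" unfolding \<open>?C p = (\<lambda>x. 0)\<close> by (simp add: tr_zero res_zero)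
      then show "(\<lambda>x. res k (tr k g (fst p)) x + (\<Sum>i\<in>I. res k (tr k g (snd p i)) x)) = (\<lambda>x. 0)"
        by (simp add: tr_add res_add tr_sum res_sum)
    qed
    have V: "fst p \<in> fin_supp (opaths (Suc k))" "\<And>i. i \<in> I \<Longrightarrow> snd p i \<in> fin_supp (opaths (Suc k))"
      using pI by (auto simp: ind_def)
    show ?thesis
      using * by (intro conjI ballI res_tr_zero[OF V(1)] res_tr_zero[OF V(2)]) blast+
  qed
  have pair: "subrep_pair ?G ?DB B"
    using B by (simp add: subrep_pair_def subrep_pair_axioms_def arD Vr.subrep_trans[OF ind_subrep[OF D]])
  have iso: "rep_iso ?G (rep_quot ?A (B \<times> {\<zero>\<^bsub>?Z\<^esub>})) (rep_quot ?V B)"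
  proof (rule rep_iso_zigzag[OF arA arA Vr_arep _ _ hom im _ B(1)])
    show "rep_hom ?G id ?A ?A" by (simp add: rep_hom_def arep.act_closed[OF arA])
    show "subrep ?G ?A (B \<times> {\<zero>\<^bsub>?Z\<^esub>})" by (rule rep_quot_plus(2)[OF pair arZ])
    fix p assume p: "p \<in> carrier ?A"
    show "id p \<in> B \<times> {\<zero>\<^bsub>?Z\<^esub>} \<longleftrightarrow> ?C p \<in> B"
    proof
      assume "id p \<in> B \<times> {\<zero>\<^bsub>?Z\<^esub>}"
      then have "fst p \<in> B" "\<And>i. i \<in> I \<Longrightarrow> snd p i = (\<lambda>x. 0)" by (auto simp: rep_dsum_simps)
      then show "?C p \<in> B" by simp
    next
      assume b: "?C p \<in> B"
      \<comment> \<open>Subtracting the total from the first component makes the components add up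
        to 0, which forces all summands from the \<open>T i\<close> to vanish.\<close>
      define q where "q = ((\<lambda>x. fst p x + (-1) * ?C p x), snd p)"
      have "?C p \<in> ind k D" using b B by blast
      then have "q \<in> carrier ?A"
        using p Isub(3)[OF D, of "fst p" "\<lambda>x. (-1) * ?C p x"] Isub(4)[OF D, of "?C p" "-1"] by (simp add: carA q_def)
      moreover have "?C q = (\<lambda>x. 0)" by (simp add: q_def)
      ultimately have q: "fst q = (\<lambda>x. 0)" "\<And>i. i \<in> I \<Longrightarrow> snd p i = (\<lambda>x. 0)" using zero[of q] by (auto simp: q_def)
      have "fst p x = ?C p x" for x using fun_cong[OF q(1), of x] by (simp add: q_def)
      then have "fst p = ?C p" by blast
      then have "fst p \<in> B" using b by simp
      moreover have "snd p = \<zero>\<^bsub>?Z\<^esub>"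
        using p q(2) by (auto simp: carA rep_dsum_simps intro!: extensionalityI[of _ I] simp: PiE_def)
      ultimately show "id p \<in> B \<times> {\<zero>\<^bsub>?Z\<^esub>}" by (cases p) simp
    qed
  qed simp
  have "arep ?G (rep_quot ?A (B \<times> {\<zero>\<^bsub>?Z\<^esub>}))"
    by (intro subrep_pair.quot_arep subrep_pair.intro subrep_pair_axioms.intro arA rep_quot_plus(2)[OF pair arZ])
  from rep_iso_trans[OF rep_iso_sym[OF this iso] rep_quot_plus(1)[OF pair arZ]]
  show ?thesis .
qed

section \<open>The Jordan-Hoelder theorem\<close>

lemma irreducible_rep_iso:
  assumes "arep K M" "arep K N" "rep_iso K M N" "irreducible_rep K M"
  shows "irreducible_rep K N"
proof -
  interpret M: arep K M by fact
  interpret N: arep K N by fact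
  obtain \<phi> where b: "bij_betw \<phi> (carrier M) (carrier N)" and h: "rep_hom K \<phi> M N"
    using assms(3) by (auto simp: rep_iso_iff)
  have z: "\<phi> \<zero>\<^bsub>M\<^esub> = \<zero>\<^bsub>N\<^esub>" by (rule M.hom_zero[OF h assms(2)])
  have im: "\<phi> ` carrier M = carrier N" using b by (simp add: bij_betw_def)
  have "carrier N \<noteq> {\<zero>\<^bsub>N\<^esub>}"
  proof
    assume N: "carrier N = {\<zero>\<^bsub>N\<^esub>}"
    have "v = \<zero>\<^bsub>M\<^esub>" if "v \<in> carrier M" for v
    proof -
      have "\<phi> v \<in> carrier N" using that im by (auto simp del: N)
      then have "\<phi> v = \<phi> \<zero>\<^bsub>M\<^esub>" using N z by simp
      then show ?thesis using b that M.zero_closed by (auto simp: bij_betw_def dest: inj_onD)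
    qed
    then show False using assms(4) M.zero_closed unfolding irreducible_rep_def by blast
  qed
  moreover have "Y = {\<zero>\<^bsub>N\<^esub>} \<or> Y = carrier N" if Y: "subrep K N Y" for Y
  proof -
    let ?W = "{v \<in> carrier M. \<phi> v \<in> Y}"
    have "?W = {\<zero>\<^bsub>M\<^esub>} \<or> ?W = carrier M"
      using subrep_vimage[OF assms(1,2) h Y] assms(4) by (simp add: irreducible_rep_def)
    moreover have "Y = \<phi> ` ?W" using N.subrepD(1)[OF Y] im by auto
    ultimately show ?thesis using z im by auto
  qed
  ultimately show ?thesis by (simp add: irreducible_rep_def)
qed

lemma subquot_iso:
  assumes "arep K M" "arep K N" and b: "bij_betw \<phi> (carrier M) (carrier N)" and h: "rep_hom K \<phi> M N"
    and W: "subrep K M W" "subrep K M W'" "W \<subseteq> W'"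
  shows "rep_iso K (subquot M W' W) (subquot N (\<phi> ` W') (\<phi> ` W))"
proof -
  interpret M: arep K M by fact
  interpret N: arep K N by fact
  have im: "subrep K N (\<phi> ` W)" "subrep K N (\<phi> ` W')"
    using subrep_image[OF assms(1,2) h] W by auto
  have MW: "arep K (M\<lparr>carrier := W'\<rparr>)" by (rule M.arep_subrep[OF W(2)])
  have NW: "arep K (N\<lparr>carrier := \<phi> ` W'\<rparr>)" by (rule N.arep_subrep[OF im(2)])
  have sM: "subrep K (M\<lparr>carrier := W'\<rparr>) W" by (simp add: M.subrep_trans[OF W(2)] W)
  have sN: "subrep K (N\<lparr>carrier := \<phi> ` W'\<rparr>) (\<phi> ` W)" using W(3) by (auto simp: N.subrep_trans[OF im(2)] im)
  show ?thesis
  proof (rule rep_iso_zigzag[OF MW MW NW _ _ _ _ sM sN])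
    show "rep_hom K id (M\<lparr>carrier := W'\<rparr>) (M\<lparr>carrier := W'\<rparr>)"
      using arep.act_closed[OF MW] by (simp add: rep_hom_def)
    show "rep_hom K \<phi> (M\<lparr>carrier := W'\<rparr>) (N\<lparr>carrier := \<phi> ` W'\<rparr>)"
      by (rule rep_hom_restrict[OF h M.subrepD(1)[OF W(2)]]) simp
    show "id v \<in> W \<longleftrightarrow> \<phi> v \<in> \<phi> ` W" if "v \<in> carrier (M\<lparr>carrier := W'\<rparr>)" for v
      using that b M.subrepD(1)[OF W(1)] M.subrepD(1)[OF W(2)] by (auto simp: bij_betw_def inj_on_def subset_iff)
  qed auto
qed

text \<open>States that \<open>U\<close> has a composition series of length \<open>n\<close> with
  \<open>c\<close> factors isomorphic to \<open>L\<close>. Building series upwards from the top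
  step, with the length recorded, suits the inductive uniqueness proof better than lists of
  subspaces.\<close>

inductive jh :: "'a::nonarch_local_field pgl set \<Rightarrow> ('a pgl, 'v) rep \<Rightarrow> ('a pgl, 'w) rep \<Rightarrow> 'v set \<Rightarrow> nat \<Rightarrow> nat \<Rightarrow> bool"
  for K M L where
    zero: "jh K M L {\<zero>\<^bsub>M\<^esub>} 0 0"
  | step: "jh K M L N n c \<Longrightarrow> irreducible_subquot K M U N \<Longrightarrow>
      jh K M L U (Suc n) (c + (if rep_iso K (subquot M U N) L then 1 else 0))"

context arep
begin

lemma subrep_pair_subquot: "subrep K M W \<Longrightarrow> subrep K M W' \<Longrightarrow> W \<subseteq> W' \<Longrightarrow> subrep_pair K (M\<lparr>carrier := W'\<rparr>) W"
  by (simp add: subrep_pair_def subrep_pair_axioms_def arep_subrep subrep_trans)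

lemma arep_subquot: "subrep K M W \<Longrightarrow> subrep K M W' \<Longrightarrow> W \<subseteq> W' \<Longrightarrow> arep K (subquot M W' W)"
  using subrep_pair.quot_arep[OF subrep_pair_subquot] .

text \<open>Half of the correspondence between subrepresentations of a quotient and those lying
  between \<open>N\<close> and \<open>U\<close>; \<open>irreducible_subquotI\<close> is the other
  half. Together they replace irreducibility of the quotient by maximality of \<open>N\<close> in
  \<open>U\<close>.\<close>

lemma irreducible_subquot_between:
  assumes "irreducible_subquot K M U N"
  shows "N \<noteq> U" "subrep K M Y \<Longrightarrow> N \<subseteq> Y \<Longrightarrow> Y \<subseteq> U \<Longrightarrow> Y = N \<or> Y = U"
proof -
  have s: "subrep K M N" "subrep K M U" "N \<subseteq> U" and irr: "irreducible_rep K (subquot M U N)"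
    using assms by (auto simp: irreducible_subquot_def)
  interpret Q: subrep_pair K "M\<lparr>carrier := U\<rparr>" N by (rule subrep_pair_subquot[OF s])
  have cz: "N +>\<^bsub>M\<lparr>carrier := U\<rparr>\<^esub> v = \<zero>\<^bsub>subquot M U N\<^esub> \<longleftrightarrow> v \<in> N" if "v \<in> U" for v
    using Q.coset_zero_iff[of v] Q.quot_zero that by simp
  show "N \<noteq> U"
  proof
    assume "N = U"
    then have "(\<lambda>v. N +>\<^bsub>M\<lparr>carrier := U\<rparr>\<^esub> v) ` U = (\<lambda>v. \<zero>\<^bsub>subquot M U N\<^esub>) ` U"
      using cz by (intro image_cong) auto
    then have "carrier (subquot M U N) = {\<zero>\<^bsub>subquot M U N\<^esub>}"
      using subrepD(2)[OF s(2)] by (auto simp: Q.quot_carrier)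
    then show False using irr by (simp add: irreducible_rep_def)
  qed
  assume Y: "subrep K M Y" "N \<subseteq> Y" "Y \<subseteq> U"
  let ?Y = "(\<lambda>v. N +>\<^bsub>M\<lparr>carrier := U\<rparr>\<^esub> v) ` Y"
  have "subrep K (subquot M U N) ?Y"
    by (rule subrep_image[OF Q.arep_axioms Q.quot_arep Q.quot_hom]) (use Y s in \<open>simp add: subrep_trans\<close>)
  then consider "?Y = {\<zero>\<^bsub>subquot M U N\<^esub>}" | "?Y = carrier (subquot M U N)"
    using irr by (auto simp: irreducible_rep_def)
  then show "Y = N \<or> Y = U"
  proof cases
    case 1
    have "Y \<subseteq> N"
    proof
      fix y assume y: "y \<in> Y"
      then have "N +>\<^bsub>M\<lparr>carrier := U\<rparr>\<^esub> y \<in> ?Y" by (rule imageI)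
      then have "N +>\<^bsub>M\<lparr>carrier := U\<rparr>\<^esub> y = \<zero>\<^bsub>subquot M U N\<^esub>" unfolding 1 by simp
      then show "y \<in> N" using cz[of y] y Y(3) by auto
    qed
    then show ?thesis using Y by blast
  next
    case 2
    have "U \<subseteq> Y"
    proof
      fix u assume u: "u \<in> U"
      then have "N +>\<^bsub>M\<lparr>carrier := U\<rparr>\<^esub> u \<in> ?Y" using 2 by (auto simp: Q.quot_carrier)
      then obtain y where y: "y \<in> Y" "N +>\<^bsub>M\<lparr>carrier := U\<rparr>\<^esub> u = N +>\<^bsub>M\<lparr>carrier := U\<rparr>\<^esub> y" by blast
      have yU: "y \<in> U" using y Y by blast
      have "u \<ominus>\<^bsub>M\<lparr>carrier := U\<rparr>\<^esub> y \<in> Y" using Q.coset_eq_iff[of u y] u yU y Y(2) by auto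
      then have "(u \<ominus>\<^bsub>M\<lparr>carrier := U\<rparr>\<^esub> y) \<oplus> y \<in> Y" using subrepD(3)[OF Y(1)] y by blast
      moreover have "(u \<ominus>\<^bsub>M\<lparr>carrier := U\<rparr>\<^esub> y) \<oplus> y = u"
        using u yU Q.a_assoc[of u "\<ominus>\<^bsub>M\<lparr>carrier := U\<rparr>\<^esub> y" y] Q.l_neg[of y] Q.r_zero[of u] Q.a_inv_closed[of y] by (simp add: Q.minus_eq)
      ultimately show "u \<in> Y" by simp
    qed
    then show ?thesis using Y by blast
  qed
qed

lemma irreducible_subquotI:
  assumes s: "subrep K M N" "subrep K M U" "N \<subseteq> U" "N \<noteq> U"
    and max: "\<And>Y. subrep K M Y \<Longrightarrow> N \<subseteq> Y \<Longrightarrow> Y \<subseteq> U \<Longrightarrow> Y = N \<or> Y = U"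
  shows "irreducible_subquot K M U N"
proof -
  interpret Q: subrep_pair K "M\<lparr>carrier := U\<rparr>" N by (rule subrep_pair_subquot[OF s(1-3)])
  let ?p = "\<lambda>v. N +>\<^bsub>M\<lparr>carrier := U\<rparr>\<^esub> v"
  have cz: "?p v = \<zero>\<^bsub>subquot M U N\<^esub> \<longleftrightarrow> v \<in> N" if "v \<in> U" for v
    using Q.coset_zero_iff[of v] Q.quot_zero that by simp
  obtain u where u: "u \<in> U" "u \<notin> N" using s(3,4) by blast
  have "carrier (subquot M U N) \<noteq> {\<zero>\<^bsub>subquot M U N\<^esub>}"
    using cz[OF u(1)] u by (auto simp: Q.quot_carrier)
  moreover have "Y = {\<zero>\<^bsub>subquot M U N\<^esub>} \<or> Y = carrier (subquot M U N)" if Y: "subrep K (subquot M U N) Y" for Y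
  proof -
    let ?W = "{v \<in> U. ?p v \<in> Y}"
    note Y' = arep.subrepD[OF Q.quot_arep Y]
    have "subrep K (M\<lparr>carrier := U\<rparr>) ?W"
      using subrep_vimage[OF Q.arep_axioms Q.quot_arep Q.quot_hom Y] by simp
    then have "subrep K M ?W" using subrep_trans[OF s(2)] by blast
    moreover have "N \<subseteq> ?W"
    proof
      fix v assume v: "v \<in> N"
      then have "?p v = \<zero>\<^bsub>subquot M U N\<^esub>" using cz[of v] s(3) by blast
      then show "v \<in> ?W" using Y'(2) v s(3) by auto
    qed
    ultimately have W: "?W = N \<or> ?W = U" by (intro max) auto
    have Y: "Y = ?p ` ?W" using Y'(1) by (auto simp: Q.quot_carrier)
    have "?p ` N = (\<lambda>v. \<zero>\<^bsub>subquot M U N\<^esub>) ` N" using cz s(3) by (intro image_cong) auto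
    then have N: "?p ` N = {\<zero>\<^bsub>subquot M U N\<^esub>}" using subrepD(2)[OF s(1)] by auto
    from W show ?thesis
    proof
      assume "?W = N"
      then have "Y = ?p ` N" by (subst Y) (simp only:)
      then show ?thesis using N by simp
    next
      assume "?W = U"
      then have "Y = ?p ` U" by (subst Y) (simp only:)
      then show ?thesis by (simp add: Q.quot_carrier)
    qed
  qed
  ultimately show ?thesis using s by (simp add: irreducible_subquot_def irreducible_rep_def)
qed

lemma second_iso:
  assumes N: "subrep K M N" and N': "subrep K M N'" and U: "subrep K M U" "N \<subseteq> U" "N' \<subseteq> U"
    and sum: "\<And>u. u \<in> U \<Longrightarrow> \<exists>n\<in>N. \<exists>n'\<in>N'. u = n \<oplus> n'"
  shows "rep_iso K (subquot M N' (N \<inter> N')) (subquot M U N)" "subrep K M (N \<inter> N')"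
proof -
  show int: "subrep K M (N \<inter> N')"
    by (rule subrepI) (use subrepD[OF N] subrepD[OF N'] in auto)
  interpret A: subrep_pair K "M\<lparr>carrier := N'\<rparr>" "N \<inter> N'" by (rule subrep_pair_subquot[OF int N']) simp
  interpret Q: subrep_pair K "M\<lparr>carrier := U\<rparr>" N by (rule subrep_pair_subquot[OF N U(1,2)])
  let ?p = "\<lambda>v. N +>\<^bsub>M\<lparr>carrier := U\<rparr>\<^esub> v"
  show "rep_iso K (subquot M N' (N \<inter> N')) (subquot M U N)"
  proof (rule A.quot_iso[OF _ Q.quot_arep])
    show "rep_hom K ?p (M\<lparr>carrier := N'\<rparr>) (subquot M U N)"
      using Q.quot_hom U(3) by (auto simp: rep_hom_def subset_iff)
    show "?p ` carrier (M\<lparr>carrier := N'\<rparr>) = carrier (subquot M U N)"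
    proof
      show "carrier (subquot M U N) \<subseteq> ?p ` carrier (M\<lparr>carrier := N'\<rparr>)"
      proof
        fix C assume "C \<in> carrier (subquot M U N)"
        then obtain u where u: "u \<in> U" "C = ?p u" by (auto simp: Q.quot_carrier)
        obtain n n' where nn: "n \<in> N" "n' \<in> N'" "u = n \<oplus> n'" using sum[OF u(1)] by blast
        have nU: "n \<in> U" "n' \<in> U" using nn U by auto
        have "u \<ominus>\<^bsub>M\<lparr>carrier := U\<rparr>\<^esub> n' = n"
          using nn nU Q.a_assoc[of n n' "\<ominus>\<^bsub>M\<lparr>carrier := U\<rparr>\<^esub> n'"] Q.r_neg[of n'] Q.r_zero[of n] Q.a_inv_closed[of n'] by (simp add: Q.minus_eq)
        then have "?p u = ?p n'" using Q.coset_eq_iff[of u n'] u nU nn by simp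
        then show "C \<in> ?p ` carrier (M\<lparr>carrier := N'\<rparr>)" using u nn by auto
      qed
    qed (use U(3) in \<open>auto simp: Q.quot_carrier\<close>)
    show "?p v = \<zero>\<^bsub>subquot M U N\<^esub> \<longleftrightarrow> v \<in> N \<inter> N'" if "v \<in> carrier (M\<lparr>carrier := N'\<rparr>)" for v
      using that U(3) Q.coset_zero_iff[of v] by (auto simp: Q.quot_zero)
  qed
qed

lemma sum_subrep:
  assumes N: "subrep K M N" and N': "subrep K M N'"
  shows "subrep K M {n \<oplus> n' | n n'. n \<in> N \<and> n' \<in> N'}" (is "subrep K M ?S")
    and "N \<subseteq> {n \<oplus> n' | n n'. n \<in> N \<and> n' \<in> N'}" "N' \<subseteq> {n \<oplus> n' | n n'. n \<in> N \<and> n' \<in> N'}"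
proof -
  note n = subrepD[OF N] and n' = subrepD[OF N']
  have c: "x \<in> carrier M" if "x \<in> N \<or> x \<in> N'" for x using that n(1) n'(1) by blast
  show "subrep K M ?S"
  proof (rule subrepI)
    fix v w assume "v \<in> ?S" "w \<in> ?S"
    then obtain a a' b b' where ab: "a \<in> N" "a' \<in> N'" "b \<in> N" "b' \<in> N'" "v = a \<oplus> a'" "w = b \<oplus> b'" by blast
    then have "v \<oplus> w = (a \<oplus> b) \<oplus> (a' \<oplus> b')" using c by (simp add: a_ac)
    then show "v \<oplus> w \<in> ?S" using ab n(3) n'(3) by blast
  next
    fix a v assume "v \<in> ?S"
    then obtain x y where xy: "x \<in> N" "y \<in> N'" "v = x \<oplus> y" by blast
    then have "a \<odot>\<^bsub>M\<^esub> v = a \<odot>\<^bsub>M\<^esub> x \<oplus> a \<odot>\<^bsub>M\<^esub> y" using c by (simp add: smult_r_distr)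
    then show "a \<odot>\<^bsub>M\<^esub> v \<in> ?S" using xy n(4) n'(4) by blast
  next
    fix g v assume g: "g \<in> K" and "v \<in> ?S"
    then obtain x y where xy: "x \<in> N" "y \<in> N'" "v = x \<oplus> y" by blast
    then have "ract M g v = ract M g x \<oplus> ract M g y" using c g by (simp add: act_add)
    then show "ract M g v \<in> ?S" using xy g n(5) n'(5) by blast
  next
    have "\<zero> = \<zero> \<oplus> \<zero>" by simp
    then show "\<zero> \<in> ?S" using n(2) n'(2) by blast
  qed (use c in auto)
  have "x = x \<oplus> \<zero>" "x = \<zero> \<oplus> x" if "x \<in> N \<or> x \<in> N'" for x using c[OF that] by auto
  then show "N \<subseteq> ?S" "N' \<subseteq> ?S" using n(2) n'(2) by blast+
qed

lemma irreducible_subquot_zero: "\<not> irreducible_subquot K M {\<zero>} N"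
proof
  assume i: "irreducible_subquot K M {\<zero>} N"
  then have "N \<subseteq> {\<zero>}" "subrep K M N" by (auto simp: irreducible_subquot_def)
  then have "N = {\<zero>}" using subrepD(2)[of N] by blast
  then show False using irreducible_subquot_between(1)[OF i] by blast
qed

text \<open>The classical exchange. Two distinct maximal subrepresentations \<open>N\<close> and
  \<open>N'\<close> of \<open>U\<close> add up to \<open>U\<close>, so by the second isomorphism
  theorem \<open>N\<close> and \<open>N'\<close> modulo their intersection are \<open>U\<close>
  modulo \<open>N'\<close> and \<open>U\<close> modulo \<open>N\<close>. Extending one series of the
  intersection through either of them lists the same two top factors in opposite order. The
  assumption \<open>ex\<close> supplies that series.\<close>

theorem jh_unique:
  assumes ex: "\<And>U. subrep K M U \<Longrightarrow> \<exists>n c. jh K M L U n c"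
  shows "jh K M L U n c \<Longrightarrow> jh K M L U n' c' \<Longrightarrow> n = n' \<and> c = c'"
proof (induction n arbitrary: U c n' c')
  case 0
  then have "U = {\<zero>}" "c = 0" by (auto elim: jh.cases)
  with 0(2) show ?case by cases (auto simp: irreducible_subquot_zero)
next
  case (Suc n)
  obtain N c0 where N: "jh K M L N n c0" "irreducible_subquot K M U N"
    "c = c0 + (if rep_iso K (subquot M U N) L then 1 else 0)"
    using Suc.prems(1) by (auto elim: jh.cases)
  note sN = N(2)[unfolded irreducible_subquot_def]
  have "U \<noteq> {\<zero>}" using N(2) irreducible_subquot_zero by blast
  with Suc.prems(2) obtain N' n0' c0' where N': "jh K M L N' n0' c0'" "irreducible_subquot K M U N'" "n' = Suc n0'"
    "c' = c0' + (if rep_iso K (subquot M U N') L then 1 else 0)"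
    by cases auto
  note sN' = N'(2)[unfolded irreducible_subquot_def]
  show ?case
  proof (cases "N = N'")
    case True
    then show ?thesis using Suc.IH[OF N(1), of n0' c0'] N N' by simp
  next
    case False
    let ?S = "{a \<oplus> b | a b. a \<in> N \<and> b \<in> N'}"
    have S: "subrep K M ?S" "N \<subseteq> ?S" "N' \<subseteq> ?S" using sum_subrep sN sN' by blast+
    have "?S \<subseteq> U" using sN sN' subrepD(3)[of U] by blast
    then have "?S = N \<or> ?S = U" using irreducible_subquot_between(2)[OF N(2) S(1,2)] by blast
    moreover have "?S \<noteq> N"
    proof
      assume "?S = N"
      then have "N' \<subseteq> N" using S(3) by simp
      then have "N = N' \<or> N = U" using irreducible_subquot_between(2)[OF N'(2)] sN by blast
      then show False using False irreducible_subquot_between(1)[OF N(2)] by blast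
    qed
    ultimately have SU: "?S = U" by blast
    have sum: "\<exists>a\<in>N. \<exists>b\<in>N'. u = a \<oplus> b" if "u \<in> U" for u using that SU by blast
    have sum': "\<exists>b\<in>N'. \<exists>a\<in>N. u = b \<oplus> a" if u: "u \<in> U" for u
    proof -
      obtain a b where ab: "a \<in> N" "b \<in> N'" "u = a \<oplus> b" using sum[OF u] by blast
      then have "a \<in> carrier M" "b \<in> carrier M" using subrepD(1)[of N] subrepD(1)[of N'] sN sN' by blast+
      then have "u = b \<oplus> a" using ab by (simp add: a_comm)
      then show ?thesis using ab by blast
    qed
    let ?Q = "N \<inter> N'"
    have Q: "subrep K M ?Q" using second_iso(2)[OF _ _ _ _ _ sum] sN sN' by blast
    have i1: "rep_iso K (subquot M N' ?Q) (subquot M U N)" using second_iso(1)[OF _ _ _ _ _ sum] sN sN' by blast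
    have i2: "rep_iso K (subquot M N ?Q) (subquot M U N')"
      using second_iso(1)[OF _ _ _ _ _ sum'] sN sN' by (simp add: Int_commute)
    have ar: "arep K (subquot M N' ?Q)" "arep K (subquot M N ?Q)" "arep K (subquot M U N)" "arep K (subquot M U N')"
      using arep_subquot[OF Q, of N'] arep_subquot[OF Q, of N] arep_subquot[of N U] arep_subquot[of N' U] sN sN' by auto
    note j1 = rep_iso_sym[OF ar(1) i1] and j2 = rep_iso_sym[OF ar(2) i2]
    have "irreducible_subquot K M N' ?Q" "irreducible_subquot K M N ?Q"
      using irreducible_rep_iso[OF ar(3,1) j1] irreducible_rep_iso[OF ar(4,2) j2] sN sN' Q
      by (auto simp: irreducible_subquot_def)
    moreover obtain m e where m: "jh K M L ?Q m e" using ex[OF Q] by blast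
    ultimately have q: "jh K M L N' (Suc m) (e + (if rep_iso K (subquot M N' ?Q) L then 1 else 0))"
      "jh K M L N (Suc m) (e + (if rep_iso K (subquot M N ?Q) L then 1 else 0))"
      using jh.step[OF m] by blast+
    have e: "rep_iso K (subquot M N' ?Q) L \<longleftrightarrow> rep_iso K (subquot M U N) L"
      "rep_iso K (subquot M N ?Q) L \<longleftrightarrow> rep_iso K (subquot M U N') L"
      using rep_iso_trans i1 i2 j1 j2 by blast+
    have 1: "n = Suc m" "c0 = e + (if rep_iso K (subquot M N ?Q) L then 1 else 0)"
      using Suc.IH[OF N(1) q(2)] by auto
    have "n = n0'" "e + (if rep_iso K (subquot M N' ?Q) L then 1 else 0) = c0'"
      using Suc.IH[OF q(1)[folded 1(1)] N'(1)] by auto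
    then show ?thesis using 1(2) N(3) N'(3,4) e by simp
  qed
qed

lemma composition_series_jh:
  assumes "composition_series K (M\<lparr>carrier := U\<rparr>) Ws" "subrep K M U"
  shows "jh K M L U (length Ws - 1) (card {i. Suc i < length Ws \<and> rep_iso K (subquot M (Ws ! Suc i) (Ws ! i)) L})"
proof -
  have irr: "irreducible_subquot K M (Ws ! Suc i) (Ws ! i)" if "Suc i < length Ws" for i
    using assms that by (auto simp: composition_series_def irreducible_subquot_def subrep_trans)
  have "jh K M L (Ws ! j) j (card {i. i < j \<and> rep_iso K (subquot M (Ws ! Suc i) (Ws ! i)) L})" if "j < length Ws" for j
    using that
  proof (induction j)
    case 0
    then show ?case using assms(1) jh.zero[of K M L] by (simp add: composition_series_def hd_conv_nth)
  next
    case (Suc j)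
    have "{i. i < Suc j \<and> rep_iso K (subquot M (Ws ! Suc i) (Ws ! i)) L} =
        {i. i < j \<and> rep_iso K (subquot M (Ws ! Suc i) (Ws ! i)) L} \<union> (if rep_iso K (subquot M (Ws ! Suc j) (Ws ! j)) L then {j} else {})"
      by (auto simp: less_Suc_eq)
    then have "card {i. i < Suc j \<and> rep_iso K (subquot M (Ws ! Suc i) (Ws ! i)) L} =
        card {i. i < j \<and> rep_iso K (subquot M (Ws ! Suc i) (Ws ! i)) L} + (if rep_iso K (subquot M (Ws ! Suc j) (Ws ! j)) L then 1 else 0)"
      by simp
    then show ?case using jh.step[OF Suc.IH irr[of j]] Suc.prems by simp
  qed
  from this[of "length Ws - 1"] show ?thesis
    using assms(1) by (auto simp: composition_series_def last_conv_nth less_diff_conv)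
qed

lemma jh_composition_series:
  "jh K M L U n c \<Longrightarrow> \<exists>Ws. composition_series K (M\<lparr>carrier := U\<rparr>) Ws \<and>
     c = card {i. Suc i < length Ws \<and> rep_iso K (subquot M (Ws ! Suc i) (Ws ! i)) L}"
proof (induction rule: jh.induct)
  case zero
  show ?case by (rule exI[of _ "[{\<zero>}]"]) (simp add: composition_series_def)
next
  case (step N n c U)
  then obtain Ws where Ws: "composition_series K (M\<lparr>carrier := N\<rparr>) Ws"
    "c = card {i. Suc i < length Ws \<and> rep_iso K (subquot M (Ws ! Suc i) (Ws ! i)) L}" by blast
  have s: "subrep K M N" "subrep K M U" "N \<subseteq> U" using step(2) by (auto simp: irreducible_subquot_def)
  have ne: "Ws \<noteq> []" and lastN: "Ws ! (length Ws - 1) = N"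
    using Ws(1) by (auto simp: composition_series_def last_conv_nth)
  let ?Ws = "Ws @ [U]"
  have "irreducible_subquot K (M\<lparr>carrier := U\<rparr>) (?Ws ! Suc i) (?Ws ! i)" if "Suc i < length ?Ws" for i
  proof (cases "Suc i < length Ws")
    case True
    then have "irreducible_subquot K (M\<lparr>carrier := N\<rparr>) (Ws ! Suc i) (Ws ! i)" using Ws(1) by (simp add: composition_series_def)
    then show ?thesis using True s by (auto simp: irreducible_subquot_def nth_append subrep_trans)
  next
    case False
    then have "i = length Ws - 1" using that by simp
    then show ?thesis using step(2) lastN ne s by (simp add: irreducible_subquot_def nth_append subrep_trans)
  qed
  then have "composition_series K (M\<lparr>carrier := U\<rparr>) ?Ws"
    using Ws(1) ne by (auto simp: composition_series_def)
  moreover have "{i. Suc i < length ?Ws \<and> rep_iso K (subquot M (?Ws ! Suc i) (?Ws ! i)) L} =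
      {i. Suc i < length Ws \<and> rep_iso K (subquot M (Ws ! Suc i) (Ws ! i)) L} \<union>
      (if rep_iso K (subquot M U N) L then {length Ws - 1} else {})"
  proof -
    have 1: "Suc i < length ?Ws \<longleftrightarrow> Suc i < length Ws \<or> i = length Ws - 1" for i using ne by (cases Ws) auto
    have 2: "subquot M (?Ws ! Suc i) (?Ws ! i) = subquot M (Ws ! Suc i) (Ws ! i)" if "Suc i < length Ws" for i
      using that by (simp add: nth_append)
    have 3: "subquot M (?Ws ! Suc (length Ws - 1)) (?Ws ! (length Ws - 1)) = subquot M U N"
      using lastN ne by (simp add: nth_append)
    show ?thesis
    proof (rule Set.set_eqI)
      fix x
      consider "Suc x < length Ws" "x \<noteq> length Ws - 1" | "x = length Ws - 1" "\<not> Suc x < length Ws" |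
        "\<not> Suc x < length Ws" "x \<noteq> length Ws - 1" by fastforce
      then show "x \<in> {i. Suc i < length ?Ws \<and> rep_iso K (subquot M (?Ws ! Suc i) (?Ws ! i)) L} \<longleftrightarrow>
        x \<in> {i. Suc i < length Ws \<and> rep_iso K (subquot M (Ws ! Suc i) (Ws ! i)) L} \<union>
          (if rep_iso K (subquot M U N) L then {length Ws - 1} else {})"
        by cases (use 1[of x] 2[of x] 3 in \<open>auto simp del: length_append\<close>)
    qed
  qed
  moreover have "finite {i. Suc i < length Ws \<and> rep_iso K (subquot M (Ws ! Suc i) (Ws ! i)) L}"
    by (rule finite_subset[of _ "{..<length Ws}"]) auto
  ultimately show ?case using Ws(2) ne by (intro exI[of _ ?Ws]) (auto simp: card_insert_if)
qed

lemma rep_mult_jh: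
  assumes ex: "\<And>U. subrep K M U \<Longrightarrow> \<exists>n c. jh K M L U n c" and "jh K M L (carrier M) n c"
  shows "rep_mult K M L = c"
proof -
  have M: "M\<lparr>carrier := carrier M\<rparr> = M" by simp
  show ?thesis
    unfolding rep_mult_def
  proof (rule the_equality)
    show "\<exists>Ws. composition_series K M Ws \<and> c = card {i. Suc i < length Ws \<and> rep_iso K (subquot M (Ws ! Suc i) (Ws ! i)) L}"
      using jh_composition_series[OF assms(2)] by simp
    fix m assume "\<exists>Ws. composition_series K M Ws \<and> m = card {i. Suc i < length Ws \<and> rep_iso K (subquot M (Ws ! Suc i) (Ws ! i)) L}"
    then obtain Ws where "composition_series K M Ws" "m = card {i. Suc i < length Ws \<and> rep_iso K (subquot M (Ws ! Suc i) (Ws ! i)) L}" by blast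
    then have "jh K M L (carrier M) (length Ws - 1) m" using composition_series_jh[of "carrier M" Ws L] subrep_carrier by simp
    then show "m = c" using jh_unique[OF ex assms(2)] by blast
  qed
qed

end

text \<open>Series are constructed inside a space of functions, where orthogonal complements exist,
  and then carried to the cohomology of the local graph, where the multiplicities are
  defined.\<close>

lemma jh_transport:
  assumes "arep K M" "arep K M'" and b: "bij_betw \<phi> (carrier M) (carrier M')" and h: "rep_hom K \<phi> M M'"
  shows "jh K M L U n c \<Longrightarrow> jh K M' L (\<phi> ` U) n c"
proof (induction rule: jh.induct)
  case zero
  show ?case using jh.zero[of K M' L] arep.hom_zero[OF assms(1) h assms(2)] by simp
next
  case (step N n c U)
  have s: "subrep K M N" "subrep K M U" "N \<subseteq> U" "irreducible_rep K (subquot M U N)"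
    using step(2) by (auto simp: irreducible_subquot_def)
  have s': "subrep K M' (\<phi> ` N)" "subrep K M' (\<phi> ` U)" "\<phi> ` N \<subseteq> \<phi> ` U"
    using subrep_image[OF assms(1,2) h] s by auto
  have i: "rep_iso K (subquot M U N) (subquot M' (\<phi> ` U) (\<phi> ` N))"
    by (rule subquot_iso[OF assms s(1-3)])
  have ar: "arep K (subquot M U N)" "arep K (subquot M' (\<phi> ` U) (\<phi> ` N))"
    using arep.arep_subquot[OF assms(1) s(1-3)] arep.arep_subquot[OF assms(2) s'] by auto
  have "irreducible_subquot K M' (\<phi> ` U) (\<phi> ` N)"
    using irreducible_rep_iso[OF ar i s(4)] s' by (simp add: irreducible_subquot_def)
  moreover have "rep_iso K (subquot M U N) L \<longleftrightarrow> rep_iso K (subquot M' (\<phi> ` U) (\<phi> ` N)) L"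
    using rep_iso_trans[OF i] rep_iso_trans[OF rep_iso_sym[OF ar(1) i]] by blast
  ultimately show ?case using jh.step[OF step(3)] by simp
qed

section \<open>Semisimplicity of permutation representations\<close>

interpretation fv: vector_space "\<lambda>(c::complex) (f::'x \<Rightarrow> complex) x. c * f x"
  by unfold_locales (auto simp: fun_eq_iff algebra_simps)

section \<open>Orthogonal projection in finite-dimensional function spaces\<close>

definition ip :: "'x set \<Rightarrow> ('x \<Rightarrow> complex) \<Rightarrow> ('x \<Rightarrow> complex) \<Rightarrow> complex"
  where "ip S f h = (\<Sum>a\<in>S. f a * cnj (h a))"

lemma ip_add_left: "ip S (\<lambda>x. f x + g x) h = ip S f h + ip S g h"
  and ip_add_right: "ip S h (\<lambda>x. f x + g x) = ip S h f + ip S h g"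
  and ip_smult_left: "ip S (\<lambda>x. c * f x) h = c * ip S f h"
  and ip_smult_right: "ip S h (\<lambda>x. c * f x) = cnj c * ip S h f"
  and ip_diff_left: "ip S (\<lambda>x. f x - g x) h = ip S f h - ip S g h"
  and ip_zero: "ip S (\<lambda>x. 0) h = 0" "ip S h (\<lambda>x. 0) = 0"
  by (simp_all add: ip_def sum.distrib sum_subtractf sum_distrib_left algebra_simps)

lemma ip_sum_left: "ip S (\<lambda>x. \<Sum>i\<in>I. f i x) h = (\<Sum>i\<in>I. ip S (f i) h)"
  unfolding ip_def sum_distrib_right by (rule sum.swap)

lemma ip_self: "finite S \<Longrightarrow> f \<in> fin_supp S \<Longrightarrow> ip S f f = 0 \<longleftrightarrow> f = (\<lambda>x. 0)"
proof -
  assume S: "finite S" and f: "f \<in> fin_supp S"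
  have "ip S f f = of_real (\<Sum>a\<in>S. (cmod (f a))\<^sup>2)"
    by (simp only: ip_def of_real_sum complex_norm_square)
  then have "ip S f f = 0 \<longleftrightarrow> (\<Sum>a\<in>S. (cmod (f a))\<^sup>2) = 0" by (simp only: of_real_eq_0_iff)
  also have "\<dots> \<longleftrightarrow> (\<forall>a\<in>S. f a = 0)" using S by (simp add: sum_nonneg_eq_0_iff)
  finally show ?thesis using f by (auto simp: fin_supp_iff fun_eq_iff)
qed

lemma subspace_fv_iff: "fv.subspace W \<longleftrightarrow> (\<lambda>x. 0) \<in> W \<and> (\<forall>f\<in>W. \<forall>h\<in>W. (\<lambda>x. f x + h x) \<in> W) \<and>
    (\<forall>c. \<forall>f\<in>W. (\<lambda>x. c * f x) \<in> W)"
  by (auto simp: fv.subspace_def zero_fun_def plus_fun_def)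

text \<open>One step of Gram-Schmidt: replace the new vector \<open>b\<close> by its component
  \<open>b'\<close> orthogonal to the previous span, then correct the earlier projection by a
  multiple of \<open>b'\<close>. If \<open>b'\<close> vanishes, \<open>b\<close> lies in that span
  and adds no condition.\<close>

lemma projection_span:
  assumes S: "finite S" and "finite B" "B \<subseteq> fin_supp S"
  shows "f \<in> fin_supp S \<Longrightarrow> \<exists>w\<in>fv.span B. \<forall>b\<in>B. ip S (\<lambda>x. f x - w x) b = 0"
  using assms(2,3)
proof (induction B arbitrary: f rule: finite_induct)
  case empty
  show ?case by (auto intro: exI[of _ "\<lambda>x. 0"] simp: zero_fun_def)
next
  case (insert b B)
  have sub: "fv.span B \<subseteq> fin_supp S"
    by (rule fv.span_minimal) (use insert.prems in \<open>auto simp: subspace_fv_iff fin_supp_add fin_supp_smult\<close>)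
  have orth: "ip S g v = 0" if "\<forall>b\<in>B. ip S g b = 0" "v \<in> fv.span B" for g v
  proof -
    have "fv.span B \<subseteq> {v. ip S g v = 0}"
      by (rule fv.span_minimal) (use that in \<open>auto simp: subspace_fv_iff ip_zero ip_add_right ip_smult_right\<close>)
    then show ?thesis using that by blast
  qed
  have IH: "\<exists>w\<in>fv.span B. \<forall>b\<in>B. ip S (\<lambda>x. f x - w x) b = 0" if "f \<in> fin_supp S" for f
    using insert.IH[OF that] insert.prems by simp
  have "b \<in> fin_supp S" using insert.prems by simp
  from IH[OF this] obtain p where p: "p \<in> fv.span B" "\<forall>a\<in>B. ip S (\<lambda>x. b x - p x) a = 0" by blast
  from IH[OF insert.prems(1)] obtain w0 where w0: "w0 \<in> fv.span B" "\<forall>a\<in>B. ip S (\<lambda>x. f x - w0 x) a = 0" by blast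
  have mono: "v \<in> fv.span (insert b B)" if "v \<in> fv.span B" for v
    using that fv.span_mono[of B "insert b B"] by blast
  define b' where "b' = (\<lambda>x. b x - p x)"
  have b'S: "b' \<in> fin_supp S"
    using fin_supp_add[OF \<open>b \<in> fin_supp S\<close> fin_supp_smult[of p S "-1"]] p sub by (auto simp: b'_def)
  have b: "b = (\<lambda>x. b' x + p x)" by (simp add: b'_def)
  show ?case
  proof (cases "b' = (\<lambda>x. 0)")
    case True
    then have "b = p" using b by simp
    then show ?thesis using w0 orth[OF w0(2)] p(1) mono by (intro bexI[of _ w0]) auto
  next
    case False
    define c where "c = ip S (\<lambda>x. f x - w0 x) b' / ip S b' b'"
    have cc: "c * ip S b' b' = ip S (\<lambda>x. f x - w0 x) b'"
      using False ip_self[OF S b'S] by (simp add: c_def)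
    define w where "w = (\<lambda>x. w0 x + c * b' x)"
    have "b' = b - p" by (simp add: b'_def fun_diff_def)
    then have "b' \<in> fv.span (insert b B)" using mono[OF p(1)] fv.span_base[of b "insert b B"] fv.span_diff by blast
    then have "w \<in> fv.span (insert b B)"
      using fv.span_add[OF mono[OF w0(1)] fv.span_scale[of b' "insert b B" c]] by (simp add: w_def plus_fun_def)
    moreover have fw: "(\<lambda>x. f x - w x) = (\<lambda>x. (f x - w0 x) - c * b' x)" by (auto simp: w_def)
    have 1: "ip S (\<lambda>x. f x - w x) a = 0" if "a \<in> B" for a
      unfolding fw ip_diff_left[of S "\<lambda>x. f x - w0 x"] ip_smult_left using that w0(2) p(2) by (simp add: b'_def)
    moreover have "ip S (\<lambda>x. f x - w x) b = 0"
    proof -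
      have "ip S (\<lambda>x. f x - w x) b' = 0"
        unfolding fw ip_diff_left[of S "\<lambda>x. f x - w0 x"] ip_smult_left using cc by simp
      moreover have "ip S (\<lambda>x. f x - w x) p = 0" using orth[OF _ p(1)] 1 by blast
      ultimately show ?thesis by (subst b) (simp add: ip_add_right)
    qed
    ultimately show ?thesis by blast
  qed
qed

lemma fin_supp_span: "finite S \<Longrightarrow> fin_supp S \<subseteq> fv.span ((\<lambda>a x. if x = a then 1 else 0) ` S)"
proof (induction S rule: finite_induct)
  case empty
  have "f = 0" if "f \<in> fin_supp {}" for f :: "'a \<Rightarrow> complex" using that by (auto simp: fin_supp_iff)
  then show ?case by auto
next
  case (insert a S)
  let ?E = "(\<lambda>a x. if x = a then 1 else (0::complex)) ` insert a S"
  show ?case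
  proof
    fix f :: "'a \<Rightarrow> complex" assume f: "f \<in> fin_supp (insert a S)"
    define f' where "f' = (\<lambda>x. if x = a then 0 else f x)"
    have "finite {x. f' x \<noteq> 0}" using f by (auto simp: fin_supp_iff f'_def elim: rev_finite_subset)
    then have "f' \<in> fin_supp S" using f by (auto simp: fin_supp_iff f'_def)
    then have "f' \<in> fv.span ?E" using insert.IH fv.span_mono[of "(\<lambda>a x. if x = a then 1 else (0::complex)) ` S" ?E] by blast
    moreover have "(\<lambda>x. f a * (if x = a then 1 else 0)) \<in> fv.span ?E"
      by (rule fv.span_scale[OF fv.span_base]) simp
    moreover have "f = f' + (\<lambda>x. f a * (if x = a then 1 else 0))" by (auto simp: f'_def)
    ultimately show "f \<in> fv.span ?E" using fv.span_add by metis
  qed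
qed

lemma finite_independent:
  assumes "finite S" "fv.independent B" "B \<subseteq> fin_supp S"
  shows "finite B"
  using fv.independent_span_bound[of "(\<lambda>a x. if x = a then 1 else 0) ` S" B] assms fin_supp_span[OF assms(1)] by auto

lemma projection:
  assumes S: "finite S" and W: "fv.subspace W" "W \<subseteq> fin_supp S" and f: "f \<in> fin_supp S"
  obtains w where "w \<in> W" "\<And>v. v \<in> W \<Longrightarrow> ip S (\<lambda>x. f x - w x) v = 0"
proof -
  obtain B where B: "B \<subseteq> W" "fv.independent B" "W \<subseteq> fv.span B" "card B = fv.dim W" by (rule fv.basis_exists)
  have BS: "B \<subseteq> fin_supp S" using B(1) W(2) by (rule order_trans)
  from projection_span[OF S finite_independent[OF S B(2) BS] BS f]
  obtain w where w: "w \<in> fv.span B" "\<forall>b\<in>B. ip S (\<lambda>x. f x - w x) b = 0" ..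
  have "fv.span B \<subseteq> {v. ip S (\<lambda>x. f x - w x) v = 0}"
    by (rule fv.span_minimal) (use w in \<open>auto simp: subspace_fv_iff ip_zero ip_add_right ip_smult_right\<close>)
  moreover have "fv.span B \<subseteq> W" by (rule fv.span_minimal[OF B(1) W(1)])
  ultimately show ?thesis using that w(1) B(3) by blast
qed

text \<open>The dimension serves as the measure for choosing maximal subrepresentations and for the
  induction in \<open>semisimple\<close>, so strict growth is what is needed.\<close>

lemma dim_less:
  assumes S: "finite S" and W: "fv.subspace W" and sub: "W \<subset> W'" "W' \<subseteq> fin_supp S"
  shows "fv.dim W < fv.dim W'"
proof -
  obtain B where B: "B \<subseteq> W" "fv.independent B" "W \<subseteq> fv.span B" "card B = fv.dim W" using fv.basis_exists[of W] by blast
  obtain B' where B': "B' \<subseteq> W'" "fv.independent B'" "W' \<subseteq> fv.span B'" "card B' = fv.dim W'" using fv.basis_exists[of W'] by blast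
  have fin: "finite B" "finite B'" using finite_independent[OF S B(2)] finite_independent[OF S B'(2)] B B' sub by auto
  obtain v where v: "v \<in> W'" "v \<notin> W" using sub by blast
  have "fv.span B \<subseteq> W" by (rule fv.span_minimal[OF B(1) W])
  then have nv: "v \<notin> fv.span B" using v by blast
  then have "fv.independent (insert v B)" by (rule fv.independent_insertI) (rule B(2))
  moreover have "insert v B \<subseteq> fv.span B'" using v B sub B' by blast
  ultimately have "card (insert v B) \<le> card B'" using fv.independent_span_bound[OF fin(2)] by blast
  moreover have "v \<notin> B" using nv fv.span_base by blast
  ultimately show ?thesis using fin B B' by simp
qed

section \<open>Invariant complements in permutation representations\<close>

definition perp :: "'x set \<Rightarrow> ('x \<Rightarrow> complex) set \<Rightarrow> ('x \<Rightarrow> complex) set"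
  where "perp S W = {f \<in> fin_supp S. \<forall>w\<in>W. ip S f w = 0}"

context
  fixes K :: "'a::nonarch_local_field pgl set" and S :: "'a vpath set"
  assumes stable: "stable K S" and fin: "finite S"
begin

interpretation R: arep K "fin_supp_rep S" by (rule fin_supp_arep[OF stable])

lemma subrep_fv: "subrep K (fin_supp_rep S) W \<Longrightarrow> fv.subspace W \<and> W \<subseteq> fin_supp S"
  using R.subrepD[of W, simplified] by (auto simp: subspace_fv_iff)

text \<open>The group permutes the finite set \<open>S\<close>, so the standard hermitian form is
  invariant without averaging over a compact group.\<close>

lemma ip_act:
  assumes g: "g \<in> K"
  shows "ip S (ract (fin_supp_rep S) g f) (ract (fin_supp_rep S) g h) = ip S f h"
proof -
  have gG: "g \<in> carrier PGL" using g stable subgroup.mem_carrier by (auto simp: stable_def)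
  have gi: "inv\<^bsub>PGL\<^esub> g \<in> K" using g stable subgroup.m_inv_closed by (auto simp: stable_def)
  have S: "\<And>k x. k \<in> K \<Longrightarrow> x \<in> S \<Longrightarrow> pact k x \<in> S" "\<And>x. x \<in> S \<Longrightarrow> set x \<subseteq> tree_verts"
    using stable by (auto simp: stable_def)
  have inv: "pact g (pact (inv\<^bsub>PGL\<^esub> g) x) = x" "pact (inv\<^bsub>PGL\<^esub> g) (pact g x) = x" if "x \<in> S" for x
    using S(2)[OF that] gG by (auto simp: subset_iff intro!: map_idI)
  have "bij_betw (pact (inv\<^bsub>PGL\<^esub> g)) S S"
    by (rule bij_betw_byWitness[where f' = "pact g"]) (use inv S(1)[OF g] S(1)[OF gi] in \<open>auto simp del: map_map\<close>)
  from sum.reindex_bij_betw[OF this, of "\<lambda>x. f x * cnj (h x)"] show ?thesis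
    by (simp add: ip_def fin_supp_rep_simps(5) del: map_map)
qed

lemma perp_subrep:
  assumes W: "subrep K (fin_supp_rep S) W" and U: "subrep K (fin_supp_rep S) U"
  shows "subrep K (fin_supp_rep S) (U \<inter> perp S W)"
proof (rule R.subrepI)
  note U' = R.subrepD[OF U, simplified]
  show "ract (fin_supp_rep S) g f \<in> U \<inter> perp S W" if g: "g \<in> K" and f: "f \<in> U \<inter> perp S W" for g f
  proof -
    have fS: "f \<in> fin_supp S" and Ws: "W \<subseteq> fin_supp S" using f subrep_fv[OF W] by (auto simp: perp_def)
    have gi: "inv\<^bsub>PGL\<^esub> g \<in> K" using g stable subgroup.m_inv_closed by (auto simp: stable_def)
    have "ip S (ract (fin_supp_rep S) g f) w = 0" if w: "w \<in> W" for w
    proof -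
      have "ract (fin_supp_rep S) (inv\<^bsub>PGL\<^esub> g) w \<in> W" using R.subrepD(5)[OF W gi w] .
      then have "ip S f (ract (fin_supp_rep S) (inv\<^bsub>PGL\<^esub> g) w) = 0" using f by (simp add: perp_def)
      moreover have "ract (fin_supp_rep S) g (ract (fin_supp_rep S) (inv\<^bsub>PGL\<^esub> g) w) = w"
        using R.act_inv[OF g, of w] w Ws by auto
      ultimately show ?thesis using ip_act[OF g, of f "ract (fin_supp_rep S) (inv\<^bsub>PGL\<^esub> g) w"] by simp
    qed
    moreover have "ract (fin_supp_rep S) g f \<in> U" using U'(5)[OF g] f by blast
    moreover have "ract (fin_supp_rep S) g f \<in> fin_supp S" using R.act_closed[OF g, of f] fS by simp
    ultimately show ?thesis by (auto simp: perp_def)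
  qed
qed (use R.subrepD[OF U, simplified] in
    \<open>auto simp: perp_def ip_zero ip_add_left ip_smult_left fin_supp_add fin_supp_smult\<close>)

lemma perp_split:
  assumes W: "subrep K (fin_supp_rep S) W" and U: "subrep K (fin_supp_rep S) U" "W \<subseteq> U" and u: "u \<in> U"
  obtains w t where "w \<in> W" "t \<in> U \<inter> perp S W" "u = (\<lambda>x. w x + t x)"
proof -
  have uS: "u \<in> fin_supp S" using subrep_fv[OF U(1)] u by blast
  obtain w where w: "w \<in> W" "\<And>v. v \<in> W \<Longrightarrow> ip S (\<lambda>x. u x - w x) v = 0"
    using projection[OF fin conjunct1[OF subrep_fv[OF W]] conjunct2[OF subrep_fv[OF W]] uS] by blast
  define t where "t = (\<lambda>x. u x + (-1) * w x)"
  have "t \<in> U" using R.subrepD(3,4)[OF U(1), simplified] u w(1) U(2) unfolding t_def by blast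
  moreover have "t \<in> perp S W" using \<open>t \<in> U\<close> subrep_fv[OF U(1)] w(2) by (auto simp: perp_def t_def)
  moreover have "u = (\<lambda>x. w x + t x)" by (simp add: t_def)
  ultimately show ?thesis using that[OF w(1)] by blast
qed

text \<open>Realizes a subquotient as an actual subspace of the functions. Only in this form can it
  be induced by \<open>ind\<close>.\<close>

lemma perp_iso:
  assumes W: "subrep K (fin_supp_rep S) W" and U: "subrep K (fin_supp_rep S) U" "W \<subseteq> U"
  shows "rep_iso K ((fin_supp_rep S)\<lparr>carrier := U \<inter> perp S W\<rparr>) (subquot (fin_supp_rep S) U W)"
proof -
  interpret Q: subrep_pair K "(fin_supp_rep S)\<lparr>carrier := U\<rparr>" W by (rule R.subrep_pair_subquot[OF W U])
  let ?p = "\<lambda>v. W +>\<^bsub>(fin_supp_rep S)\<lparr>carrier := U\<rparr>\<^esub> v" and ?T = "U \<inter> perp S W"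
  have m: "v \<ominus>\<^bsub>(fin_supp_rep S)\<lparr>carrier := U\<rparr>\<^esub> w = (\<lambda>x. v x + (-1) * w x)" if "v \<in> U" "w \<in> U" for v w
    using that by (simp add: Q.minus_eq Q.smult_minus_one[of w, symmetric])
  have eq: "?p v = ?p w \<longleftrightarrow> (\<lambda>x. v x + (-1) * w x) \<in> W" if "v \<in> U" "w \<in> U" for v w
    using Q.coset_eq_iff[of v w] m[OF that] that by simp
  have "inj_on ?p ?T"
  proof (rule inj_onI)
    fix s t assume st: "s \<in> ?T" "t \<in> ?T" "?p s = ?p t"
    then have "(\<lambda>x. s x + (-1) * t x) \<in> W" using eq by blast
    moreover have "(\<lambda>x. s x + (-1) * t x) \<in> perp S W"
      using R.subrepD(3,4)[OF perp_subrep[OF W U(1)], simplified] st by blast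
    ultimately have "(\<lambda>x. s x + (-1) * t x) = (\<lambda>x. 0)"
      using ip_self[OF fin] by (auto simp: perp_def)
    then show "s = t" by (auto simp: fun_eq_iff)
  qed
  moreover have "?p ` ?T = carrier (subquot (fin_supp_rep S) U W)"
  proof
    show "carrier (subquot (fin_supp_rep S) U W) \<subseteq> ?p ` ?T"
    proof
      fix C assume "C \<in> carrier (subquot (fin_supp_rep S) U W)"
      then obtain u where u: "u \<in> U" "C = ?p u" by (auto simp: Q.quot_carrier)
      obtain w t where wt: "w \<in> W" "t \<in> ?T" "u = (\<lambda>x. w x + t x)" by (rule perp_split[OF W U u(1)])
      have "(\<lambda>x. u x + (-1) * t x) = w" by (simp add: wt(3))
      then have "?p u = ?p t" using eq[of u t] u wt by auto
      then show "C \<in> ?p ` ?T" using u wt by blast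
    qed
  qed (auto simp: Q.quot_carrier)
  moreover have "rep_hom K ?p ((fin_supp_rep S)\<lparr>carrier := ?T\<rparr>) (subquot (fin_supp_rep S) U W)"
    using Q.quot_hom by (auto simp: rep_hom_def)
  ultimately show ?thesis by (auto simp: rep_iso_iff bij_betw_def)
qed

lemma maximal_subrep:
  assumes U: "subrep K (fin_supp_rep S) U" "U \<noteq> {\<lambda>x. 0}"
  obtains N where "irreducible_subquot K (fin_supp_rep S) U N" "fv.dim N < fv.dim U"
proof -
  let ?P = "\<lambda>N. subrep K (fin_supp_rep S) N \<and> N \<subset> U"
  have z: "?P {\<lambda>x. 0}" using U R.subrep_zero R.subrepD(2)[OF U(1)] by auto
  have dl: "fv.dim N < fv.dim N'" if "subrep K (fin_supp_rep S) N" "N \<subset> N'" "subrep K (fin_supp_rep S) N'" for N N'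
    using dim_less[OF fin _ that(2)] subrep_fv[OF that(1)] subrep_fv[OF that(3)] by blast
  have "\<forall>N. ?P N \<longrightarrow> fv.dim N < fv.dim U" using dl U(1) by blast
  from ex_has_greatest_nat[of ?P, OF z this] have "\<exists>N. ?P N \<and> (\<forall>N'. ?P N' \<longrightarrow> fv.dim N' \<le> fv.dim N)" .
  then obtain N where N: "?P N" "\<And>N'. ?P N' \<Longrightarrow> fv.dim N' \<le> fv.dim N" by blast
  have "irreducible_subquot K (fin_supp_rep S) U N"
  proof (rule R.irreducible_subquotI)
    fix Y assume Y: "subrep K (fin_supp_rep S) Y" "N \<subseteq> Y" "Y \<subseteq> U"
    show "Y = N \<or> Y = U"
    proof (rule ccontr)
      assume "\<not> ?thesis"
      then have "N \<subset> Y" "?P Y" using Y by auto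
      then show False using dl[OF _ _ Y(1), of N] N by force
    qed
  qed (use N U in auto)
  then show ?thesis using that N dl U(1) by blast
qed

text \<open>The chain \<open>N\<close> and the complements \<open>T\<close> are produced together
  because both are needed: multiplicities are counted along the chain, whereas the decomposition of
  the fibre uses the \<open>T i\<close>. The induction splits off the orthogonal complement of a
  maximal subrepresentation.\<close>

theorem semisimple:
  assumes "subrep K (fin_supp_rep S) U"
  shows "\<exists>r N T. N 0 = {\<lambda>x. 0} \<and> N r = U \<and>
    (\<forall>i<r. irreducible_subquot K (fin_supp_rep S) (N (Suc i)) (N i) \<and> subrep K (fin_supp_rep S) (T i) \<and> T i \<subseteq> U \<and>
      rep_iso K ((fin_supp_rep S)\<lparr>carrier := T i\<rparr>) (subquot (fin_supp_rep S) (N (Suc i)) (N i))) \<and>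
    (\<forall>i<r. \<forall>j<r. i \<noteq> j \<longrightarrow> (\<forall>s\<in>T i. \<forall>t\<in>T j. ip S s t = 0)) \<and>
    (\<forall>u\<in>U. \<exists>t\<in>Pi {..<r} T. u = (\<lambda>x. \<Sum>i<r. t i x))"
  using assms
proof (induction "fv.dim U" arbitrary: U rule: less_induct)
  case less
  show ?case
  proof (cases "U = {\<lambda>x. 0}")
    case True
    then show ?thesis by (intro exI[of _ 0] exI[of _ "\<lambda>_. U"]) auto
  next
    case False
    obtain M where M: "irreducible_subquot K (fin_supp_rep S) U M" "fv.dim M < fv.dim U"
      by (rule maximal_subrep[OF less.prems False])
    have sM: "subrep K (fin_supp_rep S) M" "M \<subseteq> U" using M(1) by (auto simp: irreducible_subquot_def)
    obtain r N T where IH0: "N 0 = {\<lambda>x. 0}" "N r = M"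
      "\<forall>i<r. irreducible_subquot K (fin_supp_rep S) (N (Suc i)) (N i) \<and> subrep K (fin_supp_rep S) (T i) \<and> T i \<subseteq> M \<and>
        rep_iso K ((fin_supp_rep S)\<lparr>carrier := T i\<rparr>) (subquot (fin_supp_rep S) (N (Suc i)) (N i))"
      "\<forall>i<r. \<forall>j<r. i \<noteq> j \<longrightarrow> (\<forall>s\<in>T i. \<forall>t\<in>T j. ip S s t = 0)"
      "\<forall>u\<in>M. \<exists>t\<in>Pi {..<r} T. u = (\<lambda>x. \<Sum>i<r. t i x)"
      using less.hyps[OF M(2) sM(1)] by (elim exE conjE)
    note IH = IH0(1,2) IH0(3-5)[rule_format]
    \<comment> \<open>The chain grows at its top end. The new complement is orthogonal to all of
      \<open>M\<close>, in which the earlier \<open>T i\<close> lie, so mutual orthogonality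
      persists.\<close>
    define N' where "N' i = (if i \<le> r then N i else U)" for i
    define T' where "T' i = (if i < r then T i else U \<inter> perp S M)" for i
    have "irreducible_subquot K (fin_supp_rep S) (N' (Suc i)) (N' i) \<and> subrep K (fin_supp_rep S) (T' i) \<and> T' i \<subseteq> U \<and>
        rep_iso K ((fin_supp_rep S)\<lparr>carrier := T' i\<rparr>) (subquot (fin_supp_rep S) (N' (Suc i)) (N' i))" if "i < Suc r" for i
    proof (cases "i < r")
      case True
      then show ?thesis using IH(3)[OF True] sM(2) by (auto simp: N'_def T'_def)
    next
      case False
      then have "i = r" using that by simp
      then show ?thesis
        using M(1) IH(2) perp_subrep[OF sM(1) less.prems] perp_iso[OF sM(1) less.prems sM(2)] by (auto simp: N'_def T'_def)
    qed
    moreover have "ip S s t = 0" if ij: "i < Suc r" "j < Suc r" "i \<noteq> j" "s \<in> T' i" "t \<in> T' j" for i j s t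
    proof -
      have sym: "ip S t s = cnj (ip S s t)" by (simp add: ip_def mult.commute)
      consider "i < r" "j < r" | "i < r" "j = r" | "i = r" "j < r" using ij(1-3) by linarith
      then show ?thesis
      proof cases
        case 1
        then show ?thesis using IH(4) ij by (simp add: T'_def)
      next
        case 2
        then have "ip S t s = 0" using ij IH(3)[OF 2(1)] by (auto simp: T'_def perp_def)
        then show ?thesis using sym by simp
      next
        case 3
        then show ?thesis using ij IH(3)[OF 3(2)] by (auto simp: T'_def perp_def)
      qed
    qed
    moreover have "\<exists>t\<in>Pi {..<Suc r} T'. u = (\<lambda>x. \<Sum>i<Suc r. t i x)" if u: "u \<in> U" for u
    proof -
      obtain w p where wp: "w \<in> M" "p \<in> U \<inter> perp S M" "u = (\<lambda>x. w x + p x)" by (rule perp_split[OF sM(1) less.prems sM(2) u])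
      obtain t where t: "t \<in> Pi {..<r} T" "w = (\<lambda>x. \<Sum>i<r. t i x)" using IH(5)[OF wp(1)] by blast
      have "t(r := p) \<in> Pi {..<Suc r} T'" using t(1) wp(2) by (auto simp: T'_def less_Suc_eq)
      moreover have "u = (\<lambda>x. \<Sum>i<Suc r. (t(r := p)) i x)" by (simp add: wp(3) t(2))
      ultimately show ?thesis by blast
    qed
    moreover have "N' 0 = {\<lambda>x. 0}" "N' (Suc r) = U" using IH(1) by (auto simp: N'_def)
    ultimately show ?thesis by (intro exI[of _ "Suc r"] exI[of _ N'] exI[of _ T'] conjI) auto
  qed
qed

end

section \<open>The Steinberg representation\<close>

subsection \<open>Odd functions on the oriented edges\<close>

definition Odd :: "('a::nonarch_local_field vpath \<Rightarrow> complex) set"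
  where "Odd = {f \<in> fin_supp (opaths (Suc 0)). \<forall>x y. adjacent x y \<longrightarrow> f [y, x] = - f [x, y]}"

lemma Sig_0: "Sig 0 = {[s0, s1], [s1, s0]}"
proof -
  have "a \<in> Sig 0 \<longleftrightarrow> a = [s0, s1] \<or> a = [s1, s0]" for a :: "'a vpath"
    using adjacent_s0_s1 adjacent_sym[OF adjacent_s0_s1]
    by (auto simp: Sig_def opaths_1 mid_def mid_edge_def base_def doubleton_eq_iff)
  then show ?thesis by blast
qed

lemma Dl_0: "(Dl 0 :: ('a::nonarch_local_field vpath \<Rightarrow> complex) set) = {f \<in> fin_supp (Sig 0). f [s1, s0] = - f [s0, s1]}"
proof (intro equalityI subsetI)
  fix f :: "'a vpath \<Rightarrow> complex" assume "f \<in> Dl 0"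
  then show "f \<in> {f \<in> fin_supp (Sig 0). f [s1, s0] = - f [s0, s1]}"
    by (auto simp: Dl_def coboundary_Sigma fin_supp_finite[OF finite_Sig]) (auto simp: Sig_0)
next
  fix f :: "'a vpath \<Rightarrow> complex" assume f: "f \<in> {f \<in> fin_supp (Sig 0). f [s1, s0] = - f [s0, s1]}"
  \<comment> \<open>A function on the two ends of an edge matters only up to constants, so its value
    at \<open>s0\<close> may be taken to be 0.\<close>
  define e where "e = (\<lambda>x :: 'a vpath. if x = [s1] then f [s0, s1] else 0)"
  have "[s1] \<in> verts (Sigma_graph 0)" by (simp add: Sigma_graph_def opaths_0 mid_vertex_def)
  then have "e \<in> fin_supp (verts (Sigma_graph 0))" by (auto simp: e_def fin_supp_def)
  moreover have "f = coboundary (Sigma_graph 0) e"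
    using f fin_supp_outside[of f "Sig 0"] by (auto simp: coboundary_Sigma Sig_0 e_def fun_eq_iff)
  ultimately show "f \<in> Dl 0" by (auto simp: Dl_def)
qed

text \<open>Over the edge from \<open>s0\<close> to \<open>s1\<close> the graph consists of that
  edge in both orientations, and a coboundary takes opposite values on them. By transitivity on
  oriented edges the condition spreads over the tree.\<close>

lemma ind_Dl_0: "ind 0 (Dl 0) = (Odd :: ('a::nonarch_local_field vpath \<Rightarrow> complex) set)"
proof (intro equalityI subsetI)
  fix f :: "'a vpath \<Rightarrow> complex" assume f: "f \<in> ind 0 (Dl 0)"
  have "f [y, x] = - f [x, y]" if xy: "adjacent x y" for x y
  proof -
    obtain g where g: "g \<in> carrier PGL" "vertex_act g x = s0" "vertex_act g y = s1" by (rule transitive_edges[OF xy])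
    have "[x, y] \<in> opaths (Suc 0)" "[y, x] \<in> opaths (Suc 0)" using xy adjacent_sym by (auto simp: opaths_1)
    then have "res 0 (tr 0 g f) [s0, s1] = f [x, y]" "res 0 (tr 0 g f) [s1, s0] = f [y, x]"
      using tr_apply'[of "[x, y]" 0 g f] tr_apply'[of "[y, x]" 0 g f] g by (auto simp: res_def Sig_0)
    moreover have "res 0 (tr 0 g f) \<in> Dl 0" using f g by (simp add: ind_def)
    ultimately show ?thesis by (simp add: Dl_0)
  qed
  then show "f \<in> Odd" using f by (simp add: Odd_def ind_def)
next
  fix f :: "'a vpath \<Rightarrow> complex" assume f: "f \<in> Odd"
  have "res 0 (tr 0 g f) \<in> Dl 0" if g: "g \<in> carrier PGL" for g
  proof -
    have "[s0, s1] \<in> opaths (Suc 0)" "[s1, s0] \<in> opaths (Suc 0)"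
      using adjacent_s0_s1 adjacent_sym by (auto simp: opaths_1)
    moreover have "adjacent (vertex_act (inv\<^bsub>PGL\<^esub> g) s0) (vertex_act (inv\<^bsub>PGL\<^esub> g) s1)"
      using adjacent_s0_s1 g by (intro adjacent_act) auto
    ultimately show ?thesis using f
      by (auto simp: Dl_0 fin_supp_finite[OF finite_Sig]) (auto simp: res_def Sig_0 Odd_def fin_supp_rep_simps(5))
  qed
  then show "f \<in> ind 0 (Dl 0)" using f by (simp add: ind_def Odd_def)
qed

subsection \<open>Functions with finitely supported coboundary\<close>

definition par :: "'a::nonarch_local_field vertex \<Rightarrow> 'a vertex"
  where "par x = (SOME y. adjacent x y \<and> level y < level x)"

lemma par: "x \<in> tree_verts \<Longrightarrow> 0 < level x \<Longrightarrow> adjacent x (par x) \<and> level x = Suc (level (par x))"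
  using someI_ex[OF down_nbr_exists[of x]] adjacent_level[of x "par x"] unfolding par_def by auto

lemma par_unique: "adjacent x y \<Longrightarrow> level x = Suc (level y) \<Longrightarrow> par x = y"
  using par[of x] adjacent_tree(1)[of x y] by (intro down_nbr_unique[of x]) auto

text \<open>The primitive of an odd function that vanishes at \<open>s0\<close>: the values of
  \<open>f\<close> on the edges of the path from \<open>s0\<close> to \<open>x\<close>, each
  oriented away from \<open>s0\<close>, are added up.\<close>

definition pot :: "('a::nonarch_local_field vpath \<Rightarrow> complex) \<Rightarrow> 'a vertex \<Rightarrow> complex"
  where "pot f x = (\<Sum>i<level x. f [(par ^^ Suc i) x, (par ^^ i) x])"

lemma pot_step:
  assumes "adjacent x y" "level x = Suc (level y)"
  shows "pot f x = pot f y + f [y, x]"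
proof -
  have "par x = y" by (rule par_unique[OF assms])
  then show ?thesis
    by (simp add: pot_def assms(2) sum.lessThan_Suc_shift del: sum.lessThan_Suc funpow.simps)
      (simp add: funpow_swap1)
qed

text \<open>Vertex functions that are constant on each component of the tree with finitely many
  edges removed. They form the common source from which both the odd functions, by
  \<open>cob 0\<close>, and the functions on the ends, by \<open>bdry\<close>, are obtained.\<close>

definition Efn :: "('a::nonarch_local_field vpath \<Rightarrow> complex) set"
  where "Efn = {f. (\<forall>v. v \<notin> opaths 0 \<longrightarrow> f v = 0) \<and> finite {a. cob 0 f a \<noteq> 0}}"

abbreviation Er :: "('a::nonarch_local_field pgl, 'a vpath \<Rightarrow> complex) rep"
  where "Er \<equiv> (Vr 0)\<lparr>carrier := Efn\<rparr>"

lemma cob_0: "cob 0 f a = (if a \<in> opaths (Suc 0) then f [a ! 1] - f [a ! 0] else 0)"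
  by (auto simp: cob_def opaths_1)

lemma cob_add: "cob 0 (\<lambda>x. f x + h x) = (\<lambda>a. cob 0 f a + cob 0 h a)"
  and cob_smult: "cob 0 (\<lambda>x. c * f x) = (\<lambda>a. c * cob 0 f a)"
  by (auto simp: cob_0 algebra_simps)

lemma cob_act:
  assumes "g \<in> carrier PGL"
  shows "cob 0 (ract (Vr 0) g f) = tr 0 g (cob 0 f)"
proof
  fix a
  have "[v] \<in> opaths 0 \<longleftrightarrow> v \<in> tree_verts" for v :: "'a vertex" by (auto simp: opaths_0)
  then show "cob 0 (ract (Vr 0) g f) a = tr 0 g (cob 0 f) a"
    using pact_opaths[of "inv\<^bsub>PGL\<^esub> g" a "Suc 0"] assms opaths_nth_tree[of a "Suc 0" 0] opaths_nth_tree[of a "Suc 0" 1] opaths_length[of a "Suc 0"]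
    by (auto simp: cob_0 fin_supp_rep_simps(5))
qed

lemma cob_Efn: "f \<in> Efn \<Longrightarrow> cob 0 f \<in> fin_supp (opaths (Suc 0))"
  by (auto simp: Efn_def fin_supp_iff cob_0)

lemma EfnI: "(\<And>v. v \<notin> opaths 0 \<Longrightarrow> f v = 0) \<Longrightarrow> cob 0 f \<in> fin_supp (opaths (Suc 0)) \<Longrightarrow> f \<in> Efn"
  by (auto simp: Efn_def fin_supp_iff)

lemma Efn_outside: "f \<in> Efn \<Longrightarrow> v \<notin> opaths 0 \<Longrightarrow> f v = 0"
  by (auto simp: Efn_def)

lemma Efn_add: "f \<in> Efn \<Longrightarrow> h \<in> Efn \<Longrightarrow> (\<lambda>x. f x + h x) \<in> Efn"
  by (rule EfnI) (simp_all add: cob_add fin_supp_add cob_Efn Efn_outside)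

lemma Efn_smult: "f \<in> Efn \<Longrightarrow> (\<lambda>x. c * f x) \<in> Efn"
  by (rule EfnI) (simp_all add: cob_smult fin_supp_smult cob_Efn Efn_outside)

lemma fin_supp_Efn: "f \<in> fin_supp (opaths 0) \<Longrightarrow> f \<in> Efn"
  using cob_hom[of 0] by (intro EfnI) (auto simp: fin_supp_outside rep_hom_def)

lemma Efn_arep: "arep (carrier PGL) Er"
proof (rule function_arep[OF stable_opaths])
  show "(\<lambda>x. if x \<in> opaths 0 then f (pact (inv\<^bsub>PGL\<^esub> g) x) else 0) \<in> Efn" if "g \<in> carrier PGL" "f \<in> Efn" for f and g :: "'a pgl"
    using that cob_act[OF that(1), of f] tr_closed[OF cob_Efn[OF that(2)] that(1)]
    by (intro EfnI) (auto simp: fin_supp_rep_simps(5)[of "opaths 0"])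
qed (auto simp: Efn_add Efn_smult Efn_outside intro: fin_supp_Efn)

lemma cob_Efn_hom: "rep_hom (carrier PGL) (cob 0) Er ((Vr (Suc 0))\<lparr>carrier := Odd\<rparr>)"
  unfolding rep_hom_def
proof (intro conjI ballI allI)
  fix f :: "'a vpath \<Rightarrow> complex" assume "f \<in> carrier Er"
  then show "cob 0 f \<in> carrier ((Vr (Suc 0))\<lparr>carrier := Odd\<rparr>)"
    using adjacent_sym by (auto simp: Odd_def cob_Efn) (auto simp: cob_0 opaths_1)
qed (auto simp: cob_add cob_smult cob_act)

text \<open>On a tree every odd function has a primitive: the path sums \<open>pot f\<close>
  increase by the value of \<open>f\<close> along each edge leading away from \<open>s0\<close>, and
  oddness settles the edges traversed the other way.\<close>

lemma cob_surj: "cob 0 ` Efn = (Odd :: ('a::nonarch_local_field vpath \<Rightarrow> complex) set)"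
proof
  show "cob 0 ` Efn \<subseteq> (Odd :: ('a vpath \<Rightarrow> complex) set)" using cob_Efn_hom by (auto simp: rep_hom_def)
  show "(Odd :: ('a vpath \<Rightarrow> complex) set) \<subseteq> cob 0 ` Efn"
  proof
    fix f :: "'a vpath \<Rightarrow> complex" assume f: "f \<in> Odd"
    define u where "u v = (if v \<in> opaths 0 then pot f (v ! 0) else 0)" for v
    have "cob 0 u = f"
    proof
      fix a
      show "cob 0 u a = f a"
      proof (cases "a \<in> opaths (Suc 0)")
        case True
        then obtain x y where xy: "adjacent x y" "a = [x, y]" by (auto simp: opaths_1)
        have "cob 0 u a = pot f y - pot f x"
          using True xy(2) adjacent_tree[OF xy(1)] by (simp add: cob_0 u_def opaths_0)
        also have "\<dots> = f a"
          using adjacent_level[OF xy(1)] pot_step[OF xy(1), of f] pot_step[OF adjacent_sym[OF xy(1)], of f] f xy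
          by (auto simp: Odd_def)
        finally show ?thesis .
      next
        case False
        have "f \<in> fin_supp (opaths (Suc 0))" using f by (simp add: Odd_def)
        then have "f a = 0" using False by (rule fin_supp_outside)
        then show ?thesis using False by (simp add: cob_0)
      qed
    qed
    moreover have "u \<in> Efn" by (rule EfnI) (use f calculation in \<open>auto simp: u_def Odd_def\<close>)
    ultimately show "f \<in> cob 0 ` Efn" by blast
  qed
qed

lemma cob_zero_const:
  assumes "\<And>x y. adjacent x y \<Longrightarrow> f [y] = f [x]" "x \<in> tree_verts"
  shows "f [x] = f [s0]"
  using assms(2)
proof (induction "level x" arbitrary: x rule: less_induct)
  case less
  show ?case
  proof (cases "level x = 0")
    case True
    then show ?thesis using level_zero[OF less.prems] by simp
  next
    case False
    then have "adjacent x (par x)" "level (par x) < level x" using par[of x] less.prems by auto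
    then show ?thesis using less.hyps[of "par x"] assms(1) adjacent_tree by metis
  qed
qed

subsection \<open>Boundary values\<close>

lemma sk_k: "k \<in> GLo \<Longrightarrow> vertex_act (pg k) (sk N) = vx (k ** dg (unif ^ N))"
  by (simp add: sk_def vertex_act_pg GLo_invertible invertible_dg unif)

lemma sk_tree [simp]: "sk N \<in> tree_verts"
  by (simp add: sk_def invertible_dg unif)

lemma level_sk [simp]: "level (sk N) = N"
  using level_k_sk[OF GLo_one, of N] by (simp add: sk_def)

lemma adjacent_sk': "adjacent (sk N) (sk (Suc N))"
  using adjacent_sk[OF GLo_one, of N] by (simp add: sk_def)

lemma sk_inj: "sk M = sk N \<Longrightarrow> M = N"
  using level_sk[of M] level_sk[of N] by (metis level_sk)

text \<open>
  The Borel subgroup is the stabilizer of the end of the tree to which the vertices \<open>sk j\<close> tend, so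
  its right cosets parametrize the ends.
\<close>

definition ray :: "'a::nonarch_local_field pgl \<Rightarrow> nat \<Rightarrow> 'a vpath"
  where "ray x j = [vertex_act (inv\<^bsub>PGL\<^esub> x) (sk j)]"

lemma ray_inj: "x \<in> carrier PGL \<Longrightarrow> ray x i = ray x j \<Longrightarrow> i = j"
  using sk_inj by (auto simp: ray_def act_inj)

lemma ray_opaths: "x \<in> carrier PGL \<Longrightarrow> ray x i \<in> opaths 0"
  by (simp add: ray_def opaths_0)

section \<open>Limits along rays\<close>

lemma eventually_not_in:
  assumes "finite Y" "inj f"
  shows "eventually (\<lambda>j::nat. f j \<notin> Y) sequentially"
proof -
  have "finite (f -` Y)" using assms by (rule finite_vimageI)
  then show ?thesis unfolding eventually_sequentially by (metis finite_nat_set_iff_bounded not_less vimageI)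
qed

text \<open>The limit for the discrete topology on the values. It is meaningful for eventually
  constant sequences, which \<open>ray_lim\<close> guarantees for members of
  \<open>Efn\<close>.\<close>

definition lim_at :: "(nat \<Rightarrow> complex) \<Rightarrow> complex"
  where "lim_at s = (THE c. eventually (\<lambda>j. s j = c) sequentially)"

lemma lim_at_eq: "eventually (\<lambda>j. s j = c) sequentially \<Longrightarrow> lim_at s = c"
  unfolding lim_at_def
proof (rule the_equality)
  fix c' assume "eventually (\<lambda>j. s j = c) sequentially" "eventually (\<lambda>j. s j = c') sequentially"
  then have "eventually (\<lambda>j. c = c') sequentially" by eventually_elim simp
  then show "c' = c" by simp
qed

text \<open>The edges of a ray are pairwise distinct, so beyond some point none of them lies in the
  finite support of the coboundary.\<close>

lemma ray_lim:
  assumes f: "f \<in> Efn" and x: "x \<in> carrier PGL"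
  shows "eventually (\<lambda>j. f (ray x j) = lim_at (\<lambda>j. f (ray x j))) sequentially"
proof -
  define e where "e j = [vertex_act (inv\<^bsub>PGL\<^esub> x) (sk j), vertex_act (inv\<^bsub>PGL\<^esub> x) (sk (Suc j))]" for j
  have "inj e" using x sk_inj by (auto simp: inj_def e_def act_inj)
  then have "eventually (\<lambda>j. e j \<notin> {a. cob 0 f a \<noteq> 0}) sequentially"
    using f by (intro eventually_not_in) (auto simp: Efn_def)
  then obtain J where J: "\<And>j. J \<le> j \<Longrightarrow> cob 0 f (e j) = 0" by (auto simp: eventually_sequentially)
  have "e j \<in> opaths (Suc 0)" for j
    using adjacent_act[OF _ adjacent_sk', of "inv\<^bsub>PGL\<^esub> x" j] x by (simp add: e_def opaths_1)
  then have step': "f (ray x (Suc j)) = f (ray x j)" if "J \<le> j" for j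
    using J[OF that] by (simp add: cob_0 e_def ray_def)
  have "f (ray x j) = f (ray x J)" if "J \<le> j" for j
    using that
  proof (induction j rule: dec_induct)
    case (step j)
    then show ?case using step'[of j] by simp
  qed simp
  then have ev: "eventually (\<lambda>j. f (ray x j) = f (ray x J)) sequentially" unfolding eventually_sequentially by blast
  then show ?thesis using lim_at_eq[OF ev] by simp
qed

definition bdry :: "('a::nonarch_local_field vpath \<Rightarrow> complex) \<Rightarrow> 'a pgl \<Rightarrow> complex"
  where "bdry f = (\<lambda>x\<in>carrier PGL. lim_at (\<lambda>j. f (ray x j)))"

lemma bdry_eq:
  assumes "f \<in> Efn" "x \<in> carrier PGL"
  shows "eventually (\<lambda>j. f (ray x j) = bdry f x) sequentially"
  using ray_lim[OF assms] assms(2) by (simp add: bdry_def)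

lemma borel_iff: "g \<in> borel_subgroup \<longleftrightarrow> (\<exists>A. invertible A \<and> A$2$1 = 0 \<and> g = pg A)"
  by (auto simp: borel_subgroup_def GL2_def pg_def)

lemma borel_carrier: "g \<in> borel_subgroup \<Longrightarrow> g \<in> carrier PGL"
  by (auto simp: borel_iff)

lemma borel_mult_carrier: "h \<in> borel_subgroup \<Longrightarrow> x \<in> carrier PGL \<Longrightarrow> h \<otimes>\<^bsub>PGL\<^esub> x \<in> carrier PGL"
  by (simp add: borel_carrier)

lemma borel_inv:
  assumes "g \<in> borel_subgroup"
  shows "inv\<^bsub>PGL\<^esub> g \<in> borel_subgroup"
proof -
  obtain A where A: "invertible A" "A$2$1 = 0" "g = pg A" using assms by (auto simp: borel_iff)
  have d: "A$1$1 \<noteq> 0" "A$2$2 \<noteq> 0" using A by (auto simp: inv_det det_2)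
  define C where "C = mk2 (1 / A$1$1) (- A$1$2 / (A$1$1 * A$2$2)) 0 (1 / A$2$2)"
  have "C ** A = mat 1" using A(2) d by (simp add: eq2 mm2 mat2 C_def)
  moreover have "invertible C" using d by (simp add: inv_det det_2 C_def)
  ultimately have "inv\<^bsub>PGL\<^esub> g = pg C"
    using A by (intro PGL.inv_equality) (auto simp: pg_mult pg_one)
  then show ?thesis using \<open>invertible C\<close> by (auto simp: borel_iff C_def)
qed

text \<open>An upper triangular matrix shifts the standard ray far out. The ratio of its diagonal
  entries accounts for the shift, and the upper right entry, multiplied by a high power of
  \<open>unif\<close>, becomes integral and is absorbed by \<open>GLo\<close> on the right.\<close>

lemma borel_sk:
  assumes "b \<in> borel_subgroup"
  obtains m n where "eventually (\<lambda>j. vertex_act b (sk (j + m)) = sk (j + n)) sequentially"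
proof -
  obtain A where A: "invertible A" "A$2$1 = 0" "b = pg A" using assms by (auto simp: borel_iff)
  let ?q = "absv (unif :: 'a)"
  define a d where "a = A$1$1" and "d = A$2$2"
  have ad: "a \<noteq> 0" "d \<noteq> 0" using A by (auto simp: inv_det det_2 a_def d_def)
  have q: "0 < ?q" "?q < 1" by (simp_all add: unif)
  \<comment> \<open>The shift is the valuation of \<open>d / a\<close>, an integer of either sign;
    it is recorded as the difference \<open>n - m\<close> of two naturals.\<close>
  have "\<exists>m n. absv (d / a) * ?q ^ m = ?q ^ n"
  proof (cases "absv (d / a) \<le> 1")
    case True
    then obtain n where "absv (d / a) = ?q ^ n" using absv_eq_power_unif[of "d / a"] ad by auto
    then show ?thesis by (intro exI[of _ 0] exI[of _ n]) simp
  next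
    case False
    then have "absv (a / d) \<le> 1" using ad by (simp add: divide_simps)
    then obtain m where "absv (a / d) = ?q ^ m" using absv_eq_power_unif[of "a / d"] ad by auto
    then have "absv (d / a) * ?q ^ m = absv (d / a * (a / d))" by (simp only: absv_mult)
    then have "absv (d / a) * ?q ^ m = ?q ^ 0" using ad q by simp
    then show ?thesis by blast
  qed
  then obtain m n where mn: "absv (d / a) * ?q ^ m = ?q ^ n" by blast
  have "eventually (\<lambda>j. absv (A$1$2 / a) * ?q ^ j < 1) sequentially"
  proof -
    have "(\<lambda>j. absv (A$1$2 / a) * ?q ^ j) \<longlonglongrightarrow> absv (A$1$2 / a) * 0"
      using q by (intro tendsto_mult tendsto_const LIMSEQ_power_zero) simp
    then show ?thesis by (rule order_tendstoD) simp
  qed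
  then have "eventually (\<lambda>j. vertex_act b (sk (j + m)) = sk (j + n)) sequentially"
  proof eventually_elim
    case (elim j)
    have "absv (A$1$2 / a) * ?q ^ (j + m) \<le> absv (A$1$2 / a) * ?q ^ j"
      using q by (intro mult_left_mono power_decreasing) auto
    then have small: "absv (A$1$2 * unif ^ (j + m) / a) \<le> 1" using elim by (simp add: absv_mult)
    define u where "u = d / a * unif ^ m / unif ^ n"
    have u: "absv u = 1" using mn q ad by (simp add: u_def absv_mult divide_simps)
    have un: "u * unif ^ (j + n) = d / a * unif ^ (j + m)"
      using unif(1)[where 'a='a] by (simp add: u_def power_add)
    have k: "mk2 1 (A$1$2 * unif ^ (j + m) / a) 0 1 \<in> GLo" "mk2 1 0 0 u \<in> GLo"
      using small u by (simp_all add: GLo_iff det_2)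
    have "A ** dg (unif ^ (j + m)) = mat a ** (dg (unif ^ (j + n)) ** (mk2 1 0 0 u ** mk2 1 (A$1$2 * unif ^ (j + m) / a) 0 1))"
      using ad un by (simp add: eq2 mm2 mat2 a_def[symmetric] d_def[symmetric] A(2) mult.commute)
    then have "vx (A ** dg (unif ^ (j + m))) = vx (dg (unif ^ (j + n)))"
      using ad k by (simp add: vx_scale vx_mult_GLo GLo_mult invertible_mult GLo_invertible invertible_dg unif)
    then show "vertex_act b (sk (j + m)) = sk (j + n)" using A by (simp add: sk_def vertex_act_pg invertible_dg unif)
  qed
  then show ?thesis using that by blast
qed

lemma ray_mult: "x \<in> carrier PGL \<Longrightarrow> h \<in> carrier PGL \<Longrightarrow>
    ray (h \<otimes>\<^bsub>PGL\<^esub> x) j = [vertex_act (inv\<^bsub>PGL\<^esub> x) (vertex_act (inv\<^bsub>PGL\<^esub> h) (sk j))]"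
  by (simp add: ray_def PGL.inv_mult_group act_mult)

lemma bdry_borel:
  assumes f: "f \<in> Efn" and h: "h \<in> borel_subgroup" and x: "x \<in> carrier PGL"
  shows "bdry f (h \<otimes>\<^bsub>PGL\<^esub> x) = bdry f x"
proof -
  obtain m n where ev: "eventually (\<lambda>j. vertex_act (inv\<^bsub>PGL\<^esub> h) (sk (j + m)) = sk (j + n)) sequentially"
    by (rule borel_sk[OF borel_inv[OF h]])
  have hx: "h \<otimes>\<^bsub>PGL\<^esub> x \<in> carrier PGL" using borel_carrier[OF h] x by simp
  have "eventually (\<lambda>j. f (ray (h \<otimes>\<^bsub>PGL\<^esub> x) (j + m)) = bdry f (h \<otimes>\<^bsub>PGL\<^esub> x)) sequentially"
    using bdry_eq[OF f hx] by (subst eventually_sequentially_seg)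
  moreover have "eventually (\<lambda>j. f (ray x (j + n)) = bdry f x) sequentially"
    using bdry_eq[OF f x] by (subst eventually_sequentially_seg)
  ultimately have "eventually (\<lambda>j::nat. bdry f (h \<otimes>\<^bsub>PGL\<^esub> x) = bdry f x) sequentially"
    using ev
  proof eventually_elim
    case (elim j)
    then show ?case using ray_mult[OF x borel_carrier[OF h], of "j + m"] by (simp add: ray_def)
  qed
  then show ?thesis by simp
qed

lemma bdry_act:
  assumes f: "f \<in> Efn" and g: "g \<in> carrier PGL" and x: "x \<in> carrier PGL"
  shows "bdry (ract (Vr 0) g f) x = bdry f (x \<otimes>\<^bsub>PGL\<^esub> g)"
proof -
  have "ract (Vr 0) g f (ray x j) = f (ray (x \<otimes>\<^bsub>PGL\<^esub> g) j)" for j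
    using g x ray_opaths[OF x, of j] ray_mult[OF g x, of j] by (simp add: fin_supp_rep_simps(5) ray_def)
  then show ?thesis using g x by (simp add: bdry_def)
qed

text \<open>An element fixing \<open>s0\<close> and every vertex of the finite support of the
  coboundary leaves the coboundary unchanged. It can then change \<open>f\<close> only by a
  constant, which is 0 since \<open>s0\<close> is fixed. So \<open>f\<close> itself is invariant,
  and with it its boundary values.\<close>

lemma bdry_smooth:
  assumes f: "f \<in> Efn"
  shows "\<exists>U. subgroup U PGL \<and> openin PGL_top U \<and> (\<forall>x\<in>carrier PGL. \<forall>u\<in>U. bdry f (x \<otimes>\<^bsub>PGL\<^esub> u) = bdry f x)"
proof -
  \<comment> \<open>The vertex \<open>s0\<close> is included to pin down the additive
    constant.\<close>
  define Y where "Y = insert s0 (\<Union>a\<in>{a. cob 0 f a \<noteq> 0}. set a)"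
  have supp: "a \<in> opaths (Suc 0)" if "cob 0 f a \<noteq> 0" for a using that by (auto simp: cob_0 split: if_splits)
  have Y: "finite Y" "Y \<subseteq> tree_verts"
    using cob_Efn[OF f] opaths_tree[OF supp] by (auto simp: Y_def fin_supp_iff)
  let ?U = "{g \<in> carrier PGL. \<forall>y\<in>Y. vertex_act g y = y}"
  have inv: "f [vertex_act u v] = f [v]" if u: "u \<in> ?U" and v: "v \<in> tree_verts" for u :: "'a pgl" and v
  proof -
    have uG: "u \<in> carrier PGL" using u by simp
    have cobu: "cob 0 f (pact u a) = cob 0 f a" if a: "a \<in> opaths (Suc 0)" for a
    proof -
      have fx: "pact u b = b" if "cob 0 f b \<noteq> 0" for b
        using that u by (auto simp: Y_def intro!: map_idI)
      have "pact u a = a" if "cob 0 f (pact u a) \<noteq> 0"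
        using fx[OF that] uG a by (metis pact_inv(2) pact_opaths)
      then show ?thesis using fx[of a] by metis
    qed
    have "(\<lambda>w. f (pact u w) - f w) [v] = (\<lambda>w. f (pact u w) - f w) [s0]"
    proof (rule cob_zero_const[OF _ v])
      fix x y :: "'a vertex" assume xy: "adjacent x y"
      then have a: "[x, y] \<in> opaths (Suc 0)" by (auto simp: opaths_1)
      have "pact u [x, y] \<in> opaths (Suc 0)" using a uG by (rule pact_opaths[rotated])
      then show "f (pact u [y]) - f [y] = f (pact u [x]) - f [x]"
        using cobu[OF a] a by (simp add: cob_0 algebra_simps)
    qed
    moreover have "vertex_act u s0 = s0" using u by (simp add: Y_def)
    ultimately show ?thesis by simp
  qed
  have "bdry f (x \<otimes>\<^bsub>PGL\<^esub> u) = bdry f x" if x: "x \<in> carrier PGL" and u: "u \<in> ?U" for x u :: "'a pgl"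
  proof -
    have ui: "inv\<^bsub>PGL\<^esub> u \<in> ?U" using subgroup.m_inv_closed[OF open_pointwise_stabilizer(1)[OF Y] u] .
    have uG: "u \<in> carrier PGL" using u by simp
    have "f (ray (x \<otimes>\<^bsub>PGL\<^esub> u) j) = f (ray x j)" for j
      using inv[OF ui, of "vertex_act (inv\<^bsub>PGL\<^esub> x) (sk j)"] x uG ray_mult[OF uG x, of j] by (simp add: ray_def)
    then show ?thesis using x uG by (simp add: bdry_def)
  qed
  then show ?thesis using open_pointwise_stabilizer[OF Y] by (intro exI[of _ ?U]) blast
qed

section \<open>The unnormalized induction from the Borel subgroup\<close>

abbreviation SI :: "('a::nonarch_local_field pgl, 'a pgl \<Rightarrow> complex) rep"
  where "SI \<equiv> smooth_ind borel_subgroup trivial_rep"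

lemma SI_simps:
  "carrier SI = {f \<in> extensional (carrier PGL).
       (\<forall>h\<in>borel_subgroup. \<forall>x\<in>carrier PGL. f (h \<otimes>\<^bsub>PGL\<^esub> x) = f x) \<and>
       (\<exists>U. subgroup U PGL \<and> openin PGL_top U \<and>
         (\<forall>x\<in>carrier PGL. \<forall>u\<in>U. f (x \<otimes>\<^bsub>PGL\<^esub> u) = f x))}"
  "ring.zero SI = (\<lambda>x\<in>carrier PGL. 0)"
  "f \<oplus>\<^bsub>SI\<^esub> h = (\<lambda>x\<in>carrier PGL. f x + h x)"
  "c \<odot>\<^bsub>SI\<^esub> f = (\<lambda>x\<in>carrier PGL. c * f x)"
  "ract SI g f = (\<lambda>x\<in>carrier PGL. f (x \<otimes>\<^bsub>PGL\<^esub> g))"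
  by (auto simp: smooth_ind_def trivial_rep_def PiE_def)

lemma SI_carrierI:
  assumes "f \<in> extensional (carrier PGL)" "\<And>h x. h \<in> borel_subgroup \<Longrightarrow> x \<in> carrier PGL \<Longrightarrow> f (h \<otimes>\<^bsub>PGL\<^esub> x) = f x"
    "subgroup U PGL" "openin PGL_top U" "\<And>x u. x \<in> carrier PGL \<Longrightarrow> u \<in> U \<Longrightarrow> f (x \<otimes>\<^bsub>PGL\<^esub> u) = f x"
  shows "f \<in> carrier SI"
  using assms unfolding SI_simps by blast

lemma SI_carrierE:
  assumes "f \<in> carrier SI"
  obtains U where "f \<in> extensional (carrier PGL)" "\<And>h x. h \<in> borel_subgroup \<Longrightarrow> x \<in> carrier PGL \<Longrightarrow> f (h \<otimes>\<^bsub>PGL\<^esub> x) = f x"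
    "subgroup U PGL" "openin PGL_top U" "\<And>x u. x \<in> carrier PGL \<Longrightarrow> u \<in> U \<Longrightarrow> f (x \<otimes>\<^bsub>PGL\<^esub> u) = f x"
  using assms unfolding SI_simps by blast

text \<open>The right translate by \<open>g\<close> of a function invariant under \<open>U\<close>
  is invariant under the conjugate of \<open>U\<close> by \<open>g\<close>. This shows that the
  induced space is stable under the action.\<close>

lemma subgroup_conj:
  assumes U: "subgroup U PGL" and g: "g \<in> carrier PGL"
  shows "subgroup {x \<in> carrier PGL. inv\<^bsub>PGL\<^esub> g \<otimes>\<^bsub>PGL\<^esub> x \<otimes>\<^bsub>PGL\<^esub> g \<in> U} PGL" (is "subgroup ?U PGL")
proof -
  interpret U: subgroup U PGL by (rule U)
  show ?thesis
  proof (rule PGL.subgroupI)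
    fix x y assume xy: "x \<in> ?U" "y \<in> ?U"
    have "inv\<^bsub>PGL\<^esub> g \<otimes>\<^bsub>PGL\<^esub> (x \<otimes>\<^bsub>PGL\<^esub> y) \<otimes>\<^bsub>PGL\<^esub> g =
        (inv\<^bsub>PGL\<^esub> g \<otimes>\<^bsub>PGL\<^esub> x \<otimes>\<^bsub>PGL\<^esub> g) \<otimes>\<^bsub>PGL\<^esub> (inv\<^bsub>PGL\<^esub> g \<otimes>\<^bsub>PGL\<^esub> y \<otimes>\<^bsub>PGL\<^esub> g)"
      using xy g by (simp add: PGL.m_assoc) (simp flip: PGL.m_assoc)
    then show "x \<otimes>\<^bsub>PGL\<^esub> y \<in> ?U" using xy by simp
    have "inv\<^bsub>PGL\<^esub> g \<otimes>\<^bsub>PGL\<^esub> inv\<^bsub>PGL\<^esub> x \<otimes>\<^bsub>PGL\<^esub> g = inv\<^bsub>PGL\<^esub> (inv\<^bsub>PGL\<^esub> g \<otimes>\<^bsub>PGL\<^esub> x \<otimes>\<^bsub>PGL\<^esub> g)"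
      using xy g by (simp add: PGL.inv_mult_group PGL.m_assoc)
    then show "inv\<^bsub>PGL\<^esub> x \<in> ?U" using xy by simp
  next
    show "?U \<noteq> {}" using g by (auto intro!: exI[of _ "\<one>\<^bsub>PGL\<^esub>"])
  qed auto
qed

lemma SI_arep: "arep (carrier PGL) (SI :: ('a::nonarch_local_field pgl, 'a pgl \<Rightarrow> complex) rep)"
proof -
  have add: "f \<oplus>\<^bsub>SI\<^esub> h \<in> carrier SI" if "f \<in> carrier SI" "h \<in> carrier SI" for f h :: "'a pgl \<Rightarrow> complex"
  proof -
    from that(1) obtain U :: "'a pgl set" where U: "\<And>h x. h \<in> borel_subgroup \<Longrightarrow> x \<in> carrier PGL \<Longrightarrow> f (h \<otimes>\<^bsub>PGL\<^esub> x) = f x"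
      "subgroup U PGL" "openin PGL_top U" "\<And>x u. x \<in> carrier PGL \<Longrightarrow> u \<in> U \<Longrightarrow> f (x \<otimes>\<^bsub>PGL\<^esub> u) = f x"
      by (rule SI_carrierE) blast
    from that(2) obtain U' :: "'a pgl set" where U': "\<And>b x. b \<in> borel_subgroup \<Longrightarrow> x \<in> carrier PGL \<Longrightarrow> h (b \<otimes>\<^bsub>PGL\<^esub> x) = h x"
      "subgroup U' PGL" "openin PGL_top U'" "\<And>x u. x \<in> carrier PGL \<Longrightarrow> u \<in> U' \<Longrightarrow> h (x \<otimes>\<^bsub>PGL\<^esub> u) = h x"
      by (rule SI_carrierE) blast
    show ?thesis
      using U U' PGL.subgroups_Inter_pair[OF U(2) U'(2)] subgroup.mem_carrier[OF U(2)]
      by (intro SI_carrierI[of _ "U \<inter> U'"]) (auto simp: SI_simps(3) borel_mult_carrier)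
  qed
  have smult: "c \<odot>\<^bsub>SI\<^esub> f \<in> carrier SI" if "f \<in> carrier SI" for c and f :: "'a pgl \<Rightarrow> complex"
  proof -
    from that obtain U :: "'a pgl set" where U: "\<And>h x. h \<in> borel_subgroup \<Longrightarrow> x \<in> carrier PGL \<Longrightarrow> f (h \<otimes>\<^bsub>PGL\<^esub> x) = f x"
      "subgroup U PGL" "openin PGL_top U" "\<And>x u. x \<in> carrier PGL \<Longrightarrow> u \<in> U \<Longrightarrow> f (x \<otimes>\<^bsub>PGL\<^esub> u) = f x"
      by (rule SI_carrierE) blast
    show ?thesis
      using U subgroup.mem_carrier[OF U(2)]
      by (intro SI_carrierI[of _ U]) (auto simp: SI_simps(4) borel_mult_carrier)
  qed
  have act: "ract SI g f \<in> carrier SI" if g: "g \<in> carrier PGL" and f: "f \<in> carrier SI" for g :: "'a pgl" and f :: "'a pgl \<Rightarrow> complex"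
  proof -
    from f obtain U :: "'a pgl set" where U: "\<And>h x. h \<in> borel_subgroup \<Longrightarrow> x \<in> carrier PGL \<Longrightarrow> f (h \<otimes>\<^bsub>PGL\<^esub> x) = f x"
      "subgroup U PGL" "openin PGL_top U" "\<And>x u. x \<in> carrier PGL \<Longrightarrow> u \<in> U \<Longrightarrow> f (x \<otimes>\<^bsub>PGL\<^esub> u) = f x"
      by (rule SI_carrierE) blast
    let ?U = "{x \<in> carrier PGL. inv\<^bsub>PGL\<^esub> g \<otimes>\<^bsub>PGL\<^esub> x \<otimes>\<^bsub>PGL\<^esub> g \<in> U}"
    have eq: "?U = {x \<in> carrier PGL. inv\<^bsub>PGL\<^esub> g \<otimes>\<^bsub>PGL\<^esub> x \<in> {h \<in> carrier PGL. h \<otimes>\<^bsub>PGL\<^esub> g \<in> U}}" using g by auto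
    show ?thesis
    proof (rule SI_carrierI[of _ ?U])
      show "openin PGL_top ?U" unfolding eq by (intro openin_translate U PGL.inv_closed g)
      fix x u :: "'a pgl" assume x: "x \<in> carrier PGL" and u: "u \<in> ?U"
      have "x \<otimes>\<^bsub>PGL\<^esub> u \<otimes>\<^bsub>PGL\<^esub> g = (x \<otimes>\<^bsub>PGL\<^esub> g) \<otimes>\<^bsub>PGL\<^esub> (inv\<^bsub>PGL\<^esub> g \<otimes>\<^bsub>PGL\<^esub> u \<otimes>\<^bsub>PGL\<^esub> g)"
        using x u g by (simp add: PGL.m_assoc) (simp flip: PGL.m_assoc)
      then show "ract SI g f (x \<otimes>\<^bsub>PGL\<^esub> u) = ract SI g f x"
        using x u g U(4)[of "x \<otimes>\<^bsub>PGL\<^esub> g" "inv\<^bsub>PGL\<^esub> g \<otimes>\<^bsub>PGL\<^esub> u \<otimes>\<^bsub>PGL\<^esub> g"] by (simp add: SI_simps(5))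
    next
      fix h x :: "'a pgl" assume "h \<in> borel_subgroup" "x \<in> carrier PGL"
      then show "ract SI g f (h \<otimes>\<^bsub>PGL\<^esub> x) = ract SI g f x"
        using U(1)[of h "x \<otimes>\<^bsub>PGL\<^esub> g"] g by (simp add: SI_simps(5) PGL.m_assoc borel_carrier)
    qed (auto simp: SI_simps(5) subgroup_conj[OF U(2) g])
  qed
  have restr: "(\<lambda>x\<in>carrier PGL. f x) = f" if "f \<in> carrier SI" for f :: "'a pgl \<Rightarrow> complex"
    using that by (auto simp: SI_simps(1) extensional_restrict)
  have zero: "\<zero>\<^bsub>SI\<^esub> \<in> carrier (SI :: ('a pgl, 'a pgl \<Rightarrow> complex) rep)"
    by (rule SI_carrierI[OF _ _ PGL.subgroup_self openin_carrier]) (auto simp: SI_simps(2) borel_carrier)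
  have "abelian_group (SI :: ('a pgl, 'a pgl \<Rightarrow> complex) rep)"
  proof (rule abelian_groupI)
    fix f :: "'a pgl \<Rightarrow> complex" assume f: "f \<in> carrier SI"
    show "\<exists>h\<in>carrier SI. h \<oplus>\<^bsub>SI\<^esub> f = \<zero>\<^bsub>SI\<^esub>"
      by (rule bexI[OF _ smult[OF f, of "-1"]]) (auto simp: SI_simps(2-) intro!: restrict_ext)
    show "\<zero>\<^bsub>SI\<^esub> \<oplus>\<^bsub>SI\<^esub> f = f" using restr[OF f] by (simp add: SI_simps(2-) cong: restrict_cong)
  qed (auto simp: add zero, auto simp: SI_simps(2-) algebra_simps intro!: restrict_ext)
  then have "Module.module complex_ring (SI :: ('a pgl, 'a pgl \<Rightarrow> complex) rep)"
  proof (rule modI)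
    fix f :: "'a pgl \<Rightarrow> complex" assume f: "f \<in> carrier SI"
    show "1 \<odot>\<^bsub>SI\<^esub> f = f" using restr[OF f] by (simp add: SI_simps(4))
    show "a \<odot>\<^bsub>SI\<^esub> f \<in> carrier SI" for a using f by (rule smult)
    show "(a + b) \<odot>\<^bsub>SI\<^esub> f = a \<odot>\<^bsub>SI\<^esub> f \<oplus>\<^bsub>SI\<^esub> b \<odot>\<^bsub>SI\<^esub> f" for a b
      by (rule ext) (simp add: SI_simps(3,4) distrib_right)
    show "(a * b) \<odot>\<^bsub>SI\<^esub> f = a \<odot>\<^bsub>SI\<^esub> (b \<odot>\<^bsub>SI\<^esub> f)" for a b
      by (rule ext) (simp add: SI_simps(4))
    show "a \<odot>\<^bsub>SI\<^esub> (f \<oplus>\<^bsub>SI\<^esub> h) = a \<odot>\<^bsub>SI\<^esub> f \<oplus>\<^bsub>SI\<^esub> a \<odot>\<^bsub>SI\<^esub> h" for a h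
      by (rule ext) (simp add: SI_simps(3,4) distrib_left)
  qed
  moreover have "ract SI \<one>\<^bsub>PGL\<^esub> f = f" if "f \<in> carrier SI" for f :: "'a pgl \<Rightarrow> complex"
    using restr[OF that] by (simp add: SI_simps(5) cong: restrict_cong)
  ultimately show ?thesis
    by (intro arep.intro PGL.subgroup_self)
      (auto simp: alg_rep_def act, auto simp: SI_simps(2-) PGL.m_assoc intro!: restrict_ext)
qed

lemma bdry_hom: "rep_hom (carrier PGL) bdry Er SI"
  unfolding rep_hom_def
proof (intro conjI ballI allI)
  fix f :: "'a vpath \<Rightarrow> complex" assume "f \<in> carrier Er"
  then have f: "f \<in> Efn" by simp
  obtain U where "subgroup U PGL" "openin PGL_top U" "\<forall>x\<in>carrier PGL. \<forall>u\<in>U. bdry f (x \<otimes>\<^bsub>PGL\<^esub> u) = bdry f x"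
    using bdry_smooth[OF f] by blast
  then show "bdry f \<in> carrier SI" using bdry_borel[OF f] by (intro SI_carrierI[of _ U]) (auto simp: bdry_def[of f])
  show "bdry (c \<odot>\<^bsub>Er\<^esub> f) = c \<odot>\<^bsub>SI\<^esub> bdry f" for c
  proof (rule extensionalityI[of _ "carrier PGL"])
    fix x :: "'a pgl" assume x: "x \<in> carrier PGL"
    have "eventually (\<lambda>j. c * f (ray x j) = c * bdry f x) sequentially"
      using bdry_eq[OF f x] by eventually_elim simp
    then show "bdry (c \<odot>\<^bsub>Er\<^esub> f) x = (c \<odot>\<^bsub>SI\<^esub> bdry f) x"
      using x by (simp add: SI_simps(4) bdry_def[of "\<lambda>x. c * f x"] lim_at_eq)
  qed (auto simp: SI_simps(4) bdry_def)
  show "bdry (f \<oplus>\<^bsub>Er\<^esub> h) = bdry f \<oplus>\<^bsub>SI\<^esub> bdry h" if "h \<in> carrier Er" for h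
  proof (rule extensionalityI[of _ "carrier PGL"])
    fix x :: "'a pgl" assume x: "x \<in> carrier PGL"
    have h: "h \<in> Efn" using that by simp
    have "eventually (\<lambda>j. f (ray x j) + h (ray x j) = bdry f x + bdry h x) sequentially"
      using bdry_eq[OF f x] bdry_eq[OF h x] by eventually_elim simp
    then show "bdry (f \<oplus>\<^bsub>Er\<^esub> h) x = (bdry f \<oplus>\<^bsub>SI\<^esub> bdry h) x"
      using x by (simp add: SI_simps(3) bdry_def[of "\<lambda>x. f x + h x"] lim_at_eq)
  qed (auto simp: SI_simps(3) bdry_def)
  show "bdry (ract Er g f) = ract SI g (bdry f)" if g: "g \<in> carrier PGL" for g
    using bdry_act[OF f g] by (intro extensionalityI[of _ "carrier PGL"]) (auto simp: SI_simps(5) bdry_def[of "ract (Vr 0) g f"])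
qed

text \<open>If the rays of \<open>k\<close> and \<open>k'\<close> pass through the same vertex at
  level \<open>N\<close>, the lower left entry of \<open>h\<close>, the inverse of \<open>k'\<close>
  times \<open>k\<close>, is divisible by \<open>unif ^ N\<close>. Since \<open>0 < N\<close>, its
  upper left entry is then a unit, so \<open>h\<close> is a lower unipotent matrix close to the
  identity times an upper triangular one. Conjugating the unipotent factor by the integral matrix
  \<open>k'\<close> keeps it congruent to the identity and moves it to the right, where smooth
  functions do not see it.\<close>

lemma lower_upper:
  assumes k: "k \<in> GLo" "k' \<in> GLo" and N: "0 < N"
    and eq: "vx (k ** dg (unif ^ N)) = vx (k' ** dg (unif ^ N :: 'a::nonarch_local_field))"
  obtains b u where "b \<in> borel_subgroup" "invertible u" "\<And>i j. absv (u$i$j - (mat 1 :: 'a^2^2)$i$j) \<le> absv (unif :: 'a) ^ N"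
    "inv\<^bsub>PGL\<^esub> (pg k) = b \<otimes>\<^bsub>PGL\<^esub> (inv\<^bsub>PGL\<^esub> (pg k') \<otimes>\<^bsub>PGL\<^esub> pg u)"
proof -
  let ?p = "unif :: 'a"
  have p: "?p \<noteq> 0" "absv ?p < 1" by (simp_all add: unif)
  obtain l where l: "l \<in> GLo" "k' ** l = mat 1" "l ** k' = mat 1" by (rule GLo_inv[OF k(2)])
  have inv: "invertible (k ** dg (?p ^ N))" "invertible (k' ** dg (?p ^ N))"
    using k p by (simp_all add: invertible_mult GLo_invertible invertible_dg)
  obtain c g where cg: "c \<noteq> 0" "g \<in> GLo" "k ** dg (?p ^ N) = mat c ** (k' ** dg (?p ^ N)) ** g"
    using iffD1[OF vx_eq_iff[OF inv(2) inv(1)] eq[symmetric]] by blast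
  define h where "h = l ** k"
  have h: "h \<in> GLo" using k l by (simp add: h_def GLo_mult)
  have kh: "k' ** h = k" by (simp add: h_def matrix_mul_assoc l(2))
  have hd: "h ** dg (?p ^ N) = mat c ** dg (?p ^ N) ** g"
  proof -
    have "h ** dg (?p ^ N) = l ** (mat c ** (k' ** dg (?p ^ N)) ** g)"
      by (simp add: h_def matrix_mul_assoc[symmetric] cg(3))
    also have "l ** (mat c ** (k' ** dg (?p ^ N)) ** g) = mat c ** ((l ** k') ** dg (?p ^ N)) ** g"
      by (simp add: eq2 mm2 mat2 algebra_simps)
    finally show ?thesis by (simp add: l(3))
  qed
  \<comment> \<open>Comparing determinants shows that the scalar \<open>c\<close> is a unit, so the
    factor \<open>?p ^ N\<close> in the lower left entry of \<open>h\<close> is not cancelled by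
    it.\<close>
  have "det h * ?p ^ N = c * c * ?p ^ N * det g"
    using arg_cong[OF hd, of det] by (simp add: det_mul det_dg) (simp add: det_2 mat2 mult.assoc)
  then have "det h = c * c * det g" using p by simp
  then have "absv c * absv c = 1" using h cg(2) by (simp add: GLo_iff absv_mult)
  then have c: "absv c = 1" using absv_nonneg[of c] by (metis abs_of_nonneg abs_square_eq_1 power2_eq_square)
  have "h$2$1 = c * ?p ^ N * g$2$1" using hd by (simp add: eq2 mm2 mat2)
  then have h21: "absv (h$2$1) \<le> absv ?p ^ N"
    using c cg(2) p by (simp add: absv_mult GLo_iff mult_left_le)
  have "absv ?p ^ N < 1" using p N by (simp add: power_less_one_iff)
  then have "absv (h$1$2 * h$2$1) < 1" using h21 h by (subst mult.commute, intro absv_mult_less) (auto simp: GLo_iff)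
  then have h11: "absv (h$1$1) = 1"
    using absv_diff_less[of "h$1$1 * h$2$2" 1 "h$1$2 * h$2$1"] absv_mult_less[of "h$1$1" 1 "h$2$2"] h
    by (fastforce simp: GLo_iff det_2)
  then have h0: "h$1$1 \<noteq> 0" "det h \<noteq> 0" using h by (auto simp: GLo_iff)
  \<comment> \<open>Subtracting \<open>t\<close> times the first row from the second clears the
    lower left entry of \<open>h\<close>; \<open>B\<close> is the inverse of the upper triangular
    matrix that is left.\<close>
  define t where "t = h$2$1 / h$1$1"
  have t: "absv t \<le> absv ?p ^ N" using h11 h21 by (simp add: t_def)
  define B where "B = mk2 (1 / h$1$1) (- h$1$2 / det h) 0 (h$1$1 / det h)"
  define u where "u = k' ** mk2 1 0 (- t) 1 ** l"
  have B: "invertible B" using h0 by (simp add: inv_det det_2[of B]) (simp add: B_def)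
  have "invertible (mk2 1 0 (- t) 1)" by (simp add: inv_det det_2)
  then have uinv: "invertible u" using k l by (simp add: u_def invertible_mult GLo_invertible)
  have "u$i$j - (mat 1 :: 'a^2^2)$i$j = - (t * (k'$i$2 * l$1$j))" for i j
  proof -
    have "u - mat 1 = u - k' ** l" by (simp add: l(2))
    then have "u$i$j - (mat 1 :: 'a^2^2)$i$j = (u - k' ** l)$i$j" by (metis vector_minus_component)
    then show ?thesis by (simp add: u_def mm2 algebra_simps)
  qed
  moreover have "absv (t * (k'$i$2 * l$1$j)) \<le> absv ?p ^ N" for i j
    using t k l by (intro absv_mult_le) (auto simp: GLo_def absv_mult mult_le_one)
  ultimately have cong: "absv (u$i$j - (mat 1 :: 'a^2^2)$i$j) \<le> absv ?p ^ N" for i j by simp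
  have "l ** u ** k = mk2 1 0 (- t) 1 ** h"
    by (simp add: u_def h_def matrix_mul_assoc l(3))
  moreover have "B ** (mk2 1 0 (- t) 1 ** h) = mat 1"
    using h0 by (simp add: eq2 mm2 mat2 B_def t_def) (simp add: divide_simps det_2 algebra_simps)
  ultimately have "(B ** (l ** u)) ** k = mat 1" by (simp flip: matrix_mul_assoc)
  moreover have "inv\<^bsub>PGL\<^esub> (pg k') = pg l"
    using k l by (intro PGL.inv_equality) (simp_all add: pg_mult GLo_invertible pg_one)
  ultimately have "inv\<^bsub>PGL\<^esub> (pg k) = pg B \<otimes>\<^bsub>PGL\<^esub> (inv\<^bsub>PGL\<^esub> (pg k') \<otimes>\<^bsub>PGL\<^esub> pg u)"
    using B uinv k l by (intro PGL.inv_equality) (simp_all add: pg_mult GLo_invertible invertible_mult pg_one)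
  moreover have "pg B \<in> borel_subgroup" using B by (auto simp: borel_iff B_def)
  ultimately show thesis using that uinv cong by blast
qed

text \<open>The Iwasawa decomposition. A column operation clears the lower left entry, and it is
  integral because the division is by the larger of the two entries in the bottom row. Consequently
  every end is reached by a ray starting at \<open>s0\<close>.\<close>

lemma iwasawa:
  assumes "x \<in> carrier PGL"
  obtains b k where "b \<in> borel_subgroup" "k \<in> GLo" "x = b \<otimes>\<^bsub>PGL\<^esub> inv\<^bsub>PGL\<^esub> (pg k)"
proof -
  obtain A where A: "invertible A" "x = pg A" by (rule carrier_pgE[OF assms])
  have "A$2$1 \<noteq> 0 \<or> A$2$2 \<noteq> 0" using A(1) by (auto simp: inv_det det_2)
  then obtain k where k: "k \<in> GLo" "(A ** k)$2$1 = 0"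
  proof (cases "absv (A$2$1) \<le> absv (A$2$2)")
    case True
    then have "A$2$2 \<noteq> 0" using \<open>A$2$1 \<noteq> 0 \<or> A$2$2 \<noteq> 0\<close> by auto
    then show ?thesis using True
      by (intro that[of "mk2 1 0 (- A$2$1 / A$2$2) 1"]) (auto simp: GLo_iff det_2 mm2 divide_simps)
  next
    case False
    then have "A$2$1 \<noteq> 0" by auto
    then show ?thesis using False
      by (intro that[of "mk2 (- A$2$2 / A$2$1) 1 1 0"]) (auto simp: GLo_iff det_2 mm2 divide_simps)
  qed
  have "x = pg (A ** k) \<otimes>\<^bsub>PGL\<^esub> inv\<^bsub>PGL\<^esub> (pg k)"
    using A k(1) by (simp add: pg_mult[symmetric] GLo_invertible PGL.m_assoc)
  moreover have "pg (A ** k) \<in> borel_subgroup"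
    unfolding borel_iff using A k by (intro exI[of _ "A ** k"]) (simp add: invertible_mult GLo_invertible)
  ultimately show thesis using that k(1) by blast
qed

lemma ray_k: "k \<in> GLo \<Longrightarrow> ray (inv\<^bsub>PGL\<^esub> (pg k)) j = [vx (k ** dg (unif ^ j))]"
  by (simp add: ray_def GLo_invertible sk_k)

text \<open>A smooth function \<open>F\<close> on the ends takes one value on all ends behind a
  vertex that is far enough from \<open>s0\<close>. Assigning this value to the vertex gives a
  function that no longer changes along outward edges beyond that depth and that has
  \<open>F\<close> as boundary value.\<close>

lemma bdry_surj: "bdry ` Efn = carrier (SI :: ('a::nonarch_local_field pgl, 'a pgl \<Rightarrow> complex) rep)"
proof
  show "bdry ` Efn \<subseteq> carrier (SI :: ('a pgl, 'a pgl \<Rightarrow> complex) rep)" using bdry_hom by (auto simp: rep_hom_def)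
  show "carrier (SI :: ('a pgl, 'a pgl \<Rightarrow> complex) rep) \<subseteq> bdry ` Efn"
  proof
    fix F :: "'a pgl \<Rightarrow> complex" assume "F \<in> carrier SI"
    then obtain U :: "'a pgl set" where F: "F \<in> extensional (carrier PGL)"
      "\<And>h x. h \<in> borel_subgroup \<Longrightarrow> x \<in> carrier PGL \<Longrightarrow> F (h \<otimes>\<^bsub>PGL\<^esub> x) = F x"
      and U: "subgroup U PGL" "openin PGL_top U" "\<And>x u. x \<in> carrier PGL \<Longrightarrow> u \<in> U \<Longrightarrow> F (x \<otimes>\<^bsub>PGL\<^esub> u) = F x"
      by (rule SI_carrierE) blast
    obtain N0 where N0: "\<And>A. invertible A \<Longrightarrow> (\<And>i j. absv (A$i$j - (mat 1 :: 'a^2^2)$i$j) \<le> absv (unif :: 'a) ^ N0) \<Longrightarrow> pg A \<in> U"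
      using open_contains_congruence[OF U(2) subgroup.one_closed[OF U(1)]] by blast
    \<comment> \<open>Depth \<open>N0\<close> makes the congruence condition imply membership in
      \<open>U\<close>; the bound 1 is the positivity required by
      \<open>lower_upper\<close>.\<close>
    define N1 where "N1 = max N0 1"
    have indep: "F (inv\<^bsub>PGL\<^esub> (pg k)) = F (inv\<^bsub>PGL\<^esub> (pg k'))"
      if k: "k \<in> GLo" "k' \<in> GLo" and N: "N1 \<le> N" and eq: "vx (k ** dg (unif ^ N)) = vx (k' ** dg (unif ^ N))"
      for k k' :: "'a^2^2" and N
    proof -
      have "0 < N" using N by (simp add: N1_def)
      then obtain b u where bu: "b \<in> borel_subgroup" "invertible u"
        "\<And>i j. absv (u$i$j - (mat 1 :: 'a^2^2)$i$j) \<le> absv (unif :: 'a) ^ N"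
        "inv\<^bsub>PGL\<^esub> (pg k) = b \<otimes>\<^bsub>PGL\<^esub> (inv\<^bsub>PGL\<^esub> (pg k') \<otimes>\<^bsub>PGL\<^esub> pg u)"
        using lower_upper[OF k _ eq] by blast
      have "absv (unif :: 'a) ^ N \<le> absv (unif :: 'a) ^ N0"
        using N unif(2)[where 'a='a] by (intro power_decreasing) (auto simp: N1_def)
      then have "pg u \<in> U" using bu(2,3) by (intro N0) (auto intro: order_trans)
      then show ?thesis using bu(1,2,4) k(2) F(2) U(3) by (simp add: GLo_invertible)
    qed
    \<comment> \<open>Below level \<open>N1\<close> the value of \<open>f\<close> depends on this
      choice, but only finitely many edges have both ends there, so the coboundary stays finitely
      supported.\<close>
    define kk where "kk v = (SOME k. k \<in> GLo \<and> v = vx (k ** dg (unif ^ level v)))" for v :: "'a vertex"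
    define f where "f v = (if v \<in> opaths 0 then F (inv\<^bsub>PGL\<^esub> (pg (kk (v ! 0)))) else 0)" for v
    have f: "f [vx (k ** dg (unif ^ N))] = F (inv\<^bsub>PGL\<^esub> (pg k))" if k: "k \<in> GLo" and N: "N1 \<le> N" for k N
    proof -
      let ?v = "vx (k ** dg (unif ^ N))"
      have lv: "level ?v = N" by (rule level_k_sk[OF k])
      have tv: "?v \<in> tree_verts" using k by (simp add: invertible_mult GLo_invertible invertible_dg unif)
      have "kk ?v \<in> GLo \<and> ?v = vx (kk ?v ** dg (unif ^ level ?v))"
        unfolding kk_def by (rule someI[of _ k]) (simp add: k lv)
      then have "F (inv\<^bsub>PGL\<^esub> (pg (kk ?v))) = F (inv\<^bsub>PGL\<^esub> (pg k))"
        using indep[of "kk ?v" k N] k N lv by simp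
      then show ?thesis using tv by (simp add: f_def opaths_0)
    qed
    \<comment> \<open>The matrix \<open>k\<close> that describes the outer vertex \<open>y\<close>
      also describes \<open>x\<close>, since the lower neighbour of \<open>y\<close> is
      unique.\<close>
    have step: "f [x] = f [y]" if xy: "adjacent x y" "level y = Suc (level x)" and N: "N1 \<le> level x" for x y
    proof -
      obtain k where k: "k \<in> GLo" "y = vx (k ** dg (unif ^ level y))"
        using vertex_eq_k_sk adjacent_tree(2)[OF xy(1)] by blast
      let ?x = "vx (k ** dg (unif ^ level x))"
      have "adjacent y ?x" using adjacent_sym[OF adjacent_sk[OF k(1), of "level x"]] k(2) xy(2) by simp
      then have "?x = x" using down_nbr_unique[of y ?x x] xy adjacent_sym level_k_sk[OF k(1), of "level x"] by auto
      then show ?thesis using f[OF k(1) N] f[OF k(1), of "level y"] k(2) N xy(2) by simp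
    qed
    let ?Y = "{x \<in> (tree_verts :: 'a vertex set). level x \<le> N1}"
    have "cob 0 f a = 0" if a: "a \<notin> (\<lambda>(x, y). [x, y]) ` (?Y \<times> ?Y)" for a
    proof (cases "a \<in> opaths (Suc 0)")
      case True
      then obtain x y where xy: "adjacent x y" "a = [x, y]" by (auto simp: opaths_1)
      have "\<not> (level x \<le> N1 \<and> level y \<le> N1)" using a xy adjacent_tree[OF xy(1)] by auto
      then have "f [x] = f [y]"
        using adjacent_level[OF xy(1)] step[OF xy(1)] step[OF adjacent_sym[OF xy(1)]] by auto
      then show ?thesis using xy by (simp add: cob_0)
    qed (simp add: cob_0)
    then have "{a. cob 0 f a \<noteq> 0} \<subseteq> (\<lambda>(x, y). [x, y]) ` (?Y \<times> ?Y)" by blast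
    moreover have "finite ((\<lambda>(x, y). [x, y]) ` (?Y \<times> ?Y))"
      by (intro finite_imageI finite_cartesian_product finite_level)
    ultimately have "f \<in> Efn" by (auto simp: Efn_def f_def intro: finite_subset)
    moreover have "bdry f = F"
    proof (rule extensionalityI[of _ "carrier PGL"])
      fix x :: "'a pgl" assume "x \<in> carrier PGL"
      then obtain b k where bk: "b \<in> borel_subgroup" "k \<in> GLo" "x = b \<otimes>\<^bsub>PGL\<^esub> inv\<^bsub>PGL\<^esub> (pg k)" by (rule iwasawa)
      have y: "inv\<^bsub>PGL\<^esub> (pg k) \<in> carrier PGL" using bk(2) by (simp add: GLo_invertible)
      have "eventually (\<lambda>j. f (ray (inv\<^bsub>PGL\<^esub> (pg k)) j) = F (inv\<^bsub>PGL\<^esub> (pg k))) sequentially"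
        using f[OF bk(2)] ray_k[OF bk(2)] by (intro eventually_sequentiallyI[of N1]) simp
      then have "bdry f (inv\<^bsub>PGL\<^esub> (pg k)) = F (inv\<^bsub>PGL\<^esub> (pg k))" using y by (simp add: bdry_def lim_at_eq)
      then show "bdry f x = F x" using bk bdry_borel[OF \<open>f \<in> Efn\<close> bk(1) y] F(2)[OF bk(1) y] by simp
    qed (simp_all add: bdry_def F(1))
    ultimately show "F \<in> bdry ` Efn" by blast
  qed
qed

abbreviation const_fns :: "('a::nonarch_local_field pgl \<Rightarrow> complex) set"
  where "const_fns \<equiv> {(\<lambda>x\<in>carrier PGL. c) | c. True}"

text \<open>Both conditions say that \<open>f\<close> is a constant plus a finitely supported
  function. If \<open>cob 0 f\<close> is the coboundary of such a function, the difference is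
  constant by connectedness, and rays eventually leave the support. Conversely, beyond the support
  of the coboundary \<open>f\<close> already equals its boundary value.\<close>

lemma bdry_const:
  assumes f: "f \<in> Efn"
  shows "cob 0 f \<in> Bd 0 \<longleftrightarrow> bdry f \<in> const_fns"
proof
  assume "cob 0 f \<in> Bd 0"
  then obtain h where h: "h \<in> fin_supp (opaths 0)" "cob 0 f = cob 0 h" by (auto simp: Bd_def)
  have "f [y] - h [y] = f [x] - h [x]" if xy: "adjacent x y" for x y
  proof -
    have "[x, y] \<in> opaths (Suc 0)" using xy by (auto simp: opaths_1)
    then show ?thesis using fun_cong[OF h(2), of "[x, y]"] by (simp add: cob_0 algebra_simps)
  qed
  then have fh: "f [x] - h [x] = f [s0] - h [s0]" if "x \<in> tree_verts" for x
    using cob_zero_const[of "\<lambda>v. f v - h v" x] that by simp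
  have "bdry f x = f [s0] - h [s0]" if x: "x \<in> carrier PGL" for x
  proof -
    have "eventually (\<lambda>j. ray x j \<notin> {v. h v \<noteq> 0}) sequentially"
      using h(1) ray_inj[OF x] by (intro eventually_not_in) (auto simp: fin_supp_iff inj_def)
    then have "eventually (\<lambda>j. f (ray x j) = f [s0] - h [s0]) sequentially"
    proof eventually_elim
      case (elim j)
      then show ?case using fh[of "vertex_act (inv\<^bsub>PGL\<^esub> x) (sk j)"] x by (simp add: ray_def)
    qed
    then show ?thesis using x by (simp add: bdry_def lim_at_eq)
  qed
  then have "bdry f = (\<lambda>x\<in>carrier PGL. f [s0] - h [s0])"
    by (intro extensionalityI[of _ "carrier PGL"]) (simp_all add: bdry_def[of f])
  then show "bdry f \<in> const_fns" by blast
next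
  assume "bdry f \<in> const_fns"
  then obtain c where c: "bdry f = (\<lambda>x\<in>carrier PGL. c)" by blast
  \<comment> \<open>Subtracting the boundary value does not change the coboundary; the rest of the
    proof shows that it makes the support finite.\<close>
  define h where "h v = (if v \<in> opaths 0 then f v - c else 0)" for v
  have "cob 0 h = cob 0 f"
    by (auto simp: cob_0 h_def fun_eq_iff opaths_1 opaths_0 dest: adjacent_tree)
  moreover have "h \<in> fin_supp (opaths 0)"
  proof -
    \<comment> \<open>Beyond the bound \<open>N\<close> on the levels of the support of the
      coboundary, \<open>f\<close> does not change along outward edges, and every vertex lies on
      some ray from \<open>s0\<close> by \<open>vertex_eq_k_sk\<close>.\<close>
    have "finite (\<Union>a\<in>{a. cob 0 f a \<noteq> 0}. level ` set a)" using f by (auto simp: Efn_def)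
    then obtain N where N: "\<And>a x. cob 0 f a \<noteq> 0 \<Longrightarrow> x \<in> set a \<Longrightarrow> level x < N"
      using finite_nat_set_iff_bounded[of "\<Union>a\<in>{a. cob 0 f a \<noteq> 0}. level ` set a"] by auto
    have "h [v] = 0" if v: "v \<in> tree_verts" and lv: "N \<le> level v" for v
    proof -
      obtain k where k: "k \<in> GLo" "v = vx (k ** dg (unif ^ level v))" by (rule vertex_eq_k_sk[OF v])
      have y: "inv\<^bsub>PGL\<^esub> (pg k) \<in> carrier PGL" using k(1) by (simp add: GLo_invertible)
      let ?r = "ray (inv\<^bsub>PGL\<^esub> (pg k))"
      have "f (?r j) = f (?r (level v))" if "level v \<le> j" for j
        using that
      proof (induction j rule: dec_induct)
        case (step j)
        let ?a = "[vx (k ** dg (unif ^ j)), vx (k ** dg (unif ^ Suc j))]"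
        have "?a \<in> opaths (Suc 0)" using adjacent_sk[OF k(1)] by (auto simp: opaths_1)
        moreover have "cob 0 f ?a = 0"
          using N[of ?a "vx (k ** dg (unif ^ j))"] level_k_sk[OF k(1), of j] lv step.hyps by fastforce
        ultimately show ?case using step.IH ray_k[OF k(1)] by (simp add: cob_0)
      qed simp
      then have "eventually (\<lambda>j. f (?r j) = f (?r (level v))) sequentially" by (rule eventually_sequentiallyI)
      then have "f (?r (level v)) = c" using fun_cong[OF c, of "inv\<^bsub>PGL\<^esub> (pg k)"] y by (simp add: bdry_def lim_at_eq)
      then show ?thesis using k ray_k[OF k(1), of "level v"] by (simp add: h_def)
    qed
    then have *: "N \<le> level v \<Longrightarrow> h [v] = 0" if "v \<in> tree_verts" for v using that by blast
    have "v \<in> (\<lambda>x. [x]) ` {x \<in> tree_verts. level x \<le> N}" if "h v \<noteq> 0" for v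
    proof -
      have "v \<in> opaths 0" using that by (auto simp: h_def split: if_splits)
      then obtain x where "x \<in> tree_verts" "v = [x]" by (auto simp: opaths_0)
      then show ?thesis using *[of x] that by (cases "N \<le> level x") auto
    qed
    then have "{v. h v \<noteq> 0} \<subseteq> (\<lambda>x. [x]) ` {x \<in> tree_verts. level x \<le> N}"
      by blast
    then show ?thesis using finite_subset[OF _ finite_imageI[OF finite_level]]
      by (auto simp: fin_supp_iff) (auto simp: h_def split: if_splits)
  qed
  ultimately show "cob 0 f \<in> Bd 0" by (metis Bd_def image_eqI)
qed

lemma consts_subrep: "subrep (carrier PGL) (SI :: ('a::nonarch_local_field pgl, 'a pgl \<Rightarrow> complex) rep) const_fns"
proof -
  interpret SI: arep "carrier PGL" "SI :: ('a pgl, 'a pgl \<Rightarrow> complex) rep" by (rule SI_arep)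
  show ?thesis
  proof (rule SI.subrepI)
    show "(const_fns :: ('a pgl \<Rightarrow> complex) set) \<subseteq> carrier SI"
      by (auto intro!: SI_carrierI[OF _ _ PGL.subgroup_self openin_carrier] simp: borel_carrier)
    show "ract SI g f \<in> const_fns" if "g \<in> carrier PGL" "f \<in> const_fns" for g and f :: "'a pgl \<Rightarrow> complex"
      using that by (auto simp: SI_simps(5) cong: restrict_cong)
  qed (auto simp: SI_simps(2-4) cong: restrict_cong)
qed

lemma Bd_subset_Odd: "Bd 0 \<subseteq> Odd"
  using cob_surj fin_supp_Efn by (auto simp: Bd_def)

lemma Odd_mod_Bd:
  "rep_iso (carrier PGL) (rep_quot ((Vr (Suc 0))\<lparr>carrier := Odd\<rparr>) (Bd 0)) (Steinberg :: ('a::nonarch_local_field pgl, _) rep)"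
proof -
  have odd: "subrep (carrier PGL) (Vr (Suc 0)) (Odd :: ('a vpath \<Rightarrow> complex) set)"
    using ind_subrep[OF Dl_subrep, of 0] by (simp add: ind_Dl_0)
  show ?thesis unfolding Steinberg_def
  proof (rule rep_iso_zigzag[OF Efn_arep _ SI_arep cob_Efn_hom _ bdry_hom _ _ consts_subrep])
    show "arep (carrier PGL) ((Vr (Suc 0))\<lparr>carrier := (Odd :: ('a vpath \<Rightarrow> complex) set)\<rparr>)"
      by (rule Vr.arep_subrep[OF odd])
    show "subrep (carrier PGL) ((Vr (Suc 0))\<lparr>carrier := Odd\<rparr>) (Bd 0 :: ('a vpath \<Rightarrow> complex) set)"
      using Vr.subrep_trans[OF odd, of "Bd 0"] Bd_subrep[of 0] Bd_subset_Odd by blast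
  qed (simp_all add: cob_surj bdry_surj bdry_const)
qed

section \<open>Decomposition of the cohomology\<close>

text \<open>Each complement \<open>T i\<close> is isomorphic to the corresponding factor of the
  chain, so counting the factors isomorphic to \<open>L\<close> amounts to counting complements. The
  chain is moved to the ambient space \<open>U\<close> because that is the space identified with the
  cohomology.\<close>

lemma chain_jh:
  fixes L :: "('a::nonarch_local_field pgl, 'w) rep"
  assumes "arep K M" and U: "subrep K M U" and NU: "N r \<subseteq> U" and N0: "N 0 = {\<zero>\<^bsub>M\<^esub>}"
    and irr: "\<And>i. i < r \<Longrightarrow> irreducible_subquot K M (N (Suc i)) (N i)"
    and iso: "\<And>i. i < r \<Longrightarrow> rep_iso K (M\<lparr>carrier := T i\<rparr>) (subquot M (N (Suc i)) (N i))"
    and T: "\<And>i. i < r \<Longrightarrow> subrep K M (T i)"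
  shows "jh K (M\<lparr>carrier := U\<rparr>) L (N r) r (card {i. i < r \<and> rep_iso K (M\<lparr>carrier := T i\<rparr>) L})"
    and "i < r \<Longrightarrow> irreducible_subquot K (M\<lparr>carrier := U\<rparr>) (N (Suc i)) (N i)"
proof -
  interpret M: arep K M by fact
  have sub: "N i \<subseteq> N r" if "i \<le> r" for i
    using that
  proof (induction i rule: inc_induct)
    case (step i)
    then show ?case using irr[of i] by (auto simp: irreducible_subquot_def)
  qed simp
  have irrU: "irreducible_subquot K (M\<lparr>carrier := U\<rparr>) (N (Suc i)) (N i)" if "i < r" for i
    using irr[OF that] sub[of i] sub[of "Suc i"] that NU by (auto simp: irreducible_subquot_def M.subrep_trans[OF U])
  then show "i < r \<Longrightarrow> irreducible_subquot K (M\<lparr>carrier := U\<rparr>) (N (Suc i)) (N i)" .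
  have "jh K (M\<lparr>carrier := U\<rparr>) L (N j) j (card {i. i < j \<and> rep_iso K (M\<lparr>carrier := T i\<rparr>) L})" if "j \<le> r" for j
    using that
  proof (induction j)
    case 0
    then show ?case using jh.zero[of K "M\<lparr>carrier := U\<rparr>" L] N0 by simp
  next
    case (Suc j)
    have j: "j < r" using Suc.prems by simp
    have "arep K (M\<lparr>carrier := T j\<rparr>)" by (rule M.arep_subrep[OF T[OF j]])
    then have eq: "rep_iso K (M\<lparr>carrier := T j\<rparr>) L \<longleftrightarrow> rep_iso K (subquot M (N (Suc j)) (N j)) L"
      using rep_iso_trans[OF iso[OF j]] rep_iso_trans[OF rep_iso_sym[OF _ iso[OF j]]] by blast
    let ?C = "\<lambda>j. {i. i < j \<and> rep_iso K (M\<lparr>carrier := T i\<rparr>) L}"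
    have "?C (Suc j) = (if rep_iso K (M\<lparr>carrier := T j\<rparr>) L then insert j (?C j) else ?C j)"
      by (auto simp: less_Suc_eq)
    then have "card (?C (Suc j)) = card (?C j) + (if rep_iso K (subquot M (N (Suc j)) (N j)) L then 1 else 0)"
      by (simp add: eq)
    then show ?case using jh.step[OF Suc.IH irrU[OF j]] Suc.prems by simp
  qed
  then show "jh K (M\<lparr>carrier := U\<rparr>) L (N r) r (card {i. i < r \<and> rep_iso K (M\<lparr>carrier := T i\<rparr>) L})" by blast
qed

lemma semisimpleE:
  fixes S :: "'a::nonarch_local_field vpath set"
  assumes "stable K S" "finite S" "subrep K (fin_supp_rep S) U"
  obtains N r T where "N 0 = {\<lambda>x. 0}" "N r = U"
    "\<And>i. i < r \<Longrightarrow> irreducible_subquot K (fin_supp_rep S) (N (Suc i)) (N i)"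
    "\<And>i. i < r \<Longrightarrow> subrep K (fin_supp_rep S) (T i)" "\<And>i. i < r \<Longrightarrow> T i \<subseteq> U"
    "\<And>i. i < r \<Longrightarrow> rep_iso K ((fin_supp_rep S)\<lparr>carrier := T i\<rparr>) (subquot (fin_supp_rep S) (N (Suc i)) (N i))"
    "\<And>i j s t. i < r \<Longrightarrow> j < r \<Longrightarrow> i \<noteq> j \<Longrightarrow> s \<in> T i \<Longrightarrow> t \<in> T j \<Longrightarrow> ip S s t = 0"
    "\<And>u. u \<in> U \<Longrightarrow> \<exists>t\<in>Pi {..<r} T. u = (\<lambda>x. \<Sum>i<r. t i x)"
proof -
  note claim = that
  have thesis if "N 0 = {\<lambda>x. 0} \<and> N r = U \<and>
    (\<forall>i<r. irreducible_subquot K (fin_supp_rep S) (N (Suc i)) (N i) \<and> subrep K (fin_supp_rep S) (T i) \<and> T i \<subseteq> U \<and>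
      rep_iso K ((fin_supp_rep S)\<lparr>carrier := T i\<rparr>) (subquot (fin_supp_rep S) (N (Suc i)) (N i))) \<and>
    (\<forall>i<r. \<forall>j<r. i \<noteq> j \<longrightarrow> (\<forall>s\<in>T i. \<forall>t\<in>T j. ip S s t = 0)) \<and>
    (\<forall>u\<in>U. \<exists>t\<in>Pi {..<r} T. u = (\<lambda>x. \<Sum>i<r. t i x))" for r N T
    using that by (intro claim[of N r T]) simp_all
  then show thesis using semisimple[OF assms] by (elim exE)
qed

text \<open>The local cohomology is a quotient of the functions on \<open>Sig k\<close>. Realizing
  it as the orthogonal complement of the coboundaries gives irreducible spaces \<open>T i\<close>
  that together with \<open>Dl k\<close> decompose the fibre as \<open>ind_split\<close> requires,
  and that at the same time compute the multiplicities.\<close>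

proposition Sigma_decomposition:
  fixes k :: nat
  obtains r :: nat and T :: "nat \<Rightarrow> ('a::nonarch_local_field vpath \<Rightarrow> complex) set" where
    "\<And>i. i < r \<Longrightarrow> subrep (K_par k) (Sr k) (T i)"
    "\<And>p. p \<in> fin_supp (Sig k) \<Longrightarrow> \<exists>d\<in>Dl k. \<exists>t\<in>Pi {..<r} T. p = (\<lambda>x. d x + (\<Sum>i<r. t i x))"
    "\<And>d t. d \<in> Dl k \<Longrightarrow> t \<in> Pi {..<r} T \<Longrightarrow> (\<lambda>x. d x + (\<Sum>i<r. t i x)) = (\<lambda>x. 0) \<Longrightarrow>
      d = (\<lambda>x. 0) \<and> (\<forall>i<r. t i = (\<lambda>x. 0))"
    "\<And>i. i < r \<Longrightarrow> \<exists>W W'. irreducible_subquot (K_par k) (H1c (Sigma_graph k)) W' W \<and>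
      rep_iso (K_par k) ((Sr k)\<lparr>carrier := T i\<rparr>) (subquot (H1c (Sigma_graph k)) W' W)"
    "\<And>L :: ('a pgl, 'w) rep. rep_mult (K_par k) (H1c (Sigma_graph k)) L =
      card {i. i < r \<and> rep_iso (K_par k) ((Sr k)\<lparr>carrier := T i\<rparr>) L}"
proof -
  let ?R = "Sr k :: ('a pgl, 'a vpath \<Rightarrow> complex) rep" and ?S = "Sig k :: 'a vpath set" and ?K = "K_par k :: 'a pgl set"
  let ?D = "Dl k :: ('a vpath \<Rightarrow> complex) set" and ?H = "H1c (Sigma_graph k :: ('a vpath, 'a vpath) pre_digraph)"
  note fs = stable_Sig[of k] finite_Sig[of k]
  have full: "subrep ?K ?R (fin_supp ?S)" using Sr.subrep_carrier[of k] by simp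
  have D: "subrep ?K ?R ?D" by (rule Dl_subrep)
  then have DS: "?D \<subseteq> fin_supp ?S" using Sr.subrepD(1)[OF D] by simp
  \<comment> \<open>The harmonic cochains: a copy of the cohomology of the local graph inside the
    functions on its arcs.\<close>
  define U where "U = fin_supp ?S \<inter> perp ?S ?D"
  have U: "subrep ?K ?R U" unfolding U_def by (rule perp_subrep[OF fs D full])
  have R: "?R\<lparr>carrier := fin_supp ?S\<rparr> = ?R" by (simp add: fin_supp_rep_def)
  have "rep_iso ?K (?R\<lparr>carrier := U\<rparr>) ?H"
    using perp_iso[OF fs D full DS] unfolding U_def H1c_Sigma R .
  then obtain \<phi> where b: "bij_betw \<phi> (carrier (?R\<lparr>carrier := U\<rparr>)) (carrier ?H)" and h: "rep_hom ?K \<phi> (?R\<lparr>carrier := U\<rparr>) ?H"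
    by (auto simp: rep_iso_iff)
  have arU: "arep ?K (?R\<lparr>carrier := U\<rparr>)" by (rule Sr.arep_subrep[OF U])
  have arH: "arep ?K ?H" unfolding H1c_Sigma
    by (rule subrep_pair.quot_arep) (simp add: subrep_pair_def subrep_pair_axioms_def Sr.arep_axioms D)
  obtain r N T where N0: "N 0 = {\<lambda>x. 0}" and Nr: "N r = U"
    and NT: "\<And>i. i < r \<Longrightarrow> irreducible_subquot ?K ?R (N (Suc i)) (N i)" "\<And>i. i < r \<Longrightarrow> subrep ?K ?R (T i)"
      "\<And>i. i < r \<Longrightarrow> T i \<subseteq> U" "\<And>i. i < r \<Longrightarrow> rep_iso ?K (?R\<lparr>carrier := T i\<rparr>) (subquot ?R (N (Suc i)) (N i))"
    and orth: "\<And>i j s t. i < r \<Longrightarrow> j < r \<Longrightarrow> i \<noteq> j \<Longrightarrow> s \<in> T i \<Longrightarrow> t \<in> T j \<Longrightarrow> ip ?S s t = 0"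
    and sum: "\<And>u. u \<in> U \<Longrightarrow> \<exists>t\<in>Pi {..<r} T. u = (\<lambda>x. \<Sum>i<r. t i x)"
    by (rule semisimpleE[OF fs U]) blast
  show thesis
  proof (rule that[of r T])
    show "subrep ?K ?R (T i)" if "i < r" for i using NT(2)[OF that] .
    show "\<exists>d\<in>?D. \<exists>t\<in>Pi {..<r} T. p = (\<lambda>x. d x + (\<Sum>i<r. t i x))" if p: "p \<in> fin_supp ?S" for p
    proof -
      obtain d u where du: "d \<in> ?D" "u \<in> U" "p = (\<lambda>x. d x + u x)"
        unfolding U_def by (rule perp_split[OF fs D full DS p])
      obtain t where "t \<in> Pi {..<r} T" "u = (\<lambda>x. \<Sum>i<r. t i x)" using sum[OF du(2)] by blast
      then show ?thesis using du by blast
    qed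
    show "d = (\<lambda>x. 0) \<and> (\<forall>i<r. t i = (\<lambda>x. 0))"
      if d: "d \<in> ?D" and t: "t \<in> Pi {..<r} T" and z: "(\<lambda>x. d x + (\<Sum>i<r. t i x)) = (\<lambda>x. 0)" for d t
    proof -
      have tU: "t i \<in> U" if "i < r" for i using t NT(3)[OF that] that by auto
      have td: "ip ?S (t i) d = 0" if "i < r" for i using tU[OF that] d by (simp add: U_def perp_def)
      \<comment> \<open>The vanishing sum is paired first with \<open>d\<close> and then with each
        \<open>t j\<close>; orthogonality leaves a single square norm each time.\<close>
      have zz: "ip ?S d w + (\<Sum>i<r. ip ?S (t i) w) = 0" for w
        using arg_cong[OF z, of "\<lambda>f. ip ?S f w"] by (simp add: ip_add_left ip_sum_left ip_zero)
      have "d = (\<lambda>x. 0)" using zz[of d] td ip_self[OF fs(2)] d DS by auto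
      moreover have "t j = (\<lambda>x. 0)" if j: "j < r" for j
      proof -
        have "(\<Sum>i<r. ip ?S (t i) (t j)) = (\<Sum>i<r. if i = j then ip ?S (t j) (t j) else 0)"
          using orth[of _ j] t j by (intro sum.cong) auto
        then have "ip ?S (t j) (t j) = 0" using zz[of "t j"] j \<open>d = (\<lambda>x. 0)\<close> by (simp add: ip_zero)
        then show ?thesis using ip_self[OF fs(2)] tU[OF j] by (auto simp: U_def)
      qed
      ultimately show ?thesis by blast
    qed
    show "\<exists>W W'. irreducible_subquot ?K ?H W' W \<and> rep_iso ?K (?R\<lparr>carrier := T i\<rparr>) (subquot ?H W' W)" if i: "i < r" for i
    proof -
      have s: "irreducible_subquot ?K (?R\<lparr>carrier := U\<rparr>) (N (Suc i)) (N i)"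
        by (rule chain_jh(2)[where r = r and N = N and T = T and i = i, OF Sr.arep_axioms U]) (use NT Nr N0 i in auto)
      note s' = s[unfolded irreducible_subquot_def]
      have iso: "rep_iso ?K (subquot (?R\<lparr>carrier := U\<rparr>) (N (Suc i)) (N i)) (subquot ?H (\<phi> ` N (Suc i)) (\<phi> ` N i))"
        using s' by (intro subquot_iso[OF arU arH b h]) auto
      have im: "subrep ?K ?H (\<phi> ` N i)" "subrep ?K ?H (\<phi> ` N (Suc i))" "\<phi> ` N i \<subseteq> \<phi> ` N (Suc i)"
        using subrep_image[OF arU arH h] s' by auto
      have "irreducible_subquot ?K ?H (\<phi> ` N (Suc i)) (\<phi> ` N i)"
        using irreducible_rep_iso[OF arep.arep_subquot[OF arU] arep.arep_subquot[OF arH im] iso] s' im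
        by (auto simp: irreducible_subquot_def)
      then show ?thesis using rep_iso_trans[OF NT(4)[OF i]] iso by auto
    qed
    fix L :: "('a pgl, 'w) rep"
    \<comment> \<open>Jordan-Hoelder needs every subrepresentation of the cohomology to have finite
      length. Each is the image under \<open>\<phi>\<close> of a stable subspace of
      \<open>U\<close>, to which semisimplicity applies afresh.\<close>
    have ex: "\<exists>n c. jh ?K ?H L W n c" if W: "subrep ?K ?H W" for W
    proof -
      let ?V = "{v \<in> U. \<phi> v \<in> W}"
      have "subrep ?K (?R\<lparr>carrier := U\<rparr>) ?V" using subrep_vimage[OF arU arH h W] by simp
      then have V: "subrep ?K ?R ?V" using Sr.subrep_trans[OF U, of ?V] by blast
      obtain r' N' T' where "N' 0 = {\<lambda>x. 0}" "N' r' = ?V"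
        "\<And>i. i < r' \<Longrightarrow> irreducible_subquot ?K ?R (N' (Suc i)) (N' i)" "\<And>i. i < r' \<Longrightarrow> subrep ?K ?R (T' i)"
        "\<And>i. i < r' \<Longrightarrow> rep_iso ?K (?R\<lparr>carrier := T' i\<rparr>) (subquot ?R (N' (Suc i)) (N' i))"
        by (rule semisimpleE[OF fs V]) blast
      then have "jh ?K (?R\<lparr>carrier := U\<rparr>) L ?V r' (card {i. i < r' \<and> rep_iso ?K (?R\<lparr>carrier := T' i\<rparr>) L})"
        using chain_jh(1)[where r = r' and N = N' and T = T', OF Sr.arep_axioms U] by auto
      then have "jh ?K ?H L (\<phi> ` ?V) r' (card {i. i < r' \<and> rep_iso ?K (?R\<lparr>carrier := T' i\<rparr>) L})"
        by (rule jh_transport[OF arU arH b h])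
      moreover have "W \<subseteq> \<phi> ` U" using b arep.subrepD(1)[OF arH W] by (simp add: bij_betw_def)
      then have "\<phi> ` ?V = W" by blast
      ultimately show ?thesis by auto
    qed
    have "jh ?K (?R\<lparr>carrier := U\<rparr>) L (N r) r (card {i. i < r \<and> rep_iso ?K (?R\<lparr>carrier := T i\<rparr>) L})"
      by (rule chain_jh(1)[where r = r and N = N and T = T, OF Sr.arep_axioms U]) (use NT Nr N0 in auto)
    then have "jh ?K ?H L (\<phi> ` N r) r (card {i. i < r \<and> rep_iso ?K (?R\<lparr>carrier := T i\<rparr>) L})"
      by (rule jh_transport[OF arU arH b h])
    moreover have "\<phi> ` N r = carrier ?H" using b Nr by (simp add: bij_betw_def)
    ultimately show "rep_mult ?K ?H L = card {i. i < r \<and> rep_iso ?K (?R\<lparr>carrier := T i\<rparr>) L}"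
      using arep.rep_mult_jh[OF arH ex] by simp
  qed
qed

text \<open>Tagging the summands with \<open>k\<close> keeps the index sets for different path
  lengths disjoint when they are united later.\<close>

lemma path_split:
  fixes T :: "nat \<Rightarrow> ('a::nonarch_local_field vpath \<Rightarrow> complex) set"
  assumes T: "\<And>i. i < r \<Longrightarrow> subrep (K_par k) (Sr k) (T i)"
    and dec: "\<And>p. p \<in> fin_supp (Sig k) \<Longrightarrow> \<exists>d\<in>Dl k. \<exists>t\<in>Pi {..<r} T. p = (\<lambda>x. d x + (\<Sum>i<r. t i x))"
    and uniq: "\<And>d t. d \<in> Dl k \<Longrightarrow> t \<in> Pi {..<r} T \<Longrightarrow> (\<lambda>x. d x + (\<Sum>i<r. t i x)) = (\<lambda>x. 0) \<Longrightarrow>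
      d = (\<lambda>x. 0) \<and> (\<forall>i<r. t i = (\<lambda>x. 0))"
  shows "rep_iso (carrier PGL) (H1c (path_graph k))
    (rep_plus (rep_quot ((Vr (Suc k))\<lparr>carrier := ind k (Dl k)\<rparr>) (Bd k))
      (rep_dsum ({k} \<times> {..<r}) (\<lambda>i. (Vr (Suc k))\<lparr>carrier := ind k (T (snd i))\<rparr>)))"
proof -
  let ?I = "{k} \<times> {..<r}"
  have sum: "(\<Sum>i\<in>?I. g i) = (\<Sum>i<r. g (k, i))" for g :: "nat \<times> nat \<Rightarrow> complex"
    using sum.cartesian_product[of "\<lambda>j i. g (j, i)" "{..<r}" "{k}"] by simp
  have B: "Bd k \<subseteq> (ind k (Dl k) :: ('a vpath \<Rightarrow> complex) set)"
    using Bd_subset_Odd Bd_Ed[of k] by (cases "k = 0") (simp_all add: ind_Dl_0 ind_Dl)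
  have "rep_iso (carrier PGL) (rep_quot (Vr (Suc k)) (Bd k))
    (rep_plus (rep_quot ((Vr (Suc k))\<lparr>carrier := ind k (Dl k)\<rparr>) (Bd k))
      (rep_dsum ?I (\<lambda>i. (Vr (Suc k))\<lparr>carrier := ind k (T (snd i))\<rparr>)))"
  proof (rule ind_split[OF _ Dl_subrep _ _ _ Bd_subrep B])
    fix p :: "'a vpath \<Rightarrow> complex" assume "p \<in> fin_supp (Sig k)"
    then obtain d t where dt: "d \<in> Dl k" "t \<in> Pi {..<r} T" "p = (\<lambda>x. d x + (\<Sum>i<r. t i x))" using dec by blast
    have "(\<lambda>i. t (snd i)) \<in> Pi ?I (\<lambda>i. T (snd i))" using dt(2) by auto
    moreover have "p = (\<lambda>x. d x + (\<Sum>i\<in>?I. t (snd i) x))" using dt(3) by (simp only: sum snd_conv)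
    ultimately show "\<exists>d\<in>Dl k. \<exists>t\<in>Pi ?I (\<lambda>i. T (snd i)). p = (\<lambda>x. d x + (\<Sum>i\<in>?I. t i x))"
      using dt(1) by (intro bexI[of _ d] bexI[of _ "\<lambda>i. t (snd i)"])
  next
    fix d t assume dt: "d \<in> Dl k" "t \<in> Pi ?I (\<lambda>i. T (snd i))" "(\<lambda>x. d x + (\<Sum>i\<in>?I. t i x)) = (\<lambda>x. 0)"
    have "(\<lambda>i. t (k, i)) \<in> Pi {..<r} T" using dt(2) by (auto simp: Pi_iff)
    moreover have "(\<lambda>x. d x + (\<Sum>i<r. t (k, i) x)) = (\<lambda>x. 0)" using dt(3) by (simp only: sum)
    ultimately have "d = (\<lambda>x. 0) \<and> (\<forall>i<r. t (k, i) = (\<lambda>x. 0))" by (rule uniq[OF dt(1)])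
    then show "d = (\<lambda>x. 0) \<and> (\<forall>i\<in>?I. t i = (\<lambda>x. 0))" by blast
  qed (use T in auto)
  then show ?thesis by (simp only: H1c_path)
qed

proposition path_decomposition:
  fixes T :: "nat \<Rightarrow> nat \<Rightarrow> ('a::nonarch_local_field vpath \<Rightarrow> complex) set"
  assumes T: "\<And>k i. i < r k \<Longrightarrow> subrep (K_par k) (Sr k) (T k i)"
    and dec: "\<And>k p. p \<in> fin_supp (Sig k) \<Longrightarrow> \<exists>d\<in>Dl k. \<exists>t\<in>Pi {..<r k} (T k). p = (\<lambda>x. d x + (\<Sum>i<r k. t i x))"
    and uniq: "\<And>k d t. d \<in> Dl k \<Longrightarrow> t \<in> Pi {..<r k} (T k) \<Longrightarrow> (\<lambda>x. d x + (\<Sum>i<r k. t i x)) = (\<lambda>x. 0) \<Longrightarrow>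
      d = (\<lambda>x. 0) \<and> (\<forall>i<r k. t i = (\<lambda>x. 0))"
  shows "rep_iso (carrier PGL) (H1c (path_graph n))
    (rep_plus Steinberg (rep_dsum (SIGMA k:{..n}. {..<r k}) (\<lambda>(k, i). (Vr (Suc k))\<lparr>carrier := ind k (T k i)\<rparr>)))"
proof -
  let ?Z = "\<lambda>(k, i). (Vr (Suc k))\<lparr>carrier := ind k (T k i)\<rparr>"
  have ar: "arep (carrier PGL) (rep_dsum ({k} \<times> {..<r k}) ?Z)" for k
  proof (rule rep_dsum_arep[OF _ PGL.subgroup_self])
    show "arep (carrier PGL) (?Z p)" if p: "p \<in> {k} \<times> {..<r k}" for p
    proof -
      obtain i where "p = (k, i)" "i < r k" using p by auto
      then show ?thesis using Vr.arep_subrep[OF ind_subrep[OF T[of i k]]] by simp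
    qed
  qed simp
  \<comment> \<open>The remaining quotient \<open>S\<close> is a parameter since it differs in kind:
    the Steinberg representation for \<open>k = 0\<close>, the cohomology of the previous path graph
    afterwards.\<close>
  have split: "rep_iso (carrier PGL) (H1c (path_graph k)) (rep_plus S (rep_dsum ({k} \<times> {..<r k}) ?Z))"
    if S: "rep_iso (carrier PGL) (rep_quot ((Vr (Suc k))\<lparr>carrier := ind k (Dl k)\<rparr>) (Bd k)) S"
    for k and S :: "('a pgl, 'x) rep"
  proof -
    have eq: "rep_dsum ({k} \<times> {..<r k}) (\<lambda>i. (Vr (Suc k))\<lparr>carrier := ind k (T k (snd i))\<rparr>) = rep_dsum ({k} \<times> {..<r k}) ?Z"
      by (rule rep_dsum_cong) auto
    have "rep_iso (carrier PGL) (H1c (path_graph k))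
      (rep_plus (rep_quot ((Vr (Suc k))\<lparr>carrier := ind k (Dl k)\<rparr>) (Bd k)) (rep_dsum ({k} \<times> {..<r k}) ?Z))"
      unfolding eq[symmetric] by (rule path_split) (fact T dec uniq)+
    then show ?thesis using rep_plus_cong[OF S rep_iso_refl[OF arep.rep[OF ar]]] by (rule rep_iso_trans)
  qed
  show ?thesis
  proof (induction n)
    case 0
    have I: "(SIGMA k:{..0}. {..<r k}) = {0} \<times> {..<r 0}" by auto
    have "rep_iso (carrier PGL) (rep_quot ((Vr (Suc 0))\<lparr>carrier := ind 0 (Dl 0)\<rparr>) (Bd 0)) (Steinberg :: ('a pgl, _) rep)"
      unfolding ind_Dl_0 by (rule Odd_mod_Bd)
    then show ?case unfolding I by (rule split)
  next
    case (Suc n)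
    have I: "(SIGMA k:{..Suc n}. {..<r k}) = (SIGMA k:{..n}. {..<r k}) \<union> {Suc n} \<times> {..<r (Suc n)}"
      by (auto simp: le_Suc_eq)
    have "rep_iso (carrier PGL) (H1c (path_graph (Suc n)))
        (rep_plus (H1c (path_graph n)) (rep_dsum ({Suc n} \<times> {..<r (Suc n)}) ?Z))"
      using split[of "Suc n"] Ed_mod_Bd[of n] by (simp add: ind_Dl)
    then have "rep_iso (carrier PGL) (H1c (path_graph (Suc n)))
        (rep_plus (rep_plus Steinberg (rep_dsum (SIGMA k:{..n}. {..<r k}) ?Z)) (rep_dsum ({Suc n} \<times> {..<r (Suc n)}) ?Z))"
      by (rule rep_iso_trans[OF _ rep_plus_cong[OF Suc.IH rep_iso_refl[OF arep.rep[OF ar]]]])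
    then show ?case unfolding I by (rule rep_iso_trans[OF _ rep_dsum_union]) auto
  qed
qed

theorem theoremA:
  fixes n :: nat
    and P :: "('a::nonarch_local_field pgl set \<times> ('a pgl, 'v) rep) set"
  assumes "odd (residue_char TYPE('a))"
    and "inducing_data n P"
  shows "rep_iso (carrier PGL) (H1c (path_graph n :: ('a vpath, 'a vpath) pre_digraph))
    (rep_plus Steinberg
      (rep_dsum P (\<lambda>(K, L). rep_dsum {..<inducing_mult n K L} (\<lambda>_. c_ind K L))))"
proof -
  let ?H = "\<lambda>k. H1c (Sigma_graph k :: ('a vpath, 'a vpath) pre_digraph)"
  let ?R = "\<lambda>k. Sr k :: ('a pgl, 'a vpath \<Rightarrow> complex) rep"
  \<comment> \<open>The properties are bundled so that \<open>r\<close> and \<open>T\<close> can be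
    chosen for all \<open>k\<close> at once. The test representations \<open>L\<close> live in the
    type of the members of \<open>P\<close>.\<close>
  define good where "good k r T \<longleftrightarrow> (\<forall>i<r. subrep (K_par k) (?R k) (T i)) \<and>
    (\<forall>p\<in>fin_supp (Sig k). \<exists>d\<in>Dl k. \<exists>t\<in>Pi {..<r} T. p = (\<lambda>x. d x + (\<Sum>i<r. t i x))) \<and>
    (\<forall>d t. d \<in> Dl k \<longrightarrow> t \<in> Pi {..<r} T \<longrightarrow> (\<lambda>x. d x + (\<Sum>i<r. t i x)) = (\<lambda>x. 0) \<longrightarrow>
      d = (\<lambda>x. 0) \<and> (\<forall>i<r. t i = (\<lambda>x. 0))) \<and>
    (\<forall>i<r. \<exists>W W'. irreducible_subquot (K_par k) (?H k) W' W \<and> rep_iso (K_par k) ((?R k)\<lparr>carrier := T i\<rparr>) (subquot (?H k) W' W)) \<and>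
    (\<forall>L :: ('a pgl, 'v) rep. rep_mult (K_par k) (?H k) L = card {i. i < r \<and> rep_iso (K_par k) ((?R k)\<lparr>carrier := T i\<rparr>) L})"
    for k r and T :: "nat \<Rightarrow> ('a vpath \<Rightarrow> complex) set"
  have "\<exists>r T. good k r T" for k
    by (rule Sigma_decomposition[where 'w='v and k=k]) (unfold good_def, blast)
  then obtain r T where good: "\<And>k. good k (r k) (T k)" by metis
  note T = good[unfolded good_def, THEN conjunct1, rule_format]
  note dec = good[unfolded good_def, THEN conjunct2, THEN conjunct1, rule_format]
  note uniq = good[unfolded good_def, THEN conjunct2, THEN conjunct2, THEN conjunct1, rule_format]
  note irr = good[unfolded good_def, THEN conjunct2, THEN conjunct2, THEN conjunct2, THEN conjunct1, rule_format]
  note mult = good[unfolded good_def, THEN conjunct2, THEN conjunct2, THEN conjunct2, THEN conjunct2, rule_format]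
  let ?I = "SIGMA k:{..n}. {..<r k}"
  let ?Z = "\<lambda>(k, i). (Vr (Suc k))\<lparr>carrier := ind k (T k i)\<rparr>"
  have P: "smooth_rep K L" if "(K, L) \<in> P" for K L
    using assms(2) that by (auto simp: inducing_data_def)
  have P_eq: "L = L'" if "(K, L) \<in> P" "(K, L') \<in> P" "rep_iso K L L'" for K L L'
    using assms(2) that unfolding inducing_data_def by blast
  have P_ex: "\<exists>L. (K_par k, L) \<in> P \<and> rep_iso (K_par k) (subquot (?H k) W' W) L"
    if "k \<le> n" "irreducible_subquot (K_par k) (?H k) W' W" for k W W'
    using assms(2) that unfolding inducing_data_def by blast
  \<comment> \<open>Every piece is isomorphic to an irreducible subquotient of the local cohomology,
    so completeness of \<open>P\<close> provides a label for it.\<close>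
  have "\<exists>p. p \<in> P \<and> fst p = K_par (fst j) \<and> rep_iso (K_par (fst j)) ((?R (fst j))\<lparr>carrier := T (fst j) (snd j)\<rparr>) (snd p)"
    if j: "j \<in> ?I" for j
  proof -
    obtain W W' where W: "irreducible_subquot (K_par (fst j)) (?H (fst j)) W' W"
      "rep_iso (K_par (fst j)) ((?R (fst j))\<lparr>carrier := T (fst j) (snd j)\<rparr>) (subquot (?H (fst j)) W' W)"
      using irr[of "snd j" "fst j"] j by auto
    then obtain L where "(K_par (fst j), L) \<in> P" "rep_iso (K_par (fst j)) (subquot (?H (fst j)) W' W) L"
      using P_ex[OF _ W(1)] j by auto
    then show ?thesis using rep_iso_trans[OF W(2)] by (intro exI[of _ "(K_par (fst j), L)"]) simp
  qed
  then obtain \<sigma> where \<sigma>: "\<And>j. j \<in> ?I \<Longrightarrow> \<sigma> j \<in> P" "\<And>j. j \<in> ?I \<Longrightarrow> fst (\<sigma> j) = K_par (fst j)"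
    "\<And>j. j \<in> ?I \<Longrightarrow> rep_iso (K_par (fst j)) ((?R (fst j))\<lparr>carrier := T (fst j) (snd j)\<rparr>) (snd (\<sigma> j))"
    by metis
  have "rep_iso (carrier PGL) (rep_dsum ?I ?Z)
    (rep_dsum P (\<lambda>p. rep_dsum {..<inducing_mult n (fst p) (snd p)} (\<lambda>_. c_ind (fst p) (snd p))))"
  proof (rule rep_dsum_regroup[where \<sigma> = \<sigma>])
    show "rep_iso (carrier PGL) (?Z j) (c_ind (fst (\<sigma> j)) (snd (\<sigma> j)))" if j: "j \<in> ?I" for j
    proof -
      obtain k i where ki: "j = (k, i)" "i < r k" using j by auto
      obtain L where L: "\<sigma> j = (K_par k, L)" using \<sigma>(2)[OF j] ki by (cases "\<sigma> j") simp
      have "alg_rep (K_par k) L" using P \<sigma>(1)[OF j] L by (simp add: smooth_rep_alg_rep)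
      then show ?thesis
        using ind_iso_c_ind[OF T[OF ki(2)], of L] \<sigma>(3)[OF j] by (simp add: L[unfolded ki(1)] ki(1))
    qed
    show "card {j \<in> ?I. \<sigma> j = p} = inducing_mult n (fst p) (snd p)" if p: "p \<in> P" for p
    proof -
      obtain K L where KL: "p = (K, L)" by (cases p)
      \<comment> \<open>Members of \<open>P\<close> for the same group are pairwise non-isomorphic,
        so the chosen label is the only possible one. The fibre of \<open>\<sigma>\<close> over a
        pair is therefore the set counted by the multiplicities.\<close>
      have eq: "\<sigma> (k, i) = p \<longleftrightarrow> K = K_par k \<and> rep_iso (K_par k) ((?R k)\<lparr>carrier := T k i\<rparr>) L" if ki: "k \<le> n" "i < r k" for k i
      proof
        assume "\<sigma> (k, i) = p"
        then show "K = K_par k \<and> rep_iso (K_par k) ((?R k)\<lparr>carrier := T k i\<rparr>) L"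
          using \<sigma>(2,3)[of "(k, i)"] ki KL by auto
      next
        assume K: "K = K_par k \<and> rep_iso (K_par k) ((?R k)\<lparr>carrier := T k i\<rparr>) L"
        obtain L' where L': "\<sigma> (k, i) = (K, L')" "rep_iso K ((?R k)\<lparr>carrier := T k i\<rparr>) L'" "(K, L') \<in> P"
          using \<sigma>[of "(k, i)"] ki K by (cases "\<sigma> (k, i)") auto
        have "arep (K_par k) ((?R k)\<lparr>carrier := T k i\<rparr>)" by (rule Sr.arep_subrep[OF T[OF ki(2)]])
        then have "rep_iso K L' L" using rep_iso_trans[OF rep_iso_sym] L'(2) K by blast
        then show "\<sigma> (k, i) = p" using P_eq[OF L'(3)] p L'(1) KL by auto
      qed
      have "{j \<in> ?I. \<sigma> j = p} = (SIGMA k:{..n}. {i. i < r k \<and> \<sigma> (k, i) = p})" by auto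
      then have "card {j \<in> ?I. \<sigma> j = p} = (\<Sum>k\<le>n. card {i. i < r k \<and> \<sigma> (k, i) = p})"
        by (simp add: card_SigmaI)
      also have "\<dots> = inducing_mult n K L"
        unfolding inducing_mult_def
      proof (rule sum.cong[OF refl])
        fix k assume "k \<in> {..n}"
        then have "{i. i < r k \<and> \<sigma> (k, i) = p} = {i. i < r k \<and> K = K_par k \<and> rep_iso (K_par k) ((?R k)\<lparr>carrier := T k i\<rparr>) L}"
          using eq by auto
        then show "card {i. i < r k \<and> \<sigma> (k, i) = p} = (if K = K_par k then rep_mult K (?H k) L else 0)"
          using mult[of k L] by auto
      qed
      finally show ?thesis by (simp add: KL)
    qed
  qed (use \<sigma>(1) in auto)
  moreover have "alg_rep (carrier PGL) (Steinberg :: ('a pgl, _) rep)"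
    unfolding Steinberg_def using SI_arep consts_subrep
    by (intro arep.rep subrep_pair.quot_arep subrep_pair.intro subrep_pair_axioms.intro)
  ultimately have "rep_iso (carrier PGL) (rep_plus (Steinberg :: ('a pgl, _) rep) (rep_dsum ?I ?Z))
    (rep_plus Steinberg (rep_dsum P (\<lambda>p. rep_dsum {..<inducing_mult n (fst p) (snd p)} (\<lambda>_. c_ind (fst p) (snd p)))))"
    by (intro rep_plus_cong rep_iso_refl)
  moreover have "rep_iso (carrier PGL) (H1c (path_graph n)) (rep_plus (Steinberg :: ('a pgl, _) rep) (rep_dsum ?I ?Z))"
    by (rule path_decomposition) (fact T dec uniq)+
  ultimately have "rep_iso (carrier PGL) (H1c (path_graph n)) (rep_plus (Steinberg :: ('a pgl, _) rep)
    (rep_dsum P (\<lambda>p. rep_dsum {..<inducing_mult n (fst p) (snd p)} (\<lambda>_. c_ind (fst p) (snd p)))))"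
    by (rule rep_iso_trans[rotated])
  then show ?thesis by (simp only: case_prod_beta')
qed

end
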